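(* Let $(B,g_B)$ be a non-degenerate semi-Riemannian manifold, let $(F_j,g_{F_j})$, $1\le j\le m$, be semi-regular semi-Riemannian manifolds, and let $b_j\in C^\infty(B)$. Let $P\in\Gamma(TB)$ and let $\widehat R$ be the semi-symmetric non-metric curvature, with respect to $P$, of the multiply warped product $B\times_{b_1}F_1\times\cdots\times_{b_m}F_m$. For all $X,Y,Z,T\in\Gamma(TB)$ and all $U_k\in\Gamma(TF_k)$, $V_i\in\Gamma(TF_i)$, $W_j\in\Gamma(TF_j)$, $Q_s\in\Gamma(TF_s)$: (1) $\widehat R(X,Y,Z,T)=\widehat R_B(X,Y,Z,T)$; (2) $\widehat R(X,Y,Z,W_j)=\widehat R(X,Y,W_j,Z)=\widehat R(Z,W_j,X,Y)=0$; (3) if $i=j$: $\widehat R(X,Y,V_i,W_j)=\widehat R(V_i,W_j,X,Y)=0$; (4) if $i=j$: $\widehat R(V_i,X,W_j,Y)=-\widehat R(X,V_i,W_j,Y)=b_jXY(b_j)g_{F_j}(V_j,W_j)-b_jg_B^*(\nabla^\flat_XY,db_j)g_{F_j}(V_j,W_j)-2b_jX(b_j)g_B(Y,P)g_{F_j}(V_j,W_j)$; (5) if $i=j$: $\widehat R(V_i,X,Y,W_j)=-\widehat R(X,V_i,Y,W_j)=-b_jXY(b_j)g_{F_j}(V_j,W_j)+b_jg_B^*(\nabla^\flat_XY,db_j)g_{F_j}(V_j,W_j)-b_j^2X(g_B(Y,P))g_{F_j}(V_j,W_j)$; (6) if $i\ne j$: $\widehat R(X,Y,V_i,W_j)=\widehat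 R(V_i,W_j,X,Y)=\widehat R(X,V_i,W_j,Y)=\widehat R(X,V_i,Y,W_j)=0$; (7) if $i=j=k$: $\widehat R(X,V_i,W_j,U_k)=\widehat R(W_j,U_k,X,V_i)=0$; (8) if $i=j=k$: $\widehat R(W_j,U_k,V_i,X)=b_j^2g_B(X,P)\big(\mathcal K_{F_j}(W_j,V_j,U_j)-\mathcal K_{F_j}(U_j,V_j,W_j)\big)$; (9) if $i,j,k$ are not all equal: $\widehat R(X,V_i,W_j,U_k)=\widehat R(W_j,U_k,X,V_i)=\widehat R(W_j,U_k,V_i,X)=0$; (10) if $i=j=k=s$: $\widehat R(U_k,V_i,W_j,Q_s)=b_j^2R_{F_j}(U_j,V_j,W_j,Q_j)+b_j^2g_B^*(db_j,db_j)\big(g_{F_j}(U_j,W_j)g_{F_j}(V_j,Q_j)-g_{F_j}(V_j,W_j)g_{F_j}(U_j,Q_j)\big)$; (11) if $k=j\ne i=s$: $\widehat R(U_k,V_i,W_j,Q_s)=b_ib_jg_B^*(db_i,db_j)g_{F_i}(V_i,Q_i)g_{F_j}(U_j,W_j)$; (12) if $k=s\ne j=i$: $\widehat R(U_k,V_i,W_j,Q_s)=-b_jb_kg_B^*(db_j,db_k)g_{F_j}(V_j,W_j)g_{F_k}(U_k,Q_k)$; (13) $\widehat R(U_k,V_i,W_j,Q_s)=0$ in all other cases.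
   Context: A singular semi-Riemannian manifold $(M,g)$ is a smooth manifold with a smooth symmetric bilinear form $g$ on $TM$, possibly degenerate and of variable signature; it is non-degenerate if $g$ is non-degenerate everywhere. Its Koszul form is $\mathcal K(X,Y,Z)=\frac12\{X(g(Y,Z))+Y(g(Z,X))-Z(g(X,Y))-g(X,[Y,Z])+g(Y,[Z,X])+g(Z,[X,Y])\}$, and $(\nabla^\flat_XY)(Z)=\mathcal K(X,Y,Z)$. Contraction: let $T_p^\bullet M=\{g_p(v,\cdot):v\in T_pM\}\subset T_p^*M$ with inner product $g_p^\bullet(g_p(v,\cdot),g_p(w,\cdot))=g_p(v,w)$. For 1-forms $\omega,\tau$ with values in $T^\bullet M$, $\omega(\bullet)\tau(\bullet)$ is the function $p\mapsto g^\bullet_p(\omega_p,\tau_p)$ on the dense open set where the rank of $g$ is locally constant; it is called smooth if it extends (uniquely) to a smooth function on $M$, and then the same symbol denotes the extension. $(M,g)$ is radical-stationary if $\mathcal K(X,Y,\cdot)$ takes values in $T^\bullet M$ for all vector fields $X,Y$, and semi-regular if moreover all $\mathcal K(X,Y,\bullet)\mathcal K(Z,T,\bullet)$ are smooth. On a semi-regular manifold $R(X,Y,Z,T)=X(\mathcal K(Y,Z,T))-Y(\mathcal K(X,Z,T))-\mathcal K([X,Y],Z,T)+\mathcal K(X,Z,\bullet)\mathcal K(Y,T,\bullet)-\mathcal K(Y,Z,\bullet)\mathcal K(X,T,\bullet)$. For a vector field $P$ on $M$, the semi-symmetric non-metric Koszul form is $\widehat{\mathcal K}(X,Y,Z)=\mathcal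 K(X,Y,Z)+g(Y,P)g(X,Z)$. The semi-symmetric non-metric curvature is $\widehat R(X,Y,Z,T)=(\widehat\nabla_X\widehat\nabla^\flat_YZ)(T)-(\widehat\nabla_Y\widehat\nabla^\flat_XZ)(T)-(\widehat\nabla^\flat_{[X,Y]}Z)(T)$ with $(\widehat\nabla^\flat_XY)(Z)=\widehat{\mathcal K}(X,Y,Z)$ and $(\widehat\nabla_X\omega)(T)=X(\omega(T))-(\widehat\nabla^\flat_XT)(\bullet)\,\omega(\bullet)$; that is, the formula for $R$ with $\mathcal K$ replaced everywhere by $\widehat{\mathcal K}$. Equivalently, $\widehat R(X,Y,Z,T)=R(X,Y,Z,T)+X(g(Z,P))g(Y,T)-Y(g(Z,P))g(X,T)-\widehat{\mathcal K}(Y,Z,X)g(P,T)+\widehat{\mathcal K}(X,Z,Y)g(P,T)$. The multiply warped product $B\times_{b_1}F_1\times\cdots\times_{b_m}F_m$ is $B\times F_1\times\cdots\times F_m$ with $g=\pi_B^*(g_B)+\sum_j(b_j\circ\pi_B)^2\pi_{F_j}^*(g_{F_j})$, where the $\pi$'s are the canonical projections; the $b_j$ may vanish. Under the hypotheses of the claim it is semi-regular. Vector fields in $\Gamma(TB)$, $\Gamma(TF_j)$ are identified with their lifts to the product, and functions and tensors on the factors with their pullbacks. Subscripts $B$, $F_j$ denote objects of that factor ($\widehat R_B$ uses $P$ on $B$). When indices coincide, e.g. $i=j$, $V_i$ is also written $V_j$. $g_B^*$ is the inverse metric of $g_B$ on 1-forms of $B$; in $g_B^*(\nabla^\flat_XY,db_j)$,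 $\nabla^\flat_XY=\mathcal K_B(X,Y,\cdot)$. $XY(f)$ means $X(Y(f))$. *)

theory Defs
  imports "HOL-Analysis.Analysis" "HOL-Library.Function_Algebras"
begin

section \<open>Smooth functions on subsets of Euclidean spaces\<close>

primrec Ck_on :: "nat \<Rightarrow> 'e::real_normed_vector set \<Rightarrow> ('e \<Rightarrow> 'f::real_normed_vector) \<Rightarrow> bool" where
  "Ck_on 0 A f \<longleftrightarrow> continuous_on A f"
| "Ck_on (Suc k) A f \<longleftrightarrow>
     (\<forall>x\<in>A. f differentiable (at x)) \<and> (\<forall>v. Ck_on k A (\<lambda>x. frechet_derivative f (at x) v))"

text \<open>
  Smoothness on a subset \<open>A\<close> which need not be open: local extendability to smooth functions on
  open sets. It is only used for \<open>A\<close> relatively open in a linear subspace \<open>S\<close>, where it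
  agrees with smoothness on an open subset of \<open>S\<close> seen as a copy of some R^n.
\<close>

definition smooth_on :: "'e::euclidean_space set \<Rightarrow> ('e \<Rightarrow> 'f::real_normed_vector) \<Rightarrow> bool" where
  "smooth_on A f \<longleftrightarrow>
     (\<forall>a\<in>A. \<exists>O' h. open O' \<and> a \<in> O' \<and> (\<forall>k. Ck_on k O' h) \<and> (\<forall>x\<in>A \<inter> O'. h x = f x))"

section \<open>Smooth manifolds\<close>

text \<open>
  The charts of a manifold are homeomorphisms from open sets onto relatively open subsets of one
  linear subspace \<open>model\<close> of a Euclidean space, so the dimension of the manifold is
  \<open>dim model\<close>. Hence manifolds of different dimensions can share a HOL type, as is needed for
  families of manifolds. A chart is given as a pair of its domain and its coordinate map, the
  values of the latter off the domain being irrelevant. The atlas is not required to be maximal.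
\<close>

record ('a, 'e) mfd =
  mtop :: "'a topology"
  model :: "'e set"
  atlas :: "('a set \<times> ('a \<Rightarrow> 'e)) set"

abbreviation carrier_of :: "('a, 'e) mfd \<Rightarrow> 'a set" where
  "carrier_of M \<equiv> topspace (mtop M)"

definition smooth_manifold :: "('a, 'e::euclidean_space) mfd \<Rightarrow> bool" where
  "smooth_manifold M \<longleftrightarrow>
     Hausdorff_space (mtop M) \<and> second_countable (mtop M) \<and> subspace (model M) \<and>
     (\<forall>(U, \<phi>)\<in>atlas M. openin (mtop M) U \<and> openin (top_of_set (model M)) (\<phi> ` U) \<and>
        homeomorphic_map (subtopology (mtop M) U) (top_of_set (\<phi> ` U)) \<phi>) \<and>
     (\<Union>(U, \<phi>)\<in>atlas M. U) = carrier_of M \<and>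
     (\<forall>(U, \<phi>)\<in>atlas M. \<forall>(V, \<psi>)\<in>atlas M. smooth_on (\<phi> ` (U \<inter> V)) (\<psi> \<circ> inv_into U \<phi>))"

text \<open>Values of a function off the carrier are irrelevant.\<close>

definition smooth_funs :: "('a, 'e::euclidean_space) mfd \<Rightarrow> ('a \<Rightarrow> real) set" where
  "smooth_funs M = {f. \<forall>(U, \<phi>)\<in>atlas M. smooth_on (\<phi> ` U) (f \<circ> inv_into U \<phi>)}"

text \<open>
  Tangent vectors at \<open>p\<close> are the derivations at \<open>p\<close> of the algebra of smooth functions, extended
  by 0 to all functions. By the Leibniz rule a derivation does not see the values of a function
  off the carrier: if \<open>f\<close> vanishes on the carrier, then \<open>f = f * u\<close> for the indicator \<open>u\<close> of
  the complement of the carrier.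
\<close>

definition tangent_space :: "('a, 'e::euclidean_space) mfd \<Rightarrow> 'a \<Rightarrow> (('a \<Rightarrow> real) \<Rightarrow> real) set" where
  "tangent_space M p = {v.
     (\<forall>f\<in>smooth_funs M. \<forall>h\<in>smooth_funs M. v (\<lambda>x. f x + h x) = v f + v h) \<and>
     (\<forall>c. \<forall>f\<in>smooth_funs M. v (\<lambda>x. c * f x) = c * v f) \<and>
     (\<forall>f\<in>smooth_funs M. \<forall>h\<in>smooth_funs M. v (\<lambda>x. f x * h x) = v f * h p + f p * v h) \<and>
     (\<forall>f. f \<notin> smooth_funs M \<longrightarrow> v f = 0)}"

type_synonym 'a vfield = "'a \<Rightarrow> ('a \<Rightarrow> real) \<Rightarrow> real"

definition app_vf :: "'a vfield \<Rightarrow> ('a \<Rightarrow> real) \<Rightarrow> 'a \<Rightarrow> real" where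
  "app_vf X f = (\<lambda>p. X p f)"

definition vfields :: "('a, 'e::euclidean_space) mfd \<Rightarrow> 'a vfield set" where
  "vfields M = {X. (\<forall>p\<in>carrier_of M. X p \<in> tangent_space M p) \<and>
     (\<forall>f\<in>smooth_funs M. app_vf X f \<in> smooth_funs M)}"

definition lie_bracket :: "('a, 'e::euclidean_space) mfd \<Rightarrow> 'a vfield \<Rightarrow> 'a vfield \<Rightarrow> 'a vfield" where
  "lie_bracket M X Y = (\<lambda>p f. if f \<in> smooth_funs M
     then app_vf X (app_vf Y f) p - app_vf Y (app_vf X f) p else 0)"

definition differential ::
  "('a, 'e::euclidean_space) mfd \<Rightarrow> ('c \<Rightarrow> 'a) \<Rightarrow> (('c \<Rightarrow> real) \<Rightarrow> real) \<Rightarrow> ('a \<Rightarrow> real) \<Rightarrow> real" where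
  "differential N \<pi> v = (\<lambda>h. if h \<in> smooth_funs N then v (h \<circ> \<pi>) else 0)"

section \<open>Singular semi-Riemannian manifolds\<close>

type_synonym 'a metric_form =
  "'a \<Rightarrow> (('a \<Rightarrow> real) \<Rightarrow> real) \<Rightarrow> (('a \<Rightarrow> real) \<Rightarrow> real) \<Rightarrow> real"

definition on_vf :: "'a metric_form \<Rightarrow> 'a vfield \<Rightarrow> 'a vfield \<Rightarrow> 'a \<Rightarrow> real" where
  "on_vf g X Y = (\<lambda>p. g p (X p) (Y p))"

definition singular_semi_riemannian :: "('a, 'e::euclidean_space) mfd \<Rightarrow> 'a metric_form \<Rightarrow> bool" where
  "singular_semi_riemannian M g \<longleftrightarrow> smooth_manifold M \<and>
     (\<forall>p\<in>carrier_of M. \<forall>u\<in>tangent_space M p. \<forall>v\<in>tangent_space M p.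
        g p u v = g p v u \<and>
        (\<forall>w\<in>tangent_space M p. g p u (\<lambda>f. v f + w f) = g p u v + g p u w) \<and>
        (\<forall>c. g p u (\<lambda>f. c * v f) = c * g p u v)) \<and>
     (\<forall>X\<in>vfields M. \<forall>Y\<in>vfields M. on_vf g X Y \<in> smooth_funs M)"

definition nondegenerate :: "('a, 'e::euclidean_space) mfd \<Rightarrow> 'a metric_form \<Rightarrow> bool" where
  "nondegenerate M g \<longleftrightarrow> (\<forall>p\<in>carrier_of M. \<forall>v\<in>tangent_space M p.
     (\<forall>w\<in>tangent_space M p. g p v w = 0) \<longrightarrow> v = (\<lambda>f. 0))"

text \<open>Covectors at \<open>p\<close> are represented by functions which are 0 off the tangent space at \<open>p\<close>.\<close>

type_synonym 'a covec = "(('a \<Rightarrow> real) \<Rightarrow> real) \<Rightarrow> real"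

definition flat :: "('a, 'e::euclidean_space) mfd \<Rightarrow> 'a metric_form \<Rightarrow> 'a \<Rightarrow> (('a \<Rightarrow> real) \<Rightarrow> real) \<Rightarrow> 'a covec" where
  "flat M g p v = (\<lambda>w. if w \<in> tangent_space M p then g p v w else 0)"

definition radical_annihilator :: "('a, 'e::euclidean_space) mfd \<Rightarrow> 'a metric_form \<Rightarrow> 'a \<Rightarrow> 'a covec set" where
  "radical_annihilator M g p = flat M g p ` tangent_space M p"

definition co_inner :: "('a, 'e::euclidean_space) mfd \<Rightarrow> 'a metric_form \<Rightarrow> 'a \<Rightarrow> 'a covec \<Rightarrow> 'a covec \<Rightarrow> real" where
  "co_inner M g p \<alpha> \<beta> = (THE r. \<exists>v\<in>tangent_space M p. \<exists>w\<in>tangent_space M p.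
     \<alpha> = flat M g p v \<and> \<beta> = flat M g p w \<and> r = g p v w)"

definition rank_at :: "('a, 'e::euclidean_space) mfd \<Rightarrow> 'a metric_form \<Rightarrow> 'a \<Rightarrow> nat" where
  "rank_at M g p = vector_space.dim (\<lambda>(c::real) \<alpha> v. c * \<alpha> v) (radical_annihilator M g p)"

definition regular_set :: "('a, 'e::euclidean_space) mfd \<Rightarrow> 'a metric_form \<Rightarrow> 'a set" where
  "regular_set M g =
     {p. \<exists>U. openin (mtop M) U \<and> p \<in> U \<and> (\<forall>q\<in>U. rank_at M g q = rank_at M g p)}"

text \<open>
  A 1-form is given by its action \<open>\<omega>\<close> on vector fields. \<open>covec_at M \<omega> p\<close> is its value at \<open>p\<close>,
  which exists if \<open>\<omega>\<close> is linear over the smooth functions.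
\<close>

type_synonym 'a form1 = "'a vfield \<Rightarrow> 'a \<Rightarrow> real"

definition covec_at :: "('a, 'e::euclidean_space) mfd \<Rightarrow> 'a form1 \<Rightarrow> 'a \<Rightarrow> 'a covec" where
  "covec_at M \<omega> p = (\<lambda>v. if v \<in> tangent_space M p
     then (THE r. \<forall>Z\<in>vfields M. Z p = v \<longrightarrow> \<omega> Z p = r) else 0)"

definition is_contraction ::
  "('a, 'e::euclidean_space) mfd \<Rightarrow> 'a metric_form \<Rightarrow> 'a form1 \<Rightarrow> 'a form1 \<Rightarrow> ('a \<Rightarrow> real) \<Rightarrow> bool" where
  "is_contraction M g \<omega> \<tau> h \<longleftrightarrow> h \<in> smooth_funs M \<and>
     (\<forall>p\<in>regular_set M g. h p = co_inner M g p (covec_at M \<omega> p) (covec_at M \<tau> p))"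

text \<open>The clause on points off the carrier only serves to make the description unique.\<close>

definition contraction ::
  "('a, 'e::euclidean_space) mfd \<Rightarrow> 'a metric_form \<Rightarrow> 'a form1 \<Rightarrow> 'a form1 \<Rightarrow> 'a \<Rightarrow> real" where
  "contraction M g \<omega> \<tau> = (THE h. is_contraction M g \<omega> \<tau> h \<and> (\<forall>p. p \<notin> carrier_of M \<longrightarrow> h p = 0))"

definition koszul ::
  "('a, 'e::euclidean_space) mfd \<Rightarrow> 'a metric_form \<Rightarrow> 'a vfield \<Rightarrow> 'a vfield \<Rightarrow> 'a form1" where
  "koszul M g X Y Z = (\<lambda>p. 1/2 *
     (app_vf X (on_vf g Y Z) p + app_vf Y (on_vf g Z X) p - app_vf Z (on_vf g X Y) p
      - on_vf g X (lie_bracket M Y Z) p + on_vf g Y (lie_bracket M Z X) p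
      + on_vf g Z (lie_bracket M X Y) p))"

definition radical_stationary :: "('a, 'e::euclidean_space) mfd \<Rightarrow> 'a metric_form \<Rightarrow> bool" where
  "radical_stationary M g \<longleftrightarrow> singular_semi_riemannian M g \<and>
     (\<forall>X\<in>vfields M. \<forall>Y\<in>vfields M. \<forall>p\<in>carrier_of M.
        covec_at M (koszul M g X Y) p \<in> radical_annihilator M g p)"

definition semi_regular :: "('a, 'e::euclidean_space) mfd \<Rightarrow> 'a metric_form \<Rightarrow> bool" where
  "semi_regular M g \<longleftrightarrow> radical_stationary M g \<and>
     (\<forall>X\<in>vfields M. \<forall>Y\<in>vfields M. \<forall>Z\<in>vfields M. \<forall>T\<in>vfields M.
        \<exists>h. is_contraction M g (koszul M g X Y) (koszul M g Z T) h)"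

definition riemann ::
  "('a, 'e::euclidean_space) mfd \<Rightarrow> 'a metric_form \<Rightarrow> 'a vfield \<Rightarrow> 'a vfield \<Rightarrow> 'a vfield \<Rightarrow> 'a form1" where
  "riemann M g X Y Z T = (\<lambda>p.
     app_vf X (koszul M g Y Z T) p - app_vf Y (koszul M g X Z T) p
     - koszul M g (lie_bracket M X Y) Z T p
     + contraction M g (koszul M g X Z) (koszul M g Y T) p
     - contraction M g (koszul M g Y Z) (koszul M g X T) p)"

section \<open>The semi-symmetric non-metric connection\<close>

definition ssnm_koszul ::
  "('a, 'e::euclidean_space) mfd \<Rightarrow> 'a metric_form \<Rightarrow> 'a vfield \<Rightarrow> 'a vfield \<Rightarrow> 'a vfield \<Rightarrow> 'a form1" where
  "ssnm_koszul M g P X Y Z = (\<lambda>p. koszul M g X Y Z p + on_vf g Y P p * on_vf g X Z p)"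

definition ssnm_deriv ::
  "('a, 'e::euclidean_space) mfd \<Rightarrow> 'a metric_form \<Rightarrow> 'a vfield \<Rightarrow> 'a vfield \<Rightarrow> 'a form1 \<Rightarrow> 'a form1" where
  "ssnm_deriv M g P X \<omega> T =
     (\<lambda>p. app_vf X (\<omega> T) p - contraction M g (ssnm_koszul M g P X T) \<omega> p)"

definition ssnm_riemann ::
  "('a, 'e::euclidean_space) mfd \<Rightarrow> 'a metric_form \<Rightarrow> 'a vfield \<Rightarrow>
   'a vfield \<Rightarrow> 'a vfield \<Rightarrow> 'a vfield \<Rightarrow> 'a form1" where
  "ssnm_riemann M g P X Y Z T = (\<lambda>p.
     ssnm_deriv M g P X (ssnm_koszul M g P Y Z) T p
     - ssnm_deriv M g P Y (ssnm_koszul M g P X Z) T p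
     - ssnm_koszul M g P (lie_bracket M X Y) Z T p)"

section \<open>The inverse of a non-degenerate metric\<close>

definition sharp :: "('a, 'e::euclidean_space) mfd \<Rightarrow> 'a metric_form \<Rightarrow> 'a \<Rightarrow> 'a covec \<Rightarrow> ('a \<Rightarrow> real) \<Rightarrow> real" where
  "sharp M g p \<alpha> = (THE v. v \<in> tangent_space M p \<and> flat M g p v = \<alpha>)"

definition inverse_metric ::
  "('a, 'e::euclidean_space) mfd \<Rightarrow> 'a metric_form \<Rightarrow> 'a form1 \<Rightarrow> 'a form1 \<Rightarrow> 'a \<Rightarrow> real" where
  "inverse_metric M g \<omega> \<tau> =
     (\<lambda>p. g p (sharp M g p (covec_at M \<omega> p)) (sharp M g p (covec_at M \<tau> p)))"

definition d_fun :: "('a \<Rightarrow> real) \<Rightarrow> 'a form1" where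
  "d_fun f Z = app_vf Z f"

section \<open>Multiply warped products\<close>

text \<open>
  The factors \<open>F j\<close> are indexed by a finite type \<open>'m\<close>, which is nonempty like every type; a point
  of the product is a pair of a point of \<open>B\<close> and a family of points of the \<open>F j\<close>.
\<close>

definition prod_mfd :: "('b, 'd::euclidean_space) mfd \<Rightarrow> ('m::finite \<Rightarrow> ('f, 'e::euclidean_space) mfd) \<Rightarrow>
    ('b \<times> ('m \<Rightarrow> 'f), 'd \<times> ('e ^ 'm)) mfd" where
  "prod_mfd B F = \<lparr>
     mtop = prod_topology (mtop B) (product_topology (\<lambda>j. mtop (F j)) UNIV),
     model = {(x, y). x \<in> model B \<and> (\<forall>j. y $ j \<in> model (F j))},
     atlas = {(U \<times> (\<Pi> j\<in>UNIV. V j), \<lambda>(p, q). (\<phi> p, \<chi> j. \<psi> j (q j))) | U \<phi> V \<psi>.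
        (U, \<phi>) \<in> atlas B \<and> (\<forall>j. (V j, \<psi> j) \<in> atlas (F j))}\<rparr>"

definition warped_metric ::
  "('b, 'd::euclidean_space) mfd \<Rightarrow> 'b metric_form \<Rightarrow> ('m::finite \<Rightarrow> ('f, 'e::euclidean_space) mfd) \<Rightarrow>
   ('m \<Rightarrow> 'f metric_form) \<Rightarrow> ('m \<Rightarrow> 'b \<Rightarrow> real) \<Rightarrow> ('b \<times> ('m \<Rightarrow> 'f)) metric_form" where
  "warped_metric B gB F gF b = (\<lambda>(p, q) v w.
     gB p (differential B fst v) (differential B fst w) +
     (\<Sum>j\<in>UNIV. (b j p)\<^sup>2 *
        gF j (q j) (differential (F j) (\<lambda>x. snd x j) v) (differential (F j) (\<lambda>x. snd x j) w)))"

text \<open>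
  Lifts of vector fields from the factors, by means of the inclusions of the slices of the product.
\<close>

definition lift_base ::
  "('b, 'd::euclidean_space) mfd \<Rightarrow> ('m::finite \<Rightarrow> ('f, 'e::euclidean_space) mfd) \<Rightarrow>
   'b vfield \<Rightarrow> ('b \<times> ('m \<Rightarrow> 'f)) vfield" where
  "lift_base B F X = (\<lambda>(p, q). differential (prod_mfd B F) (\<lambda>p'. (p', q)) (X p))"

definition lift_fibre ::
  "('b, 'd::euclidean_space) mfd \<Rightarrow> ('m::finite \<Rightarrow> ('f, 'e::euclidean_space) mfd) \<Rightarrow> 'm \<Rightarrow>
   'f vfield \<Rightarrow> ('b \<times> ('m \<Rightarrow> 'f)) vfield" where
  "lift_fibre B F j V =
     (\<lambda>(p, q). differential (prod_mfd B F) (\<lambda>y. (p, q(j := y))) (V (q j)))"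

end

theory Submission
  imports Defs
begin

text \<open>
  By Hadamard's lemma a tangent vector acts on the coordinate representation of a function as a
  directional derivative. Hence tangent vectors of the product split into a base part and fibre parts,
  vector fields on a product are determined by the functions pulled back from the factors, and the
  Koszul form of the warped metric on lifts reduces to the Koszul forms and metrics of the factors.

  The contractions are computed at the points where the rank of \<open>g\<close> is locally constant. These are dense,
  since the rank is lower semicontinuous, and both sides of every identity are smooth. The rank of the
  warped metric at \<open>(p, q)\<close> is the rank of \<open>g\<^sub>B\<close> plus the ranks of those \<open>g\<^sub>F\<^sub>j\<close> at \<open>q\<^sub>j\<close> with \<open>b\<^sub>j(p) \<noteq> 0\<close>.
  So at such a point either \<open>b\<^sub>j(p) \<noteq> 0\<close>, and \<open>q\<^sub>j\<close> is a point of locally constant rank of \<open>g\<^sub>F\<^sub>j\<close>, or \<open>b\<^sub>j\<close> vanishes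
  near \<open>p\<close>, or \<open>g\<^sub>F\<^sub>j\<close> vanishes at \<open>q\<^sub>j\<close>. In each case the \<open>1\<close>-forms \<open>K(A, C, \<bullet>)\<close> for lifts \<open>A, C\<close> are
  represented by explicit tangent vectors, which yields their contractions.
\<close>

section \<open>Functions of class C^k on open sets\<close>

text \<open>The obstacle is that the warping functions may vanish. Where \<open>b j\<close> is 0,
  the fibre \<open>j\<close> contributes nothing to the pointwise inner product of covectors, yet
  the smooth contraction may contain X(b_j) Y(b_j) g_F(V, W), which need not be 0 there: its value
  at such a point is a limit from regular points. Every form \<open>Kh A C\<close> with lifts
  \<open>A\<close>, \<open>C\<close> has a common shape, \<open>nform\<close>, whose fibre part
  carries a factor b_j. Dividing by b_j^2 leaves a / b_j in the representing vector, and the weight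
  b_j^2 of the metric cancels the two denominators in the inner product. So one formula,
  \<open>contraction_nform\<close>, serves all pairs of lifts and yields the smooth extension
  together with its value. Each curvature component is then algebra; its cancellations come from the
  symmetry of the fibre metric, from metric compatibility and torsion-freeness of the fibre Koszul
  forms, and from commutators on the base. Tangent vectors are derivations of globally defined
  functions, so coordinates, frames and inverses, which exist only locally, are replaced by global
  objects that agree with them near a point.\<close>

lemma frechet_derivative_eqI: "(f has_derivative f') (at x) \<Longrightarrow> frechet_derivative f (at x) v = f' v"
  using frechet_derivative_at by metis

lemma frechet_derivative_cong_open:
  assumes "open A" "x \<in> A" "\<And>y. y \<in> A \<Longrightarrow> f y = g y"
  shows "frechet_derivative f (at x) = frechet_derivative g (at x)"
proof -
  have "(f has_derivative f') (at x) \<longleftrightarrow> (g has_derivative f') (at x)" for f'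
    using assms by (metis has_derivative_transform_within_open)
  then show ?thesis by (simp add: frechet_derivative_def)
qed

lemma Ck_on_cong:
  assumes "open A" "\<And>x. x \<in> A \<Longrightarrow> f x = g x"
  shows "Ck_on k A f \<longleftrightarrow> Ck_on k A g"
  using assms
proof (induction k arbitrary: f g)
  case 0
  then show ?case by (auto cong: continuous_on_cong)
next
  case (Suc k)
  have d: "f differentiable (at x) \<longleftrightarrow> g differentiable (at x)" if "x \<in> A" for x
    using that Suc.prems unfolding differentiable_def by (metis has_derivative_transform_within_open)
  have "Ck_on k A (\<lambda>x. frechet_derivative f (at x) v) \<longleftrightarrow> Ck_on k A (\<lambda>x. frechet_derivative g (at x) v)" for v
    using Suc.prems frechet_derivative_cong_open[of A _ f g] by (intro Suc.IH) auto
  with d show ?case by simp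
qed

lemma Ck_on_subset: "Ck_on k A f \<Longrightarrow> B \<subseteq> A \<Longrightarrow> Ck_on k B f"
  by (induction k arbitrary: f) (auto intro: continuous_on_subset)

lemma Ck_on_continuous: "Ck_on k A f \<Longrightarrow> continuous_on A f"
  by (cases k) (auto intro!: continuous_at_imp_continuous_on differentiable_imp_continuous_within)

lemma Ck_on_SucD: "Ck_on (Suc k) A f \<Longrightarrow> Ck_on k A f"
proof (induction k arbitrary: f)
  case 0
  then show ?case using Ck_on_continuous by fastforce
next
  case (Suc k)
  then show ?case by (metis Ck_on.simps(2))
qed

lemma Ck_on_local:
  assumes "\<And>a. a \<in> A \<Longrightarrow> \<exists>O'. open O' \<and> a \<in> O' \<and> Ck_on k O' f"
  shows "Ck_on k A f"
  using assms
proof (induction k arbitrary: f)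
  case 0
  then show ?case
    by (auto intro!: continuous_at_imp_continuous_on) (metis continuous_on_eq_continuous_at)
next
  case (Suc k)
  have "f differentiable (at x)" if "x \<in> A" for x
    using Suc.prems[OF that] by auto
  moreover have "Ck_on k A (\<lambda>x. frechet_derivative f (at x) v)" for v
    using Suc.prems by (intro Suc.IH) force
  ultimately show ?case by simp
qed

lemma Ck_on_const [simp]: "Ck_on k A (\<lambda>x. c)"
  by (induction k arbitrary: c) (auto simp: frechet_derivative_const)

text \<open>Any explicit derivative may be supplied: on the open set it agrees pointwise with
  \<open>frechet_derivative\<close>, and \<open>Ck_on\<close> sees only the values there.\<close>

lemma Ck_on_SucI:
  assumes "\<And>x. x \<in> A \<Longrightarrow> (f has_derivative f' x) (at x)" "\<And>v. Ck_on k A (\<lambda>x. f' x v)" "open A"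
  shows "Ck_on (Suc k) A f"
proof -
  have "Ck_on k A (\<lambda>x. frechet_derivative f (at x) v)" for v
    using assms(1,2) Ck_on_cong[OF assms(3), of "\<lambda>x. frechet_derivative f (at x) v" "\<lambda>x. f' x v"]
    by (simp add: frechet_derivative_eqI)
  then show ?thesis using assms(1) by (auto simp: differentiable_def)
qed

lemma Ck_on_SucE:
  assumes "Ck_on (Suc k) A f" "x \<in> A"
  shows "(f has_derivative frechet_derivative f (at x)) (at x)"
  using assms frechet_derivative_works by auto

lemma Ck_on_bounded_linear: "bounded_linear f \<Longrightarrow> open A \<Longrightarrow> Ck_on k A f"
proof (cases k)
  case 0
  moreover assume "bounded_linear f"
  ultimately show ?thesis by (simp add: linear_continuous_on)
next
  case (Suc l)
  assume "bounded_linear f" "open A"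
  then show ?thesis unfolding Suc
    by (intro Ck_on_SucI) (auto intro: bounded_linear_imp_has_derivative)
qed

lemma Ck_on_linear_comp:
  assumes L: "bounded_linear L" and A: "open A" and f: "Ck_on k A f"
  shows "Ck_on k A (\<lambda>x. L (f x))"
  using f
proof (induction k arbitrary: f)
  case 0
  then show ?case using L by (auto intro: bounded_linear.continuous_on)
next
  case (Suc k)
  show ?case
  proof (rule Ck_on_SucI[OF _ _ A])
    show "((\<lambda>x. L (f x)) has_derivative (\<lambda>v. L (frechet_derivative f (at x) v))) (at x)" if "x \<in> A" for x
      by (rule bounded_linear.has_derivative[OF L Ck_on_SucE[OF Suc.prems that]])
    show "Ck_on k A (\<lambda>x. L (frechet_derivative f (at x) v))" for v
      using Suc by auto
  qed
qed

lemma Ck_on_add: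
  assumes A: "open A" and "Ck_on k A f" "Ck_on k A g"
  shows "Ck_on k A (\<lambda>x. f x + g x)"
  using assms(2,3)
proof (induction k arbitrary: f g)
  case 0
  then show ?case by (auto intro: continuous_intros)
next
  case (Suc k)
  show ?case
  proof (rule Ck_on_SucI[OF _ _ A])
    show "((\<lambda>x. f x + g x) has_derivative (\<lambda>v. frechet_derivative f (at x) v + frechet_derivative g (at x) v)) (at x)"
      if "x \<in> A" for x
      by (intro has_derivative_add Ck_on_SucE[OF Suc.prems(1) that] Ck_on_SucE[OF Suc.prems(2) that])
    show "Ck_on k A (\<lambda>x. frechet_derivative f (at x) v + frechet_derivative g (at x) v)" for v
      using Suc by auto
  qed
qed

lemma Ck_on_sum:
  "open A \<Longrightarrow> (\<And>i. i \<in> I \<Longrightarrow> Ck_on k A (f i)) \<Longrightarrow> Ck_on k A (\<lambda>x. \<Sum>i\<in>I. f i x)"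
  by (induction I rule: infinite_finite_induct) (auto intro: Ck_on_add)

text \<open>Covers products, scalar multiples and inner products at once. The induction closes
  because the Leibniz rule again yields bilinear expressions, in functions that are still of class
  C^k.\<close>

lemma Ck_on_bilinear:
  assumes H: "bounded_bilinear H" and A: "open A" and "Ck_on k A f" "Ck_on k A g"
  shows "Ck_on k A (\<lambda>x. H (f x) (g x))"
  using assms(3,4)
proof (induction k arbitrary: f g)
  case 0
  then show ?case using H by (auto intro: bounded_bilinear.continuous_on)
next
  case (Suc k)
  show ?case
  proof (rule Ck_on_SucI[OF _ _ A])
    show "((\<lambda>x. H (f x) (g x)) has_derivative
        (\<lambda>v. H (f x) (frechet_derivative g (at x) v) + H (frechet_derivative f (at x) v) (g x))) (at x)"
      if "x \<in> A" for x
      by (intro bounded_bilinear.FDERIV[OF H] Ck_on_SucE[OF Suc.prems(1) that] Ck_on_SucE[OF Suc.prems(2) that])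
    show "Ck_on k A (\<lambda>x. H (f x) (frechet_derivative g (at x) v) + H (frechet_derivative f (at x) v) (g x))" for v
      using Suc.prems by (intro Ck_on_add[OF A] Suc.IH) (auto intro: Ck_on_SucD)
  qed
qed

lemma Ck_on_compose:
  fixes f :: "'a::euclidean_space \<Rightarrow> 'b::euclidean_space"
  assumes A: "open A" and C: "open C" and "f ` A \<subseteq> C" and "Ck_on k A f" "Ck_on k C g"
  shows "Ck_on k A (\<lambda>x. g (f x))"
  using assms(4,5)
proof (induction k arbitrary: g)
  case 0
  then show ?case using assms(3) by (auto intro: continuous_on_compose2)
next
  case (Suc k)
  let ?f' = "\<lambda>x. frechet_derivative f (at x)" and ?g' = "\<lambda>x. frechet_derivative g (at x)"
  show ?case
  proof (rule Ck_on_SucI[OF _ _ A])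
    fix x assume x: "x \<in> A"
    then have fx: "f x \<in> C" using assms(3) by auto
    note g = Ck_on_SucE[OF Suc.prems(2) fx]
    have "(g \<circ> f has_derivative ?g' (f x) \<circ> ?f' x) (at x)"
      by (intro diff_chain_at g Ck_on_SucE[OF Suc.prems(1) x])
    \<comment> \<open>\<open>Ck_on\<close> speaks of derivatives in a fixed direction, whereas the
      direction \<open>?f' x v\<close> moves with \<open>x\<close>. Expanding it in the standard
      basis separates the two dependences.\<close>
    moreover have "?g' (f x) w = (\<Sum>b\<in>Basis. (w \<bullet> b) *\<^sub>R ?g' (f x) b)" for w
    proof -
      interpret g: bounded_linear "?g' (f x)" by (rule has_derivative_bounded_linear[OF g])
      show ?thesis by (metis (no_types, lifting) euclidean_representation g.sum g.scaleR sum.cong)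
    qed
    ultimately show "((\<lambda>x. g (f x)) has_derivative (\<lambda>v. \<Sum>b\<in>Basis. (?f' x v \<bullet> b) *\<^sub>R ?g' (f x) b)) (at x)"
      by (metis (no_types, lifting) comp_def ext has_derivative_eq_rhs)
  next
    fix v
    have f: "Ck_on k A f" using Ck_on_SucD Suc.prems by blast
    show "Ck_on k A (\<lambda>x. \<Sum>b\<in>Basis. (?f' x v \<bullet> b) *\<^sub>R ?g' (f x) b)"
    proof (intro Ck_on_sum[OF A] Ck_on_bilinear[OF bounded_bilinear_scaleR A])
      fix b :: 'b
      show "Ck_on k A (\<lambda>x. ?f' x v \<bullet> b)"
        using Suc.prems(1) by (intro Ck_on_linear_comp[OF bounded_linear_inner_left A]) auto
      show "Ck_on k A (\<lambda>x. ?g' (f x) b)"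
        using Suc.prems by (intro Suc.IH f) auto
    qed
  qed
qed

definition Cinf_on :: "'e::real_normed_vector set \<Rightarrow> ('e \<Rightarrow> 'f::real_normed_vector) \<Rightarrow> bool" where
  "Cinf_on A f \<longleftrightarrow> (\<forall>k. Ck_on k A f)"

lemma smooth_on_alt: "smooth_on A f \<longleftrightarrow>
     (\<forall>a\<in>A. \<exists>O' h. open O' \<and> a \<in> O' \<and> Cinf_on O' h \<and> (\<forall>x\<in>A \<inter> O'. h x = f x))"
  unfolding smooth_on_def Cinf_on_def by simp

lemma Cinf_on_cong: "open A \<Longrightarrow> (\<And>x. x \<in> A \<Longrightarrow> f x = g x) \<Longrightarrow> Cinf_on A f \<longleftrightarrow> Cinf_on A g"
  unfolding Cinf_on_def using Ck_on_cong by blast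
lemma Cinf_on_subset: "Cinf_on A f \<Longrightarrow> B \<subseteq> A \<Longrightarrow> Cinf_on B f"
  unfolding Cinf_on_def using Ck_on_subset by blast
lemma Cinf_on_continuous: "Cinf_on A f \<Longrightarrow> continuous_on A f"
  unfolding Cinf_on_def using Ck_on_continuous by blast
lemma Cinf_on_local:
  "(\<And>a. a \<in> A \<Longrightarrow> \<exists>O'. open O' \<and> a \<in> O' \<and> Cinf_on O' f) \<Longrightarrow> Cinf_on A f"
  unfolding Cinf_on_def by (intro allI Ck_on_local) blast
lemma Cinf_on_const [simp]: "Cinf_on A (\<lambda>x. c)"
  unfolding Cinf_on_def by simp
lemma Cinf_on_linear: "bounded_linear f \<Longrightarrow> open A \<Longrightarrow> Cinf_on A f"
  unfolding Cinf_on_def by (simp add: Ck_on_bounded_linear)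
lemma Cinf_on_linear_comp: "bounded_linear L \<Longrightarrow> open A \<Longrightarrow> Cinf_on A f \<Longrightarrow> Cinf_on A (\<lambda>x. L (f x))"
  unfolding Cinf_on_def by (simp add: Ck_on_linear_comp)
lemma Cinf_on_add: "open A \<Longrightarrow> Cinf_on A f \<Longrightarrow> Cinf_on A g \<Longrightarrow> Cinf_on A (\<lambda>x. f x + g x)"
  unfolding Cinf_on_def by (simp add: Ck_on_add)
lemma Cinf_on_sum: "open A \<Longrightarrow> (\<And>i. i \<in> I \<Longrightarrow> Cinf_on A (f i)) \<Longrightarrow> Cinf_on A (\<lambda>x. \<Sum>i\<in>I. f i x)"
  unfolding Cinf_on_def by (simp add: Ck_on_sum)
lemma Cinf_on_bilinear:
  "bounded_bilinear H \<Longrightarrow> open A \<Longrightarrow> Cinf_on A f \<Longrightarrow> Cinf_on A g \<Longrightarrow> Cinf_on A (\<lambda>x. H (f x) (g x))"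
  unfolding Cinf_on_def by (simp add: Ck_on_bilinear)
lemmas Cinf_on_mult = Cinf_on_bilinear[OF bounded_bilinear_mult]
lemma Cinf_on_compose:
  fixes f :: "'a::euclidean_space \<Rightarrow> 'b::euclidean_space"
  shows "open A \<Longrightarrow> open C \<Longrightarrow> f ` A \<subseteq> C \<Longrightarrow> Cinf_on A f \<Longrightarrow> Cinf_on C g \<Longrightarrow> Cinf_on A (\<lambda>x. g (f x))"
  unfolding Cinf_on_def by (simp add: Ck_on_compose)
lemma Cinf_on_deriv: "Cinf_on A f \<Longrightarrow> Cinf_on A (\<lambda>x. frechet_derivative f (at x) v)"
  unfolding Cinf_on_def by (metis Ck_on.simps(2))
lemma Cinf_on_has_derivative:
  "Cinf_on A f \<Longrightarrow> x \<in> A \<Longrightarrow> (f has_derivative frechet_derivative f (at x)) (at x)"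
  unfolding Cinf_on_def using Ck_on_SucE by blast
text \<open>The derivative is a polynomial in \<open>inverse\<close> itself, so the class rises by
  one at each step through closure under products.\<close>

lemma Cinf_on_inverse: "Cinf_on {x::real. x \<noteq> 0} inverse"
proof -
  have o: "open {x::real. x \<noteq> 0}" by (simp add: open_Collect_neq)
  have "Ck_on k {x::real. x \<noteq> 0} inverse" for k
  proof (induction k)
    case 0
    show ?case by (auto intro: continuous_intros)
  next
    case (Suc k)
    have "Ck_on k {x::real. x \<noteq> 0} (\<lambda>x. (inverse x * inverse x) * (- v))" for v
      by (intro Ck_on_bilinear[OF bounded_bilinear_mult o] Suc Ck_on_const)
    then show ?case
      by (intro Ck_on_SucI[where f'="\<lambda>x v. (inverse x * inverse x) * (- v)"] o)
        (auto intro!: derivative_eq_intros)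
  qed
  then show ?thesis by (simp add: Cinf_on_def)
qed

section \<open>Bump functions\<close>

text \<open>The flat function exp(-1/t), extended by 0, together with its multiples by t^(-n). The
  powers are carried along because only the whole family is closed, up to linear combinations, under
  differentiation.\<close>

definition flat_exp :: "nat \<Rightarrow> real \<Rightarrow> real" where
  "flat_exp n t = (if t > 0 then inverse t ^ n * exp (- inverse t) else 0)"

text \<open>With s = 1/t this is the decay of s^n exp(-s) at infinity on the right; on the left the
  function is 0.\<close>

lemma flat_exp_tendsto_0: "(flat_exp n \<longlongrightarrow> 0) (at 0)"
proof -
  have "((\<lambda>x::real. inverse x ^ n / exp (inverse x)) \<longlongrightarrow> 0) (at_right 0)"
    by (rule filterlim_compose[OF tendsto_power_div_exp_0 filterlim_inverse_at_top_right])
  then have "(flat_exp n \<longlongrightarrow> 0) (at_right 0)"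
    by (rule tendsto_cong[THEN iffD1, rotated])
      (auto simp: flat_exp_def eventually_at_filter exp_minus field_simps)
  moreover have "(flat_exp n \<longlongrightarrow> 0) (at_left 0)"
    by (rule tendsto_eventually) (auto simp: flat_exp_def eventually_at_filter)
  ultimately show ?thesis by (simp add: filterlim_split_at_real)
qed

lemma flat_exp_has_derivative:
  "(flat_exp n has_real_derivative (flat_exp (n + 2) t - real n * flat_exp (n + 1) t)) (at t)"
proof -
  consider "t > 0" | "t < 0" | "t = 0" by linarith
  then show ?thesis
  proof cases
    case 1
    have "((\<lambda>t. inverse t ^ n * exp (- inverse t)) has_real_derivative
        (flat_exp (n + 2) t - real n * flat_exp (n + 1) t)) (at t)"
    proof -
      have d: "(inverse has_real_derivative - (inverse t ^ Suc (Suc 0))) (at t)"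
        using 1 by (intro DERIV_inverse) simp
      show ?thesis
        by (rule DERIV_cong[OF DERIV_mult[OF DERIV_power[OF d] DERIV_chain2[OF DERIV_exp DERIV_minus[OF d]]]])
          (use 1 in \<open>cases n; simp add: flat_exp_def algebra_simps\<close>)
    qed
    then show ?thesis
      by (rule has_field_derivative_transform_within_open[of _ _ _ "{0<..}"])
        (use 1 in \<open>auto simp: flat_exp_def\<close>)
  next
    case 2
    have "((\<lambda>t::real. 0) has_real_derivative 0) (at t)" by simp
    then have "(flat_exp n has_real_derivative 0) (at t)"
      by (rule has_field_derivative_transform_within_open[of _ _ _ "{..<0}"])
        (use 2 in \<open>auto simp: flat_exp_def\<close>)
    then show ?thesis using 2 by (simp add: flat_exp_def)
  next
    case 3
    \<comment> \<open>Since \<open>flat_exp n 0 = 0\<close>, the difference quotient at 0 is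
      \<open>flat_exp (Suc n)\<close>, whose limit is already known.\<close>
    have "((\<lambda>h. (flat_exp n (0 + h) - flat_exp n 0) / h) \<longlongrightarrow> 0) (at 0)"
      by (rule tendsto_cong[THEN iffD1, OF _ flat_exp_tendsto_0[of "Suc n"]])
        (auto simp: flat_exp_def field_simps eventually_at_filter)
    then show ?thesis unfolding 3 DERIV_def by (simp add: flat_exp_def)
  qed
qed

lemma Cinf_on_flat_exp: "Cinf_on UNIV (flat_exp n)"
proof -
  have "Ck_on k UNIV (flat_exp n)" for k
  proof (induction k arbitrary: n)
    case 0
    show ?case
      by (auto intro!: continuous_at_imp_continuous_on DERIV_isCont flat_exp_has_derivative)
  next
    case (Suc k)
    have "Ck_on k UNIV (\<lambda>x. (flat_exp (n + 2) x + (- real n) * flat_exp (n + 1) x) * v)" for v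
      by (intro Ck_on_bilinear[OF bounded_bilinear_mult] Ck_on_add Suc Ck_on_const open_UNIV)
    then show ?case
      using flat_exp_has_derivative[of n]
      by (intro Ck_on_SucI[where f'="\<lambda>x v. (flat_exp (n + 2) x + (- real n) * flat_exp (n + 1) x) * v"])
        (auto simp: has_field_derivative_def)
  qed
  then show ?thesis by (simp add: Cinf_on_def)
qed

text \<open>The quotient \<open>\<sigma>\<close> is a smooth step, 0 for t <= 0 and 1 for t >= 1; it
  is composed with a quadratic function of the distance to \<open>a\<close>.\<close>

lemma euclidean_bump:
  fixes a :: "'e::euclidean_space"
  assumes "r > 0"
  shows "\<exists>\<beta> :: 'e \<Rightarrow> real. Cinf_on UNIV \<beta> \<and> (\<forall>x\<in>ball a r. \<beta> x = 1) \<and> (\<forall>x. x \<notin> ball a (2 * r) \<longrightarrow> \<beta> x = 0)"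
proof -
  define \<sigma> where "\<sigma> t = flat_exp 0 t * inverse (flat_exp 0 t + flat_exp 0 (1 + (-1) * t))" for t
  \<comment> \<open>At least 1 on the ball of radius \<open>r\<close> and nonpositive from radius
    sqrt 2 * r on, hence off the ball of radius 2 * r. The squared norm keeps it smooth at the
    centre.\<close>
  define u where "u x = 2 + (- inverse (r\<^sup>2)) * ((x - a) \<bullet> (x - a))" for x
  define \<beta> where "\<beta> x = \<sigma> (u x)" for x
  \<comment> \<open>The numbers t and 1 - t are never both nonpositive, so the denominator of
    \<open>\<sigma>\<close> does not vanish.\<close>
  have pos: "flat_exp 0 t + flat_exp 0 (1 + (-1) * t) > 0" for t
    by (cases "t > 0") (auto simp: flat_exp_def add_pos_nonneg)
  have c: "Cinf_on UNIV (\<lambda>t. flat_exp 0 (1 + (-1) * t))"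
  proof -
    have "Cinf_on UNIV (\<lambda>t::real. 1 + (-1) * t)"
      by (intro Cinf_on_add Cinf_on_mult Cinf_on_const open_UNIV Cinf_on_linear[OF bounded_linear_ident])
    then show ?thesis by (intro Cinf_on_compose[OF _ _ _ _ Cinf_on_flat_exp]) auto
  qed
  have "Cinf_on UNIV \<sigma>"
    unfolding \<sigma>_def
    by (intro Cinf_on_mult Cinf_on_flat_exp open_UNIV
        Cinf_on_compose[OF _ _ _ _ Cinf_on_inverse, where f="\<lambda>t. flat_exp 0 t + flat_exp 0 (1 + (-1) * t)"]
        Cinf_on_add c) (use pos in \<open>auto simp: open_Collect_neq less_le\<close>)
  moreover have "Cinf_on UNIV u"
  proof -
    have "Cinf_on UNIV (\<lambda>x. x + (- a))"
      by (intro Cinf_on_add Cinf_on_const open_UNIV Cinf_on_linear[OF bounded_linear_ident])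
    then show ?thesis
      unfolding u_def
      by (intro Cinf_on_add Cinf_on_mult Cinf_on_const open_UNIV Cinf_on_bilinear[OF bounded_bilinear_inner]) simp_all
  qed
  ultimately have "Cinf_on UNIV \<beta>"
    using Cinf_on_compose[OF open_UNIV open_UNIV subset_UNIV, of u \<sigma>] by (simp add: \<beta>_def[abs_def])
  moreover have "\<beta> x = 1" if "x \<in> ball a r" for x
  proof -
    have "(x - a) \<bullet> (x - a) \<le> r\<^sup>2"
      using that unfolding mem_ball dist_norm dot_square_norm
      by (intro power_mono) (auto simp: norm_minus_commute)
    then have "u x \<ge> 1" using assms by (simp add: u_def field_simps)
    then have "flat_exp 0 (1 + (-1) * u x) = 0" "flat_exp 0 (u x) \<noteq> 0" by (auto simp: flat_exp_def)
    then show ?thesis by (simp add: \<beta>_def \<sigma>_def)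
  qed
  moreover have "\<beta> x = 0" if "x \<notin> ball a (2 * r)" for x
  proof -
    have "(2 * r)\<^sup>2 \<le> (x - a) \<bullet> (x - a)"
      using that assms unfolding mem_ball dist_norm dot_square_norm
      by (intro power_mono) (auto simp: norm_minus_commute)
    then have "2 * r\<^sup>2 \<le> (x - a) \<bullet> (x - a)"
    proof -
      have "(2 * r)\<^sup>2 = 4 * r\<^sup>2" by (simp add: power_mult_distrib)
      with \<open>(2 * r)\<^sup>2 \<le> _\<close> show ?thesis using zero_le_power2[of r] by linarith
    qed
    then have "u x \<le> 0" using assms by (simp add: u_def field_simps)
    then show ?thesis by (simp add: \<beta>_def \<sigma>_def flat_exp_def)
  qed
  ultimately show ?thesis by blast
qed

section \<open>Hadamard's lemma\<close>

text \<open>Differentiation under the integral asks for a derivative that is continuous as a map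
  into bounded linear functions. In finite dimension this may be checked on basis vectors, which is
  what \<open>Ck_on\<close> provides.\<close>

lemma Ck_on_Suc_blinfun:
  fixes f :: "'e::euclidean_space \<Rightarrow> real"
  assumes "Ck_on (Suc k) A f"
  obtains D where "\<And>x. x \<in> A \<Longrightarrow> (f has_derivative blinfun_apply (D x)) (at x)" "continuous_on A D"
    "\<And>x v. x \<in> A \<Longrightarrow> blinfun_apply (D x) v = frechet_derivative f (at x) v"
proof
  define D where "D x = Blinfun (frechet_derivative f (at x))" for x
  show *: "blinfun_apply (D x) v = frechet_derivative f (at x) v" if "x \<in> A" for x v
    unfolding D_def
    using Ck_on_SucE[OF assms that] by (metis bounded_linear_Blinfun_apply has_derivative_bounded_linear)
  then have "blinfun_apply (D x) = frechet_derivative f (at x)" if "x \<in> A" for x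
    using that by auto
  then show "(f has_derivative blinfun_apply (D x)) (at x)" if "x \<in> A" for x
    using that Ck_on_SucE[OF assms that] by auto
  show "continuous_on A D"
  proof (rule continuous_on_blinfun_componentwise)
    fix i :: 'e
    have "continuous_on A (\<lambda>x. frechet_derivative f (at x) i)"
      using assms by (intro Ck_on_continuous[of k]) simp
    then show "continuous_on A (\<lambda>x. blinfun_apply (D x) i)"
      by (simp add: * cong: continuous_on_cong)
  qed
qed

lemma ray_in_ball:
  fixes a :: "'a::real_normed_vector"
  assumes "x \<in> ball a r" "t \<in> {0..1}"
  shows "a + t *\<^sub>R (x - a) \<in> ball a r"
proof -
  have "norm (t *\<^sub>R (x - a)) \<le> norm (x - a)"
    using assms by (simp add: mult_left_le_one_le)
  then show ?thesis using assms by (simp add: dist_norm norm_minus_commute)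
qed

lemma continuous_on_ray:
  fixes a :: "'a::real_normed_vector"
  assumes "continuous_on (ball a r) g"
  shows "continuous_on (ball a r \<times> cbox (0::real) 1) (\<lambda>z. g (a + snd z *\<^sub>R (fst z - a)))"
proof (rule continuous_on_compose2[OF assms])
  show "continuous_on (ball a r \<times> cbox (0::real) 1) (\<lambda>z. a + snd z *\<^sub>R (fst z - a))"
    by (intro continuous_intros)
  show "(\<lambda>z. a + snd z *\<^sub>R (fst z - a)) ` (ball a r \<times> cbox (0::real) 1) \<subseteq> ball a r"
    using ray_in_ball[of _ a r] unfolding image_subset_iff by (metis cbox_interval mem_Times_iff)
qed

lemma continuous_on_ray_at:
  fixes a :: "'a::real_normed_vector"
  assumes "continuous_on (ball a r) g" "x \<in> ball a r"
  shows "continuous_on {0..1::real} (\<lambda>t. g (a + t *\<^sub>R (x - a)))"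
proof (rule continuous_on_compose2[OF assms(1)])
  show "continuous_on {0..1::real} (\<lambda>t. a + t *\<^sub>R (x - a))"
    by (intro continuous_intros)
qed (use ray_in_ball[OF assms(2)] in blast)

text \<open>The weight t^n makes the induction go through: each differentiation in \<open>x\<close>
  under the integral produces one more factor \<open>t\<close> from the inner map
  \<open>a + t *\<^sub>R (x - a)\<close>.\<close>

lemma Ck_on_ray_integral:
  fixes f :: "'e::euclidean_space \<Rightarrow> real"
  assumes "Ck_on k (ball a r) f"
  shows "Ck_on k (ball a r) (\<lambda>x. integral {0..1} (\<lambda>t. t ^ n * f (a + t *\<^sub>R (x - a))))"
  using assms
proof (induction k arbitrary: f n)
  case 0
  note in_ball = ray_in_ball[of _ a r]
  have "continuous_on (ball a r \<times> cbox 0 1) (\<lambda>(x, t). t ^ n * f (a + t *\<^sub>R (x - a)))"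
    unfolding split_beta using 0 by (intro continuous_on_mult continuous_on_ray) (auto intro!: continuous_intros)
  from integral_continuous_on_param[OF this] show ?case by simp
next
  case (Suc k)
  note in_ball = ray_in_ball[of _ a r]
  obtain D where D: "\<And>x. x \<in> ball a r \<Longrightarrow> (f has_derivative blinfun_apply (D x)) (at x)"
    "continuous_on (ball a r) D"
    "\<And>x v. x \<in> ball a r \<Longrightarrow> blinfun_apply (D x) v = frechet_derivative f (at x) v"
    using Ck_on_Suc_blinfun[OF Suc.prems] by blast
  define fx where "fx x t = (t ^ Suc n) *\<^sub>R D (a + t *\<^sub>R (x - a))" for x and t :: real
  have cfx: "continuous_on (ball a r \<times> cbox 0 1) (\<lambda>(x, t). fx x t)"
    unfolding split_beta fx_def
    by (intro continuous_on_scaleR continuous_on_ray D(2)) (intro continuous_intros)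
  have cf: "continuous_on (cbox 0 1) (\<lambda>t. t ^ m * f (a + t *\<^sub>R (x - a)))" if "x \<in> ball a r" for x m
  proof -
    have "continuous_on (cbox (0::real) 1) (\<lambda>t. f (a + t *\<^sub>R (x - a)))"
      using continuous_on_ray_at[OF Ck_on_continuous[OF Suc.prems] that] by simp
    then show ?thesis by (intro continuous_on_mult) (auto intro: continuous_intros)
  qed
  show ?case
  proof (rule Ck_on_SucI)
    fix x0 assume x0: "x0 \<in> ball a r"
    have "((\<lambda>x. integral (cbox 0 1) (\<lambda>t. t ^ n * f (a + t *\<^sub>R (x - a)))) has_derivative
      integral (cbox 0 1) (fx x0)) (at x0 within ball a r)"
    proof (rule leibniz_rule[OF _ _ cfx x0 convex_ball])
      fix x t assume x: "x \<in> ball a r" and t: "t \<in> cbox (0::real) 1"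
      have "((\<lambda>x. f (a + t *\<^sub>R (x - a))) has_derivative (\<lambda>v. blinfun_apply (D (a + t *\<^sub>R (x - a))) (t *\<^sub>R v))) (at x)"
        using x t in_ball
        by (intro has_derivative_compose[of "\<lambda>x. a + t *\<^sub>R (x - a)", OF _ D(1)])
          (auto intro!: derivative_eq_intros simp del: mem_ball)
      then have "((\<lambda>x. t ^ n * f (a + t *\<^sub>R (x - a))) has_derivative
          (\<lambda>v. t ^ n * blinfun_apply (D (a + t *\<^sub>R (x - a))) (t *\<^sub>R v))) (at x)"
        by (rule has_derivative_mult_right)
      then show "((\<lambda>x. t ^ n * f (a + t *\<^sub>R (x - a))) has_derivative blinfun_apply (fx x t)) (at x within ball a r)"
        by (auto simp: fx_def blinfun.scaleR_left blinfun.scaleR_right algebra_simps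
            intro!: has_derivative_at_withinI elim!: has_derivative_eq_rhs)
    qed (use cf integrable_continuous in blast)
    then show "((\<lambda>x. integral {0..1} (\<lambda>t. t ^ n * f (a + t *\<^sub>R (x - a)))) has_derivative
      blinfun_apply (integral (cbox 0 1) (fx x0))) (at x0)"
      using x0 by (simp add: at_within_open[OF x0 open_ball])
  next
    fix v
    have "blinfun_apply (integral (cbox 0 1) (fx x)) v =
        integral {0..1} (\<lambda>t. t ^ Suc n * frechet_derivative f (at (a + t *\<^sub>R (x - a))) v)" if x: "x \<in> ball a r" for x
    proof -
      have "continuous_on {0..1} (\<lambda>t. (t ^ Suc n) *\<^sub>R D (a + t *\<^sub>R (x - a)))"
        by (intro continuous_on_scaleR continuous_on_ray_at[OF D(2) x]) (intro continuous_intros)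
      then have "continuous_on (cbox 0 1) (fx x)"
        by (simp add: fx_def[abs_def])
      then have "fx x integrable_on cbox 0 1" by (rule integrable_continuous)
      then have "blinfun_apply (integral (cbox 0 1) (fx x)) v = integral (cbox 0 1) (\<lambda>t. blinfun_apply (fx x t) v)"
        using integral_linear[OF _ blinfun.bounded_linear_left[of v], of "fx x" "cbox 0 1"] by (simp add: o_def)
      also have "\<dots> = integral {0..1} (\<lambda>t. t ^ Suc n * frechet_derivative f (at (a + t *\<^sub>R (x - a))) v)"
        unfolding cbox_interval
        by (rule integral_cong) (use x in_ball in \<open>simp add: fx_def blinfun.scaleR_left D(3) del: mem_ball\<close>)
      finally show ?thesis .
    qed
    moreover have "Ck_on k (ball a r) (\<lambda>x. integral {0..1} (\<lambda>t. t ^ Suc n * frechet_derivative f (at (a + t *\<^sub>R (x - a))) v))"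
      using Suc.prems by (intro Suc.IH) auto
    ultimately show "Ck_on k (ball a r) (\<lambda>x. blinfun_apply (integral (cbox 0 1) (fx x)) v)"
      by (subst Ck_on_cong) auto
  qed auto
qed

text \<open>Integrate the derivative of \<open>f\<close> along the segment from \<open>a\<close> to
  \<open>x\<close>. The coefficients \<open>G v\<close> exist for every direction \<open>v\<close>,
  and the expansion asks only that \<open>x - a\<close> be a combination of \<open>I\<close>; later
  \<open>I\<close> is a basis of the model space, which may be a proper subspace.\<close>

lemma hadamard:
  fixes f :: "'e::euclidean_space \<Rightarrow> real"
  assumes f: "Cinf_on (ball a r) f" and r: "r > 0"
  shows "\<exists>G :: 'e \<Rightarrow> 'e \<Rightarrow> real. (\<forall>v. Cinf_on (ball a r) (G v)) \<and>
    (\<forall>v. G v a = frechet_derivative f (at a) v) \<and>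
    (\<forall>I c x. finite I \<longrightarrow> x \<in> ball a r \<longrightarrow> x - a = (\<Sum>i\<in>I. c i *\<^sub>R i) \<longrightarrow> f x = f a + (\<Sum>i\<in>I. c i * G i x))"
proof -
  define G where "G v x = integral {0..1} (\<lambda>t. t ^ 0 * frechet_derivative f (at (a + t *\<^sub>R (x - a))) v)" for v x
  have 1: "Cinf_on (ball a r) (G v)" for v
    using Cinf_on_deriv[OF f, of v] unfolding G_def Cinf_on_def by (intro allI Ck_on_ray_integral) simp
  have 2: "G v a = frechet_derivative f (at a) v" for v
    by (simp add: G_def)
  have "f x = f a + (\<Sum>i\<in>I. c i * G i x)"
    if I: "finite I" and x: "x \<in> ball a r" and s: "x - a = (\<Sum>i\<in>I. c i *\<^sub>R i)" for I c x
  proof -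
  note in_ball = ray_in_ball[OF x]
  let ?D = "\<lambda>t. frechet_derivative f (at (a + t *\<^sub>R (x - a)))"
  have "((\<lambda>t. ?D t (x - a)) has_integral f (a + 1 *\<^sub>R (x - a)) - f (a + 0 *\<^sub>R (x - a))) {0..1}"
  proof (rule fundamental_theorem_of_calculus)
    fix t :: real assume t: "t \<in> {0..1}"
    have "((\<lambda>t. f (a + t *\<^sub>R (x - a))) has_derivative (\<lambda>v. ?D t (v *\<^sub>R (x - a)))) (at t)"
      by (rule has_derivative_compose[of "\<lambda>t. a + t *\<^sub>R (x - a)", OF _ Cinf_on_has_derivative[OF f in_ball[OF t]]])
        (auto intro!: derivative_eq_intros)
    moreover have "linear (?D t)"
      using Cinf_on_has_derivative[OF f in_ball[OF t]] has_derivative_linear by blast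
    ultimately show "((\<lambda>t. f (a + t *\<^sub>R (x - a))) has_vector_derivative ?D t (x - a)) (at t within {0..1})"
      by (auto simp: has_vector_derivative_def linear_cmul intro: has_derivative_at_withinI)
  qed auto
  moreover have "((\<lambda>t. \<Sum>i\<in>I. c i * ?D t i) has_integral (\<Sum>i\<in>I. c i * G i x)) {0..1}"
  proof (intro has_integral_sum I has_integral_mult_right)
    fix i
    have "continuous_on {0..1} (\<lambda>t. ?D t i)"
      by (rule continuous_on_ray_at[OF Cinf_on_continuous[OF Cinf_on_deriv[OF f]] x])
    then show "((\<lambda>t. ?D t i) has_integral G i x) {0..1}"
      unfolding G_def by (auto intro!: integrable_integral integrable_continuous_real)
  qed
  moreover have D: "?D t (x - a) = (\<Sum>i\<in>I. c i * ?D t i)" if "t \<in> {0..1}" for t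
  proof -
    have "linear (?D t)"
      using Cinf_on_has_derivative[OF f in_ball[OF that]] has_derivative_linear by blast
    then show ?thesis unfolding s by (simp add: linear_sum linear_cmul)
  qed
  ultimately have "f (a + 1 *\<^sub>R (x - a)) - f (a + 0 *\<^sub>R (x - a)) = (\<Sum>i\<in>I. c i * G i x)"
    using has_integral_unique has_integral_cong[of "{0..1}" "\<lambda>t. ?D t (x - a)", OF D] by blast
  then show ?thesis by simp
  qed
  with 1 2 show ?thesis by blast
qed

section \<open>Smooth functions and tangent vectors on manifolds\<close>

definition mbasis :: "('a, 'e::euclidean_space) mfd \<Rightarrow> 'e set" where
  "mbasis M = (SOME E. E \<subseteq> model M \<and> pairwise orthogonal E \<and> (\<forall>x\<in>E. norm x = 1) \<and> finite E \<and> span E = model M)"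

definition mproj :: "('a, 'e::euclidean_space) mfd \<Rightarrow> 'e \<Rightarrow> 'e" where
  "mproj M x = (\<Sum>b\<in>mbasis M. (x \<bullet> b) *\<^sub>R b)"

text \<open>
  Precomposition with the orthogonal projection onto the model space turns the coordinate
  representation of a function into a function on an open subset of the ambient Euclidean space.
\<close>

definition cdom :: "('a, 'e::euclidean_space) mfd \<Rightarrow> 'a set \<Rightarrow> ('a \<Rightarrow> 'e) \<Rightarrow> 'e set" where
  "cdom M U \<phi> = {x. mproj M x \<in> \<phi> ` U}"

definition crep :: "('a, 'e::euclidean_space) mfd \<Rightarrow> 'a set \<Rightarrow> ('a \<Rightarrow> 'e) \<Rightarrow> ('a \<Rightarrow> real) \<Rightarrow> 'e \<Rightarrow> real" where
  "crep M U \<phi> f = (\<lambda>x. f (inv_into U \<phi> (mproj M x)))"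

definition cderiv :: "('a, 'e::euclidean_space) mfd \<Rightarrow> 'a set \<Rightarrow> ('a \<Rightarrow> 'e) \<Rightarrow> 'e \<Rightarrow> ('a \<Rightarrow> real) \<Rightarrow> 'a \<Rightarrow> real" where
  "cderiv M U \<phi> b f p = frechet_derivative (crep M U \<phi> f) (at (\<phi> p)) b"

locale premanifold =
  fixes M :: "('a, 'e::euclidean_space) mfd"
  assumes Hausdorff: "Hausdorff_space (mtop M)"
    and subspace_model: "subspace (model M)"
    and chart_open: "(U, \<phi>) \<in> atlas M \<Longrightarrow> openin (mtop M) U"
    and chart_image_open: "(U, \<phi>) \<in> atlas M \<Longrightarrow> openin (top_of_set (model M)) (\<phi> ` U)"
    and chart_homeo: "(U, \<phi>) \<in> atlas M \<Longrightarrow>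
      homeomorphic_map (subtopology (mtop M) U) (top_of_set (\<phi> ` U)) \<phi>"
    and atlas_cover: "p \<in> carrier_of M \<Longrightarrow> \<exists>U \<phi>. (U, \<phi>) \<in> atlas M \<and> p \<in> U"
    and transition: "(U, \<phi>) \<in> atlas M \<Longrightarrow> (V, \<psi>) \<in> atlas M \<Longrightarrow>
      smooth_on (\<phi> ` (U \<inter> V)) (\<psi> \<circ> inv_into U \<phi>)"

lemma smooth_manifold_premanifold: "smooth_manifold M \<Longrightarrow> premanifold M"
  unfolding smooth_manifold_def by unfold_locales fast+

lemma orthonormal_basis_exists:
  fixes S :: "'e::euclidean_space set"
  assumes "subspace S"
  shows "\<exists>E. E \<subseteq> S \<and> pairwise orthogonal E \<and> (\<forall>x\<in>E. norm x = 1) \<and> finite E \<and> span E = S"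
  by (rule orthonormal_basis_subspace[OF assms]) (metis independent_imp_finite)

lemma smooth_funs_cong:
  assumes "\<And>p. p \<in> (\<Union>(U, \<phi>)\<in>atlas M. U) \<Longrightarrow> f p = h p"
  shows "f \<in> smooth_funs M \<longleftrightarrow> h \<in> smooth_funs M"
proof -
  have "smooth_on (\<phi> ` U) (f \<circ> inv_into U \<phi>) \<longleftrightarrow> smooth_on (\<phi> ` U) (h \<circ> inv_into U \<phi>)"
    if "(U, \<phi>) \<in> atlas M" for U \<phi>
  proof -
    have "(f \<circ> inv_into U \<phi>) x = (h \<circ> inv_into U \<phi>) x" if "x \<in> \<phi> ` U" for x
      using that assms \<open>(U, \<phi>) \<in> atlas M\<close> inv_into_into[OF that] by fastforce
    then show ?thesis unfolding smooth_on_def by (metis IntD1)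
  qed
  then show ?thesis unfolding smooth_funs_def by auto
qed

context premanifold
begin

section \<open>Orthogonal projection onto the model space and coordinate representations\<close>

lemma mbasis: "mbasis M \<subseteq> model M" "pairwise orthogonal (mbasis M)" "x \<in> mbasis M \<Longrightarrow> norm x = 1"
  "finite (mbasis M)" "span (mbasis M) = model M"
  using someI_ex[OF orthonormal_basis_exists[OF subspace_model]] unfolding mbasis_def by auto

lemma mbasis_inner: "b \<in> mbasis M \<Longrightarrow> c \<in> mbasis M \<Longrightarrow> b \<bullet> c = (if b = c then 1 else 0)"
  using mbasis(2,3) by (auto simp: pairwise_def orthogonal_def norm_eq_1)

lemma bounded_linear_mproj: "bounded_linear (mproj M)"
  unfolding mproj_def
  by (intro bounded_linear_sum bounded_linear_scaleR_const bounded_linear_inner_left)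

lemma mproj_in: "mproj M x \<in> model M"
  unfolding mproj_def using mbasis(1) subspace_model
  by (intro subspace_sum subspace_scale) auto

lemma mproj_id: "x \<in> model M \<Longrightarrow> mproj M x = x"
proof -
  assume "x \<in> model M"
  then have "x \<in> span (mbasis M)" using mbasis by simp
  then show ?thesis
  proof (induction rule: span_induct_alt)
    case base
    show ?case by (simp add: mproj_def)
  next
    case (step c b y)
    have "mproj M b = b"
      using step(1) mbasis(4) by (simp add: mproj_def mbasis_inner if_distrib[of "\<lambda>c. c *\<^sub>R _"] cong: if_cong)
    then show ?case
      using step(2) bounded_linear_mproj by (simp add: bounded_linear.linear linear_add linear_scale)
  qed
qed

lemma open_mproj_vimage: "openin (top_of_set (model M)) A \<Longrightarrow> open {x. mproj M x \<in> A}"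
proof -
  assume "openin (top_of_set (model M)) A"
  then obtain O' where O': "open O'" "A = model M \<inter> O'"
    using openin_open by blast
  then have "{x. mproj M x \<in> A} = mproj M -` O'" using mproj_in by auto
  moreover have "continuous_on UNIV (mproj M)"
    using bounded_linear_mproj linear_continuous_on by blast
  ultimately show ?thesis using O'(1) by (simp add: open_vimage)
qed

text \<open>Replaces local extendability by smoothness on a single open set. One direction composes
  each local extension with the projection; in the other, \<open>f\<close> composed with the
  projection is itself the extension.\<close>

lemma smooth_on_iff:
  assumes A: "openin (top_of_set (model M)) A"
  shows "smooth_on A f \<longleftrightarrow> Cinf_on {x. mproj M x \<in> A} (\<lambda>x. f (mproj M x))"
proof
  assume f: "smooth_on A f"
  show "Cinf_on {x. mproj M x \<in> A} (\<lambda>x. f (mproj M x))"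
  proof (rule Cinf_on_local)
    fix x assume "x \<in> {x. mproj M x \<in> A}"
    then obtain O' h where O': "open O'" "mproj M x \<in> O'" "Cinf_on O' h" "\<forall>y\<in>A \<inter> O'. h y = f y"
      using f unfolding smooth_on_alt by blast
    have op: "open (mproj M -` O')"
      by (rule open_vimage[OF O'(1) linear_continuous_on[OF bounded_linear_mproj]])
    have "Cinf_on (mproj M -` O') (\<lambda>x. h (mproj M x))"
      by (rule Cinf_on_compose[OF op O'(1) _ Cinf_on_linear[OF bounded_linear_mproj op] O'(3)]) auto
    then have "Cinf_on ({x. mproj M x \<in> A} \<inter> (mproj M -` O')) (\<lambda>x. h (mproj M x))"
      by (rule Cinf_on_subset) simp
    then have "Cinf_on ({x. mproj M x \<in> A} \<inter> (mproj M -` O')) (\<lambda>x. f (mproj M x))"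
      by (rule Cinf_on_cong[THEN iffD1, rotated -1])
        (use op O' open_mproj_vimage[OF A] in auto)
    then show "\<exists>O'. open O' \<and> x \<in> O' \<and> Cinf_on O' (\<lambda>x. f (mproj M x))"
      using op O'(2) open_mproj_vimage[OF A] \<open>x \<in> {x. mproj M x \<in> A}\<close>
      by (intro exI[of _ "{x. mproj M x \<in> A} \<inter> (mproj M -` O')"]) auto
  qed
next
  assume f: "Cinf_on {x. mproj M x \<in> A} (\<lambda>x. f (mproj M x))"
  have id: "mproj M x = x" if "x \<in> A" for x
    using that A mproj_id openin_imp_subset by blast
  show "smooth_on A f"
    unfolding smooth_on_alt
    using f open_mproj_vimage[OF A] id
    by (intro ballI exI[of _ "{x. mproj M x \<in> A}"] exI[of _ "\<lambda>x. f (mproj M x)"]) auto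
qed

lemma open_cdom: "(U, \<phi>) \<in> atlas M \<Longrightarrow> open (cdom M U \<phi>)"
  unfolding cdom_def by (rule open_mproj_vimage[OF chart_image_open])

lemma smooth_funs_iff:
  "f \<in> smooth_funs M \<longleftrightarrow> (\<forall>U \<phi>. (U, \<phi>) \<in> atlas M \<longrightarrow> Cinf_on (cdom M U \<phi>) (crep M U \<phi> f))"
  unfolding smooth_funs_def cdom_def crep_def
  by (auto simp: smooth_on_iff[OF chart_image_open])

lemma chart_subset: "(U, \<phi>) \<in> atlas M \<Longrightarrow> U \<subseteq> carrier_of M"
  using chart_open openin_subset by blast

lemma chart_inj: "(U, \<phi>) \<in> atlas M \<Longrightarrow> inj_on \<phi> U"
  using homeomorphic_imp_injective_map[OF chart_homeo] chart_subset by (metis inf.absorb2 topspace_subtopology)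

lemma chart_in_model: "(U, \<phi>) \<in> atlas M \<Longrightarrow> p \<in> U \<Longrightarrow> \<phi> p \<in> model M"
  using chart_image_open openin_imp_subset by blast

lemma mproj_chart: "(U, \<phi>) \<in> atlas M \<Longrightarrow> p \<in> U \<Longrightarrow> mproj M (\<phi> p) = \<phi> p"
  using chart_in_model mproj_id by blast

lemma chart_in_cdom: "(U, \<phi>) \<in> atlas M \<Longrightarrow> p \<in> U \<Longrightarrow> \<phi> p \<in> cdom M U \<phi>"
  by (simp add: cdom_def mproj_chart)

lemma crep_chart: "(U, \<phi>) \<in> atlas M \<Longrightarrow> p \<in> U \<Longrightarrow> crep M U \<phi> f (\<phi> p) = f p"
  by (simp add: crep_def mproj_chart chart_inj inv_into_f_f)

lemma chart_open_image:
  assumes c: "(U, \<phi>) \<in> atlas M" and W: "openin (mtop M) W" "W \<subseteq> U"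
  shows "openin (top_of_set (model M)) (\<phi> ` W)"
proof -
  have "openin (subtopology (mtop M) U) W"
    using W openin_subtopology_Int2 by (metis inf.absorb2 openin_subtopology_Int2)
  then have "openin (top_of_set (\<phi> ` U)) (\<phi> ` W)"
    using homeomorphic_imp_open_map[OF chart_homeo[OF c]] by (simp add: open_map_def)
  then show ?thesis using chart_image_open[OF c] openin_trans by blast
qed

lemma chart_preimage_open:
  assumes c: "(U, \<phi>) \<in> atlas M" and "open O'"
  shows "openin (mtop M) {p \<in> U. \<phi> p \<in> O'}"
proof -
  have "continuous_map (subtopology (mtop M) U) (top_of_set (\<phi> ` U)) \<phi>"
    using chart_homeo[OF c] homeomorphic_imp_continuous_map by blast
  then have "openin (subtopology (mtop M) U) {p \<in> topspace (subtopology (mtop M) U). \<phi> p \<in> \<phi> ` U \<inter> O'}"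
    by (rule openin_continuous_map_preimage) (use assms(2) openin_open_Int in blast)
  moreover have "{p \<in> topspace (subtopology (mtop M) U). \<phi> p \<in> \<phi> ` U \<inter> O'} = {p \<in> U. \<phi> p \<in> O'}"
    using chart_subset[OF c] by auto
  ultimately show ?thesis using chart_open[OF c] openin_trans_full by metis
qed

lemma smooth_funs_carrier_cong:
  "(\<And>p. p \<in> carrier_of M \<Longrightarrow> f p = h p) \<Longrightarrow> f \<in> smooth_funs M \<longleftrightarrow> h \<in> smooth_funs M"
  using chart_subset by (intro smooth_funs_cong) blast

text \<open>The comparison functions are global, so this is how objects that are cut off near a
  point are glued.\<close>

lemma smooth_funs_localI:
  assumes "\<And>p. p \<in> carrier_of M \<Longrightarrow> \<exists>W h. openin (mtop M) W \<and> p \<in> W \<and> h \<in> smooth_funs M \<and> (\<forall>x\<in>W. f x = h x)"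
  shows "f \<in> smooth_funs M"
  unfolding smooth_funs_iff
proof (intro allI impI Cinf_on_local)
  fix U \<phi> x assume c: "(U, \<phi>) \<in> atlas M" and x: "x \<in> cdom M U \<phi>"
  then obtain p where p: "p \<in> U" "mproj M x = \<phi> p" unfolding cdom_def by auto
  with c chart_subset assms obtain W h where
    W: "openin (mtop M) W" "p \<in> W" "h \<in> smooth_funs M" "\<forall>x\<in>W. f x = h x" by (meson subsetD)
  let ?D = "{y. mproj M y \<in> \<phi> ` (U \<inter> W)}"
  have op: "open ?D"
    by (intro open_mproj_vimage chart_open_image[OF c] openin_Int W chart_open[OF c]) auto
  have "Cinf_on ?D (crep M U \<phi> h)"
  proof (rule Cinf_on_subset)
    show "Cinf_on (cdom M U \<phi>) (crep M U \<phi> h)" using W(3) c unfolding smooth_funs_iff by blast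
  qed (auto simp: cdom_def)
  moreover have "crep M U \<phi> h y = crep M U \<phi> f y" if "y \<in> ?D" for y
    using that W(4) chart_inj[OF c] by (auto simp: crep_def inv_into_f_f)
  ultimately have "Cinf_on ?D (crep M U \<phi> f)" by (rule Cinf_on_cong[OF op, THEN iffD1, rotated])
  moreover have "x \<in> ?D" using p W by auto
  ultimately show "\<exists>O'. open O' \<and> x \<in> O' \<and> Cinf_on O' (crep M U \<phi> f)" using op by blast
qed

section \<open>The algebra of smooth functions and its bump functions\<close>

lemma smooth_const [simp, intro]: "(\<lambda>x. c) \<in> smooth_funs M"
  unfolding smooth_funs_iff by (simp add: crep_def)

lemma smooth_add [intro]:
  assumes "f \<in> smooth_funs M" "h \<in> smooth_funs M" shows "(\<lambda>x. f x + h x) \<in> smooth_funs M"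
  unfolding smooth_funs_iff
proof (intro allI impI)
  fix U \<phi> assume c: "(U, \<phi>) \<in> atlas M"
  have "Cinf_on (cdom M U \<phi>) (\<lambda>x. crep M U \<phi> f x + crep M U \<phi> h x)"
    using assms c open_cdom[OF c] unfolding smooth_funs_iff by (intro Cinf_on_add) auto
  then show "Cinf_on (cdom M U \<phi>) (crep M U \<phi> (\<lambda>x. f x + h x))" by (simp add: crep_def)
qed

lemma smooth_mult [intro]:
  assumes "f \<in> smooth_funs M" "h \<in> smooth_funs M" shows "(\<lambda>x. f x * h x) \<in> smooth_funs M"
  unfolding smooth_funs_iff
proof (intro allI impI)
  fix U \<phi> assume c: "(U, \<phi>) \<in> atlas M"
  have "Cinf_on (cdom M U \<phi>) (\<lambda>x. crep M U \<phi> f x * crep M U \<phi> h x)"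
    using assms c open_cdom[OF c] unfolding smooth_funs_iff by (intro Cinf_on_mult) auto
  then show "Cinf_on (cdom M U \<phi>) (crep M U \<phi> (\<lambda>x. f x * h x))" by (simp add: crep_def)
qed

lemma smooth_minus [intro]: "f \<in> smooth_funs M \<Longrightarrow> (\<lambda>x. - f x) \<in> smooth_funs M"
  using smooth_mult[of "\<lambda>x. -1" f] by simp

lemma smooth_diff [intro]:
  "f \<in> smooth_funs M \<Longrightarrow> h \<in> smooth_funs M \<Longrightarrow> (\<lambda>x. f x - h x) \<in> smooth_funs M"
  using smooth_add[of f "\<lambda>x. - h x"] smooth_minus by simp

lemma smooth_sum [intro]:
  "(\<And>i. i \<in> I \<Longrightarrow> f i \<in> smooth_funs M) \<Longrightarrow> (\<lambda>x. \<Sum>i\<in>I. f i x) \<in> smooth_funs M"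
  by (induction I rule: infinite_finite_induct) auto

lemma smooth_power [intro]: "f \<in> smooth_funs M \<Longrightarrow> (\<lambda>x. f x ^ n) \<in> smooth_funs M"
  by (induction n) auto

text \<open>Multiply by a bump function in the chart and extend by 0. The extension is smooth
  because the set \<open>K\<close> that carries it is closed in the whole manifold: it corresponds
  to a compact set in the chart, and the manifold is Hausdorff.\<close>

lemma smooth_extension:
  assumes c: "(U, \<phi>) \<in> atlas M" and p: "p \<in> U" and N: "openin (mtop M) N" "p \<in> N"
    and O': "open O'" "\<phi> p \<in> O'" and F: "Cinf_on O' F"
  shows "\<exists>h W K. h \<in> smooth_funs M \<and> openin (mtop M) W \<and> p \<in> W \<and> W \<subseteq> U \<inter> N \<and>
    (\<forall>x\<in>W. \<phi> x \<in> O') \<and> (\<forall>x\<in>W. h x = F (\<phi> x)) \<and>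
    closedin (mtop M) K \<and> K \<subseteq> U \<inter> N \<and> (\<forall>x. x \<notin> K \<longrightarrow> h x = 0)"
proof -
  have "openin (top_of_set (model M)) (\<phi> ` (U \<inter> N))"
    by (intro chart_open_image[OF c] openin_Int chart_open[OF c] N) auto
  then obtain A where A: "open A" "\<phi> ` (U \<inter> N) = model M \<inter> A"
    by (metis openin_open)
  have "\<phi> p \<in> A \<inter> O'" using A p N O' by blast
  then obtain R where R: "R > 0" "ball (\<phi> p) R \<subseteq> A \<inter> O'"
    using open_contains_ball[of "A \<inter> O'"] A O' by (meson open_Int)
  \<comment> \<open>With this radius the bump vanishes beyond 2 * r = R / 2, well inside the ball on
    which \<open>F\<close> is available.\<close>
  define r where "r = R / 4"
  have r: "r > 0" "2 * r < R" using R by (auto simp: r_def)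
  obtain \<beta> :: "'e \<Rightarrow> real" where \<beta>: "Cinf_on UNIV \<beta>" "\<forall>x\<in>ball (\<phi> p) r. \<beta> x = 1"
    "\<forall>x. x \<notin> ball (\<phi> p) (2 * r) \<longrightarrow> \<beta> x = 0" using euclidean_bump[OF r(1), of "\<phi> p"] by blast
  define H where "H y = (if y \<in> ball (\<phi> p) R then \<beta> y * F y else 0)" for y
  have H0: "H y = 0" if "y \<notin> cball (\<phi> p) (2 * r)" for y
    using that \<beta>(3)[rule_format, of y] by (auto simp: H_def)
  have H: "Cinf_on UNIV H"
  proof (rule Cinf_on_local)
    fix y
    show "\<exists>O'. open O' \<and> y \<in> O' \<and> Cinf_on O' H"
    proof (cases "y \<in> ball (\<phi> p) R")
      case True
      have "Cinf_on (ball (\<phi> p) R) (\<lambda>y. \<beta> y * F y)"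
        using \<beta>(1) F R by (intro Cinf_on_mult) (auto elim: Cinf_on_subset)
      then have "Cinf_on (ball (\<phi> p) R) H"
        by (rule Cinf_on_cong[THEN iffD1, rotated -1]) (auto simp: H_def)
      then show ?thesis using True open_ball by blast
    next
      case False
      have "Cinf_on (- cball (\<phi> p) (2 * r)) (\<lambda>y. 0)" by simp
      then have "Cinf_on (- cball (\<phi> p) (2 * r)) H"
        by (rule Cinf_on_cong[THEN iffD1, rotated -1]) (use H0 in auto)
      moreover have "y \<in> - cball (\<phi> p) (2 * r)" using False r by auto
      ultimately show ?thesis by (metis closed_cball open_Compl)
    qed
  qed
  define h where "h x = (if x \<in> U then H (\<phi> x) else 0)" for x
  define K where "K = {x \<in> U. \<phi> x \<in> cball (\<phi> p) (2 * r)}"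
  define W where "W = {x \<in> U. \<phi> x \<in> ball (\<phi> p) r}"
  have inU: "x \<in> N" if "x \<in> U" "\<phi> x \<in> ball (\<phi> p) R" for x
  proof -
    have "\<phi> x \<in> \<phi> ` (U \<inter> N)" using that A R chart_in_model[OF c] by blast
    then show ?thesis using chart_inj[OF c] that by (auto dest: inj_onD)
  qed
  have ball_mono: "cball (\<phi> p) (2 * r) \<subseteq> ball (\<phi> p) R" "ball (\<phi> p) r \<subseteq> ball (\<phi> p) R"
    "ball (\<phi> p) r \<subseteq> cball (\<phi> p) (2*r)"
    using r by auto
  have KN: "K \<subseteq> U \<inter> N" using inU ball_mono unfolding K_def by blast
  have h0: "h x = 0" if "x \<notin> K" for x using that H0 unfolding h_def K_def by auto
  have Kcl: "closedin (mtop M) K"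
  proof -
    \<comment> \<open>The model space is closed, so this is compact; its image under the inverse
      chart is \<open>K\<close>.\<close>
    let ?C = "cball (\<phi> p) (2 * r) \<inter> model M"
    have "compact ?C"
      by (intro compact_Int_closed compact_cball closed_subspace subspace_model)
    moreover have CU: "?C \<subseteq> \<phi> ` U" using A R ball_mono by blast
    ultimately have "compactin (top_of_set (\<phi> ` U)) ?C" by (simp add: compactin_subtopology)
    moreover obtain g where g: "homeomorphic_maps (subtopology (mtop M) U) (top_of_set (\<phi> ` U)) \<phi> g"
      using chart_homeo[OF c] homeomorphic_map_maps by blast
    ultimately have "compactin (subtopology (mtop M) U) (g ` ?C)"
      using image_compactin unfolding homeomorphic_maps_def by blast
    then have "compactin (mtop M) (g ` ?C)" by (simp add: compactin_subtopology)
    moreover have "g ` ?C = K"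
    proof -
      have 1: "g (\<phi> x) = x" if "x \<in> U" for x
        using g that chart_subset[OF c] unfolding homeomorphic_maps_def by auto
      then show ?thesis unfolding K_def using CU chart_in_model[OF c] by (auto simp: image_iff) (metis IntI imageE mem_cball subsetD)+
    qed
    ultimately show ?thesis using compactin_imp_closedin[OF Hausdorff] by simp
  qed
  have "h \<in> smooth_funs M"
    unfolding smooth_funs_iff
  proof (intro allI impI Cinf_on_local)
    fix V \<psi> y assume d: "(V, \<psi>) \<in> atlas M" and y: "y \<in> cdom M V \<psi>"
    then obtain q where q: "q \<in> V" "mproj M y = \<psi> q" unfolding cdom_def by auto
    show "\<exists>O'. open O' \<and> y \<in> O' \<and> Cinf_on O' (crep M V \<psi> h)"
    \<comment> \<open>If \<open>q\<close> lies in \<open>U\<close>, then \<open>h\<close> is read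
      through the transition map; otherwise \<open>q\<close> lies off the closed set
      \<open>K\<close>, near which \<open>h\<close> is 0.\<close>
    proof (cases "q \<in> U")
      case True
      let ?D = "{x. mproj M x \<in> \<psi> ` (V \<inter> U)}"
      have oi: "openin (top_of_set (model M)) (\<psi> ` (V \<inter> U))"
        by (intro chart_open_image[OF d] openin_Int chart_open[OF d] chart_open[OF c]) auto
      note op = open_mproj_vimage[OF oi]
      have t: "Cinf_on ?D (\<lambda>x. (\<phi> \<circ> inv_into V \<psi>) (mproj M x))"
        using transition[OF d c] smooth_on_iff[OF oi] by blast
      have "Cinf_on ?D (\<lambda>x. H ((\<phi> \<circ> inv_into V \<psi>) (mproj M x)))"
        by (rule Cinf_on_compose[OF op open_UNIV subset_UNIV t H])
      then have "Cinf_on ?D (crep M V \<psi> h)"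
      proof (rule Cinf_on_cong[OF op, THEN iffD1, rotated])
        fix x assume "x \<in> ?D"
        then obtain z where z: "z \<in> V" "z \<in> U" "mproj M x = \<psi> z" by blast
        then have "inv_into V \<psi> (mproj M x) = z" using chart_inj[OF d] by (simp add: inv_into_f_f)
        then show "H ((\<phi> \<circ> inv_into V \<psi>) (mproj M x)) = crep M V \<psi> h x"
          using z by (simp add: crep_def h_def)
      qed
      moreover have "y \<in> ?D" using True q by auto
      ultimately show ?thesis using op by blast
    next
      case False
      let ?W = "V \<inter> (carrier_of M - K)"
      let ?D = "{x. mproj M x \<in> \<psi> ` ?W}"
      have oi: "openin (top_of_set (model M)) (\<psi> ` ?W)"
        by (intro chart_open_image[OF d] openin_Int chart_open[OF d] openin_diff Kcl) auto
      note op = open_mproj_vimage[OF oi]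
      have "0 = crep M V \<psi> h x" if "x \<in> ?D" for x
        using that chart_inj[OF d] h0 by (auto simp: crep_def inv_into_f_f)
      then have "Cinf_on ?D (crep M V \<psi> h)" 
        by (rule Cinf_on_cong[OF op, of "\<lambda>x. 0", THEN iffD1, OF _ Cinf_on_const])
      moreover have "y \<in> ?D" using False q chart_subset[OF d] KN by auto
      ultimately show ?thesis using op by blast
    qed
  qed
  moreover have "openin (mtop M) W" unfolding W_def by (rule chart_preimage_open[OF c open_ball])
  moreover have "p \<in> W" using p r by (simp add: W_def)
  moreover have "W \<subseteq> U \<inter> N" using inU ball_mono unfolding W_def by blast
  moreover have "\<phi> x \<in> O'" if "x \<in> W" for x using that R ball_mono unfolding W_def by blast
  moreover have "h x = F (\<phi> x)" if "x \<in> W" for x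
    using that \<beta>(2) ball_mono unfolding W_def h_def H_def by auto
  ultimately show ?thesis using Kcl KN h0 by blast
qed

text \<open>The constant 1 on a chart, extended. The closed set \<open>K\<close> inside
  \<open>N\<close> is kept, since products with the bump vanish off it.\<close>

lemma bump:
  assumes "openin (mtop M) N" "p \<in> N"
  obtains \<theta> W K where "\<theta> \<in> smooth_funs M" "openin (mtop M) W" "p \<in> W" "W \<subseteq> N"
    "\<And>x. x \<in> W \<Longrightarrow> \<theta> x = 1" "closedin (mtop M) K" "K \<subseteq> N" "\<And>x. x \<notin> K \<Longrightarrow> \<theta> x = 0"
proof -
  have "p \<in> carrier_of M" using assms openin_subset by blast
  then obtain U \<phi> where c: "(U, \<phi>) \<in> atlas M" "p \<in> U" using atlas_cover by blast
  obtain \<theta> W K where *: "\<theta> \<in> smooth_funs M" "openin (mtop M) W" "p \<in> W" "W \<subseteq> U \<inter> N"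
    "\<And>x. x \<in> W \<Longrightarrow> \<theta> x = 1" "closedin (mtop M) K" "K \<subseteq> U \<inter> N" "\<And>x. x \<notin> K \<Longrightarrow> \<theta> x = 0"
    using smooth_extension[OF c assms open_UNIV UNIV_I Cinf_on_const, of 1] by metis
  show thesis by (rule that[of \<theta> W K]) (use * in auto)
qed

lemma smooth_chart_continuous:
  assumes "f \<in> smooth_funs M" "(U, \<phi>) \<in> atlas M"
  shows "continuous_map (subtopology (mtop M) U) euclideanreal f"
proof -
  have "continuous_map (top_of_set (\<phi> ` U)) euclideanreal (crep M U \<phi> f)"
    using assms smooth_funs_iff Cinf_on_continuous chart_in_cdom
    by (metis (no_types, lifting) continuous_map_iff_continuous continuous_on_subset image_subsetI)
  then have "continuous_map (subtopology (mtop M) U) euclideanreal (crep M U \<phi> f \<circ> \<phi>)"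
    using continuous_map_compose homeomorphic_imp_continuous_map[OF chart_homeo[OF assms(2)]] by blast
  then show ?thesis
    by (rule continuous_map_eq) (use crep_chart[OF assms(2)] in auto)
qed

lemma smooth_nonzero_open:
  assumes "f \<in> smooth_funs M"
  shows "openin (mtop M) {p \<in> carrier_of M. f p \<noteq> 0}"
proof -
  have "\<exists>T. openin (mtop M) T \<and> p \<in> T \<and> T \<subseteq> {p \<in> carrier_of M. f p \<noteq> 0}"
    if p: "p \<in> carrier_of M" "f p \<noteq> 0" for p
  proof -
    obtain U \<phi> where c: "(U, \<phi>) \<in> atlas M" "p \<in> U" using atlas_cover p by blast
    have "openin (subtopology (mtop M) U) {x \<in> topspace (subtopology (mtop M) U). f x \<in> - {0}}"
      by (rule openin_continuous_map_preimage[OF smooth_chart_continuous[OF assms c(1)]]) auto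
    then have "openin (mtop M) {x \<in> topspace (subtopology (mtop M) U). f x \<in> - {0}}"
      using chart_open[OF c(1)] openin_trans_full by blast
    then show ?thesis using p c by (intro exI[of _ "{x \<in> topspace (subtopology (mtop M) U). f x \<in> - {0}}"]) auto
  qed
  then show ?thesis by (subst openin_subopen) blast
qed

text \<open>Supplies the inverse of the pivot in the elimination of
  \<open>smooth_linear_solve\<close>; the reciprocal is taken in a chart and then made
  global.\<close>

lemma smooth_local_inverse:
  assumes "f \<in> smooth_funs M" "p \<in> carrier_of M" "f p \<noteq> 0"
  obtains h W where "h \<in> smooth_funs M" "openin (mtop M) W" "p \<in> W" "\<And>x. x \<in> W \<Longrightarrow> h x * f x = 1"
proof -
  obtain U \<phi> where c: "(U, \<phi>) \<in> atlas M" "p \<in> U" using atlas_cover assms by blast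
  let ?O = "{x \<in> cdom M U \<phi>. crep M U \<phi> f x \<noteq> 0}"
  have C: "Cinf_on (cdom M U \<phi>) (crep M U \<phi> f)" using assms c smooth_funs_iff by blast
  have "open ?O"
  proof -
    have "open (cdom M U \<phi> \<inter> crep M U \<phi> f -` (- {0}))"
      by (rule continuous_open_preimage[OF Cinf_on_continuous[OF C] open_cdom[OF c(1)]]) auto
    moreover have "cdom M U \<phi> \<inter> crep M U \<phi> f -` (- {0}) = ?O" by auto
    ultimately show ?thesis by simp
  qed
  moreover have "\<phi> p \<in> ?O" using c assms by (simp add: chart_in_cdom crep_chart)
  moreover have "Cinf_on ?O (\<lambda>x. inverse (crep M U \<phi> f x))"
  proof (rule Cinf_on_compose[OF \<open>open ?O\<close> _ _ _ Cinf_on_inverse])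
    show "open {x::real. x \<noteq> 0}" by (simp add: open_Collect_neq)
    show "Cinf_on ?O (crep M U \<phi> f)" by (rule Cinf_on_subset[OF C]) auto
  qed auto
  ultimately obtain h W K where *: "h \<in> smooth_funs M" "openin (mtop M) W" "p \<in> W" "W \<subseteq> U \<inter> U"
    "\<forall>x\<in>W. \<phi> x \<in> ?O" "\<forall>x\<in>W. h x = inverse (crep M U \<phi> f (\<phi> x))"
    using smooth_extension[OF c chart_open[OF c(1)] c(2), of ?O "\<lambda>x. inverse (crep M U \<phi> f x)"] by blast
  have "h x * f x = 1" if "x \<in> W" for x
    using * that c by (auto simp: crep_chart subset_iff)
  then show thesis using that * by blast
qed

section \<open>Tangent vectors as derivations\<close>

lemma tangent_add: "v \<in> tangent_space M p \<Longrightarrow> f \<in> smooth_funs M \<Longrightarrow> h \<in> smooth_funs M \<Longrightarrow>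
    v (\<lambda>x. f x + h x) = v f + v h"
  unfolding tangent_space_def by blast
lemma tangent_cmult: "v \<in> tangent_space M p \<Longrightarrow> f \<in> smooth_funs M \<Longrightarrow> v (\<lambda>x. c * f x) = c * v f"
  unfolding tangent_space_def by blast
lemma tangent_mult: "v \<in> tangent_space M p \<Longrightarrow> f \<in> smooth_funs M \<Longrightarrow> h \<in> smooth_funs M \<Longrightarrow>
    v (\<lambda>x. f x * h x) = v f * h p + f p * v h"
  unfolding tangent_space_def by blast
lemma tangent_off: "v \<in> tangent_space M p \<Longrightarrow> f \<notin> smooth_funs M \<Longrightarrow> v f = 0"
  unfolding tangent_space_def by blast
lemma tangent_minus: "v \<in> tangent_space M p \<Longrightarrow> f \<in> smooth_funs M \<Longrightarrow> v (\<lambda>x. - f x) = - v f"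
  using tangent_cmult[of v p f "-1"] by simp
lemma tangent_diff: "v \<in> tangent_space M p \<Longrightarrow> f \<in> smooth_funs M \<Longrightarrow> h \<in> smooth_funs M \<Longrightarrow>
    v (\<lambda>x. f x - h x) = v f - v h"
  using tangent_add[of v p f "\<lambda>x. - h x"] tangent_minus[of v p h] by (simp add: smooth_minus)

text \<open>The Leibniz rule for 1 * 1 gives v(1) = 2 * v(1).\<close>

lemma tangent_const: "v \<in> tangent_space M p \<Longrightarrow> v (\<lambda>x. c) = 0"
  using tangent_mult[of v p "\<lambda>x. 1" "\<lambda>x. 1"] tangent_cmult[of v p "\<lambda>x. 1" c] by simp

lemma tangent_sum:
  "v \<in> tangent_space M p \<Longrightarrow> (\<And>i. i \<in> I \<Longrightarrow> f i \<in> smooth_funs M) \<Longrightarrow>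
    v (\<lambda>x. \<Sum>i\<in>I. f i x) = (\<Sum>i\<in>I. v (f i))"
proof (induction I rule: infinite_finite_induct)
  case (insert i I)
  then show ?case using tangent_add[OF insert.prems(1), of "f i" "\<lambda>x. \<Sum>i\<in>I. f i x"] by (auto simp: smooth_sum)
qed (auto simp: tangent_const)

text \<open>A bump carried by \<open>W\<close> kills \<open>f - h\<close>. The Leibniz rule at
  \<open>p\<close>, where the bump is 1 and the difference is 0, leaves only the value of
  \<open>v\<close> on the difference.\<close>

lemma tangent_local:
  assumes v: "v \<in> tangent_space M p" and f: "f \<in> smooth_funs M" and h: "h \<in> smooth_funs M"
    and W: "openin (mtop M) W" "p \<in> W" "\<And>x. x \<in> W \<Longrightarrow> f x = h x"
  shows "v f = v h"
proof -
  obtain \<theta> W' K where \<theta>: "\<theta> \<in> smooth_funs M" "p \<in> W'"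
    "\<And>x. x \<in> W' \<Longrightarrow> \<theta> x = 1" "K \<subseteq> W" "\<And>x. x \<notin> K \<Longrightarrow> \<theta> x = 0" using bump[OF W(1,2)] by metis
  have "(\<lambda>x. \<theta> x * (f x - h x)) = (\<lambda>x. 0)" using \<theta> W by (auto simp: fun_eq_iff)
  then have "v (\<lambda>x. \<theta> x * (f x - h x)) = 0" using tangent_const[OF v] by simp
  then have "v \<theta> * (f p - h p) + \<theta> p * v (\<lambda>x. f x - h x) = 0"
    using tangent_mult[OF v \<theta>(1) smooth_diff[OF f h]] by simp
  then show ?thesis using \<theta> W tangent_diff[OF v f h] by simp
qed

text \<open>Equality on the carrier is not equality of functions in HOL. Either both functions are
  smooth, and locality applies, or neither is, and \<open>v\<close> is 0 on both.\<close>

lemma tangent_cong: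
  assumes v: "v \<in> tangent_space M p" and p: "p \<in> carrier_of M"
    and eq: "\<And>x. x \<in> carrier_of M \<Longrightarrow> f x = h x"
  shows "v f = v h"
proof (cases "f \<in> smooth_funs M")
  case True
  then show ?thesis
    using smooth_funs_carrier_cong[of f h] eq p by (intro tangent_local[OF v, of f h "carrier_of M"]) auto
next
  case False
  then show ?thesis using smooth_funs_carrier_cong[of f h] eq tangent_off[OF v] by metis
qed

lemma tangent_zero: "(\<lambda>f. 0) \<in> tangent_space M p"
  unfolding tangent_space_def by simp

lemma tangent_space_add:
  "v \<in> tangent_space M p \<Longrightarrow> w \<in> tangent_space M p \<Longrightarrow> (\<lambda>f. v f + w f) \<in> tangent_space M p"
  unfolding tangent_space_def by (auto simp: algebra_simps)

lemma tangent_space_scale: "v \<in> tangent_space M p \<Longrightarrow> (\<lambda>f. c * v f) \<in> tangent_space M p"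
  unfolding tangent_space_def by (auto simp: algebra_simps)

lemma tangent_space_sum:
  "(\<And>i. i \<in> I \<Longrightarrow> v i \<in> tangent_space M p) \<Longrightarrow> (\<lambda>f. \<Sum>i\<in>I. v i f) \<in> tangent_space M p"
  by (induction I rule: infinite_finite_induct) (auto simp: tangent_zero tangent_space_add)

section \<open>Coordinate derivatives and local frames\<close>

lemma cderiv_tangent:
  assumes c: "(U, \<phi>) \<in> atlas M" and p: "p \<in> U"
  shows "(\<lambda>f. if f \<in> smooth_funs M then cderiv M U \<phi> b f p else 0) \<in> tangent_space M p"
proof -
  note d = Cinf_on_has_derivative[OF _ chart_in_cdom[OF c p]]
  have D: "(crep M U \<phi> f has_derivative frechet_derivative (crep M U \<phi> f) (at (\<phi> p))) (at (\<phi> p))"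
    if "f \<in> smooth_funs M" for f
    using that c unfolding smooth_funs_iff by (intro d) blast
  have 1: "cderiv M U \<phi> b (\<lambda>x. f x + h x) p = cderiv M U \<phi> b f p + cderiv M U \<phi> b h p"
    if "f \<in> smooth_funs M" "h \<in> smooth_funs M" for f h
    using frechet_derivative_eqI[OF has_derivative_add[OF D[OF that(1)] D[OF that(2)]]]
    by (simp add: cderiv_def crep_def)
  have 2: "cderiv M U \<phi> b (\<lambda>x. k * f x) p = k * cderiv M U \<phi> b f p" if "f \<in> smooth_funs M" for f k
    using frechet_derivative_eqI[OF has_derivative_mult_right[OF D[OF that(1)]]]
    by (simp add: cderiv_def crep_def)
  have 3: "cderiv M U \<phi> b (\<lambda>x. f x * h x) p = cderiv M U \<phi> b f p * h p + f p * cderiv M U \<phi> b h p"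
    if "f \<in> smooth_funs M" "h \<in> smooth_funs M" for f h
    using frechet_derivative_eqI[OF has_derivative_mult[OF D[OF that(1)] D[OF that(2)]]] crep_chart[OF c p]
    by (simp add: cderiv_def) (simp add: crep_def)
  show ?thesis
    unfolding tangent_space_def using 1 2 3 smooth_mult[OF smooth_const] by (auto simp: smooth_add smooth_mult)
qed

lemma cderiv_smooth_local:
  assumes c: "(U, \<phi>) \<in> atlas M" and p: "p \<in> U" and f: "f \<in> smooth_funs M"
  obtains h W where "h \<in> smooth_funs M" "openin (mtop M) W" "p \<in> W" "W \<subseteq> U" "\<And>x. x \<in> W \<Longrightarrow> h x = cderiv M U \<phi> b f x"
proof -
  have "Cinf_on (cdom M U \<phi>) (\<lambda>y. frechet_derivative (crep M U \<phi> f) (at y) b)"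
    using f c unfolding smooth_funs_iff by (intro Cinf_on_deriv) blast
  from smooth_extension[OF c p chart_open[OF c] p open_cdom[OF c] chart_in_cdom[OF c p] this]
  show thesis using that unfolding cderiv_def by (metis inf.idem)
qed

text \<open>A coordinate field extended by 0; smooth across the border of \<open>U\<close> because
  the cutoff already vanishes off a closed subset of \<open>U\<close>.\<close>

lemma chart_vfield:
  assumes c: "(U, \<phi>) \<in> atlas M" and \<theta>: "\<theta> \<in> smooth_funs M"
    and K: "closedin (mtop M) K" "K \<subseteq> U" "\<And>x. x \<notin> K \<Longrightarrow> \<theta> x = 0"
  shows "(\<lambda>p f. if p \<in> U \<and> f \<in> smooth_funs M then \<theta> p * cderiv M U \<phi> b f p else 0) \<in> vfields M"
    (is "?X \<in> _")
proof -
  have "?X p \<in> tangent_space M p" for p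
  proof (cases "p \<in> U")
    case True
    show ?thesis
      using tangent_space_scale[OF cderiv_tangent[OF c True, of b], of "\<theta> p"] True
      by (simp add: if_distrib cong: if_cong)
  next
    case False
    then show ?thesis by (simp add: tangent_zero)
  qed
  moreover have "app_vf ?X f \<in> smooth_funs M" if f: "f \<in> smooth_funs M" for f
  proof (rule smooth_funs_localI)
    fix p assume p: "p \<in> carrier_of M"
    show "\<exists>W h. openin (mtop M) W \<and> p \<in> W \<and> h \<in> smooth_funs M \<and> (\<forall>x\<in>W. app_vf ?X f x = h x)"
    proof (cases "p \<in> U")
      case True
      obtain h W where h: "h \<in> smooth_funs M" "openin (mtop M) W" "p \<in> W" "W \<subseteq> U"
        "\<And>x. x \<in> W \<Longrightarrow> h x = cderiv M U \<phi> b f x" using cderiv_smooth_local[OF c True f] by metis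
      then show ?thesis using f \<theta>
        by (intro exI[of _ W] exI[of _ "\<lambda>x. \<theta> x * h x"]) (auto simp: app_vf_def)
    next
      case False
      then show ?thesis using K p
        by (intro exI[of _ "carrier_of M - K"] exI[of _ "\<lambda>x. 0"]) (auto simp: app_vf_def)
    qed
  qed
  ultimately show ?thesis by (simp add: vfields_def)
qed

lemma local_coordinates:
  assumes c: "(U, \<phi>) \<in> atlas M" and p: "p \<in> U" and N: "openin (mtop M) N" "p \<in> N"
  obtains xc W where "openin (mtop M) W" "p \<in> W" "W \<subseteq> U \<inter> N"
    "\<And>b. b \<in> mbasis M \<Longrightarrow> xc b \<in> smooth_funs M" "\<And>b x. b \<in> mbasis M \<Longrightarrow> x \<in> W \<Longrightarrow> xc b x = \<phi> x \<bullet> b"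
proof -
  have "\<exists>h W. h \<in> smooth_funs M \<and> openin (mtop M) W \<and> p \<in> W \<and> W \<subseteq> U \<inter> N \<and> (\<forall>x\<in>W. h x = \<phi> x \<bullet> b)" for b
  proof -
    have "Cinf_on UNIV (\<lambda>x. x \<bullet> b)" by (intro Cinf_on_linear bounded_linear_inner_left) auto
    from smooth_extension[OF c p N open_UNIV UNIV_I this] show ?thesis by metis
  qed
  then obtain h W where h: "\<And>b. h b \<in> smooth_funs M" "\<And>b. openin (mtop M) (W b)" "\<And>b. p \<in> W b"
    "\<And>b. W b \<subseteq> U \<inter> N" "\<And>b x. x \<in> W b \<Longrightarrow> h b x = \<phi> x \<bullet> b" by metis
  show thesis
  proof (rule that[of "(U \<inter> N) \<inter> (\<Inter>b\<in>mbasis M. W b)" h])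
    show "openin (mtop M) ((U \<inter> N) \<inter> (\<Inter>b\<in>mbasis M. W b))"
    proof (cases "mbasis M = {}")
      case True
      then show ?thesis using c N chart_open by auto
    next
      case False
      then show ?thesis using c N h(2) chart_open mbasis(4) by (intro openin_Int openin_INT2) auto
    qed
  qed (use h p N in auto)
qed

text \<open>Near \<open>p\<close>, Hadamard's lemma gives f = f(p) + sum of (x_b - x_b(p)) h_b with
  smooth h_b. In the Leibniz rule at \<open>p\<close> only v(x_b) h_b(p) survives, and h_b(p) is the
  partial derivative.\<close>

lemma tangent_repr:
  assumes c: "(U, \<phi>) \<in> atlas M" and W: "openin (mtop M) W" "p \<in> W" "W \<subseteq> U"
    and xc: "\<And>b. b \<in> mbasis M \<Longrightarrow> xc b \<in> smooth_funs M"
      "\<And>b x. b \<in> mbasis M \<Longrightarrow> x \<in> W \<Longrightarrow> xc b x = \<phi> x \<bullet> b"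
    and v: "v \<in> tangent_space M p" and f: "f \<in> smooth_funs M"
  shows "v f = (\<Sum>b\<in>mbasis M. v (xc b) * cderiv M U \<phi> b f p)"
proof -
  have p: "p \<in> U" using W by blast
  obtain R where R: "R > 0" "ball (\<phi> p) R \<subseteq> cdom M U \<phi>"
    using open_cdom[OF c] chart_in_cdom[OF c p] open_contains_ball by blast
  have "Cinf_on (ball (\<phi> p) R) (crep M U \<phi> f)"
    using f c R unfolding smooth_funs_iff by (blast intro: Cinf_on_subset)
  from hadamard[OF this R(1)] obtain G where G: "\<forall>b. Cinf_on (ball (\<phi> p) R) (G b)"
    "\<forall>b. G b (\<phi> p) = frechet_derivative (crep M U \<phi> f) (at (\<phi> p)) b"
    "\<forall>I k x. finite I \<longrightarrow> x \<in> ball (\<phi> p) R \<longrightarrow> x - \<phi> p = (\<Sum>i\<in>I. k i *\<^sub>R i) \<longrightarrow>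
      crep M U \<phi> f x = crep M U \<phi> f (\<phi> p) + (\<Sum>i\<in>I. k i * G i x)"
    by (elim exE conjE) (rule that)
  \<comment> \<open>Hadamard's coefficients live on a coordinate ball only, but \<open>v\<close>
    acts on global functions; each coefficient is replaced by a global one that agrees with it near
    \<open>p\<close>.\<close>
  have "\<exists>h V. h \<in> smooth_funs M \<and> openin (mtop M) V \<and> p \<in> V \<and> V \<subseteq> U \<inter> W \<and> (\<forall>x\<in>V. h x = G b (\<phi> x))" for b
  proof -
    have "\<phi> p \<in> ball (\<phi> p) R" using R by simp
    from smooth_extension[OF c p W(1,2) open_ball this G(1)[rule_format, of b]]
    show ?thesis by (elim exE conjE) (intro exI conjI; assumption)
  qed
  then have "\<forall>b. \<exists>hV. fst hV \<in> smooth_funs M \<and> openin (mtop M) (snd hV) \<and> p \<in> snd hV \<and> snd hV \<subseteq> U \<inter> W \<and>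
      (\<forall>x\<in>snd hV. fst hV x = G b (\<phi> x))" by simp
  then obtain hV where hV: "\<forall>b. fst (hV b) \<in> smooth_funs M \<and> openin (mtop M) (snd (hV b)) \<and> p \<in> snd (hV b) \<and> snd (hV b) \<subseteq> U \<inter> W \<and>
      (\<forall>x\<in>snd (hV b). fst (hV b) x = G b (\<phi> x))" by (rule choice[THEN exE])
  define h where "h b = fst (hV b)" for b
  define V where "V b = snd (hV b)" for b
  have h: "h b \<in> smooth_funs M" "openin (mtop M) (V b)" "p \<in> V b" "V b \<subseteq> U \<inter> W"
    "x \<in> V b \<Longrightarrow> h b x = G b (\<phi> x)" for b x
    using hV by (auto simp: h_def V_def)
  let ?VB = "{x \<in> U. \<phi> x \<in> ball (\<phi> p) R} \<inter> W"
  let ?V = "?VB \<inter> (\<Inter>b\<in>mbasis M. V b)"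
  have oVB: "openin (mtop M) ?VB" using W c by (intro openin_Int chart_preimage_open) auto
  have oV: "openin (mtop M) ?V"
  proof (cases "mbasis M = {}")
    case True
    then show ?thesis using oVB by simp
  next
    case False
    then show ?thesis by (intro openin_Int[OF oVB] openin_INT2[OF mbasis(4)] h(2))
  qed
  have pV: "p \<in> ?V" using p W R h by auto
  define F where "F x = f p + (\<Sum>b\<in>mbasis M. (xc b x - \<phi> p \<bullet> b) * h b x)" for x
  have Fs: "F \<in> smooth_funs M"
    unfolding F_def using h xc by (intro smooth_add smooth_const smooth_sum smooth_mult smooth_diff) auto
  have "f x = F x" if "x \<in> ?V" for x
  proof -
    have x: "x \<in> U" "\<phi> x \<in> ball (\<phi> p) R" "x \<in> W" using that by auto
    have "\<phi> x - \<phi> p \<in> model M"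
      using chart_in_model[OF c] x p subspace_model by (intro subspace_diff) auto
    then have "\<phi> x - \<phi> p = (\<Sum>b\<in>mbasis M. ((\<phi> x - \<phi> p) \<bullet> b) *\<^sub>R b)"
      using mproj_id by (metis mproj_def)
    from G(3)[rule_format, OF mbasis(4) x(2) this]
    have "f x = f p + (\<Sum>b\<in>mbasis M. ((\<phi> x - \<phi> p) \<bullet> b) * G b (\<phi> x))"
      using crep_chart[OF c] x(1) p by simp
    also have "\<dots> = F x"
      unfolding F_def using that x h(5) xc(2)
      by (intro arg_cong2[of _ _ _ _ "(+)"] sum.cong refl) (auto simp: inner_diff_left)
    finally show ?thesis .
  qed
  then have "v f = v F" by (rule tangent_local[OF v f Fs oV pV])
  also have "v F = (\<Sum>b\<in>mbasis M. v (\<lambda>x. (xc b x - \<phi> p \<bullet> b) * h b x))"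
    unfolding F_def using h xc
    by (subst tangent_add[OF v]) (auto simp: tangent_const[OF v] intro!: tangent_sum[OF v] smooth_sum smooth_mult smooth_diff)
  also have "\<dots> = (\<Sum>b\<in>mbasis M. v (xc b) * cderiv M U \<phi> b f p)"
  proof (rule sum.cong[OF refl])
    fix b assume b: "b \<in> mbasis M"
    have "v (\<lambda>x. (xc b x - \<phi> p \<bullet> b) * h b x) = v (\<lambda>x. xc b x - \<phi> p \<bullet> b) * h b p + (xc b p - \<phi> p \<bullet> b) * v (h b)"
      using h xc b by (intro tangent_mult[OF v]) auto
    moreover have "v (\<lambda>x. xc b x - \<phi> p \<bullet> b) = v (xc b)"
      using tangent_diff[OF v] xc b tangent_const[OF v] by simp
    moreover have "h b p = cderiv M U \<phi> b f p" using h(3,5) G(2) by (simp add: cderiv_def)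
    ultimately show "v (\<lambda>x. (xc b x - \<phi> p \<bullet> b) * h b x) = v (xc b) * cderiv M U \<phi> b f p"
      using xc(2)[OF b W(2)] by simp
  qed
  finally show ?thesis .
qed

lemma cderiv_coord:
  assumes c: "(U, \<phi>) \<in> atlas M" and W: "openin (mtop M) W" "p \<in> W" "W \<subseteq> U"
    and xc: "\<And>x. x \<in> W \<Longrightarrow> f x = \<phi> x \<bullet> b" and b: "b \<in> mbasis M" "d \<in> mbasis M"
  shows "cderiv M U \<phi> d f p = (if b = d then 1 else 0)"
proof -
  let ?D = "{x. mproj M x \<in> \<phi> ` W}"
  have op: "open ?D" by (intro open_mproj_vimage chart_open_image[OF c W(1,3)])
  have eq: "crep M U \<phi> f y = mproj M y \<bullet> b" if "y \<in> ?D" for y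
    using that xc W(3) chart_inj[OF c] by (auto simp: crep_def inv_into_f_f subset_iff)
  have in_D: "\<phi> p \<in> ?D" using W mproj_chart[OF c] by auto
  have "bounded_linear (\<lambda>y. mproj M y \<bullet> b)"
    using bounded_linear_mproj bounded_linear_inner_left_comp by blast
  then have "((\<lambda>y. mproj M y \<bullet> b) has_derivative (\<lambda>y. mproj M y \<bullet> b)) (at (\<phi> p))"
    by (rule bounded_linear_imp_has_derivative)
  then have "cderiv M U \<phi> d f p = mproj M d \<bullet> b"
    using frechet_derivative_cong_open[OF op in_D eq] unfolding cderiv_def by (simp add: frechet_derivative_eqI)
  also have "mproj M d = d" using b mbasis(1) mproj_id by blast
  finally show ?thesis using mbasis_inner b by (simp add: inner_commute)
qed

text \<open>Frame fields and coordinate functions are global and dual to each other on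
  \<open>N\<close>. The expansion holds for every \<open>f\<close>, since both sides are 0 when
  \<open>f\<close> is not smooth; so it can be used as an equation between tangent vectors.\<close>

lemma local_frame:
  assumes p0: "p0 \<in> carrier_of M"
  shows "\<exists>e xc N. openin (mtop M) N \<and> p0 \<in> N \<and> (\<forall>b\<in>mbasis M. e b \<in> vfields M) \<and>
    (\<forall>b\<in>mbasis M. xc b \<in> smooth_funs M) \<and>
    (\<forall>p\<in>N. \<forall>b\<in>mbasis M. \<forall>d\<in>mbasis M. e b p (xc d) = (if b = d then 1 else 0)) \<and>
    (\<forall>p\<in>N. \<forall>v\<in>tangent_space M p. \<forall>f. v f = (\<Sum>b\<in>mbasis M. v (xc b) * e b p f))"
proof -
  obtain U \<phi> where c: "(U, \<phi>) \<in> atlas M" "p0 \<in> U" using atlas_cover p0 by blast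
  obtain \<theta> W K where \<theta>: "\<theta> \<in> smooth_funs M" "openin (mtop M) W" "p0 \<in> W" "W \<subseteq> U"
    "\<And>x. x \<in> W \<Longrightarrow> \<theta> x = 1" "closedin (mtop M) K" "K \<subseteq> U" "\<And>x. x \<notin> K \<Longrightarrow> \<theta> x = 0"
    using bump[OF chart_open[OF c(1)] c(2)] by metis
  obtain xc N where N: "openin (mtop M) N" "p0 \<in> N" "N \<subseteq> U \<inter> W"
    "\<And>b. b \<in> mbasis M \<Longrightarrow> xc b \<in> smooth_funs M" "\<And>b x. b \<in> mbasis M \<Longrightarrow> x \<in> N \<Longrightarrow> xc b x = \<phi> x \<bullet> b"
    using local_coordinates[OF c \<theta>(2,3)] by metis
  define e where "e b p f = (if p \<in> U \<and> f \<in> smooth_funs M then \<theta> p * cderiv M U \<phi> b f p else 0)" for b p f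
  have eN: "e b p f = (if f \<in> smooth_funs M then cderiv M U \<phi> b f p else 0)" if "p \<in> N" for b p f
    using that N \<theta> by (auto simp: e_def subset_iff)
  show ?thesis
  proof (intro exI[of _ e] exI[of _ xc] exI[of _ N] conjI ballI allI N(1,2))
    show "e b \<in> vfields M" for b
      using chart_vfield[OF c(1) \<theta>(1,6,7,8), of b] unfolding e_def[abs_def] by blast
    show "xc b \<in> smooth_funs M" if "b \<in> mbasis M" for b using N that by simp
    show "e b p (xc d) = (if b = d then 1 else 0)" if "b \<in> mbasis M" "d \<in> mbasis M" "p \<in> N" for b d p
      using that N cderiv_coord[OF c(1) N(1) that(3), of "xc d" d b] by (auto simp: eN)
    show "v f = (\<Sum>b\<in>mbasis M. v (xc b) * e b p f)" if "p \<in> N" "v \<in> tangent_space M p" for p v f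
    proof (cases "f \<in> smooth_funs M")
      case True
      then show ?thesis using tangent_repr[OF c(1) N(1) that(1) _ N(4,5) that(2) True] N(3) eN[OF that(1)] by simp
    next
      case False
      then show ?thesis using eN[OF that(1)] tangent_off[OF that(2)] by simp
    qed
  qed
qed

end

section \<open>Vector fields and tensorial forms\<close>

definition tensorial :: "('a, 'e::euclidean_space) mfd \<Rightarrow> 'a form1 \<Rightarrow> bool" where
  "tensorial M \<omega> \<longleftrightarrow> (\<forall>p\<in>carrier_of M. \<forall>Z\<in>vfields M.
     (\<forall>Z'\<in>vfields M. \<omega> (\<lambda>p f. Z p f + Z' p f) p = \<omega> Z p + \<omega> Z' p) \<and>
     (\<forall>f\<in>smooth_funs M. \<omega> (\<lambda>p h. f p * Z p h) p = f p * \<omega> Z p))"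

context premanifold
begin
lemma vf_tangent: "X \<in> vfields M \<Longrightarrow> p \<in> carrier_of M \<Longrightarrow> X p \<in> tangent_space M p"
  by (simp add: vfields_def)

lemma vf_smooth: "X \<in> vfields M \<Longrightarrow> f \<in> smooth_funs M \<Longrightarrow> app_vf X f \<in> smooth_funs M"
  by (simp add: vfields_def)

lemma vf_zero: "(\<lambda>p f. 0) \<in> vfields M"
  by (auto simp: vfields_def tangent_zero app_vf_def)

lemma vf_add:
  assumes "X \<in> vfields M" "Y \<in> vfields M" shows "(\<lambda>p f. X p f + Y p f) \<in> vfields M"
proof -
  have "app_vf (\<lambda>p f. X p f + Y p f) f = (\<lambda>p. app_vf X f p + app_vf Y f p)" for f
    by (simp add: app_vf_def)
  then show ?thesis using assms by (auto simp: vfields_def tangent_space_add smooth_add)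
qed

lemma vf_fscale:
  assumes "X \<in> vfields M" "f \<in> smooth_funs M" shows "(\<lambda>p h. f p * X p h) \<in> vfields M"
proof -
  have "app_vf (\<lambda>p h. f p * X p h) h = (\<lambda>p. f p * app_vf X h p)" for h
    by (simp add: app_vf_def)
  then show ?thesis using assms by (auto simp: vfields_def tangent_space_scale smooth_mult)
qed

lemma vf_sum:
  "(\<And>i. i \<in> I \<Longrightarrow> X i \<in> vfields M) \<Longrightarrow> (\<lambda>p f. \<Sum>i\<in>I. X i p f) \<in> vfields M"
proof (induction I rule: infinite_finite_induct)
  case (insert i I)
  then have "(\<lambda>p f. X i p f + (\<Sum>i\<in>I. X i p f)) \<in> vfields M" by (intro vf_add) auto
  then show ?case using insert by simp
qed (auto simp: vf_zero)

lemma vf_app_cong: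
  assumes "X \<in> vfields M" "p \<in> carrier_of M" "\<And>x. x \<in> carrier_of M \<Longrightarrow> f x = h x"
  shows "X p f = X p h"
  by (rule tangent_cong[OF vf_tangent[OF assms(1,2)] assms(2,3)])

lemma app_vf_add:
  assumes "X \<in> vfields M" "f \<in> smooth_funs M" "h \<in> smooth_funs M" "p \<in> carrier_of M"
  shows "app_vf X (\<lambda>x. f x + h x) p = app_vf X f p + app_vf X h p"
  unfolding app_vf_def by (rule tangent_add[OF vf_tangent[OF assms(1,4)] assms(2,3)])

lemma app_vf_cmult:
  assumes "X \<in> vfields M" "f \<in> smooth_funs M" "p \<in> carrier_of M"
  shows "app_vf X (\<lambda>x. c * f x) p = c * app_vf X f p"
  unfolding app_vf_def by (rule tangent_cmult[OF vf_tangent[OF assms(1,3)] assms(2)])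

lemma app_vf_mult:
  assumes "X \<in> vfields M" "f \<in> smooth_funs M" "h \<in> smooth_funs M" "p \<in> carrier_of M"
  shows "app_vf X (\<lambda>x. f x * h x) p = app_vf X f p * h p + f p * app_vf X h p"
  unfolding app_vf_def by (rule tangent_mult[OF vf_tangent[OF assms(1,4)] assms(2,3)])

lemma lie_bracket_tangent:
  assumes X: "X \<in> vfields M" and Y: "Y \<in> vfields M" and p: "p \<in> carrier_of M"
  shows "lie_bracket M X Y p \<in> tangent_space M p"
proof -
  have add: "A p (app_vf C (\<lambda>x. f x + h x)) = A p (app_vf C f) + A p (app_vf C h)"
    if "A \<in> vfields M" "C \<in> vfields M" "f \<in> smooth_funs M" "h \<in> smooth_funs M" for A C f h
  proof -
    have "A p (app_vf C (\<lambda>x. f x + h x)) = A p (\<lambda>x. app_vf C f x + app_vf C h x)"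
      by (rule vf_app_cong[OF that(1) p]) (simp add: app_vf_add that)
    then show ?thesis using tangent_add[OF vf_tangent[OF that(1) p] vf_smooth vf_smooth, OF that(2,3) that(2,4)] by simp
  qed
  have scale: "A p (app_vf C (\<lambda>x. c * f x)) = c * A p (app_vf C f)"
    if "A \<in> vfields M" "C \<in> vfields M" "f \<in> smooth_funs M" for A C f c
  proof -
    have "A p (app_vf C (\<lambda>x. c * f x)) = A p (\<lambda>x. c * app_vf C f x)"
      by (rule vf_app_cong[OF that(1) p]) (simp add: app_vf_cmult that)
    then show ?thesis using tangent_cmult[OF vf_tangent[OF that(1) p] vf_smooth, OF that(2,3)] by simp
  qed
  \<comment> \<open>The two middle terms are symmetric in \<open>A\<close> and \<open>C\<close>, so
    they cancel in the commutator.\<close>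
  have mult: "A p (app_vf C (\<lambda>x. f x * h x)) = A p (app_vf C f) * h p + C p f * A p h + A p f * C p h + f p * A p (app_vf C h)"
    if "A \<in> vfields M" "C \<in> vfields M" "f \<in> smooth_funs M" "h \<in> smooth_funs M" for A C f h
  proof -
    note Cf = vf_smooth[OF that(2,3)] and Ch = vf_smooth[OF that(2,4)] and A = vf_tangent[OF that(1) p]
    have "A p (app_vf C (\<lambda>x. f x * h x)) = A p (\<lambda>x. app_vf C f x * h x + f x * app_vf C h x)"
      by (rule vf_app_cong[OF that(1) p]) (simp add: app_vf_mult that)
    also have "\<dots> = A p (\<lambda>x. app_vf C f x * h x) + A p (\<lambda>x. f x * app_vf C h x)"
      by (rule tangent_add[OF A smooth_mult[OF Cf that(4)] smooth_mult[OF that(3) Ch]])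
    finally show ?thesis
      unfolding tangent_mult[OF A Cf that(4)] tangent_mult[OF A that(3) Ch] by (simp add: app_vf_def)
  qed
  have L: "lie_bracket M X Y p f = X p (app_vf Y f) - Y p (app_vf X f)" if "f \<in> smooth_funs M" for f
    using that by (simp add: lie_bracket_def app_vf_def[of _ "app_vf _ _"])
  show ?thesis
    unfolding tangent_space_def
  proof (intro CollectI conjI ballI allI impI)
    fix f h assume fh: "f \<in> smooth_funs M" "h \<in> smooth_funs M"
    show "lie_bracket M X Y p (\<lambda>x. f x + h x) = lie_bracket M X Y p f + lie_bracket M X Y p h"
      unfolding L[OF fh(1)] L[OF fh(2)] L[OF smooth_add[OF fh]] add[OF X Y fh] add[OF Y X fh] by simp
    show "lie_bracket M X Y p (\<lambda>x. f x * h x) = lie_bracket M X Y p f * h p + f p * lie_bracket M X Y p h"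
      unfolding L[OF fh(1)] L[OF fh(2)] L[OF smooth_mult[OF fh]] mult[OF X Y fh] mult[OF Y X fh]
      by (simp add: algebra_simps)
  next
    fix c f assume f: "f \<in> smooth_funs M"
    show "lie_bracket M X Y p (\<lambda>x. c * f x) = c * lie_bracket M X Y p f"
      unfolding L[OF f] L[OF smooth_mult[OF smooth_const f]] scale[OF X Y f] scale[OF Y X f]
      by (simp add: algebra_simps)
  next
    fix f assume "f \<notin> smooth_funs M"
    then show "lie_bracket M X Y p f = 0" by (simp add: lie_bracket_def)
  qed
qed

lemma vf_bracket: assumes "X \<in> vfields M" "Y \<in> vfields M" shows "lie_bracket M X Y \<in> vfields M"
proof -
  have "app_vf (lie_bracket M X Y) f = (\<lambda>p. app_vf X (app_vf Y f) p - app_vf Y (app_vf X f) p)"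
    if "f \<in> smooth_funs M" for f
    using that by (simp add: lie_bracket_def app_vf_def)
  then show ?thesis
    using assms lie_bracket_tangent by (simp add: vfields_def smooth_diff)
qed

lemma lie_bracket_anti: "lie_bracket M X Y p = (\<lambda>f. - lie_bracket M Y X p f)"
  by (auto simp: lie_bracket_def)

lemma lie_bracket_add_right:
  assumes "X \<in> vfields M" "Y \<in> vfields M" "Z \<in> vfields M" "p \<in> carrier_of M"
  shows "lie_bracket M X (\<lambda>p f. Y p f + Z p f) p = (\<lambda>f. lie_bracket M X Y p f + lie_bracket M X Z p f)"
proof
  fix f
  show "lie_bracket M X (\<lambda>p f. Y p f + Z p f) p f = lie_bracket M X Y p f + lie_bracket M X Z p f"
  proof (cases "f \<in> smooth_funs M")
    case True
    have "X p (app_vf (\<lambda>p f. Y p f + Z p f) f) = X p (app_vf Y f) + X p (app_vf Z f)"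
      using app_vf_add[OF assms(1) vf_smooth[OF assms(2) True] vf_smooth[OF assms(3) True] assms(4)]
      by (simp add: app_vf_def)
    then show ?thesis using True by (simp add: lie_bracket_def app_vf_def)
  qed (simp add: lie_bracket_def)
qed

lemma lie_bracket_fscale_right:
  assumes "X \<in> vfields M" "Y \<in> vfields M" "h \<in> smooth_funs M" "p \<in> carrier_of M"
  shows "lie_bracket M X (\<lambda>p f. h p * Y p f) p = (\<lambda>f. X p h * Y p f + h p * lie_bracket M X Y p f)"
proof
  fix f
  show "lie_bracket M X (\<lambda>p f. h p * Y p f) p f = X p h * Y p f + h p * lie_bracket M X Y p f"
  proof (cases "f \<in> smooth_funs M")
    case True
    have "X p (app_vf (\<lambda>p f. h p * Y p f) f) = X p h * Y p f + h p * X p (app_vf Y f)"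
      using app_vf_mult[OF assms(1,3) vf_smooth[OF assms(2) True] assms(4)]
      by (simp add: app_vf_def)
    then show ?thesis using True by (simp add: lie_bracket_def app_vf_def algebra_simps)
  qed (simp add: lie_bracket_def tangent_off[OF vf_tangent[OF assms(2,4)]])
qed

lemma lie_bracket_cong:
  assumes X: "X \<in> vfields M" "X' \<in> vfields M" "\<And>x. x \<in> carrier_of M \<Longrightarrow> X x = X' x"
    and Y: "Y \<in> vfields M" "Y' \<in> vfields M" "\<And>x. x \<in> carrier_of M \<Longrightarrow> Y x = Y' x"
    and p: "p \<in> carrier_of M"
  shows "lie_bracket M X Y p = lie_bracket M X' Y' p"
proof
  fix f
  have "X' p (app_vf Y f) = X' p (app_vf Y' f)" by (rule vf_app_cong[OF X(2) p]) (simp add: app_vf_def Y)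
  moreover have "Y' p (app_vf X f) = Y' p (app_vf X' f)" by (rule vf_app_cong[OF Y(2) p]) (simp add: app_vf_def X)
  ultimately show "lie_bracket M X Y p f = lie_bracket M X' Y' p f"
    by (simp add: lie_bracket_def app_vf_def[of _ "app_vf _ _"] X(3)[OF p] Y(3)[OF p])
qed

text \<open>Freeze the frame coefficients of \<open>v\<close> and use them as constants.\<close>

lemma vf_extension:
  assumes p: "p \<in> carrier_of M" and v: "v \<in> tangent_space M p"
  obtains Z where "Z \<in> vfields M" "Z p = v"
proof -
  obtain e xc N where N: "openin (mtop M) N" "p \<in> N" and e0: "\<forall>b\<in>mbasis M. e b \<in> vfields M"
    and xc0: "\<forall>b\<in>mbasis M. xc b \<in> smooth_funs M"
    and "\<forall>q\<in>N. \<forall>b\<in>mbasis M. \<forall>d\<in>mbasis M. e b q (xc d) = (if b = d then 1 else 0)"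
    and r0: "\<forall>q\<in>N. \<forall>v\<in>tangent_space M q. \<forall>f. v f = (\<Sum>b\<in>mbasis M. v (xc b) * e b q f)"
    using local_frame[OF p] by (elim exE conjE) (rule that)
  note e = e0[rule_format] and xc = xc0[rule_format] and r = r0[rule_format]
  let ?Z = "\<lambda>q f. \<Sum>b\<in>mbasis M. v (xc b) * e b q f"
  have "?Z \<in> vfields M"
    using e by (intro vf_sum vf_fscale) auto
  moreover have "?Z p = v" by (intro ext) (rule r[OF N(2) v, symmetric])
  ultimately show thesis using that by blast
qed

section \<open>Values of tensorial forms at a point; linear systems with smooth coefficients\<close>

lemma tensorial_add:
  "tensorial M \<omega> \<Longrightarrow> p \<in> carrier_of M \<Longrightarrow> Z \<in> vfields M \<Longrightarrow> Z' \<in> vfields M \<Longrightarrow>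
    \<omega> (\<lambda>p f. Z p f + Z' p f) p = \<omega> Z p + \<omega> Z' p"
  unfolding tensorial_def by blast

lemma tensorial_fscale:
  "tensorial M \<omega> \<Longrightarrow> p \<in> carrier_of M \<Longrightarrow> Z \<in> vfields M \<Longrightarrow> f \<in> smooth_funs M \<Longrightarrow>
    \<omega> (\<lambda>p h. f p * Z p h) p = f p * \<omega> Z p"
  unfolding tensorial_def by blast

lemma tensorial_sum:
  assumes "tensorial M \<omega>" "p \<in> carrier_of M"
  shows "(\<And>i. i \<in> I \<Longrightarrow> X i \<in> vfields M) \<Longrightarrow> \<omega> (\<lambda>p f. \<Sum>i\<in>I. X i p f) p = (\<Sum>i\<in>I. \<omega> (X i) p)"
proof (induction I rule: infinite_finite_induct)
  case (insert i I)
  have Xi: "X i \<in> vfields M" and XI: "(\<lambda>p f. \<Sum>i\<in>I. X i p f) \<in> vfields M"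
    using insert.prems by (auto intro: vf_sum)
  have "\<omega> (\<lambda>p f. \<Sum>i\<in>insert i I. X i p f) p = \<omega> (\<lambda>p f. X i p f + (\<Sum>i\<in>I. X i p f)) p"
    using insert.hyps by simp
  also have "\<dots> = \<omega> (X i) p + \<omega> (\<lambda>p f. \<Sum>i\<in>I. X i p f) p"
    by (rule tensorial_add[OF assms Xi XI])
  also have "\<omega> (\<lambda>p f. \<Sum>i\<in>I. X i p f) p = (\<Sum>i\<in>I. \<omega> (X i) p)"
    using insert.prems by (intro insert.IH) auto
  finally show ?case using insert.hyps by simp
next
  have "\<omega> (\<lambda>p f. 0) p = 0" using tensorial_fscale[OF assms vf_zero smooth_const[of 0]] by simp
  moreover case empty
  ultimately show ?case by simp
next
  have "\<omega> (\<lambda>p f. 0) p = 0" using tensorial_fscale[OF assms vf_zero smooth_const[of 0]] by simp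
  moreover case (infinite A)
  ultimately show ?case by simp
qed

text \<open>The difference \<open>D\<close> of the two fields vanishes at \<open>p\<close>. After a
  cutoff it is a combination of global frame fields with smooth coefficients that vanish at
  \<open>p\<close>, and these coefficients can be pulled out of \<open>\<omega>\<close>.\<close>

lemma tensorial_local:
  assumes \<omega>: "tensorial M \<omega>" and p: "p \<in> carrier_of M"
    and Z: "Z \<in> vfields M" "Z' \<in> vfields M" "Z p = Z' p"
  shows "\<omega> Z p = \<omega> Z' p"
proof -
  obtain e xc N where N: "openin (mtop M) N" "p \<in> N" and e0: "\<forall>b\<in>mbasis M. e b \<in> vfields M"
    and xc0: "\<forall>b\<in>mbasis M. xc b \<in> smooth_funs M"
    and "\<forall>q\<in>N. \<forall>b\<in>mbasis M. \<forall>d\<in>mbasis M. e b q (xc d) = (if b = d then 1 else 0)"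
    and r0: "\<forall>q\<in>N. \<forall>v\<in>tangent_space M q. \<forall>f. v f = (\<Sum>b\<in>mbasis M. v (xc b) * e b q f)"
    using local_frame[OF p] by (elim exE conjE) (rule that)
  note e = e0[rule_format] and xc = xc0[rule_format] and r = r0[rule_format]
  obtain \<theta> W K where \<theta>: "\<theta> \<in> smooth_funs M" "p \<in> W" "\<And>x. x \<in> W \<Longrightarrow> \<theta> x = 1"
    "K \<subseteq> N" "\<And>x. x \<notin> K \<Longrightarrow> \<theta> x = 0" using bump[OF N] by metis
  define D where "D = (\<lambda>p f. Z p f + (- 1) * Z' p f)"
  have mZ': "(\<lambda>p f. (- 1) * Z' p f) \<in> vfields M" by (intro vf_fscale[OF Z(2)] smooth_const)
  have D: "D \<in> vfields M" unfolding D_def by (rule vf_add[OF Z(1) mZ'])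
  have D0: "D p f = 0" for f by (simp add: D_def Z)
  have "\<omega> D p = \<omega> Z p + (- 1) * \<omega> Z' p"
    unfolding D_def tensorial_add[OF \<omega> p Z(1) mZ'] tensorial_fscale[OF \<omega> p Z(2) smooth_const] ..
  moreover have "\<omega> D p = 0"
  proof -
    \<comment> \<open>An equation of global fields, although the frame expansion holds on
      \<open>N\<close> only: off \<open>K\<close> the factor \<open>\<theta>\<close> makes both
      sides 0.\<close>
    have eq: "(\<lambda>q f. \<theta> q * D q f) = (\<lambda>q f. \<Sum>b\<in>mbasis M. (\<theta> q * app_vf D (xc b) q) * e b q f)"
    proof (intro ext)
      fix q f
      show "\<theta> q * D q f = (\<Sum>b\<in>mbasis M. (\<theta> q * app_vf D (xc b) q) * e b q f)"
      proof (cases "q \<in> K")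
        case True
        then have q: "q \<in> N" "q \<in> carrier_of M" using \<theta>(4) openin_subset[OF N(1)] by auto
        have "D q f = (\<Sum>b\<in>mbasis M. D q (xc b) * e b q f)" by (rule r[OF q(1) vf_tangent[OF D q(2)]])
        then show ?thesis by (simp add: sum_distrib_left app_vf_def mult_ac)
      qed (simp add: \<theta>)
    qed
    have "\<omega> (\<lambda>q f. \<theta> q * D q f) p = (\<Sum>b\<in>mbasis M. \<omega> (\<lambda>q f. (\<theta> q * app_vf D (xc b) q) * e b q f) p)"
      unfolding eq
    proof (rule tensorial_sum[OF \<omega> p])
      show "(\<lambda>q f. (\<theta> q * app_vf D (xc b) q) * e b q f) \<in> vfields M" if "b \<in> mbasis M" for b
        by (rule vf_fscale[OF e[OF that] smooth_mult[OF \<theta>(1) vf_smooth[OF D xc[OF that]]]])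
    qed
    also have "\<dots> = (\<Sum>b\<in>mbasis M. (\<theta> p * app_vf D (xc b) p) * \<omega> (e b) p)"
    proof (rule sum.cong[OF refl])
      fix b assume b: "b \<in> mbasis M"
      show "\<omega> (\<lambda>q f. (\<theta> q * app_vf D (xc b) q) * e b q f) p = (\<theta> p * app_vf D (xc b) p) * \<omega> (e b) p"
        by (rule tensorial_fscale[OF \<omega> p e[OF b] smooth_mult[OF \<theta>(1) vf_smooth[OF D xc[OF b]]]])
    qed
    also have "\<dots> = 0" by (simp add: app_vf_def D0)
    finally show ?thesis using tensorial_fscale[OF \<omega> p D \<theta>(1)] \<theta>(2,3) by simp
  qed
  ultimately show ?thesis by simp
qed

lemma covec_at_eq:
  assumes "tensorial M \<omega>" "p \<in> carrier_of M" "Z \<in> vfields M"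
  shows "covec_at M \<omega> p (Z p) = \<omega> Z p"
proof -
  have "(THE r. \<forall>Z'\<in>vfields M. Z' p = Z p \<longrightarrow> \<omega> Z' p = r) = \<omega> Z p"
  proof (rule the_equality)
    show "\<forall>Z'\<in>vfields M. Z' p = Z p \<longrightarrow> \<omega> Z' p = \<omega> Z p"
      using tensorial_local[OF assms(1,2) _ assms(3)] by blast
  qed (use assms(3) in blast)
  then show ?thesis using vf_tangent[OF assms(3,2)] by (simp add: covec_at_def)
qed

text \<open>Gaussian elimination over the local ring of germs of smooth functions.\<close>

lemma smooth_linear_solve:
  assumes "finite J" "finite I" "card I = card J" "p \<in> carrier_of M"
    "\<And>i j. i \<in> I \<Longrightarrow> j \<in> J \<Longrightarrow> G i j \<in> smooth_funs M" "\<And>i. i \<in> I \<Longrightarrow> w i \<in> smooth_funs M"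
    "\<And>c. (\<And>i. i \<in> I \<Longrightarrow> (\<Sum>j\<in>J. G i j p * c j) = 0) \<Longrightarrow> \<forall>j\<in>J. c j = 0"
  shows "\<exists>c W. (\<forall>j\<in>J. c j \<in> smooth_funs M) \<and> openin (mtop M) W \<and> p \<in> W \<and>
    (\<forall>x\<in>W. \<forall>i\<in>I. (\<Sum>j\<in>J. G i j x * c j x) = w i x)"
  using assms
proof (induction J arbitrary: I G w rule: finite_induct)
  case empty
  then show ?case by (intro exI[of _ "\<lambda>_ _. 0"] exI[of _ "carrier_of M"]) auto
next
  case (insert j0 J)
  note sing = insert.prems(6)
  have sum_ins: "(\<Sum>j\<in>insert j0 J. F j) = F j0 + (\<Sum>j\<in>J. F j)" for F :: "_ \<Rightarrow> real"
    using insert.hyps by simp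
  \<comment> \<open>Were the column \<open>j0\<close> zero at \<open>p\<close>, the corresponding
    unit vector would lie in the kernel.\<close>
  have "\<exists>i0\<in>I. G i0 j0 p \<noteq> 0"
  proof (rule ccontr)
    assume "\<not> ?thesis"
    then have "\<forall>j\<in>insert j0 J. (if j = j0 then 1 else 0::real) = 0"
      using insert.hyps by (intro sing) (auto simp: sum_ins intro!: sum.neutral)
    then show False by simp
  qed
  then obtain i0 where i0: "i0 \<in> I" "G i0 j0 p \<noteq> 0" by blast
  define I' where "I' = I - {i0}"
  have I': "finite I'" "card I' = card J" "I = insert i0 I'" "i0 \<notin> I'"
    using insert.prems(1,2) insert.hyps i0 by (auto simp: I'_def)
  obtain h W where h: "h \<in> smooth_funs M" "openin (mtop M) W" "p \<in> W" "\<And>x. x \<in> W \<Longrightarrow> h x * G i0 j0 x = 1"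
    using smooth_local_inverse[OF insert.prems(4)[OF i0(1)] insert.prems(3) i0(2)] by auto
  \<comment> \<open>On \<open>W\<close>, where \<open>h\<close> inverts the pivot, this is the Schur
    complement of the pivot; elsewhere it is merely some smooth function.\<close>
  define G' where "G' i j = (\<lambda>x. G i j x - G i j0 x * h x * G i0 j x)" for i j
  define w' where "w' i = (\<lambda>x. w i x - G i j0 x * h x * w i0 x)" for i
  have key: "G i j0 x * (h x * (w0 - (\<Sum>j\<in>J. G i0 j x * c j))) + (\<Sum>j\<in>J. G i j x * c j)
      = (\<Sum>j\<in>J. G' i j x * c j) + G i j0 x * h x * w0" for i x w0 and c :: "_ \<Rightarrow> real"
    unfolding G'_def by (simp add: algebra_simps sum_subtractf sum_distrib_left)
  have "\<exists>c W. (\<forall>j\<in>J. c j \<in> smooth_funs M) \<and> openin (mtop M) W \<and> p \<in> W \<and>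
    (\<forall>x\<in>W. \<forall>i\<in>I'. (\<Sum>j\<in>J. G' i j x * c j x) = w' i x)"
  proof (rule insert.IH[OF I'(1,2) insert.prems(3)])
    show "G' i j \<in> smooth_funs M" if "i \<in> I'" "j \<in> J" for i j
      unfolding G'_def using that insert.prems(4) h(1) I' by (intro smooth_diff smooth_mult) auto
    show "w' i \<in> smooth_funs M" if "i \<in> I'" for i
      unfolding w'_def using that insert.prems(4,5) h(1) I' by (intro smooth_diff smooth_mult) auto
    fix c assume c: "\<And>i. i \<in> I' \<Longrightarrow> (\<Sum>j\<in>J. G' i j p * c j) = 0"
    \<comment> \<open>The pivot row, solved for the entry \<open>j0\<close>, extends a kernel vector
      of the reduced matrix to one of the full matrix.\<close>
    define c' where "c' = c(j0 := h p * (0 - (\<Sum>j\<in>J. G i0 j p * c j)))"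
    have c'J: "(\<Sum>j\<in>J. F j * c' j) = (\<Sum>j\<in>J. F j * c j)" for F
      using insert.hyps by (intro sum.cong) (auto simp: c'_def)
    have "\<forall>j\<in>insert j0 J. c' j = 0"
    proof (rule sing)
      fix i assume i: "i \<in> I"
      show "(\<Sum>j\<in>insert j0 J. G i j p * c' j) = 0"
      proof (cases "i = i0")
        case True
        have "G i0 j0 p * (h p * (0 - s)) = - s" for s
        proof -
          have "G i0 j0 p * (h p * (0 - s)) = (h p * G i0 j0 p) * (0 - s)" by (simp only: mult_ac)
          then show ?thesis using h(4)[OF h(3)] by simp
        qed
        then show ?thesis unfolding sum_ins c'J True by (simp add: c'_def)
      next
        case False
        then have "(\<Sum>j\<in>J. G' i j p * c j) = 0" using c i I' by auto
        then show ?thesis using key[of i p 0 c] unfolding sum_ins c'J by (simp add: c'_def)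
      qed
    qed
    then show "\<forall>j\<in>J. c j = 0" using insert.hyps by (auto simp: c'_def split: if_splits)
  qed
  then obtain c W' where c: "\<forall>j\<in>J. c j \<in> smooth_funs M" "openin (mtop M) W'" "p \<in> W'"
    "\<forall>x\<in>W'. \<forall>i\<in>I'. (\<Sum>j\<in>J. G' i j x * c j x) = w' i x" by blast
  \<comment> \<open>Back substitution: the pivot row determines the remaining unknown.\<close>
  define c' where "c' = c(j0 := (\<lambda>x. h x * (w i0 x - (\<Sum>j\<in>J. G i0 j x * c j x))))"
  have c'J: "(\<Sum>j\<in>J. F j * c' j x) = (\<Sum>j\<in>J. F j * c j x)" for F x
    using insert.hyps by (intro sum.cong) (auto simp: c'_def)
  have "c' j \<in> smooth_funs M" if "j \<in> insert j0 J" for j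
    using that c(1) h(1) insert.prems(4,5) i0(1) unfolding c'_def
    by (auto intro!: smooth_mult smooth_diff smooth_sum)
  moreover have "(\<Sum>j\<in>insert j0 J. G i j x * c' j x) = w i x" if x: "x \<in> W \<inter> W'" and i: "i \<in> I" for x i
  proof (cases "i = i0")
    case True
    have gh: "G i0 j0 x * (h x * s) = s" for s
    proof -
      have "G i0 j0 x * (h x * s) = (h x * G i0 j0 x) * s" by (simp only: mult_ac)
      then show ?thesis using h(4)[of x] x by (simp only: mult_1 Int_iff)
    qed
    have c'0: "c' j0 x = h x * (w i0 x - (\<Sum>j\<in>J. G i0 j x * c j x))" by (simp add: c'_def)
    show ?thesis unfolding sum_ins c'J True c'0 gh by simp
  next
    case False
    then have "(\<Sum>j\<in>J. G' i j x * c j x) = w' i x" using c i x I' by auto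
    then show ?thesis using key[of i x "w i0 x" "\<lambda>j. c j x"] unfolding sum_ins c'J by (simp add: c'_def w'_def)
  qed
  ultimately show ?case
    using h(2,3) c(2,3) by (intro exI[of _ c'] exI[of _ "W \<inter> W'"]) auto
qed

end

section \<open>Singular metrics and their Koszul forms\<close>

locale metric_manifold = premanifold M for M :: "('a, 'e::euclidean_space) mfd" +
  fixes g :: "'a metric_form"
  assumes g_sym: "p \<in> carrier_of M \<Longrightarrow> u \<in> tangent_space M p \<Longrightarrow> v \<in> tangent_space M p \<Longrightarrow> g p u v = g p v u"
    and g_add_right: "p \<in> carrier_of M \<Longrightarrow> u \<in> tangent_space M p \<Longrightarrow> v \<in> tangent_space M p \<Longrightarrow>
      w \<in> tangent_space M p \<Longrightarrow> g p u (\<lambda>f. v f + w f) = g p u v + g p u w"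
    and g_scale_right: "p \<in> carrier_of M \<Longrightarrow> u \<in> tangent_space M p \<Longrightarrow> v \<in> tangent_space M p \<Longrightarrow>
      g p u (\<lambda>f. c * v f) = c * g p u v"
    and g_smooth: "X \<in> vfields M \<Longrightarrow> Y \<in> vfields M \<Longrightarrow> on_vf g X Y \<in> smooth_funs M"

lemma singular_semi_riemannian_metric_manifold:
  assumes "singular_semi_riemannian M g" shows "metric_manifold M g"
proof -
  interpret premanifold M
    using assms smooth_manifold_premanifold unfolding singular_semi_riemannian_def by blast
  show ?thesis
    using assms unfolding singular_semi_riemannian_def by unfold_locales simp_all
qed

text \<open>The scalar multiplication is the one in \<open>rank_at\<close>, so the dimension theory
  of \<open>fs\<close> applies to ranks.\<close>

interpretation fs: vector_space "\<lambda>(c::real) (\<alpha> :: 'x \<Rightarrow> real) v. c * \<alpha> v"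
  by unfold_locales (auto simp: fun_eq_iff algebra_simps)

lemma fs_sum_apply: "(\<Sum>i\<in>I. F i) x = (\<Sum>i\<in>I. F i x)" for F :: "'i \<Rightarrow> 'x \<Rightarrow> real"
  by (induction I rule: infinite_finite_induct) auto

text \<open>Independence of a set does not see repetitions in a family. Injectivity is derived as
  well, so that the index set and the image have the same cardinality.\<close>

lemma fs_independent_family:
  fixes F :: "'i \<Rightarrow> 'x \<Rightarrow> real"
  assumes fin: "finite S" and ind: "\<And>c i. (\<And>x. (\<Sum>i\<in>S. c i * F i x) = 0) \<Longrightarrow> i \<in> S \<Longrightarrow> c i = 0"
  shows "inj_on F S" "fs.independent (F ` S)"
proof -
  show inj: "inj_on F S"
  proof (rule inj_onI, rule ccontr)
    fix i j assume ij: "i \<in> S" "j \<in> S" "F i = F j" "i \<noteq> j"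
    \<comment> \<open>Coefficients 1 and -1 on two equal members would be a nontrivial
      relation.\<close>
    define c where "c k = (if k = i then 1 else if k = j then -1 else 0::real)" for k
    have "(\<Sum>k\<in>S. c k * F k x) = 0" for x
    proof -
      have "(\<Sum>k\<in>S. c k * F k x) = (\<Sum>k\<in>{i, j}. c k * F k x)"
        using ij fin by (intro sum.mono_neutral_right) (auto simp: c_def)
      also have "\<dots> = 0" using ij by (simp add: c_def)
      finally show ?thesis .
    qed
    from ind[OF this ij(1)] show False by (simp add: c_def)
  qed
  show "fs.independent (F ` S)"
  proof
    assume "fs.dependent (F ` S)"
    then obtain u where u: "\<exists>v\<in>F ` S. u v \<noteq> 0" "(\<Sum>v\<in>F ` S. (\<lambda>x. u v * v x)) = 0"
      using fs.dependent_finite[of "F ` S"] fin by auto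
    have "(\<Sum>i\<in>S. u (F i) * F i x) = 0" for x
    proof -
      have "(\<Sum>v\<in>F ` S. (\<lambda>x. u v * v x)) x = 0" using u(2) by simp
      then show ?thesis by (simp add: fs_sum_apply sum.reindex[OF inj])
    qed
    from ind[OF this] u(1) show False by auto
  qed
qed

context metric_manifold
begin
lemma g_add_left: "p \<in> carrier_of M \<Longrightarrow> u \<in> tangent_space M p \<Longrightarrow> v \<in> tangent_space M p \<Longrightarrow>
      w \<in> tangent_space M p \<Longrightarrow> g p (\<lambda>f. v f + w f) u = g p v u + g p w u"
  using g_add_right[of p u v w] g_sym[of p u] tangent_space_add[of v p w] by metis

lemma g_scale_left: "p \<in> carrier_of M \<Longrightarrow> u \<in> tangent_space M p \<Longrightarrow> v \<in> tangent_space M p \<Longrightarrow>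
      g p (\<lambda>f. c * v f) u = c * g p v u"
  using g_scale_right[of p u v c] g_sym[of p u] tangent_space_scale[of v p c] by metis

lemma g_minus_right: "p \<in> carrier_of M \<Longrightarrow> u \<in> tangent_space M p \<Longrightarrow> v \<in> tangent_space M p \<Longrightarrow>
      g p u (\<lambda>f. - v f) = - g p u v"
  using g_scale_right[of p u v "-1"] by simp

lemma g_zero_right: "p \<in> carrier_of M \<Longrightarrow> u \<in> tangent_space M p \<Longrightarrow> g p u (\<lambda>f. 0) = 0"
  using g_scale_right[of p u "\<lambda>f. 0" 0] tangent_zero by simp

lemma g_zero_left: "p \<in> carrier_of M \<Longrightarrow> u \<in> tangent_space M p \<Longrightarrow> g p (\<lambda>f. 0) u = 0"
  using g_zero_right g_sym tangent_zero by metis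

lemma g_sum_right:
  "p \<in> carrier_of M \<Longrightarrow> u \<in> tangent_space M p \<Longrightarrow> (\<And>i. i \<in> I \<Longrightarrow> v i \<in> tangent_space M p) \<Longrightarrow>
    g p u (\<lambda>f. \<Sum>i\<in>I. c i * v i f) = (\<Sum>i\<in>I. c i * g p u (v i))"
proof (induction I rule: infinite_finite_induct)
  case (insert i I)
  have "g p u (\<lambda>f. (c i * v i f) + (\<Sum>i\<in>I. c i * v i f)) = g p u (\<lambda>f. c i * v i f) + g p u (\<lambda>f. \<Sum>i\<in>I. c i * v i f)"
    using insert by (intro g_add_right tangent_space_scale tangent_space_sum) auto
  then show ?case using insert by (simp add: g_scale_right)
qed (auto simp: g_zero_right)

lemma on_vf_sym: "X \<in> vfields M \<Longrightarrow> Y \<in> vfields M \<Longrightarrow> p \<in> carrier_of M \<Longrightarrow> on_vf g X Y p = on_vf g Y X p"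
  by (simp add: on_vf_def g_sym vf_tangent)

lemma on_vf_add: "X \<in> vfields M \<Longrightarrow> Y \<in> vfields M \<Longrightarrow> Z \<in> vfields M \<Longrightarrow> p \<in> carrier_of M \<Longrightarrow>
    on_vf g X (\<lambda>p f. Y p f + Z p f) p = on_vf g X Y p + on_vf g X Z p"
  by (simp add: on_vf_def g_add_right vf_tangent)

lemma on_vf_fscale: "X \<in> vfields M \<Longrightarrow> Y \<in> vfields M \<Longrightarrow> p \<in> carrier_of M \<Longrightarrow>
    on_vf g X (\<lambda>p h. f p * Y p h) p = f p * on_vf g X Y p"
  by (simp add: on_vf_def g_scale_right vf_tangent)

lemma koszul_smooth:
  assumes "X \<in> vfields M" "Y \<in> vfields M" "Z \<in> vfields M"
  shows "koszul M g X Y Z \<in> smooth_funs M"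
  unfolding koszul_def using assms
  by (intro smooth_mult smooth_const smooth_add smooth_diff vf_smooth g_smooth vf_bracket)

lemma koszul_add:
  assumes "X \<in> vfields M" "Y \<in> vfields M" "Z \<in> vfields M" "Z' \<in> vfields M" "p \<in> carrier_of M"
  shows "koszul M g X Y (\<lambda>p f. Z p f + Z' p f) p = koszul M g X Y Z p + koszul M g X Y Z' p"
proof -
  let ?S = "\<lambda>p f. Z p f + Z' p f"
  note V = assms(1-4) and p = assms(5)
  note S = vf_add[OF V(3,4)]
  have 1: "X p (on_vf g Y ?S) = X p (on_vf g Y Z) + X p (on_vf g Y Z')"
    using tangent_add[OF vf_tangent[OF V(1) p] g_smooth[OF V(2,3)] g_smooth[OF V(2,4)]]
      vf_app_cong[OF V(1) p, of "on_vf g Y ?S" "\<lambda>x. on_vf g Y Z x + on_vf g Y Z' x"]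
    by (simp add: on_vf_add V)
  have 2: "Y p (on_vf g ?S X) = Y p (on_vf g Z X) + Y p (on_vf g Z' X)"
    using tangent_add[OF vf_tangent[OF V(2) p] g_smooth[OF V(3,1)] g_smooth[OF V(4,1)]]
      vf_app_cong[OF V(2) p, of "on_vf g ?S X" "\<lambda>x. on_vf g Z X x + on_vf g Z' X x"]
    by (simp add: on_vf_def g_add_left vf_tangent V)
  have 3: "on_vf g X (lie_bracket M Y ?S) p = on_vf g X (lie_bracket M Y Z) p + on_vf g X (lie_bracket M Y Z') p"
    by (simp add: on_vf_def lie_bracket_add_right V p g_add_right vf_tangent lie_bracket_tangent)
  have b: "lie_bracket M ?S X p = (\<lambda>f. lie_bracket M Z X p f + lie_bracket M Z' X p f)"
    using lie_bracket_anti[of X ?S p] lie_bracket_anti[of ?S X p] lie_bracket_anti[of Z X p] lie_bracket_anti[of Z' X p]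
      lie_bracket_add_right[OF V(1,3,4) p] by (auto simp: fun_eq_iff)
  have 4: "on_vf g Y (lie_bracket M ?S X) p = on_vf g Y (lie_bracket M Z X) p + on_vf g Y (lie_bracket M Z' X) p"
    by (simp add: on_vf_def b V p g_add_right vf_tangent lie_bracket_tangent)
  have 5: "on_vf g ?S (lie_bracket M X Y) p = on_vf g Z (lie_bracket M X Y) p + on_vf g Z' (lie_bracket M X Y) p"
    by (simp add: on_vf_def V p g_add_left vf_tangent lie_bracket_tangent)
  show ?thesis
    unfolding koszul_def app_vf_def 1 2 3 4 5 by (simp add: algebra_simps add_divide_distrib)
qed

text \<open>The terms that differentiate \<open>k\<close> cancel in pairs: X(k) g(Y,Z) against the
  bracket of \<open>k Z\<close> with \<open>X\<close>, and Y(k) g(Z,X) against the bracket of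
  \<open>Y\<close> with \<open>k Z\<close>.\<close>

lemma koszul_fscale:
  assumes "X \<in> vfields M" "Y \<in> vfields M" "Z \<in> vfields M" "k \<in> smooth_funs M" "p \<in> carrier_of M"
  shows "koszul M g X Y (\<lambda>p f. k p * Z p f) p = k p * koszul M g X Y Z p"
proof -
  let ?S = "\<lambda>p f. k p * Z p f"
  note V = assms(1-3) and k = assms(4) and p = assms(5)
  note S = vf_fscale[OF V(3) k]
  have 1: "X p (on_vf g Y ?S) = X p k * on_vf g Y Z p + k p * X p (on_vf g Y Z)"
    using tangent_mult[OF vf_tangent[OF V(1) p] k g_smooth[OF V(2,3)]]
      vf_app_cong[OF V(1) p, of "on_vf g Y ?S" "\<lambda>x. k x * on_vf g Y Z x"]
    by (simp add: on_vf_fscale V)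
  have 2: "Y p (on_vf g ?S X) = Y p k * on_vf g Z X p + k p * Y p (on_vf g Z X)"
    using tangent_mult[OF vf_tangent[OF V(2) p] k g_smooth[OF V(3,1)]]
      vf_app_cong[OF V(2) p, of "on_vf g ?S X" "\<lambda>x. k x * on_vf g Z X x"]
    by (simp add: on_vf_def g_scale_left vf_tangent V)
  have 3: "on_vf g X (lie_bracket M Y ?S) p = Y p k * on_vf g X Z p + k p * on_vf g X (lie_bracket M Y Z) p"
    by (simp add: on_vf_def lie_bracket_fscale_right V k p g_add_right g_scale_right vf_tangent
        lie_bracket_tangent tangent_space_scale)
  have b: "lie_bracket M ?S X p = (\<lambda>f. - (X p k) * Z p f + k p * lie_bracket M Z X p f)"
    using lie_bracket_anti[of X ?S p] lie_bracket_anti[of ?S X p] lie_bracket_anti[of Z X p]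
      lie_bracket_fscale_right[OF V(1,3) k p] by (auto simp: fun_eq_iff)
  have "g p (Y p) (\<lambda>f. - (X p k) * Z p f + k p * lie_bracket M Z X p f) =
      g p (Y p) (\<lambda>f. - (X p k) * Z p f) + g p (Y p) (\<lambda>f. k p * lie_bracket M Z X p f)"
    by (intro g_add_right p vf_tangent V tangent_space_scale lie_bracket_tangent)
  then have 4: "on_vf g Y (lie_bracket M ?S X) p = - (X p k) * on_vf g Y Z p + k p * on_vf g Y (lie_bracket M Z X) p"
    unfolding on_vf_def b by (simp add: V p g_scale_right[of p "Y p" _ "- X p k", simplified] g_scale_right vf_tangent lie_bracket_tangent)
  have 5: "on_vf g ?S (lie_bracket M X Y) p = k p * on_vf g Z (lie_bracket M X Y) p"
    by (simp add: on_vf_def V p g_scale_left vf_tangent lie_bracket_tangent)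
  have 6: "on_vf g X Z p = on_vf g Z X p" by (rule on_vf_sym[OF V(1,3) p])
  have 7: "Z p (on_vf g X Y) * k p = k p * Z p (on_vf g X Y)" by simp
  show ?thesis
    unfolding koszul_def app_vf_def 1 2 3 4 5 6 by (simp add: algebra_simps)
qed

lemma tensorial_koszul: "X \<in> vfields M \<Longrightarrow> Y \<in> vfields M \<Longrightarrow> tensorial M (koszul M g X Y)"
  unfolding tensorial_def by (simp add: koszul_add koszul_fscale)

lemma koszul_cong:
  assumes X: "X \<in> vfields M" "X' \<in> vfields M" "\<And>x. x \<in> carrier_of M \<Longrightarrow> X x = X' x"
    and Y: "Y \<in> vfields M" "Y' \<in> vfields M" "\<And>x. x \<in> carrier_of M \<Longrightarrow> Y x = Y' x"
    and Z: "Z \<in> vfields M" "Z' \<in> vfields M" "\<And>x. x \<in> carrier_of M \<Longrightarrow> Z x = Z' x"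
    and p: "p \<in> carrier_of M"
  shows "koszul M g X Y Z p = koszul M g X' Y' Z' p"
proof -
  have on: "on_vf g A C p = on_vf g A' C' p"
    if "\<And>x. x \<in> carrier_of M \<Longrightarrow> A x = A' x" "\<And>x. x \<in> carrier_of M \<Longrightarrow> C x = C' x" "p \<in> carrier_of M" for A A' C C' p
    using that by (simp add: on_vf_def)
  have app: "app_vf D (on_vf g A C) p = app_vf D' (on_vf g A' C') p"
    if "\<And>x. x \<in> carrier_of M \<Longrightarrow> A x = A' x" "\<And>x. x \<in> carrier_of M \<Longrightarrow> C x = C' x" "D' \<in> vfields M" "D p = D' p" for A A' C C' D D'
    using vf_app_cong[OF that(3) p, of "on_vf g A C" "on_vf g A' C'"] on[OF that(1,2)] that(4) by (simp add: app_vf_def)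
  show ?thesis
    unfolding koszul_def
    by (intro arg_cong2[of _ _ _ _ "(*)"] arg_cong2[of _ _ _ _ "(+)"] arg_cong2[of _ _ _ _ "(-)"] refl app on
        X Y Z p lie_bracket_cong)
qed

text \<open>Metric compatibility of the Levi-Civita connection in lowered form, which makes sense
  for degenerate \<open>g\<close>. It turns derivatives of fibre metrics into fibre Koszul
  forms.\<close>

lemma koszul_metric:
  assumes "X \<in> vfields M" "Y \<in> vfields M" "Z \<in> vfields M" "p \<in> carrier_of M"
  shows "koszul M g X Y Z p + koszul M g X Z Y p = X p (on_vf g Y Z)"
proof -
  have a: "on_vf g A (lie_bracket M C D) p = - on_vf g A (lie_bracket M D C) p"
    if "A \<in> vfields M" "C \<in> vfields M" "D \<in> vfields M" for A C D
    unfolding on_vf_def lie_bracket_anti[of C D p] using that assms(4)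
    by (intro g_minus_right vf_tangent lie_bracket_tangent)
  have s: "A p (on_vf g C D) = A p (on_vf g D C)" if "A \<in> vfields M" "C \<in> vfields M" "D \<in> vfields M" for A C D
    by (rule vf_app_cong[OF that(1) assms(4)]) (rule on_vf_sym[OF that(2,3)])
  show ?thesis
    unfolding koszul_def app_vf_def
    using a[of X Y Z] a[of Y Z X] a[of Z X Y] s[of X Y Z] s[of Y Z X] s[of Z X Y] assms by (simp add: field_simps)
qed

text \<open>Vanishing torsion in lowered form; it does for fibre brackets what
  \<open>koszul_metric\<close> does for derivatives.\<close>

lemma koszul_torsion:
  assumes "X \<in> vfields M" "Y \<in> vfields M" "Z \<in> vfields M" "p \<in> carrier_of M"
  shows "koszul M g X Y Z p - koszul M g Y X Z p = on_vf g (lie_bracket M X Y) Z p"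
proof -
  have a: "on_vf g A (lie_bracket M C D) p = - on_vf g A (lie_bracket M D C) p"
    if "A \<in> vfields M" "C \<in> vfields M" "D \<in> vfields M" for A C D
    unfolding on_vf_def lie_bracket_anti[of C D p] using that assms(4)
    by (intro g_minus_right vf_tangent lie_bracket_tangent)
  have s: "A p (on_vf g C D) = A p (on_vf g D C)" if "A \<in> vfields M" "C \<in> vfields M" "D \<in> vfields M" for A C D
    by (rule vf_app_cong[OF that(1) assms(4)]) (rule on_vf_sym[OF that(2,3)])
  show ?thesis
    unfolding koszul_def app_vf_def
    using a[of X Y Z] a[of Y Z X] a[of Z X Y] s[of X Y Z] s[of Y Z X] s[of Z X Y] assms
      on_vf_sym[OF vf_bracket[OF assms(1,2)] assms(3,4)] by (simp add: field_simps)
qed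

lemma tensorial_ssnm_koszul:
  assumes "X \<in> vfields M" "Y \<in> vfields M"
  shows "tensorial M (ssnm_koszul M g P X Y)"
  unfolding tensorial_def ssnm_koszul_def using assms
  by (simp add: koszul_add koszul_fscale on_vf_add on_vf_fscale algebra_simps)

lemma ssnm_koszul_smooth:
  assumes "X \<in> vfields M" "Y \<in> vfields M" "Z \<in> vfields M" "P \<in> vfields M"
  shows "ssnm_koszul M g P X Y Z \<in> smooth_funs M"
  unfolding ssnm_koszul_def using assms by (intro smooth_add smooth_mult koszul_smooth g_smooth)

lemma ssnm_koszul_cong:
  assumes X: "X \<in> vfields M" "X' \<in> vfields M" "\<And>x. x \<in> carrier_of M \<Longrightarrow> X x = X' x"
    and YZ: "Y \<in> vfields M" "Z \<in> vfields M" and p: "p \<in> carrier_of M"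
  shows "ssnm_koszul M g P X Y Z p = ssnm_koszul M g P X' Y Z p"
  unfolding ssnm_koszul_def
  using koszul_cong[OF X YZ(1,1) refl YZ(2,2) refl p] X(3)[OF p] by (simp add: on_vf_def)

section \<open>Contractions\<close>

lemma flat_apply: "w \<in> tangent_space M p \<Longrightarrow> flat M g p v w = g p v w"
  by (simp add: flat_def)

text \<open>Well-definedness: two vectors with the same covector differ by a radical vector, and by
  symmetry \<open>g\<close> ignores such a vector in either slot.\<close>

lemma co_inner_flat:
  assumes p: "p \<in> carrier_of M" and v: "v \<in> tangent_space M p" and w: "w \<in> tangent_space M p"
  shows "co_inner M g p (flat M g p v) (flat M g p w) = g p v w"
  unfolding co_inner_def
proof (rule the_equality)
  show "\<exists>v'\<in>tangent_space M p. \<exists>w'\<in>tangent_space M p.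
     flat M g p v = flat M g p v' \<and> flat M g p w = flat M g p w' \<and> g p v w = g p v' w'"
    using v w by blast
  fix r assume "\<exists>v'\<in>tangent_space M p. \<exists>w'\<in>tangent_space M p.
     flat M g p v = flat M g p v' \<and> flat M g p w = flat M g p w' \<and> r = g p v' w'"
  then obtain v' w' where *: "v' \<in> tangent_space M p" "w' \<in> tangent_space M p"
    "flat M g p v = flat M g p v'" "flat M g p w = flat M g p w'" "r = g p v' w'" by blast
  have "r = g p v w'" using fun_cong[OF *(3), of w'] *(2,5) by (simp add: flat_apply)
  also have "\<dots> = g p w' v" using g_sym p v *(2) by blast
  also have "\<dots> = g p w v" using fun_cong[OF *(4), of v] v by (simp add: flat_apply)
  also have "\<dots> = g p v w" using g_sym p v w by blast
  finally show "r = g p v w" .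
qed

lemma co_inner_sym:
  assumes "p \<in> carrier_of M"
  shows "co_inner M g p \<alpha> \<beta> = co_inner M g p \<beta> \<alpha>"
proof -
  have "(\<exists>v\<in>tangent_space M p. \<exists>w\<in>tangent_space M p. \<alpha> = flat M g p v \<and> \<beta> = flat M g p w \<and> r = g p v w) \<longleftrightarrow>
    (\<exists>v\<in>tangent_space M p. \<exists>w\<in>tangent_space M p. \<beta> = flat M g p v \<and> \<alpha> = flat M g p w \<and> r = g p v w)" for r
    using g_sym[OF assms] by metis
  then show ?thesis by (simp add: co_inner_def)
qed

section \<open>Rank of the metric and density of the regular set\<close>

lemma radical_annihilator_finite_dim:
  assumes p: "p \<in> carrier_of M"
  shows "\<exists>S. finite S \<and> card S \<le> card (mbasis M) \<and> radical_annihilator M g p \<subseteq> fs.span S"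
proof -
  obtain e xc N where N: "openin (mtop M) N" "p \<in> N" and e0: "\<forall>b\<in>mbasis M. e b \<in> vfields M"
    and xc0: "\<forall>b\<in>mbasis M. xc b \<in> smooth_funs M"
    and "\<forall>q\<in>N. \<forall>b\<in>mbasis M. \<forall>d\<in>mbasis M. e b q (xc d) = (if b = d then 1 else 0)"
    and r0: "\<forall>q\<in>N. \<forall>v\<in>tangent_space M q. \<forall>f. v f = (\<Sum>b\<in>mbasis M. v (xc b) * e b q f)"
    using local_frame[OF p] by (elim exE conjE) (rule that)
  note e = e0[rule_format] and xc = xc0[rule_format] and r = r0[rule_format]
  let ?S = "(\<lambda>b. flat M g p (e b p)) ` mbasis M"
  have "radical_annihilator M g p \<subseteq> fs.span ?S"
  proof
    fix \<alpha> assume "\<alpha> \<in> radical_annihilator M g p"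
    then obtain v where v: "v \<in> tangent_space M p" "\<alpha> = flat M g p v" unfolding radical_annihilator_def by blast
    have v_eq: "v = (\<lambda>f. \<Sum>b\<in>mbasis M. v (xc b) * e b p f)" by (intro ext r[OF N(2) v(1)])
    have "\<alpha> = (\<Sum>b\<in>mbasis M. (\<lambda>u. v (xc b) * flat M g p (e b p) u))"
    proof
      fix u
      show "\<alpha> u = (\<Sum>b\<in>mbasis M. (\<lambda>u. v (xc b) * flat M g p (e b p) u)) u"
      proof (cases "u \<in> tangent_space M p")
        case True
        have "g p v u = g p u (\<lambda>f. \<Sum>b\<in>mbasis M. v (xc b) * e b p f)"
          using arg_cong[OF v_eq, of "g p u"] g_sym[OF p v(1) True] by simp
        also have "\<dots> = (\<Sum>b\<in>mbasis M. v (xc b) * g p (e b p) u)"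
          using e vf_tangent p True by (subst g_sum_right) (auto intro!: sum.cong g_sym)
        finally show ?thesis using True by (simp add: fs_sum_apply v flat_apply)
      qed (simp add: v fs_sum_apply flat_def)
    qed
    also have "\<dots> \<in> fs.span ?S"
      by (intro fs.span_sum fs.span_scale fs.span_base) auto
    finally show "\<alpha> \<in> fs.span ?S" .
  qed
  then show ?thesis using mbasis(4) card_image_le by (intro exI[of _ ?S]) auto
qed

text \<open>Covectors live in a space of all functions, which can be infinite-dimensional; the
  finite spanning set is what bounds independent sets and makes the rank an honest maximum.\<close>

lemma radical_annihilator_independent:
  assumes p: "p \<in> carrier_of M" and C: "C \<subseteq> radical_annihilator M g p" "fs.independent C"
  shows "finite C" "card C \<le> rank_at M g p" "card C \<le> card (mbasis M)"
proof -
  obtain S where S: "finite S" "card S \<le> card (mbasis M)" "radical_annihilator M g p \<subseteq> fs.span S"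
    using radical_annihilator_finite_dim[OF p] by blast
  have b: "finite C \<and> card C \<le> card S" if "C \<subseteq> radical_annihilator M g p" "fs.independent C" for C
    using fs.independent_span_bound[OF S(1) that(2)] that(1) S(3) by blast
  from b[OF C] S(2) show "finite C" "card C \<le> card (mbasis M)" by auto
  obtain B where B: "C \<subseteq> B" "B \<subseteq> radical_annihilator M g p" "fs.independent B" "radical_annihilator M g p \<subseteq> fs.span B"
    using fs.maximal_independent_subset_extend[OF C] by blast
  then have "card B = rank_at M g p" unfolding rank_at_def using fs.basis_card_eq_dim by blast
  moreover have "finite B" using b[OF B(2,3)] by blast
  ultimately show "card C \<le> rank_at M g p" using card_mono[OF _ B(1)] by simp
qed

lemma radical_annihilator_basis:
  assumes p: "p \<in> carrier_of M"
  obtains B where "B \<subseteq> radical_annihilator M g p" "fs.independent B" "radical_annihilator M g p \<subseteq> fs.span B"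
    "finite B" "card B = rank_at M g p"
proof -
  obtain B where B: "B \<subseteq> radical_annihilator M g p" "fs.independent B" "radical_annihilator M g p \<subseteq> fs.span B"
    "card B = rank_at M g p" using fs.basis_exists[of "radical_annihilator M g p"] unfolding rank_at_def by blast
  show thesis by (rule that[OF B(1-3) radical_annihilator_independent(1)[OF p B(1,2)] B(4)])
qed

lemma rank_at_le: "p \<in> carrier_of M \<Longrightarrow> rank_at M g p \<le> card (mbasis M)"
  using radical_annihilator_basis radical_annihilator_independent(3) by metis

text \<open>Extend vectors whose covectors form a basis at \<open>p\<close> to fields. Their Gram
  matrix is invertible at \<open>p\<close>, hence nearby, and the columns of the inverse are
  coefficients of vectors dual to the covectors of these fields, which therefore stay
  independent.\<close>

lemma rank_at_lower_semicontinuous: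
  assumes p: "p \<in> carrier_of M"
  obtains W where "openin (mtop M) W" "p \<in> W" "\<And>x. x \<in> W \<Longrightarrow> rank_at M g p \<le> rank_at M g x"
proof -
  obtain B where B: "B \<subseteq> radical_annihilator M g p" "fs.independent B" "radical_annihilator M g p \<subseteq> fs.span B"
    "finite B" "card B = rank_at M g p" using radical_annihilator_basis[OF p] by blast
  have "\<forall>\<beta>\<in>B. \<exists>V. V \<in> vfields M \<and> \<beta> = flat M g p (V p)"
  proof
    fix \<beta> assume "\<beta> \<in> B"
    then obtain v where v: "v \<in> tangent_space M p" "\<beta> = flat M g p v" using B(1) unfolding radical_annihilator_def by blast
    then obtain Z where "Z \<in> vfields M" "Z p = v" using vf_extension[OF p] by blast
    with v show "\<exists>V. V \<in> vfields M \<and> \<beta> = flat M g p (V p)" by blast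
  qed
  then obtain V where V: "\<And>\<beta>. \<beta> \<in> B \<Longrightarrow> V \<beta> \<in> vfields M" "\<And>\<beta>. \<beta> \<in> B \<Longrightarrow> \<beta> = flat M g p (V \<beta> p)"
    by metis
  \<comment> \<open>A kernel vector \<open>c\<close> of the Gram matrix yields a vector
    \<open>w\<close> killed by \<open>B\<close>, hence by every covector of the annihilator. So
    \<open>w\<close> is radical, and \<open>c\<close> is a linear relation on
    \<open>B\<close>.\<close>
  have nonsing: "\<forall>\<gamma>\<in>B. c \<gamma> = 0"
    if c: "\<And>\<beta>. \<beta> \<in> B \<Longrightarrow> (\<Sum>\<gamma>\<in>B. on_vf g (V \<beta>) (V \<gamma>) p * c \<gamma>) = 0" for c
  proof -
    define w where "w = (\<lambda>f. \<Sum>\<gamma>\<in>B. c \<gamma> * V \<gamma> p f)"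
    have w: "w \<in> tangent_space M p"
      unfolding w_def using V vf_tangent p by (intro tangent_space_sum tangent_space_scale) auto
    have gw: "g p u w = (\<Sum>\<gamma>\<in>B. c \<gamma> * g p u (V \<gamma> p))" if "u \<in> tangent_space M p" for u
      unfolding w_def using V vf_tangent p that by (intro g_sum_right) auto
    have B0: "\<beta> w = 0" if "\<beta> \<in> B" for \<beta>
    proof -
      have "\<beta> w = g p (V \<beta> p) w" using V(2)[OF that] w by (metis flat_apply)
      then show ?thesis using c[OF that] gw[of "V \<beta> p"] V(1)[OF that] vf_tangent p by (simp add: on_vf_def mult.commute)
    qed
    have "fs.span B \<subseteq> {\<alpha>. \<alpha> w = 0}"
      by (intro fs.span_minimal) (auto simp: B0 fs.subspace_def)
    then have r0: "\<alpha> w = 0" if "\<alpha> \<in> radical_annihilator M g p" for \<alpha> using that B(3) by blast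
    have "(\<Sum>\<gamma>\<in>B. (\<lambda>u. c \<gamma> * \<gamma> u)) = 0"
    proof
      fix u
      show "(\<Sum>\<gamma>\<in>B. (\<lambda>u. c \<gamma> * \<gamma> u)) u = 0 u"
      proof (cases "u \<in> tangent_space M p")
        case True
        have "\<gamma> u = g p u (V \<gamma> p)" if "\<gamma> \<in> B" for \<gamma>
          using V(2)[OF that] True g_sym[OF p True vf_tangent[OF V(1)[OF that] p]] by (metis flat_apply)
        then have "(\<Sum>\<gamma>\<in>B. c \<gamma> * \<gamma> u) = g p u w" using gw[OF True] by simp
        also have "\<dots> = 0" using r0[of "flat M g p u"] True w by (simp add: radical_annihilator_def flat_apply)
        finally show ?thesis by (simp add: fs_sum_apply)
      next
        case False
        have "\<gamma> u = 0" if "\<gamma> \<in> B" for \<gamma> using V(2)[OF that] False by (metis flat_def)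
        then have "(\<Sum>\<gamma>\<in>B. c \<gamma> * \<gamma> u) = 0" by (intro sum.neutral) auto
        then show ?thesis by (simp add: fs_sum_apply)
      qed
    qed
    then have z: "(\<Sum>\<gamma>\<in>B. (\<lambda>u. c \<gamma> * \<gamma> u)) = 0" .
    show ?thesis
    proof (rule ccontr)
      assume "\<not> ?thesis"
      then have "\<exists>\<gamma>\<in>B. c \<gamma> \<noteq> 0" by blast
      with z have "fs.dependent B" unfolding fs.dependent_finite[OF B(4)] by (intro exI[of _ c] conjI)
      then show False using B(2) by simp
    qed
  qed
  \<comment> \<open>The column \<open>\<kappa>\<close> of the inverse Gram matrix, as functions near
    \<open>p\<close>.\<close>
  have "\<exists>c W. (\<forall>\<gamma>\<in>B. c \<gamma> \<in> smooth_funs M) \<and> openin (mtop M) W \<and> p \<in> W \<and>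
    (\<forall>x\<in>W. \<forall>\<beta>\<in>B. (\<Sum>\<gamma>\<in>B. on_vf g (V \<beta>) (V \<gamma>) x * c \<gamma> x) = (if \<beta> = \<kappa> then 1 else 0))" for \<kappa>
  proof (rule smooth_linear_solve[OF B(4,4) refl p])
    show "on_vf g (V i) (V j) \<in> smooth_funs M" if "i \<in> B" "j \<in> B" for i j
      using g_smooth V(1) that by simp
    show "\<forall>\<gamma>\<in>B. c \<gamma> = 0" if "\<And>\<beta>. \<beta> \<in> B \<Longrightarrow> (\<Sum>\<gamma>\<in>B. on_vf g (V \<beta>) (V \<gamma>) p * c \<gamma>) = 0" for c
      using nonsing that .
  qed simp
  note ex = this
  have "\<forall>\<kappa>. \<exists>cW. openin (mtop M) (snd cW) \<and> p \<in> snd cW \<and>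
    (\<forall>x\<in>snd cW. \<forall>\<beta>\<in>B. (\<Sum>\<gamma>\<in>B. on_vf g (V \<beta>) (V \<gamma>) x * fst cW \<gamma> x) = (if \<beta> = \<kappa> then 1 else 0))"
    unfolding split_paired_Ex fst_conv snd_conv
    by (intro allI) (rule ex[THEN exE], elim exE conjE, intro exI conjI)
  then obtain cW where cW: "\<forall>\<kappa>. openin (mtop M) (snd (cW \<kappa>)) \<and> p \<in> snd (cW \<kappa>) \<and>
    (\<forall>x\<in>snd (cW \<kappa>). \<forall>\<beta>\<in>B. (\<Sum>\<gamma>\<in>B. on_vf g (V \<beta>) (V \<gamma>) x * fst (cW \<kappa>) \<gamma> x) = (if \<beta> = \<kappa> then 1 else 0))"
    by (rule choice[THEN exE])
  define W where "W = carrier_of M \<inter> (\<Inter>\<kappa>\<in>B. snd (cW \<kappa>))"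
  have "openin (mtop M) W"
  proof (cases "B = {}")
    case False
    show ?thesis unfolding W_def using cW by (intro openin_Int openin_INT2[OF B(4) False]) auto
  qed (simp add: W_def)
  moreover have "p \<in> W" using cW p by (simp add: W_def)
  moreover have "rank_at M g p \<le> rank_at M g x" if x: "x \<in> W" for x
  proof -
    have xc: "x \<in> carrier_of M" using x by (simp add: W_def)
    let ?F = "\<lambda>\<beta>. flat M g x (V \<beta> x)"
    have ind: "d \<kappa> = 0" if d: "\<And>u. (\<Sum>\<beta>\<in>B. d \<beta> * ?F \<beta> u) = 0" and \<kappa>: "\<kappa> \<in> B" for d \<kappa>
    proof -
      \<comment> \<open>Pairing a relation with this dual vector isolates its coefficient at
        \<open>\<kappa>\<close>.\<close>
      define u where "u = (\<lambda>f. \<Sum>\<gamma>\<in>B. fst (cW \<kappa>) \<gamma> x * V \<gamma> x f)"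
      have u: "u \<in> tangent_space M x"
        unfolding u_def using V vf_tangent xc by (intro tangent_space_sum tangent_space_scale) auto
      have "?F \<beta> u = (if \<beta> = \<kappa> then 1 else 0)" if "\<beta> \<in> B" for \<beta>
      proof -
        have "?F \<beta> u = (\<Sum>\<gamma>\<in>B. fst (cW \<kappa>) \<gamma> x * g x (V \<beta> x) (V \<gamma> x))"
          unfolding flat_apply[OF u] unfolding u_def using V vf_tangent xc that by (intro g_sum_right) auto
        also have "\<dots> = (\<Sum>\<gamma>\<in>B. on_vf g (V \<beta>) (V \<gamma>) x * fst (cW \<kappa>) \<gamma> x)"
          by (simp add: on_vf_def mult.commute)
        also have "\<dots> = (if \<beta> = \<kappa> then 1 else 0)" using cW x \<kappa> that by (simp add: W_def)
        finally show ?thesis .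
      qed
      then have "(\<Sum>\<beta>\<in>B. d \<beta> * ?F \<beta> u) = (\<Sum>\<beta>\<in>B. if \<beta> = \<kappa> then d \<beta> else 0)"
        by (intro sum.cong) auto
      then show ?thesis using d[of u] \<kappa> B(4) by simp
    qed
    have F: "inj_on ?F B" "fs.independent (?F ` B)"
      by (rule fs_independent_family[OF B(4)], erule (1) ind)+
    have "?F ` B \<subseteq> radical_annihilator M g x"
      using V vf_tangent xc unfolding radical_annihilator_def by auto
    from radical_annihilator_independent(2)[OF xc this F(2)] show ?thesis
      using card_image[OF F(1)] B(5) by simp
  qed
  ultimately show thesis using that by blast
qed

text \<open>Ranks are bounded by the dimension, so the rank attains a maximum on \<open>W\<close>;
  by lower semicontinuity it is constant near such a point.\<close>

lemma regular_set_dense: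
  assumes "openin (mtop M) W" "p \<in> W"
  shows "\<exists>x\<in>W. x \<in> regular_set M g"
proof -
  have car: "W \<subseteq> carrier_of M" using assms openin_subset by blast
  have "\<forall>y. y \<in> W \<longrightarrow> rank_at M g y < Suc (card (mbasis M))" using car rank_at_le by (auto simp: less_Suc_eq_le)
  then obtain x where x: "x \<in> W" "\<forall>y. y \<in> W \<longrightarrow> rank_at M g y \<le> rank_at M g x"
    using ex_has_greatest_nat[of "\<lambda>y. y \<in> W" p "rank_at M g"] assms(2) by (metis less_imp_le)
  obtain W' where W': "openin (mtop M) W'" "x \<in> W'" "\<And>y. y \<in> W' \<Longrightarrow> rank_at M g x \<le> rank_at M g y"
    using rank_at_lower_semicontinuous[of x] x(1) car by auto
  have "x \<in> regular_set M g"
    unfolding regular_set_def using x W' assms(1)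
    by (auto intro!: exI[of _ "W \<inter> W'"] antisym)
  then show ?thesis using x by blast
qed

lemma regular_set_carrier: "p \<in> regular_set M g \<Longrightarrow> p \<in> carrier_of M"
  unfolding regular_set_def using openin_subset by fastforce

text \<open>If two extensions differed at a point, they would differ on an open set, which meets the
  dense regular set, where both are prescribed.\<close>

lemma contraction_eqI:
  assumes h: "is_contraction M g \<omega> \<tau> h" and p: "p \<in> carrier_of M"
  shows "contraction M g \<omega> \<tau> p = h p"
proof -
  have uniq: "h1 x = h2 x" if c: "is_contraction M g \<omega> \<tau> h1" "is_contraction M g \<omega> \<tau> h2" "x \<in> carrier_of M" for h1 h2 x
  proof (rule ccontr)
    assume ne: "h1 x \<noteq> h2 x"
    have s: "(\<lambda>x. h1 x - h2 x) \<in> smooth_funs M"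
      using c unfolding is_contraction_def by (intro smooth_diff) auto
    have "x \<in> {p \<in> carrier_of M. h1 p - h2 p \<noteq> 0}" using ne c(3) by simp
    then obtain y where "y \<in> {p \<in> carrier_of M. h1 p - h2 p \<noteq> 0}" "y \<in> regular_set M g"
      using regular_set_dense[OF smooth_nonzero_open[OF s]] by blast
    then show False using c unfolding is_contraction_def by auto
  qed
  \<comment> \<open>The description in \<open>contraction\<close> fixes the value 0 off the carrier,
    while \<open>h\<close> may have any values there.\<close>
  define h' where "h' x = (if x \<in> carrier_of M then h x else 0)" for x
  have h': "is_contraction M g \<omega> \<tau> h'"
    using h smooth_funs_carrier_cong[of h h'] regular_set_carrier unfolding is_contraction_def by (auto simp: h'_def)
  have "contraction M g \<omega> \<tau> = h'"
    unfolding contraction_def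
  proof (rule the_equality)
    show "is_contraction M g \<omega> \<tau> h' \<and> (\<forall>p. p \<notin> carrier_of M \<longrightarrow> h' p = 0)"
      using h' by (simp add: h'_def)
    show "h1 = h'" if "is_contraction M g \<omega> \<tau> h1 \<and> (\<forall>p. p \<notin> carrier_of M \<longrightarrow> h1 p = 0)" for h1
      using uniq[of h1 h'] h' that by (auto simp: fun_eq_iff h'_def)
  qed
  then show ?thesis using p by (simp add: h'_def)
qed

lemma is_contraction_sym: "is_contraction M g \<omega> \<tau> h \<Longrightarrow> is_contraction M g \<tau> \<omega> h"
  using co_inner_sym regular_set_carrier unfolding is_contraction_def by auto

end

section \<open>Slices of products\<close>

context premanifold
begin
lemma chart_path:
  assumes c: "(U, \<phi>) \<in> atlas M" and p: "p \<in> U" and b: "b \<in> model M"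
  shows "\<forall>\<^sub>F t in nhds (0::real). \<phi> p + t *\<^sub>R b \<in> \<phi> ` U"
proof -
  have "isCont (\<lambda>t::real. \<phi> p + t *\<^sub>R b) 0" by (intro continuous_intros)
  then have "((\<lambda>t::real. \<phi> p + t *\<^sub>R b) \<longlongrightarrow> \<phi> p + 0 *\<^sub>R b) (nhds 0)"
    using tendsto_at_iff_tendsto_nhds[of "\<lambda>t::real. \<phi> p + t *\<^sub>R b" 0] unfolding isCont_def by blast
  then have "\<forall>\<^sub>F t in nhds (0::real). \<phi> p + t *\<^sub>R b \<in> cdom M U \<phi>"
    by (rule topological_tendstoD) (use open_cdom[OF c] chart_in_cdom[OF c p] in auto)
  moreover have "mproj M (\<phi> p + t *\<^sub>R b) = \<phi> p + t *\<^sub>R b" for t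
    using b chart_in_model[OF c p] subspace_model by (intro mproj_id subspace_add subspace_scale)
  ultimately show ?thesis by (simp add: cdom_def)
qed

lemma path_deriv:
  assumes c: "(U, \<phi>) \<in> atlas M" and p: "p \<in> U" and f: "f \<in> smooth_funs M" and b: "b \<in> model M"
  shows "((\<lambda>t. f (inv_into U \<phi> (\<phi> p + t *\<^sub>R b))) has_real_derivative cderiv M U \<phi> b f p) (at 0)"
proof -
  have C: "Cinf_on (cdom M U \<phi>) (crep M U \<phi> f)" using f c smooth_funs_iff by blast
  have D: "(crep M U \<phi> f has_derivative frechet_derivative (crep M U \<phi> f) (at (\<phi> p))) (at (\<phi> p + 0 *\<^sub>R b))"
    using Cinf_on_has_derivative[OF C chart_in_cdom[OF c p]] by simp
  have "((\<lambda>t::real. \<phi> p + t *\<^sub>R b) has_derivative (\<lambda>t. t *\<^sub>R b)) (at 0)"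
    by (auto intro!: derivative_eq_intros)
  from has_derivative_compose[OF this D]
  have "((\<lambda>t. crep M U \<phi> f (\<phi> p + t *\<^sub>R b)) has_derivative (\<lambda>t. frechet_derivative (crep M U \<phi> f) (at (\<phi> p)) (t *\<^sub>R b))) (at 0)" .
  moreover have "frechet_derivative (crep M U \<phi> f) (at (\<phi> p)) (t *\<^sub>R b) = cderiv M U \<phi> b f p * t" for t
    using linear_cmul[OF has_derivative_linear[OF D]] by (simp add: cderiv_def)
  moreover have "mproj M (\<phi> p + t *\<^sub>R b) = \<phi> p + t *\<^sub>R b" for t
    using b chart_in_model[OF c p] subspace_model by (intro mproj_id subspace_add subspace_scale)
  ultimately show ?thesis by (simp add: has_field_derivative_def crep_def)
qed

text \<open>Compares derivatives taken in different charts or manifolds through a function of one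
  real variable; agreement for small parameters is enough.\<close>

lemma cderiv_eqI:
  assumes c: "(U, \<phi>) \<in> atlas M" "p \<in> U" "f \<in> smooth_funs M" "b \<in> model M"
    and D: "(k has_real_derivative d) (at 0)"
    and eq: "\<forall>\<^sub>F t in nhds 0. f (inv_into U \<phi> (\<phi> p + t *\<^sub>R b)) = k t"
  shows "cderiv M U \<phi> b f p = d"
proof -
  have "((\<lambda>t. f (inv_into U \<phi> (\<phi> p + t *\<^sub>R b))) has_real_derivative d) (at 0)"
    using DERIV_cong_ev[OF refl eq refl] D by blast
  then show ?thesis using path_deriv[OF c] DERIV_unique by blast
qed

lemma local_family:
  assumes "finite I" "p \<in> carrier_of M"
    "\<And>i. i \<in> I \<Longrightarrow> \<exists>h W. h \<in> smooth_funs M \<and> openin (mtop M) W \<and> p \<in> W \<and> (\<forall>x\<in>W. h x = F i x)"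
  shows "\<exists>h W. (\<forall>i\<in>I. h i \<in> smooth_funs M) \<and> openin (mtop M) W \<and> p \<in> W \<and> (\<forall>i\<in>I. \<forall>x\<in>W. h i x = F i x)"
  using assms(1,3)
proof (induction I rule: finite_induct)
  case empty
  show ?case using assms(2) by (intro exI[of _ F] exI[of _ "carrier_of M"]) auto
next
  case (insert i I)
  obtain h W where h: "\<forall>i\<in>I. h i \<in> smooth_funs M" "openin (mtop M) W" "p \<in> W" "\<forall>i\<in>I. \<forall>x\<in>W. h i x = F i x"
    using insert by blast
  obtain k V where k: "k \<in> smooth_funs M" "openin (mtop M) V" "p \<in> V" "\<forall>x\<in>V. k x = F i x"
    using insert.prems by blast
  show ?case
    by (rule exI[of _ "h(i := k)"], rule exI[of _ "W \<inter> V"])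
      (use h k insert.hyps in \<open>auto intro: openin_Int\<close>)
qed

end

lemma differential_tangent:
  assumes M: "premanifold M" and N: "premanifold N"
    and pull: "\<And>h. h \<in> smooth_funs M \<Longrightarrow> h \<circ> \<iota> \<in> smooth_funs N"
    and v: "v \<in> tangent_space N y"
  shows "differential M \<iota> v \<in> tangent_space M (\<iota> y)"
proof -
  interpret M: premanifold M by (rule M)
  interpret N: premanifold N by (rule N)
  have D: "differential M \<iota> v h = v (h \<circ> \<iota>)" if "h \<in> smooth_funs M" for h
    using that by (simp add: differential_def)
  show ?thesis
    unfolding tangent_space_def
  proof (intro CollectI conjI ballI allI impI)
    fix f h assume fh: "f \<in> smooth_funs M" "h \<in> smooth_funs M"
    show "differential M \<iota> v (\<lambda>x. f x + h x) = differential M \<iota> v f + differential M \<iota> v h"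
      unfolding D[OF fh(1)] D[OF fh(2)] D[OF M.smooth_add[OF fh]]
      using N.tangent_add[OF v pull[OF fh(1)] pull[OF fh(2)]] by (simp add: o_def)
    show "differential M \<iota> v (\<lambda>x. f x * h x) = differential M \<iota> v f * h (\<iota> y) + f (\<iota> y) * differential M \<iota> v h"
      unfolding D[OF fh(1)] D[OF fh(2)] D[OF M.smooth_mult[OF fh]]
      using N.tangent_mult[OF v pull[OF fh(1)] pull[OF fh(2)]] by (simp add: o_def)
  next
    fix c f assume f: "f \<in> smooth_funs M"
    show "differential M \<iota> v (\<lambda>x. c * f x) = c * differential M \<iota> v f"
      unfolding D[OF f] D[OF M.smooth_mult[OF M.smooth_const f]]
      using N.tangent_cmult[OF v pull[OF f], of c] by (simp add: o_def)
  next
    fix f assume "f \<notin> smooth_funs M"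
    then show "differential M \<iota> v f = 0" by (simp add: differential_def)
  qed
qed

text \<open>
  Through every point \<open>x\<close> of \<open>M\<close> passes a copy \<open>\<iota> x\<close> of \<open>N\<close>, and \<open>\<pi>\<close> projects \<open>M\<close> to \<open>N\<close>. In suitable
  charts \<open>\<pi>\<close> is a linear map \<open>C\<close> and the slices are translates of a linear map \<open>A\<close>.
\<close>

definition slice_chart where
  "slice_chart M N \<pi> \<iota> UU \<Phi> U \<phi> A C \<longleftrightarrow> (UU, \<Phi>) \<in> atlas M \<and> (U, \<phi>) \<in> atlas N \<and>
     linear A \<and> linear C \<and> A ` model N \<subseteq> model M \<and> C ` model M \<subseteq> model N \<and>
     (\<forall>x\<in>UU. \<pi> x \<in> U \<and> \<phi> (\<pi> x) = C (\<Phi> x)) \<and>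
     (\<forall>x\<in>UU. \<forall>y\<in>U. \<iota> x y \<in> UU \<and> \<Phi> (\<iota> x y) = \<Phi> x + A (\<phi> y - \<phi> (\<pi> x)))"

lemma slice_chartD:
  assumes "slice_chart M N \<pi> \<iota> UU \<Phi> U \<phi> A C"
  shows "(UU, \<Phi>) \<in> atlas M" "(U, \<phi>) \<in> atlas N" "linear A" "linear C"
    "b \<in> model N \<Longrightarrow> A b \<in> model M" "c \<in> model M \<Longrightarrow> C c \<in> model N"
    "x \<in> UU \<Longrightarrow> \<pi> x \<in> U" "x \<in> UU \<Longrightarrow> \<phi> (\<pi> x) = C (\<Phi> x)"
    "x \<in> UU \<Longrightarrow> y \<in> U \<Longrightarrow> \<iota> x y \<in> UU"
    "x \<in> UU \<Longrightarrow> y \<in> U \<Longrightarrow> \<Phi> (\<iota> x y) = \<Phi> x + A (\<phi> y - \<phi> (\<pi> x))"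
  using assms unfolding slice_chart_def image_subset_iff by simp_all

text \<open>Abstracted so that the base and every fibre of the product are instances of one theory.
  By \<open>iota_pi\<close> a point lies on its own slice, and by \<open>iota_iota\<close> all
  points of a slice define the same slice.\<close>

locale slices = M: premanifold M + N: premanifold N
  for M :: "('a, 'd::euclidean_space) mfd" and N :: "('c, 'e::euclidean_space) mfd" +
  fixes \<pi> :: "'a \<Rightarrow> 'c" and \<iota> :: "'a \<Rightarrow> 'c \<Rightarrow> 'a"
  assumes pi_carrier: "x \<in> carrier_of M \<Longrightarrow> \<pi> x \<in> carrier_of N"
    and iota_carrier: "x \<in> carrier_of M \<Longrightarrow> y \<in> carrier_of N \<Longrightarrow> \<iota> x y \<in> carrier_of M"
    and pi_iota: "\<pi> (\<iota> x y) = y"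
    and iota_iota: "\<iota> (\<iota> x y) = \<iota> x"
    and iota_pi: "\<iota> x (\<pi> x) = x"
    and slice_chart_exists: "x \<in> carrier_of M \<Longrightarrow> \<exists>UU \<Phi> U \<phi> A C. x \<in> UU \<and> slice_chart M N \<pi> \<iota> UU \<Phi> U \<phi> A C"
begin
lemma pull_smooth:
  assumes f: "f \<in> smooth_funs N" shows "f \<circ> \<pi> \<in> smooth_funs M"
proof (rule M.smooth_funs_localI)
  fix x assume "x \<in> carrier_of M"
  from slice_chart_exists[OF this] obtain UU \<Phi> U \<phi> A C
    where x: "x \<in> UU" and s: "slice_chart M N \<pi> \<iota> UU \<Phi> U \<phi> A C"
    by (elim exE conjE) (rule that)
  note c = slice_chartD(1,2,4)[OF s] and p = slice_chartD(7,8)[OF s]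
  have bC: "bounded_linear C" using c(3) linear_conv_bounded_linear by blast
  let ?O = "C -` cdom N U \<phi>"
  have O: "open ?O" by (rule open_vimage[OF N.open_cdom[OF c(2)] linear_continuous_on[OF bC]])
  have Cf: "Cinf_on (cdom N U \<phi>) (crep N U \<phi> f)" using f c(2) N.smooth_funs_iff by blast
  have F: "Cinf_on ?O (\<lambda>z. crep N U \<phi> f (C z))"
    by (rule Cinf_on_compose[OF O N.open_cdom[OF c(2)] _ Cinf_on_linear[OF bC O] Cf]) auto
  have "\<Phi> x \<in> ?O" using p(2)[OF x] N.chart_in_cdom[OF c(2) p(1)[OF x]] by simp
  from M.smooth_extension[OF c(1) x M.chart_open[OF c(1)] x O this F]
  obtain h W K where h: "h \<in> smooth_funs M" "openin (mtop M) W" "x \<in> W" "W \<subseteq> UU \<inter> UU"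
    "\<forall>x\<in>W. h x = crep N U \<phi> f (C (\<Phi> x))" by (elim exE conjE) (rule that)
  have "(f \<circ> \<pi>) z = h z" if "z \<in> W" for z
  proof -
    have z: "z \<in> UU" using h(4) that by blast
    show ?thesis using h(5) that p[OF z] N.crep_chart[OF c(2) p(1)[OF z], of f] by simp
  qed
  then show "\<exists>W h. openin (mtop M) W \<and> x \<in> W \<and> h \<in> smooth_funs M \<and> (\<forall>z\<in>W. (f \<circ> \<pi>) z = h z)"
    using h(1-3) by blast
qed

lemma slice_smooth:
  assumes h: "h \<in> smooth_funs M" and x: "x \<in> carrier_of M"
  shows "h \<circ> \<iota> x \<in> smooth_funs N"
proof (rule N.smooth_funs_localI)
  fix y assume y: "y \<in> carrier_of N"
  \<comment> \<open>The point \<open>y\<close> need not lie in the chart found at \<open>x\<close>;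
    the same slice is described from its point over \<open>y\<close>.\<close>
  define x' where "x' = \<iota> x y"
  have x': "x' \<in> carrier_of M" "\<pi> x' = y" "\<iota> x' = \<iota> x"
    using iota_carrier[OF x y] by (simp_all add: x'_def pi_iota iota_iota)
  from slice_chart_exists[OF x'(1)] obtain UU \<Phi> U \<phi> A C
    where xU: "x' \<in> UU" and s: "slice_chart M N \<pi> \<iota> UU \<Phi> U \<phi> A C"
    by (elim exE conjE) (rule that)
  note c = slice_chartD(1-3)[OF s]
  have yU: "y \<in> U" using slice_chartD(7)[OF s xU] x'(2) by simp
  have io: "\<And>z. z \<in> U \<Longrightarrow> \<iota> x' z \<in> UU" "\<And>z. z \<in> U \<Longrightarrow> \<Phi> (\<iota> x' z) = \<Phi> x' + A (\<phi> z - \<phi> y)"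
    using slice_chartD(9,10)[OF s xU] x'(2) by simp_all
  have bA: "bounded_linear A" using c(3) linear_conv_bounded_linear by blast
  \<comment> \<open>The slice in coordinates, extended to an affine map between the ambient
    spaces.\<close>
  define T where "T z = (\<Phi> x' - A (\<phi> y)) + A z" for z
  have T: "Cinf_on UNIV T" unfolding T_def by (intro Cinf_on_add Cinf_on_const open_UNIV Cinf_on_linear[OF bA])
  have Tphi: "T (\<phi> z) = \<Phi> (\<iota> x' z)" if "z \<in> U" for z
    using io(2)[OF that] linear_diff[OF c(3)] by (simp add: T_def)
  let ?O = "T -` cdom M UU \<Phi>"
  have O: "open ?O" by (rule open_vimage[OF M.open_cdom[OF c(1)] Cinf_on_continuous[OF T]])
  have Ch: "Cinf_on (cdom M UU \<Phi>) (crep M UU \<Phi> h)" using h c(1) M.smooth_funs_iff by blast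
  have F: "Cinf_on ?O (\<lambda>z. crep M UU \<Phi> h (T z))"
    by (rule Cinf_on_compose[OF O M.open_cdom[OF c(1)] _ Cinf_on_subset[OF T subset_UNIV] Ch]) auto
  have "\<phi> y \<in> ?O" using Tphi[OF yU] M.chart_in_cdom[OF c(1) io(1)[OF yU]] by simp
  from N.smooth_extension[OF c(2) yU N.chart_open[OF c(2)] yU O this F]
  obtain k W K where k: "k \<in> smooth_funs N" "openin (mtop N) W" "y \<in> W" "W \<subseteq> U \<inter> U"
    "\<forall>z\<in>W. k z = crep M UU \<Phi> h (T (\<phi> z))" by (elim exE conjE) (rule that)
  have "(h \<circ> \<iota> x) z = k z" if "z \<in> W" for z
  proof -
    have z: "z \<in> U" using k(4) that by blast
    show ?thesis using k(5) that Tphi[OF z] M.crep_chart[OF c(1) io(1)[OF z], of h] x'(3) by simp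
  qed
  then show "\<exists>W k. openin (mtop N) W \<and> y \<in> W \<and> k \<in> smooth_funs N \<and> (\<forall>z\<in>W. (h \<circ> \<iota> x) z = k z)"
    using k(1-3) by blast
qed

definition lift :: "'c vfield \<Rightarrow> 'a vfield" where
  "lift X = (\<lambda>x. differential M (\<iota> x) (X (\<pi> x)))"

lemma lift_apply: "h \<in> smooth_funs M \<Longrightarrow> lift X x h = X (\<pi> x) (h \<circ> \<iota> x)"
  by (simp add: lift_def differential_def)

lemma push_tangent: "v \<in> tangent_space M x \<Longrightarrow> differential N \<pi> v \<in> tangent_space N (\<pi> x)"
  by (rule differential_tangent[OF N.premanifold_axioms M.premanifold_axioms pull_smooth])

lemma lift_tangent:
  assumes "X \<in> vfields N" "x \<in> carrier_of M" shows "lift X x \<in> tangent_space M x"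
  using differential_tangent[OF M.premanifold_axioms N.premanifold_axioms slice_smooth[OF _ assms(2)]
      N.vf_tangent[OF assms(1) pi_carrier[OF assms(2)]]]
  by (simp add: lift_def iota_pi)

lemma cderiv_slice:
  assumes s: "slice_chart M N \<pi> \<iota> UU \<Phi> U \<phi> A C" and x: "x \<in> UU" and h: "h \<in> smooth_funs M" and b: "b \<in> model N"
  shows "cderiv N U \<phi> b (h \<circ> \<iota> x) (\<pi> x) = cderiv M UU \<Phi> (A b) h x"
proof -
  note c = slice_chartD(1-3)[OF s] slice_chartD(5)[OF s b] slice_chartD(7)[OF s x]
    and io = slice_chartD(9,10)[OF s x]
  have xc: "x \<in> carrier_of M" using x M.chart_subset[OF c(1)] by blast
  show ?thesis
  proof (rule N.cderiv_eqI[OF c(2,5) slice_smooth[OF h xc] b M.path_deriv[OF c(1) x h c(4)]])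
    show "\<forall>\<^sub>F t in nhds 0. (h \<circ> \<iota> x) (inv_into U \<phi> (\<phi> (\<pi> x) + t *\<^sub>R b)) = h (inv_into UU \<Phi> (\<Phi> x + t *\<^sub>R A b))"
    proof (rule eventually_mono[OF N.chart_path[OF c(2,5) b]])
      fix t assume "\<phi> (\<pi> x) + t *\<^sub>R b \<in> \<phi> ` U"
      then obtain z where z: "z \<in> U" "\<phi> (\<pi> x) + t *\<^sub>R b = \<phi> z" by blast
      then have "\<phi> z - \<phi> (\<pi> x) = t *\<^sub>R b" by (simp add: algebra_simps)
      then have "\<Phi> (\<iota> x z) = \<Phi> x + t *\<^sub>R A b" using io(2)[OF z(1)] linear_cmul[OF c(3)] by simp
      then show "(h \<circ> \<iota> x) (inv_into U \<phi> (\<phi> (\<pi> x) + t *\<^sub>R b)) = h (inv_into UU \<Phi> (\<Phi> x + t *\<^sub>R A b))"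
        using z inv_into_f_f[OF N.chart_inj[OF c(2)] z(1)] inv_into_f_f[OF M.chart_inj[OF c(1)] io(1)[OF z(1)]] by simp
    qed
  qed
qed

text \<open>In charts, projecting and returning along the slice is affine with linear part
  \<open>A\<close> after \<open>C\<close>. This isolates the component of a direction that belongs
  to one factor.\<close>

lemma cderiv_slice_pull:
  assumes s: "slice_chart M N \<pi> \<iota> UU \<Phi> U \<phi> A C" and x: "x \<in> UU" and h: "h \<in> smooth_funs M" and b: "b \<in> model M"
  shows "cderiv M UU \<Phi> b (h \<circ> \<iota> x \<circ> \<pi>) x = cderiv M UU \<Phi> (A (C b)) h x"
proof -
  note c = slice_chartD(1,3,4)[OF s] slice_chartD(5)[OF s slice_chartD(6)[OF s b]]
    and p = slice_chartD(7,8)[OF s] and io = slice_chartD(9,10)[OF s x]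
  have xc: "x \<in> carrier_of M" using x M.chart_subset[OF c(1)] by blast
  show ?thesis
  proof (rule M.cderiv_eqI[OF c(1) x pull_smooth[OF slice_smooth[OF h xc]] b M.path_deriv[OF c(1) x h c(4)]])
    show "\<forall>\<^sub>F t in nhds 0. (h \<circ> \<iota> x \<circ> \<pi>) (inv_into UU \<Phi> (\<Phi> x + t *\<^sub>R b)) = h (inv_into UU \<Phi> (\<Phi> x + t *\<^sub>R A (C b)))"
    proof (rule eventually_mono[OF M.chart_path[OF c(1) x b]])
      fix t assume "\<Phi> x + t *\<^sub>R b \<in> \<Phi> ` UU"
      then obtain z where z: "z \<in> UU" "\<Phi> x + t *\<^sub>R b = \<Phi> z" by blast
      have "\<phi> (\<pi> z) - \<phi> (\<pi> x) = t *\<^sub>R C b"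
        using z(2)[symmetric] p(2)[OF z(1)] p(2)[OF x] linear_add[OF c(3)] linear_cmul[OF c(3)] by simp
      then have "\<Phi> (\<iota> x (\<pi> z)) = \<Phi> x + t *\<^sub>R A (C b)"
        using io(2)[OF p(1)[OF z(1)]] linear_cmul[OF c(2)] by simp
      then show "(h \<circ> \<iota> x \<circ> \<pi>) (inv_into UU \<Phi> (\<Phi> x + t *\<^sub>R b)) = h (inv_into UU \<Phi> (\<Phi> x + t *\<^sub>R A (C b)))"
        using z inv_into_f_f[OF M.chart_inj[OF c(1)] z(1)]
          inv_into_f_f[OF M.chart_inj[OF c(1)] io(1)[OF p(1)[OF z(1)]]] by simp
    qed
  qed
qed

text \<open>Locally \<open>X\<close> is the sum of X(x_b) times coordinate derivatives. Hence the
  lift applied to \<open>h\<close> is the sum of the pulled-back X(x_b) times the derivatives of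
  \<open>h\<close> along \<open>A b\<close>, all of them smooth.\<close>

lemma lift_vfield:
  assumes X: "X \<in> vfields N" shows "lift X \<in> vfields M"
proof -
  have "app_vf (lift X) h \<in> smooth_funs M" if h: "h \<in> smooth_funs M" for h
  proof (rule M.smooth_funs_localI)
    fix x assume xc: "x \<in> carrier_of M"
    from slice_chart_exists[OF this] obtain UU \<Phi> U \<phi> A C
      where x: "x \<in> UU" and s: "slice_chart M N \<pi> \<iota> UU \<Phi> U \<phi> A C"
      by (elim exE conjE) (rule that)
    note c = slice_chartD(1,2,4)[OF s] and p = slice_chartD(7,8)[OF s]
    note pxU = p(1)[OF x]
    obtain xc W where W: "openin (mtop N) W" "\<pi> x \<in> W" "W \<subseteq> U \<inter> U"
      "\<And>b. b \<in> mbasis N \<Longrightarrow> xc b \<in> smooth_funs N" "\<And>b z. b \<in> mbasis N \<Longrightarrow> z \<in> W \<Longrightarrow> xc b z = \<phi> z \<bullet> b"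
      by (rule N.local_coordinates[OF c(2) pxU N.chart_open[OF c(2)] pxU]) (rule that)
    then have WU: "W \<subseteq> U" by blast
    obtain A' where A': "open A'" "\<phi> ` W = model N \<inter> A'"
      using N.chart_open_image[OF c(2) W(1) WU] unfolding openin_open by blast
    \<comment> \<open>The part in \<open>UU\<close> of the preimage of \<open>W\<close> under
      \<open>\<pi>\<close>; it is open because \<open>\<pi>\<close> is the linear map
      \<open>C\<close> in these charts.\<close>
    define V where "V = {z \<in> UU. \<Phi> z \<in> C -` A'}"
    have V: "openin (mtop M) V"
      unfolding V_def using c(3) linear_conv_bounded_linear
      by (intro M.chart_preimage_open[OF c(1)] open_vimage[OF A'(1)] linear_continuous_on) blast
    have VW: "\<pi> z \<in> W" "z \<in> UU" if "z \<in> V" for z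
    proof -
      show z: "z \<in> UU" using that by (simp add: V_def)
      have "\<phi> (\<pi> z) \<in> \<phi> ` W"
        using that A'(2) N.chart_in_model[OF c(2) p(1)[OF z]] p(2)[OF z] by (auto simp: V_def)
      then obtain w where "w \<in> W" "\<phi> (\<pi> z) = \<phi> w" by blast
      then show "\<pi> z \<in> W" using inj_onD[OF N.chart_inj[OF c(2)], of "\<pi> z" w] p(1)[OF z] WU by auto
    qed
    have "\<phi> (\<pi> x) \<in> \<phi> ` W" using W(2) by (rule imageI)
    then have xV: "x \<in> V" using x unfolding A'(2) p(2)[OF x] by (simp add: V_def)
    have "\<exists>k W. k \<in> smooth_funs M \<and> openin (mtop M) W \<and> x \<in> W \<and> (\<forall>z\<in>W. k z = cderiv M UU \<Phi> (A b) h z)" for b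
    proof -
      obtain k W where "k \<in> smooth_funs M" "openin (mtop M) W" "x \<in> W" "W \<subseteq> UU" "\<And>z. z \<in> W \<Longrightarrow> k z = cderiv M UU \<Phi> (A b) h z"
        by (rule M.cderiv_smooth_local[OF c(1) x h, of "A b"]) (rule that)
      then show ?thesis by (intro exI[of _ k] exI[of _ W]) simp
    qed
    from M.local_family[OF N.mbasis(4) xc, of "\<lambda>b. cderiv M UU \<Phi> (A b) h", OF this]
    obtain k V' where k: "\<forall>b\<in>mbasis N. k b \<in> smooth_funs M" "openin (mtop M) V'" "x \<in> V'"
      "\<forall>b\<in>mbasis N. \<forall>z\<in>V'. k b z = cderiv M UU \<Phi> (A b) h z" by (elim exE conjE) (rule that)
    let ?k = "\<lambda>z. \<Sum>b\<in>mbasis N. (app_vf X (xc b) \<circ> \<pi>) z * k b z"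
    have "?k \<in> smooth_funs M"
      using k(1) W(4) by (intro M.smooth_sum M.smooth_mult pull_smooth N.vf_smooth[OF X]) auto
    moreover have "app_vf (lift X) h z = ?k z" if z: "z \<in> V \<inter> V'" for z
    proof -
      have zU: "z \<in> UU" and zW: "\<pi> z \<in> W" using VW z by auto
      have zc: "z \<in> carrier_of M" using zU M.chart_subset[OF c(1)] by blast
      have "app_vf (lift X) h z = X (\<pi> z) (h \<circ> \<iota> z)" by (simp add: app_vf_def lift_apply[OF h])
      also have "\<dots> = (\<Sum>b\<in>mbasis N. X (\<pi> z) (xc b) * cderiv N U \<phi> b (h \<circ> \<iota> z) (\<pi> z))"
        by (rule N.tangent_repr[OF c(2) W(1) zW WU W(4,5) N.vf_tangent[OF X pi_carrier[OF zc]] slice_smooth[OF h zc]])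
      also have "\<dots> = ?k z"
        using k(4) z cderiv_slice[OF s zU h] N.mbasis(1) by (intro sum.cong refl) (auto simp: app_vf_def)
      finally show ?thesis .
    qed
    ultimately show "\<exists>W k. openin (mtop M) W \<and> x \<in> W \<and> k \<in> smooth_funs M \<and> (\<forall>z\<in>W. app_vf (lift X) h z = k z)"
      using V k(2,3) xV by (intro exI[of _ "V \<inter> V'"] exI[of _ ?k]) (auto intro: openin_Int)
  qed
  then show ?thesis using lift_tangent[OF X] by (simp add: vfields_def)
qed

lemma lift_pull:
  assumes X: "X \<in> vfields N" and x: "x \<in> carrier_of M" and f: "f \<in> smooth_funs N"
  shows "lift X x (f \<circ> \<pi>) = X (\<pi> x) f"
  unfolding lift_apply[OF pull_smooth[OF f]]
  by (rule N.tangent_cong[OF N.vf_tangent[OF X pi_carrier[OF x]] pi_carrier[OF x]]) (simp add: pi_iota)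

lemma lift_const:
  assumes X: "X \<in> vfields N" and x: "x \<in> carrier_of M" and h: "h \<in> smooth_funs M"
    and "\<And>y. y \<in> carrier_of N \<Longrightarrow> h (\<iota> x y) = c"
  shows "lift X x h = 0"
proof -
  have "X (\<pi> x) (h \<circ> \<iota> x) = X (\<pi> x) (\<lambda>y. c)"
    using assms(4) by (intro N.tangent_cong[OF N.vf_tangent[OF X pi_carrier[OF x]] pi_carrier[OF x]]) simp
  then show ?thesis using N.tangent_const[OF N.vf_tangent[OF X pi_carrier[OF x]]] by (simp add: lift_apply[OF h])
qed

lemma push_lift:
  assumes X: "X \<in> vfields N" and x: "x \<in> carrier_of M"
  shows "differential N \<pi> (lift X x) = X (\<pi> x)"
  using lift_pull[OF assms] N.tangent_off[OF N.vf_tangent[OF X pi_carrier[OF x]]]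
  by (auto simp: differential_def fun_eq_iff)

end

section \<open>The product manifold\<close>

lemma axis_sum:
  fixes y :: "'m::finite \<Rightarrow> 'e::euclidean_space"
  shows "(\<Sum>j\<in>UNIV. (0::'d::euclidean_space, axis j (y j))) = (0, vec_lambda y)"
  by (simp add: prod_eq_iff fst_sum snd_sum vec_eq_iff axis_def)

locale product_manifold = base: premanifold B for B :: "('b, 'd::euclidean_space) mfd" +
  fixes F :: "'m::finite \<Rightarrow> ('f, 'e::euclidean_space) mfd"
  assumes fibres: "premanifold (F j)"

sublocale product_manifold \<subseteq> fib: premanifold "F j" for j
  by (rule fibres)

context product_manifold
begin
abbreviation "M \<equiv> prod_mfd B F"
abbreviation "pchart \<phi> \<psi> \<equiv> \<lambda>(p, q). (\<phi> p, vec_lambda (\<lambda>j. \<psi> j (q j)))"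
abbreviation "pdom U V \<equiv> U \<times> (Pi UNIV V)"

lemma carrier_prod: "(p, q) \<in> carrier_of M \<longleftrightarrow> p \<in> carrier_of B \<and> (\<forall>j. q j \<in> carrier_of (F j))"
  by (auto simp: prod_mfd_def PiE_def Pi_def)

lemma atlas_prodE:
  assumes "(UU, \<Phi>) \<in> atlas M"
  obtains U \<phi> V \<psi> where "UU = pdom U V" "\<Phi> = pchart \<phi> \<psi>" "(U, \<phi>) \<in> atlas B" "\<And>j. (V j, \<psi> j) \<in> atlas (F j)"
  using assms unfolding prod_mfd_def by auto

lemma atlas_prodI:
  "(U, \<phi>) \<in> atlas B \<Longrightarrow> (\<And>j. (V j, \<psi> j) \<in> atlas (F j)) \<Longrightarrow> (pdom U V, pchart \<phi> \<psi>) \<in> atlas M"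
  unfolding prod_mfd_def by auto

lemma model_prod: "(x, y) \<in> model M \<longleftrightarrow> x \<in> model B \<and> (\<forall>j. y $ j \<in> model (F j))"
  by (simp add: prod_mfd_def)

lemma openin_pdom:
  assumes "openin (mtop B) U" "\<And>j. openin (mtop (F j)) (V j)"
  shows "openin (mtop M) (pdom U V)"
proof -
  have "openin (product_topology (\<lambda>j. mtop (F j)) UNIV) (PiE UNIV V)"
    by (rule product_topology_basis) (use assms in auto)
  then show ?thesis using assms by (simp add: prod_mfd_def openin_prod_Times_iff PiE_UNIV_domain)
qed

lemma openin_prodD:
  assumes W: "openin (mtop M) W" and x: "(p, q) \<in> W"
  obtains U V where "openin (mtop B) U" "\<And>j. openin (mtop (F j)) (V j)" "p \<in> U" "\<And>j. q j \<in> V j" "pdom U V \<subseteq> W"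
proof -
  have "openin (prod_topology (mtop B) (product_topology (\<lambda>j. mtop (F j)) UNIV)) W"
    using W by (simp add: prod_mfd_def)
  from this[unfolded openin_prod_topology_alt, rule_format, OF x]
  obtain U V' where U: "openin (mtop B) U" and V': "openin (product_topology (\<lambda>j. mtop (F j)) UNIV) V'"
    and p: "p \<in> U" and q: "q \<in> V'" and UV: "U \<times> V' \<subseteq> W" by (elim exE conjE) (rule that)
  obtain V where V: "\<And>j. openin (mtop (F j)) (V j)" "q \<in> PiE UNIV V" "PiE UNIV V \<subseteq> V'"
    using V' q unfolding openin_product_topology_alt by (meson UNIV_I)
  show thesis
  proof (rule that[OF U V(1) p])
    show "q j \<in> V j" for j using V(2) by (auto simp: PiE_UNIV_domain)
    show "pdom U V \<subseteq> W" using V(3) UV by (auto simp: PiE_UNIV_domain)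
  qed
qed

context
  fixes U \<phi> V \<psi>
  assumes cU: "(U, \<phi>) \<in> atlas B" and cV: "\<And>j. (V j, \<psi> j) \<in> atlas (F j)"
begin
lemma pchart_inj: "inj_on (pchart \<phi> \<psi>) (pdom U V)"
proof (rule inj_onI, clarify)
  fix p q p' q'
  assume a: "p \<in> U" "q \<in> Pi UNIV V" "p' \<in> U" "q' \<in> Pi UNIV V" "\<phi> p = \<phi> p'"
    "vec_lambda (\<lambda>j. \<psi> j (q j)) = vec_lambda (\<lambda>j. \<psi> j (q' j))"
  have "q j = q' j" for j
  proof (rule inj_onD[OF fib.chart_inj[OF cV[of j]]])
    show "\<psi> j (q j) = \<psi> j (q' j)" using arg_cong[OF a(6), of "\<lambda>v. v $ j"] by simp
  qed (use a in auto)
  then show "p = p' \<and> q = q'" using a inj_onD[OF base.chart_inj[OF cU]] by auto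
qed

lemma pchart_preimage_open:
  assumes "open O'" shows "openin (mtop M) {x \<in> pdom U V. pchart \<phi> \<psi> x \<in> O'}"
proof (subst openin_subopen, intro ballI)
  fix x assume "x \<in> {x \<in> pdom U V. pchart \<phi> \<psi> x \<in> O'}"
  then obtain p q where x: "x = (p, q)" "p \<in> U" "\<And>j. q j \<in> V j" "(\<phi> p, vec_lambda (\<lambda>j. \<psi> j (q j))) \<in> O'"
    by auto
  obtain A C where AC: "open A" "open C" "(\<phi> p, vec_lambda (\<lambda>j. \<psi> j (q j))) \<in> A \<times> C" "A \<times> C \<subseteq> O'"
    using open_prod_elim[OF assms x(4)] by blast
  then have "vec_lambda (\<lambda>j. \<psi> j (q j)) \<in> C" by blast
  then obtain D where D: "\<forall>j. open (D j) \<and> vec_lambda (\<lambda>j. \<psi> j (q j)) $ j \<in> D j" "\<forall>y. (\<forall>j. y $ j \<in> D j) \<longrightarrow> y \<in> C"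
    using AC(2) unfolding open_vec_def by blast
  let ?W = "pdom {p \<in> U. \<phi> p \<in> A} (\<lambda>j. {y \<in> V j. \<psi> j y \<in> D j})"
  have "openin (mtop M) ?W"
    using AC D by (intro openin_pdom base.chart_preimage_open[OF cU] fib.chart_preimage_open[OF cV]) auto
  moreover have "x \<in> ?W" using x AC D by auto
  moreover have "?W \<subseteq> {x \<in> pdom U V. pchart \<phi> \<psi> x \<in> O'}"
    using AC(4) D(2) by (auto simp: Pi_iff subset_iff)
  ultimately show "\<exists>T. openin (mtop M) T \<and> x \<in> T \<and> T \<subseteq> {x \<in> pdom U V. pchart \<phi> \<psi> x \<in> O'}" by blast
qed

lemma pchart_image:
  "pchart \<phi> \<psi> ` pdom U' V' = {(x, y). x \<in> \<phi> ` U' \<and> (\<forall>j. y $ j \<in> \<psi> j ` V' j)}"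
proof (intro set_eqI iffI)
  fix z assume "z \<in> {(x, y). x \<in> \<phi> ` U' \<and> (\<forall>j. y $ j \<in> \<psi> j ` V' j)}"
  then obtain x y where z: "z = (x, y)" "x \<in> \<phi> ` U'" and y: "\<forall>j. y $ j \<in> \<psi> j ` V' j" by auto
  from y have z3: "\<forall>j. \<exists>v. v \<in> V' j \<and> y $ j = \<psi> j v" by blast
  from choice[OF z3] obtain q where q: "\<forall>j. q j \<in> V' j \<and> y $ j = \<psi> j (q j)" by blast
  then have "y = vec_lambda (\<lambda>j. \<psi> j (q j))" by (simp add: vec_eq_iff)
  then show "z \<in> pchart \<phi> \<psi> ` pdom U' V'" using z q by auto
qed (auto intro!: imageI simp: Pi_iff)

lemma pchart_image_open:
  assumes W: "openin (mtop M) W" "W \<subseteq> pdom U V"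
  shows "openin (top_of_set (model M)) (pchart \<phi> \<psi> ` W)"
proof (subst openin_subopen, intro ballI)
  fix z assume "z \<in> pchart \<phi> \<psi> ` W"
  then obtain p q where x: "(p, q) \<in> W" "z = (\<phi> p, vec_lambda (\<lambda>j. \<psi> j (q j)))" by auto
  obtain U1 V1 where U1: "openin (mtop B) U1" "\<And>j. openin (mtop (F j)) (V1 j)" "p \<in> U1" "\<And>j. q j \<in> V1 j" "pdom U1 V1 \<subseteq> W"
    using openin_prodD[OF W(1) x(1)] by blast
  have pq: "p \<in> U" "\<And>j. q j \<in> V j" using x(1) W(2) by auto
  let ?U = "U \<inter> U1" and ?V = "\<lambda>j. V j \<inter> V1 j"
  have "openin (top_of_set (model B)) (\<phi> ` ?U)"
    by (intro base.chart_open_image[OF cU] openin_Int base.chart_open[OF cU] U1) auto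
  then obtain A where A: "open A" "\<phi> ` ?U = model B \<inter> A" unfolding openin_open by blast
  have "openin (top_of_set (model (F j))) (\<psi> j ` ?V j)" for j
    by (intro fib.chart_open_image[OF cV] openin_Int fib.chart_open[OF cV] U1) auto
  then have "\<forall>j. \<exists>D. open D \<and> \<psi> j ` ?V j = model (F j) \<inter> D" unfolding openin_open by blast
  from choice[OF this] obtain D where D: "\<forall>j. open (D j) \<and> \<psi> j ` ?V j = model (F j) \<inter> D j" by blast
  have eq: "pchart \<phi> \<psi> ` pdom ?U ?V = model M \<inter> (A \<times> {y. \<forall>j. y $ j \<in> D j})"
    unfolding pchart_image using A(2) D by (auto simp: model_prod)
  have "openin (top_of_set (model M)) (pchart \<phi> \<psi> ` pdom ?U ?V)"
    unfolding eq using A(1) D by (intro openin_open_Int open_Times open_vector_box) auto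
  moreover have "z \<in> pchart \<phi> \<psi> ` pdom ?U ?V"
    using x(2) pq U1(3,4) by (intro image_eqI[of _ _ "(p, q)"]) auto
  moreover have "pchart \<phi> \<psi> ` pdom ?U ?V \<subseteq> pchart \<phi> \<psi> ` W"
    using U1(5) by (intro image_mono) auto
  ultimately show "\<exists>T. openin (top_of_set (model M)) T \<and> z \<in> T \<and> T \<subseteq> pchart \<phi> \<psi> ` W" by blast
qed

lemma openin_pdom_chart: "openin (mtop M) (pdom U V)"
  by (rule openin_pdom[OF base.chart_open[OF cU] fib.chart_open[OF cV]])

lemma pchart_homeo:
  "homeomorphic_map (subtopology (mtop M) (pdom U V)) (top_of_set (pchart \<phi> \<psi> ` pdom U V)) (pchart \<phi> \<psi>)"
proof (rule bijective_open_imp_homeomorphic_map)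
  have top: "topspace (subtopology (mtop M) (pdom U V)) = pdom U V"
    using openin_subset[OF openin_pdom_chart] by auto
  show "continuous_map (subtopology (mtop M) (pdom U V)) (top_of_set (pchart \<phi> \<psi> ` pdom U V)) (pchart \<phi> \<psi>)"
    unfolding continuous_map_def top
  proof (intro conjI allI impI)
    fix T assume "openin (top_of_set (pchart \<phi> \<psi> ` pdom U V)) T"
    then obtain O' where O': "open O'" "T = pchart \<phi> \<psi> ` pdom U V \<inter> O'" unfolding openin_open by blast
    have "{x \<in> pdom U V. pchart \<phi> \<psi> x \<in> T} = {x \<in> pdom U V. pchart \<phi> \<psi> x \<in> O'}" using O'(2) by blast
    then show "openin (subtopology (mtop M) (pdom U V)) {x \<in> pdom U V. pchart \<phi> \<psi> x \<in> T}"
      using pchart_preimage_open[OF O'(1)] openin_pdom_chart by (simp add: openin_open_subtopology)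
  qed auto
  show "open_map (subtopology (mtop M) (pdom U V)) (top_of_set (pchart \<phi> \<psi> ` pdom U V)) (pchart \<phi> \<psi>)"
    unfolding open_map_def
  proof (intro allI impI)
    fix W assume "openin (subtopology (mtop M) (pdom U V)) W"
    then have W: "openin (mtop M) W" "W \<subseteq> pdom U V" using openin_pdom_chart by (auto simp: openin_open_subtopology)
    then have sub: "pchart \<phi> \<psi> ` W \<subseteq> pchart \<phi> \<psi> ` pdom U V" by (intro image_mono)
    show "openin (top_of_set (pchart \<phi> \<psi> ` pdom U V)) (pchart \<phi> \<psi> ` W)"
      by (rule openin_subset_trans[OF pchart_image_open[OF W] sub
          openin_imp_subset[OF pchart_image_open[OF openin_pdom_chart subset_refl]]])
  qed
  show "pchart \<phi> \<psi> ` topspace (subtopology (mtop M) (pdom U V)) = topspace (top_of_set (pchart \<phi> \<psi> ` pdom U V))"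
    unfolding top by simp
  show "inj_on (pchart \<phi> \<psi>) (topspace (subtopology (mtop M) (pdom U V)))"
    unfolding top by (rule pchart_inj)
qed

end

text \<open>Smoothness on a relatively open set means extension to open sets of the ambient space,
  so the extensions of the factor transitions are assembled on a product of open sets.\<close>

lemma prod_transition:
  assumes cU: "(U, \<phi>) \<in> atlas B" and cV: "\<And>j. (V j, \<psi> j) \<in> atlas (F j)"
    and cU': "(U', \<phi>') \<in> atlas B" and cV': "\<And>j. (V' j, \<psi>' j) \<in> atlas (F j)"
  shows "smooth_on (pchart \<phi> \<psi> ` (pdom U V \<inter> pdom U' V')) (pchart \<phi>' \<psi>' \<circ> inv_into (pdom U V) (pchart \<phi> \<psi>))"
  unfolding smooth_on_alt
proof (intro ballI)
  fix a assume "a \<in> pchart \<phi> \<psi> ` (pdom U V \<inter> pdom U' V')"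
  then obtain x where x: "x \<in> pdom U V \<inter> pdom U' V'" "a = pchart \<phi> \<psi> x" by blast
  obtain p q where "x = (p, q)" by (cases x)
  with x have a: "a = (\<phi> p, vec_lambda (\<lambda>j. \<psi> j (q j)))" "p \<in> U \<inter> U'" "\<And>j. q j \<in> V j \<inter> V' j" by auto
  have "\<phi> p \<in> \<phi> ` (U \<inter> U')" using a by blast
  then obtain A h where h: "open A" "\<phi> p \<in> A" "Cinf_on A h" "\<forall>x\<in>\<phi> ` (U \<inter> U') \<inter> A. h x = (\<phi>' \<circ> inv_into U \<phi>) x"
    using base.transition[OF cU cU'] unfolding smooth_on_alt by blast
  have "\<exists>Dk. open (fst Dk) \<and> \<psi> j (q j) \<in> fst Dk \<and> Cinf_on (fst Dk) (snd Dk) \<and>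
      (\<forall>x\<in>\<psi> j ` (V j \<inter> V' j) \<inter> fst Dk. snd Dk x = (\<psi>' j \<circ> inv_into (V j) (\<psi> j)) x)" for j
  proof -
    have "\<psi> j (q j) \<in> \<psi> j ` (V j \<inter> V' j)" using a by blast
    then obtain D k where "open D" "\<psi> j (q j) \<in> D" "Cinf_on D k" "\<forall>x\<in>\<psi> j ` (V j \<inter> V' j) \<inter> D. k x = (\<psi>' j \<circ> inv_into (V j) (\<psi> j)) x"
      using fib.transition[OF cV cV'] unfolding smooth_on_alt by blast
    then show ?thesis by (intro exI[of _ "(D, k)"]) simp
  qed
  then have "\<forall>j. \<exists>Dk. open (fst Dk) \<and> \<psi> j (q j) \<in> fst Dk \<and> Cinf_on (fst Dk) (snd Dk) \<and>
      (\<forall>x\<in>\<psi> j ` (V j \<inter> V' j) \<inter> fst Dk. snd Dk x = (\<psi>' j \<circ> inv_into (V j) (\<psi> j)) x)" by blast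
  from choice[OF this] obtain Dk where Dk: "\<forall>j. open (fst (Dk j)) \<and> \<psi> j (q j) \<in> fst (Dk j) \<and> Cinf_on (fst (Dk j)) (snd (Dk j)) \<and>
      (\<forall>x\<in>\<psi> j ` (V j \<inter> V' j) \<inter> fst (Dk j). snd (Dk j) x = (\<psi>' j \<circ> inv_into (V j) (\<psi> j)) x)" by blast
  let ?O = "A \<times> {y. \<forall>j. y $ j \<in> fst (Dk j)}"
  \<comment> \<open>Written as a sum of linear embeddings of the factor maps, so that closure under
    linear maps and sums yields smoothness.\<close>
  let ?H = "\<lambda>z. (h (fst z), 0) + (\<Sum>j\<in>UNIV. (0, axis j (snd (Dk j) (snd z $ j))))"
  have O: "open ?O" using h(1) Dk by (intro open_Times open_vector_box) auto
  have lin: "bounded_linear (\<lambda>x::'d. (x, 0::'e^'m))" "\<And>j. bounded_linear (\<lambda>x::'e. (0::'d, axis j x))"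
    "\<And>j. bounded_linear (\<lambda>z::'d \<times> ('e^'m). snd z $ j)"
    by (auto simp: linear_conv_bounded_linear[symmetric] linear_iff axis_def vec_eq_iff)
  have H: "Cinf_on ?O ?H"
  proof (intro Cinf_on_add[OF O] Cinf_on_sum[OF O])
    have "Cinf_on ?O (\<lambda>z. h (fst z))"
      by (rule Cinf_on_compose[OF O h(1) _ Cinf_on_linear[OF bounded_linear_fst O] h(3)]) auto
    from Cinf_on_linear_comp[OF lin(1) O this] show "Cinf_on ?O (\<lambda>z. (h (fst z), 0::'e^'m))" by simp
    fix j
    have "Cinf_on ?O (\<lambda>z. snd (Dk j) (snd z $ j))"
      by (rule Cinf_on_compose[OF O, of "fst (Dk j)", OF _ _ Cinf_on_linear[OF lin(3) O]]) (use Dk in auto)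
    from Cinf_on_linear_comp[OF lin(2)[of j] O this] show "Cinf_on ?O (\<lambda>z. (0::'d, axis j (snd (Dk j) (snd z $ j))))" by simp
  qed
  have eq: "?H z = (pchart \<phi>' \<psi>' \<circ> inv_into (pdom U V) (pchart \<phi> \<psi>)) z"
    if z: "z \<in> pchart \<phi> \<psi> ` (pdom U V \<inter> pdom U' V') \<inter> ?O" for z
  proof -
    obtain x' where x': "x' \<in> pdom U V \<inter> pdom U' V'" "z = pchart \<phi> \<psi> x'" using z by blast
    obtain p' q' where "x' = (p', q')" by (cases x')
    with x' have pq: "z = pchart \<phi> \<psi> (p', q')" "p' \<in> U \<inter> U'" "\<And>j. q' j \<in> V j \<inter> V' j" by auto
    have "inv_into (pdom U V) (pchart \<phi> \<psi>) z = (p', q')"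
      unfolding pq(1) by (rule inv_into_f_f[OF pchart_inj[OF cU cV]]) (use pq in auto)
    moreover have "h (\<phi> p') = \<phi>' p'"
      using h(4) z pq base.chart_inj[OF cU] by (auto simp: inv_into_f_f)
    moreover have "snd (Dk j) (\<psi> j (q' j)) = \<psi>' j (q' j)" for j
    proof -
      have "\<psi> j (q' j) \<in> \<psi> j ` (V j \<inter> V' j) \<inter> fst (Dk j)" using z pq by auto
      then have "snd (Dk j) (\<psi> j (q' j)) = (\<psi>' j \<circ> inv_into (V j) (\<psi> j)) (\<psi> j (q' j))" using Dk by blast
      then show ?thesis using pq(3)[of j] fib.chart_inj[OF cV[of j]] by (simp add: inv_into_f_f)
    qed
    ultimately show ?thesis using pq(1) by (simp add: axis_sum)
  qed
  have aO: "a \<in> ?O" using a h(2) Dk by simp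
  show "\<exists>O' h. open O' \<and> a \<in> O' \<and> Cinf_on O' h \<and>
     (\<forall>x\<in>pchart \<phi> \<psi> ` (pdom U V \<inter> pdom U' V') \<inter> O'. h x = (pchart \<phi>' \<psi>' \<circ> inv_into (pdom U V) (pchart \<phi> \<psi>)) x)"
    by (rule exI[of _ ?O], rule exI[of _ ?H]) (intro conjI O aO H ballI eq)
qed

lemma premanifold_prod: "premanifold M"
proof
  show "Hausdorff_space (mtop M)"
    using base.Hausdorff fib.Hausdorff
    by (simp add: prod_mfd_def Hausdorff_space_prod_topology Hausdorff_space_product_topology)
  show "subspace (model M)"
    using base.subspace_model fib.subspace_model unfolding subspace_def
    by (auto simp: model_prod zero_prod_def)
  show "openin (mtop M) UU" if "(UU, \<Phi>) \<in> atlas M" for UU \<Phi>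
    using that
  proof (rule atlas_prodE)
    fix U \<phi> V \<psi> assume a: "UU = pdom U V" "\<Phi> = pchart \<phi> \<psi>" "(U, \<phi>) \<in> atlas B" "\<And>j. (V j, \<psi> j) \<in> atlas (F j)"
    show ?thesis unfolding a(1) by (rule openin_pdom_chart[OF a(3,4)])
  qed
  show "openin (top_of_set (model M)) (\<Phi> ` UU)" if "(UU, \<Phi>) \<in> atlas M" for UU \<Phi>
    using that
  proof (rule atlas_prodE)
    fix U \<phi> V \<psi> assume a: "UU = pdom U V" "\<Phi> = pchart \<phi> \<psi>" "(U, \<phi>) \<in> atlas B" "\<And>j. (V j, \<psi> j) \<in> atlas (F j)"
    show ?thesis unfolding a(1,2) by (rule pchart_image_open[OF a(3,4) openin_pdom_chart[OF a(3,4)] subset_refl])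
  qed
  show "homeomorphic_map (subtopology (mtop M) UU) (top_of_set (\<Phi> ` UU)) \<Phi>" if "(UU, \<Phi>) \<in> atlas M" for UU \<Phi>
    using that
  proof (rule atlas_prodE)
    fix U \<phi> V \<psi> assume a: "UU = pdom U V" "\<Phi> = pchart \<phi> \<psi>" "(U, \<phi>) \<in> atlas B" "\<And>j. (V j, \<psi> j) \<in> atlas (F j)"
    show ?thesis unfolding a(1,2) by (rule pchart_homeo[OF a(3,4)])
  qed
  show "\<exists>UU \<Phi>. (UU, \<Phi>) \<in> atlas M \<and> x \<in> UU" if "x \<in> carrier_of M" for x
  proof -
    obtain p q where x: "x = (p, q)" by (cases x)
    have pc: "p \<in> carrier_of B" "\<And>j. q j \<in> carrier_of (F j)" using that carrier_prod[of p q] x by auto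
    obtain U \<phi> where U: "(U, \<phi>) \<in> atlas B" "p \<in> U" using base.atlas_cover[OF pc(1)] by blast
    have "\<exists>c. c \<in> atlas (F j) \<and> q j \<in> fst c" for j using fib.atlas_cover[OF pc(2)[of j]] by auto
    then have "\<forall>j. \<exists>c. c \<in> atlas (F j) \<and> q j \<in> fst c" by blast
    from choice[OF this] obtain c where c: "\<forall>j. c j \<in> atlas (F j) \<and> q j \<in> fst (c j)" by blast
    have "(pdom U (\<lambda>j. fst (c j)), pchart \<phi> (\<lambda>j. snd (c j))) \<in> atlas M" using c by (intro atlas_prodI U) auto
    moreover have "x \<in> pdom U (\<lambda>j. fst (c j))" using x U c by auto
    ultimately show ?thesis by blast
  qed
  show "smooth_on (\<Phi> ` (UU \<inter> VV)) (\<Psi> \<circ> inv_into UU \<Phi>)" if "(UU, \<Phi>) \<in> atlas M" "(VV, \<Psi>) \<in> atlas M" for UU \<Phi> VV \<Psi>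
  proof -
    from that(1) obtain U \<phi> V \<psi> where a: "UU = pdom U V" "\<Phi> = pchart \<phi> \<psi>" "(U, \<phi>) \<in> atlas B" "\<And>j. (V j, \<psi> j) \<in> atlas (F j)"
      by (rule atlas_prodE) (rule that)
    from that(2) obtain U' \<phi>' V' \<psi>' where a': "VV = pdom U' V'" "\<Psi> = pchart \<phi>' \<psi>'" "(U', \<phi>') \<in> atlas B" "\<And>j. (V' j, \<psi>' j) \<in> atlas (F j)"
      by (rule atlas_prodE) (rule that)
    show ?thesis unfolding a(1,2) a'(1,2) by (rule prod_transition[OF a(3,4) a'(3,4)])
  qed
qed

end

sublocale product_manifold \<subseteq> tot: premanifold M
  by (rule premanifold_prod)

context product_manifold
begin
lemma slice_chart_base:
  assumes "(U, \<phi>) \<in> atlas B" "\<And>j. (V j, \<psi> j) \<in> atlas (F j)"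
  shows "slice_chart M B fst (\<lambda>x p. (p, snd x)) (pdom U V) (pchart \<phi> \<psi>) U \<phi> (\<lambda>x. (x, 0)) fst"
  unfolding slice_chart_def
proof (intro conjI ballI)
  show "(pdom U V, pchart \<phi> \<psi>) \<in> atlas M" by (rule atlas_prodI) (use assms in auto)
  show "linear (\<lambda>x::'d. (x, 0::'e^'m))" by (auto simp: linear_iff)
  show "linear (fst :: 'd \<times> ('e^'m) \<Rightarrow> 'd)" by (auto simp: linear_iff)
  show "(\<lambda>x. (x, 0)) ` model B \<subseteq> model M"
    using subspace_0[OF fib.subspace_model] by (auto simp: model_prod)
qed (use assms in \<open>auto simp: prod_mfd_def\<close>)

lemma slice_chart_fibre:
  assumes "(U, \<phi>) \<in> atlas B" "\<And>j. (V j, \<psi> j) \<in> atlas (F j)"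
  shows "slice_chart M (F j) (\<lambda>x. snd x j) (\<lambda>x y. (fst x, (snd x)(j := y))) (pdom U V) (pchart \<phi> \<psi>) (V j) (\<psi> j)
    (\<lambda>y. (0, axis j y)) (\<lambda>z. snd z $ j)"
  unfolding slice_chart_def
proof (intro conjI ballI)
  show "(pdom U V, pchart \<phi> \<psi>) \<in> atlas M" by (rule atlas_prodI) (use assms in auto)
  show "linear (\<lambda>y::'e. (0::'d, axis j y))" by (auto simp: linear_iff axis_def vec_eq_iff)
  show "linear (\<lambda>z::'d \<times> ('e^'m). snd z $ j)" by (auto simp: linear_iff)
  show "(\<lambda>y. (0, axis j y)) ` model (F j) \<subseteq> model M"
    using subspace_0[OF fib.subspace_model] subspace_0[OF base.subspace_model] by (auto simp: model_prod axis_def)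
qed (use assms in \<open>auto simp: prod_mfd_def Pi_iff vec_eq_iff axis_def\<close>)

lemma prod_chart_at:
  assumes "x \<in> carrier_of M"
  obtains U \<phi> V \<psi> where "(U, \<phi>) \<in> atlas B" "\<And>j. (V j, \<psi> j) \<in> atlas (F j)" "x \<in> pdom U V"
proof -
  from tot.atlas_cover[OF assms] obtain UU \<Phi> where c: "(UU, \<Phi>) \<in> atlas M" "x \<in> UU" by blast
  from c(1) show thesis
  proof (rule atlas_prodE)
    fix U \<phi> V \<psi> assume a: "UU = pdom U V" "\<Phi> = pchart \<phi> \<psi>" "(U, \<phi>) \<in> atlas B" "\<And>j. (V j, \<psi> j) \<in> atlas (F j)"
    show thesis by (rule that[OF a(3,4)]) (use c(2) a(1) in simp)
  qed
qed

end

sublocale product_manifold \<subseteq> bs: slices M B fst "\<lambda>x p. (p, snd x)"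
proof
  show "\<exists>UU \<Phi> U \<phi> A C. x \<in> UU \<and> slice_chart M B fst (\<lambda>x p. (p, snd x)) UU \<Phi> U \<phi> A C" if "x \<in> carrier_of M" for x
  proof (rule prod_chart_at[OF that])
    fix U \<phi> V \<psi> assume c: "(U, \<phi>) \<in> atlas B" "\<And>j. (V j, \<psi> j) \<in> atlas (F j)" "x \<in> pdom U V"
    show ?thesis by (intro exI conjI) (rule c(3), rule slice_chart_base[OF c(1,2)])
  qed
qed (auto simp: carrier_prod)

sublocale product_manifold \<subseteq> fb: slices M "F j" "\<lambda>x. snd x j" "\<lambda>x y. (fst x, (snd x)(j := y))" for j
proof
  show "\<exists>UU \<Phi> U \<phi> A C. x \<in> UU \<and> slice_chart M (F j) (\<lambda>x. snd x j) (\<lambda>x y. (fst x, (snd x)(j := y))) UU \<Phi> U \<phi> A C"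
    if "x \<in> carrier_of M" for x
  proof (rule prod_chart_at[OF that])
    fix U \<phi> V \<psi> assume c: "(U, \<phi>) \<in> atlas B" "\<And>j. (V j, \<psi> j) \<in> atlas (F j)" "x \<in> pdom U V"
    show ?thesis by (intro exI conjI) (rule c(3), rule slice_chart_fibre[OF c(1,2)])
  qed
qed (auto simp: carrier_prod)

context product_manifold
begin
lemma lift_base_eq: "lift_base B F X = bs.lift X"
  by (auto simp: lift_base_def bs.lift_def)

lemma lift_fibre_eq: "lift_fibre B F j V = fb.lift j V"
  by (auto simp: lift_fibre_def fb.lift_def)

text \<open>The coordinate derivative is linear in the direction. Split the direction into its base
  component and its fibre components: each acts on \<open>f\<close> as the whole direction acts on
  the restriction of \<open>f\<close> to a slice, pulled back.\<close>

lemma tangent_split: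
  assumes v: "v \<in> tangent_space M x" and x: "x \<in> carrier_of M" and f: "f \<in> smooth_funs M"
  shows "v f = v (f \<circ> (\<lambda>p. (p, snd x)) \<circ> fst) + (\<Sum>j\<in>UNIV. v (f \<circ> (\<lambda>y. (fst x, (snd x)(j := y))) \<circ> (\<lambda>x. snd x j)))"
proof -
  obtain U \<phi> V \<psi> where c: "(U, \<phi>) \<in> atlas B" "\<And>j. (V j, \<psi> j) \<in> atlas (F j)" "x \<in> pdom U V"
    by (rule prod_chart_at[OF x]) (rule that)
  let ?UU = "pdom U V" and ?\<Phi> = "pchart \<phi> \<psi>"
  have a: "(?UU, ?\<Phi>) \<in> atlas M" by (rule atlas_prodI[OF c(1,2)])
  let ?gB = "f \<circ> (\<lambda>p. (p, snd x)) \<circ> fst" and ?gF = "\<lambda>j. f \<circ> (\<lambda>y. (fst x, (snd x)(j := y))) \<circ> (\<lambda>x. snd x j)"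
  have s0: "?gB \<in> smooth_funs M" by (intro bs.pull_smooth bs.slice_smooth f x)
  have s: "?gF j \<in> smooth_funs M" for j by (intro fb.pull_smooth fb.slice_smooth f x)
  obtain xc W where W: "openin (mtop M) W" "x \<in> W" "W \<subseteq> ?UU \<inter> ?UU"
      "\<And>b. b \<in> mbasis M \<Longrightarrow> xc b \<in> smooth_funs M" "\<And>b z. b \<in> mbasis M \<Longrightarrow> z \<in> W \<Longrightarrow> xc b z = ?\<Phi> z \<bullet> b"
    by (rule tot.local_coordinates[OF a c(3) tot.chart_open[OF a] c(3)]) (rule that)
  have WU: "W \<subseteq> ?UU" using W(3) by blast
  have rep: "v h = (\<Sum>b\<in>mbasis M. v (xc b) * cderiv M ?UU ?\<Phi> b h x)" if "h \<in> smooth_funs M" for h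
    by (rule tot.tangent_repr[OF a W(1,2) WU W(4,5) v that])
  have key: "cderiv M ?UU ?\<Phi> b f x = cderiv M ?UU ?\<Phi> b ?gB x + (\<Sum>j\<in>UNIV. cderiv M ?UU ?\<Phi> b (?gF j) x)" if b: "b \<in> mbasis M" for b
  proof -
    have bm: "b \<in> model M" using b tot.mbasis(1) by blast
    have "Cinf_on (cdom M ?UU ?\<Phi>) (crep M ?UU ?\<Phi> f)" using f a tot.smooth_funs_iff by blast
    from Cinf_on_has_derivative[OF this tot.chart_in_cdom[OF a c(3)]]
    have L: "linear (\<lambda>b. cderiv M ?UU ?\<Phi> b f x)"
      unfolding cderiv_def using has_derivative_linear by blast
    have "b = (fst b, 0) + (\<Sum>j\<in>UNIV. (0, axis j (snd b $ j)))"
      unfolding axis_sum by (simp add: prod_eq_iff)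
    then have "cderiv M ?UU ?\<Phi> b f x = cderiv M ?UU ?\<Phi> ((fst b, 0) + (\<Sum>j\<in>UNIV. (0, axis j (snd b $ j)))) f x"
      by (rule arg_cong)
    also have "\<dots> = cderiv M ?UU ?\<Phi> (fst b, 0) f x + (\<Sum>j\<in>UNIV. cderiv M ?UU ?\<Phi> (0, axis j (snd b $ j)) f x)"
      by (simp only: linear_add[OF L] linear_sum[OF L])
    also have "cderiv M ?UU ?\<Phi> (fst b, 0) f x = cderiv M ?UU ?\<Phi> b ?gB x"
      by (rule bs.cderiv_slice_pull[OF slice_chart_base[OF c(1,2)] c(3) f bm, symmetric])
    also have "(\<Sum>j\<in>UNIV. cderiv M ?UU ?\<Phi> (0, axis j (snd b $ j)) f x) = (\<Sum>j\<in>UNIV. cderiv M ?UU ?\<Phi> b (?gF j) x)"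
      by (rule sum.cong[OF refl], rule fb.cderiv_slice_pull[OF slice_chart_fibre[OF c(1,2)] c(3) f bm, symmetric])
    finally show ?thesis .
  qed
  have "v f = (\<Sum>b\<in>mbasis M. v (xc b) * (cderiv M ?UU ?\<Phi> b ?gB x + (\<Sum>j\<in>UNIV. cderiv M ?UU ?\<Phi> b (?gF j) x)))"
    unfolding rep[OF f] by (rule sum.cong[OF refl]) (simp only: key)
  also have "\<dots> = (\<Sum>b\<in>mbasis M. v (xc b) * cderiv M ?UU ?\<Phi> b ?gB x) +
      (\<Sum>b\<in>mbasis M. \<Sum>j\<in>UNIV. v (xc b) * cderiv M ?UU ?\<Phi> b (?gF j) x)"
    by (simp only: distrib_left sum.distrib sum_distrib_left)
  also have "(\<Sum>b\<in>mbasis M. \<Sum>j\<in>UNIV. v (xc b) * cderiv M ?UU ?\<Phi> b (?gF j) x) =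
      (\<Sum>j\<in>UNIV. \<Sum>b\<in>mbasis M. v (xc b) * cderiv M ?UU ?\<Phi> b (?gF j) x)"
    by (rule sum.swap)
  finally show ?thesis by (simp only: rep[OF s0] rep[OF s])
qed

end

section \<open>Non-degenerate metrics\<close>

locale nondegenerate_manifold = metric_manifold M g for M :: "('a, 'e::euclidean_space) mfd" and g +
  assumes nondeg: "nondegenerate M g"
begin
lemma nondegD:
  assumes p: "p \<in> carrier_of M" and v: "v \<in> tangent_space M p" and w: "w \<in> tangent_space M p"
    and eq: "\<And>Z. Z \<in> vfields M \<Longrightarrow> g p v (Z p) = g p w (Z p)"
  shows "v = w"
proof -
  let ?d = "\<lambda>f. v f + (- 1) * w f"
  have mw: "(\<lambda>f. (- 1) * w f) \<in> tangent_space M p" by (rule tangent_space_scale[OF w])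
  have d: "?d \<in> tangent_space M p" by (rule tangent_space_add[OF v mw])
  have "g p ?d u = 0" if u: "u \<in> tangent_space M p" for u
  proof -
    obtain Z where Z: "Z \<in> vfields M" "Z p = u" by (rule vf_extension[OF p u]) (rule that)
    have "g p ?d u = g p v u + g p (\<lambda>f. (- 1) * w f) u" by (rule g_add_left[OF p u v mw])
    also have "g p (\<lambda>f. (- 1) * w f) u = (- 1) * g p w u" by (rule g_scale_left[OF p u w])
    finally show ?thesis using eq[OF Z(1)] Z(2) by simp
  qed
  then have "?d = (\<lambda>f. 0)" using nondeg p d unfolding nondegenerate_def by blast
  then have "v f + (- 1) * w f = 0" for f by (rule fun_cong)
  then show ?thesis by (auto simp: fun_eq_iff)
qed

text \<open>In a local frame, raising the index is a linear system with the Gram matrix as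
  coefficients. Non-degeneracy makes it solvable with smooth solutions, and makes the local
  solutions agree.\<close>

lemma sharp_vfield:
  assumes \<omega>: "tensorial M \<omega>" and sm: "\<And>Z. Z \<in> vfields M \<Longrightarrow> \<omega> Z \<in> smooth_funs M"
  shows "\<exists>A. A \<in> vfields M \<and> (\<forall>p\<in>carrier_of M. \<forall>Z\<in>vfields M. on_vf g A Z p = \<omega> Z p)"
proof -
  have local: "\<exists>Y W. Y \<in> vfields M \<and> openin (mtop M) W \<and> p0 \<in> W \<and>
      (\<forall>p\<in>W. \<forall>Z\<in>vfields M. g p (Y p) (Z p) = \<omega> Z p)" if p0: "p0 \<in> carrier_of M" for p0
  proof -
    obtain e xc N where N: "openin (mtop M) N" "p0 \<in> N" and e0: "\<forall>b\<in>mbasis M. e b \<in> vfields M"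
      and xc0: "\<forall>b\<in>mbasis M. xc b \<in> smooth_funs M"
      and ex0: "\<forall>q\<in>N. \<forall>b\<in>mbasis M. \<forall>d\<in>mbasis M. e b q (xc d) = (if b = d then 1 else 0)"
      and r0: "\<forall>q\<in>N. \<forall>v\<in>tangent_space M q. \<forall>f. v f = (\<Sum>b\<in>mbasis M. v (xc b) * e b q f)"
      using local_frame[OF p0] by (elim exE conjE) (rule that)
    note e = e0[rule_format] and xc = xc0[rule_format] and r = r0[rule_format] and ex = ex0[rule_format]
    let ?G = "\<lambda>a b. on_vf g (e a) (e b)"
    have "\<exists>c W. (\<forall>b\<in>mbasis M. c b \<in> smooth_funs M) \<and> openin (mtop M) W \<and> p0 \<in> W \<and>
      (\<forall>x\<in>W. \<forall>a\<in>mbasis M. (\<Sum>b\<in>mbasis M. ?G a b x * c b x) = \<omega> (e a) x)"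
    proof (rule smooth_linear_solve[OF mbasis(4) mbasis(4) refl p0])
      show "?G a b \<in> smooth_funs M" if "a \<in> mbasis M" "b \<in> mbasis M" for a b
        by (rule g_smooth[OF e[OF that(1)] e[OF that(2)]])
      show "\<omega> (e a) \<in> smooth_funs M" if "a \<in> mbasis M" for a by (rule sm[OF e[OF that]])
      fix c :: "'e \<Rightarrow> real"
      assume c: "\<And>a. a \<in> mbasis M \<Longrightarrow> (\<Sum>b\<in>mbasis M. ?G a b p0 * c b) = 0"
      \<comment> \<open>A kernel vector of the Gram matrix gives a vector orthogonal to the frame,
        hence 0; the coordinate functions then read off its coefficients.\<close>
      define v where "v = (\<lambda>f. \<Sum>b\<in>mbasis M. c b * e b p0 f)"
      have eT: "e b p0 \<in> tangent_space M p0" if "b \<in> mbasis M" for b by (rule vf_tangent[OF e[OF that] p0])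
      have v: "v \<in> tangent_space M p0" unfolding v_def by (intro tangent_space_sum tangent_space_scale eT)
      have gz: "g p0 v (Z p0) = g p0 (\<lambda>f. 0) (Z p0)" if Z: "Z \<in> vfields M" for Z
      proof -
        note ZT = vf_tangent[OF Z p0]
        have Zeq: "Z p0 = (\<lambda>f. \<Sum>a\<in>mbasis M. Z p0 (xc a) * e a p0 f)" by (intro ext r[OF N(2) ZT])
        have ge: "g p0 v (e a p0) = 0" if a: "a \<in> mbasis M" for a
        proof -
          have "g p0 (e a p0) v = (\<Sum>b\<in>mbasis M. c b * g p0 (e a p0) (e b p0))"
            unfolding v_def by (rule g_sum_right[OF p0 eT[OF a] eT])
          also have "\<dots> = 0" using c[OF a] by (simp add: on_vf_def mult.commute)
          finally show ?thesis using g_sym[OF p0 v eT[OF a]] by simp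
        qed
        have "g p0 v (Z p0) = g p0 v (\<lambda>f. \<Sum>a\<in>mbasis M. Z p0 (xc a) * e a p0 f)" by (rule arg_cong[OF Zeq])
        also have "\<dots> = (\<Sum>a\<in>mbasis M. Z p0 (xc a) * g p0 v (e a p0))"
          by (rule g_sum_right[OF p0 v eT])
        also have "\<dots> = 0" by (rule sum.neutral) (simp add: ge)
        finally show ?thesis using g_zero_left[OF p0 ZT] by simp
      qed
      have v0: "v = (\<lambda>f. 0)" by (rule nondegD[OF p0 v tangent_zero]) (rule gz)
      show "\<forall>b\<in>mbasis M. c b = 0"
      proof
        fix d assume d: "d \<in> mbasis M"
        have "v (xc d) = (\<Sum>b\<in>mbasis M. if b = d then c b else 0)"
          unfolding v_def by (rule sum.cong[OF refl]) (simp add: ex[OF N(2) _ d])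
        then show "c d = 0" using v0 d mbasis(4) by simp
      qed
    qed
    then obtain c W where c: "\<forall>b\<in>mbasis M. c b \<in> smooth_funs M" and W: "openin (mtop M) W" "p0 \<in> W"
      and eq: "\<forall>x\<in>W. \<forall>a\<in>mbasis M. (\<Sum>b\<in>mbasis M. ?G a b x * c b x) = \<omega> (e a) x"
      by (elim exE conjE) (rule that)
    define Y where "Y = (\<lambda>p f. \<Sum>b\<in>mbasis M. c b p * e b p f)"
    have Y: "Y \<in> vfields M" unfolding Y_def by (intro vf_sum vf_fscale e c[rule_format])
    have "g p (Y p) (Z p) = \<omega> Z p" if p: "p \<in> N \<inter> W" and Z: "Z \<in> vfields M" for p Z
    proof -
      have pc: "p \<in> carrier_of M" and pN: "p \<in> N" and pW: "p \<in> W" using p openin_subset[OF N(1)] by auto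
      note ZT = vf_tangent[OF Z pc]
      have eT: "e b p \<in> tangent_space M p" if "b \<in> mbasis M" for b by (rule vf_tangent[OF e[OF that] pc])
      have YT: "Y p \<in> tangent_space M p" by (rule vf_tangent[OF Y pc])
      have Zeq: "Z p = (\<lambda>f. \<Sum>a\<in>mbasis M. Z p (xc a) * e a p f)" by (intro ext r[OF pN ZT])
      have ge: "g p (Y p) (e a p) = \<omega> (e a) p" if a: "a \<in> mbasis M" for a
      proof -
        have "g p (Y p) (e a p) = g p (e a p) (Y p)" by (rule g_sym[OF pc YT eT[OF a]])
        also have "\<dots> = (\<Sum>b\<in>mbasis M. c b p * g p (e a p) (e b p))"
          unfolding Y_def by (rule g_sum_right[OF pc eT[OF a] eT])
        also have "\<dots> = \<omega> (e a) p" using eq[rule_format, OF pW a] by (simp add: on_vf_def mult.commute)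
        finally show ?thesis .
      qed
      \<comment> \<open>Constant coefficients: this field agrees with \<open>Z\<close> at
        \<open>p\<close>, which is all that the tensorial \<open>\<omega>\<close> sees.\<close>
      have sv: "(\<lambda>q f. \<Sum>a\<in>mbasis M. Z p (xc a) * e a q f) \<in> vfields M"
        by (intro vf_sum vf_fscale e smooth_const)
      have "g p (Y p) (Z p) = g p (Y p) (\<lambda>f. \<Sum>a\<in>mbasis M. Z p (xc a) * e a p f)" by (rule arg_cong[OF Zeq])
      also have "\<dots> = (\<Sum>a\<in>mbasis M. Z p (xc a) * g p (Y p) (e a p))" by (rule g_sum_right[OF pc YT eT])
      also have "\<dots> = (\<Sum>a\<in>mbasis M. Z p (xc a) * \<omega> (e a) p)" by (rule sum.cong[OF refl]) (simp add: ge)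
      also have "\<dots> = (\<Sum>a\<in>mbasis M. \<omega> (\<lambda>q f. Z p (xc a) * e a q f) p)"
        by (rule sum.cong[OF refl]) (rule tensorial_fscale[OF \<omega> pc e smooth_const, symmetric])
      also have "\<dots> = \<omega> (\<lambda>q f. \<Sum>a\<in>mbasis M. Z p (xc a) * e a q f) p"
        by (rule tensorial_sum[OF \<omega> pc, symmetric]) (intro vf_fscale e smooth_const)
      also have "\<dots> = \<omega> Z p" by (rule tensorial_local[OF \<omega> pc sv Z Zeq[symmetric]])
      finally show ?thesis .
    qed
    then show ?thesis using Y N W by (intro exI[of _ Y] exI[of _ "N \<inter> W"]) auto
  qed
  \<comment> \<open>Chosen point by point; uniqueness of the representing vector identifies it with
    the smooth local solutions.\<close>
  define A where "A p = (SOME v. v \<in> tangent_space M p \<and> (\<forall>Z\<in>vfields M. g p v (Z p) = \<omega> Z p))" for p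
  have A: "A p \<in> tangent_space M p \<and> (\<forall>Z\<in>vfields M. g p (A p) (Z p) = \<omega> Z p)" if p: "p \<in> carrier_of M" for p
  proof -
    obtain Y W where "Y \<in> vfields M" "openin (mtop M) W" "p \<in> W" "\<forall>q\<in>W. \<forall>Z\<in>vfields M. g q (Y q) (Z q) = \<omega> Z q"
      using local[OF p] by (elim exE conjE) (rule that)
    then have "Y p \<in> tangent_space M p \<and> (\<forall>Z\<in>vfields M. g p (Y p) (Z p) = \<omega> Z p)"
      using vf_tangent[of Y p] p by simp
    then show ?thesis
      unfolding A_def by (rule someI[of "\<lambda>v. v \<in> tangent_space M p \<and> (\<forall>Z\<in>vfields M. g p v (Z p) = \<omega> Z p)"])
  qed
  have "app_vf A f \<in> smooth_funs M" if f: "f \<in> smooth_funs M" for f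
  proof (rule smooth_funs_localI)
    fix p assume p: "p \<in> carrier_of M"
    obtain Y W where Y: "Y \<in> vfields M" and W: "openin (mtop M) W" "p \<in> W"
      and eq: "\<forall>q\<in>W. \<forall>Z\<in>vfields M. g q (Y q) (Z q) = \<omega> Z q"
      using local[OF p] by (elim exE conjE) (rule that)
    have "app_vf A f q = app_vf Y f q" if q: "q \<in> W" for q
    proof -
      have qc: "q \<in> carrier_of M" using q openin_subset[OF W(1)] by blast
      have "A q = Y q"
        by (rule nondegD[OF qc _ vf_tangent[OF Y qc]]) (use A[OF qc] eq q in auto)
      then show ?thesis by (simp add: app_vf_def)
    qed
    then show "\<exists>W h. openin (mtop M) W \<and> p \<in> W \<and> h \<in> smooth_funs M \<and> (\<forall>x\<in>W. app_vf A f x = h x)"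
      using W vf_smooth[OF Y f] by (intro exI[of _ W] exI[of _ "app_vf Y f"]) simp
  qed
  then have "A \<in> vfields M" using A by (simp add: vfields_def)
  then show ?thesis using A by (intro exI[of _ A]) (simp add: on_vf_def)
qed

lemma covec_at_sharp:
  assumes \<omega>: "tensorial M \<omega>" and p: "p \<in> carrier_of M" and A: "A \<in> vfields M"
    and eq: "\<And>Z. Z \<in> vfields M \<Longrightarrow> on_vf g A Z p = \<omega> Z p"
  shows "covec_at M \<omega> p = flat M g p (A p)"
proof
  fix v
  show "covec_at M \<omega> p v = flat M g p (A p) v"
  proof (cases "v \<in> tangent_space M p")
    case True
    obtain Z where Z: "Z \<in> vfields M" "Z p = v" by (rule vf_extension[OF p True]) (rule that)
    show ?thesis using covec_at_eq[OF \<omega> p Z(1)] eq[OF Z(1)] Z(2) True by (simp add: on_vf_def flat_apply)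
  qed (simp add: covec_at_def flat_def)
qed

lemma sharp_flat:
  assumes p: "p \<in> carrier_of M" and v: "v \<in> tangent_space M p"
  shows "sharp M g p (flat M g p v) = v"
  unfolding sharp_def
proof (rule the_equality)
  fix w assume w: "w \<in> tangent_space M p \<and> flat M g p w = flat M g p v"
  show "w = v"
  proof (rule nondegD[OF p _ v])
    fix Z assume "Z \<in> vfields M"
    then show "g p w (Z p) = g p v (Z p)" using w vf_tangent[OF _ p, of Z] flat_apply by metis
  qed (use w in blast)
qed (use v in blast)

lemma inverse_metric_eq:
  assumes \<omega>: "tensorial M \<omega>" "A \<in> vfields M" "\<And>Z. Z \<in> vfields M \<Longrightarrow> on_vf g A Z p = \<omega> Z p"
    and \<tau>: "tensorial M \<tau>" "C \<in> vfields M" "\<And>Z. Z \<in> vfields M \<Longrightarrow> on_vf g C Z p = \<tau> Z p"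
    and p: "p \<in> carrier_of M"
  shows "inverse_metric M g \<omega> \<tau> p = on_vf g A C p"
proof -
  have 1: "covec_at M \<omega> p = flat M g p (A p)" by (rule covec_at_sharp[OF \<omega>(1) p \<omega>(2)]) (rule \<omega>(3))
  have 2: "covec_at M \<tau> p = flat M g p (C p)" by (rule covec_at_sharp[OF \<tau>(1) p \<tau>(2)]) (rule \<tau>(3))
  show ?thesis
    unfolding inverse_metric_def 1 2 by (simp add: sharp_flat p vf_tangent \<omega>(2) \<tau>(2) on_vf_def)
qed

text \<open>The representing vectors form smooth fields, so their inner product is already the
  smooth extension.\<close>

lemma contraction_nondeg:
  assumes \<omega>: "tensorial M \<omega>" "A \<in> vfields M" "\<And>Z p. p \<in> carrier_of M \<Longrightarrow> Z \<in> vfields M \<Longrightarrow> on_vf g A Z p = \<omega> Z p"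
    and \<tau>: "tensorial M \<tau>" "C \<in> vfields M" "\<And>Z p. p \<in> carrier_of M \<Longrightarrow> Z \<in> vfields M \<Longrightarrow> on_vf g C Z p = \<tau> Z p"
    and p: "p \<in> carrier_of M"
  shows "contraction M g \<omega> \<tau> p = on_vf g A C p"
proof (rule contraction_eqI[OF _ p])
  have "on_vf g A C x = co_inner M g x (covec_at M \<omega> x) (covec_at M \<tau> x)" if "x \<in> regular_set M g" for x
  proof -
    have x: "x \<in> carrier_of M" by (rule regular_set_carrier[OF that])
    have 1: "covec_at M \<omega> x = flat M g x (A x)" by (rule covec_at_sharp[OF \<omega>(1) x \<omega>(2)]) (rule \<omega>(3)[OF x])
    have 2: "covec_at M \<tau> x = flat M g x (C x)" by (rule covec_at_sharp[OF \<tau>(1) x \<tau>(2)]) (rule \<tau>(3)[OF x])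
    show ?thesis
      unfolding 1 2 by (simp add: co_inner_flat x vf_tangent \<omega>(2) \<tau>(2) on_vf_def)
  qed
  then show "is_contraction M g \<omega> \<tau> (on_vf g A C)" using g_smooth \<omega>(2) \<tau>(2) by (simp add: is_contraction_def)
qed

lemma rank_at_nondeg:
  assumes p: "p \<in> carrier_of M"
  shows "rank_at M g p = card (mbasis M)"
proof (rule antisym[OF rank_at_le[OF p]])
  obtain e xc N where N: "openin (mtop M) N" "p \<in> N" and e0: "\<forall>b\<in>mbasis M. e b \<in> vfields M"
    and "\<forall>b\<in>mbasis M. xc b \<in> smooth_funs M"
    and ex0: "\<forall>q\<in>N. \<forall>b\<in>mbasis M. \<forall>d\<in>mbasis M. e b q (xc d) = (if b = d then 1 else 0)"
    and "\<forall>q\<in>N. \<forall>v\<in>tangent_space M q. \<forall>f. v f = (\<Sum>b\<in>mbasis M. v (xc b) * e b q f)"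
    using local_frame[OF p] by (elim exE conjE) (rule that)
  note e = e0[rule_format] and ex = ex0[rule_format]
  have eT: "e b p \<in> tangent_space M p" if "b \<in> mbasis M" for b by (rule vf_tangent[OF e[OF that] p])
  let ?F = "\<lambda>b. flat M g p (e b p)"
  have ind: "c d = 0" if c: "\<And>u. (\<Sum>b\<in>mbasis M. c b * ?F b u) = 0" and d: "d \<in> mbasis M" for c d
  proof -
    define v where "v = (\<lambda>f. \<Sum>b\<in>mbasis M. c b * e b p f)"
    have v: "v \<in> tangent_space M p" unfolding v_def by (intro tangent_space_sum tangent_space_scale eT)
    have gz: "g p v (Z p) = g p (\<lambda>f. 0) (Z p)" if Z: "Z \<in> vfields M" for Z
    proof -
      note ZT = vf_tangent[OF Z p]
      have "g p v (Z p) = g p (Z p) v" by (rule g_sym[OF p v ZT])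
      also have "\<dots> = (\<Sum>b\<in>mbasis M. c b * g p (Z p) (e b p))" unfolding v_def by (rule g_sum_right[OF p ZT eT])
      also have "\<dots> = (\<Sum>b\<in>mbasis M. c b * ?F b (Z p))"
        by (rule sum.cong[OF refl]) (simp add: flat_apply[OF ZT] g_sym[OF p ZT eT])
      also have "\<dots> = 0" by (rule c)
      finally show ?thesis using g_zero_left[OF p ZT] by simp
    qed
    have v0: "v = (\<lambda>f. 0)" by (rule nondegD[OF p v tangent_zero]) (rule gz)
    have "v (xc d) = (\<Sum>b\<in>mbasis M. if b = d then c b else 0)"
      unfolding v_def by (rule sum.cong[OF refl]) (simp add: ex[OF N(2) _ d])
    then show ?thesis using v0 d mbasis(4) by simp
  qed
  have F: "inj_on ?F (mbasis M)" "fs.independent (?F ` mbasis M)"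
    by (rule fs_independent_family[OF mbasis(4)], erule (1) ind)+
  have "?F ` mbasis M \<subseteq> radical_annihilator M g p" unfolding radical_annihilator_def using eT by blast
  from radical_annihilator_independent(2)[OF p this F(2)] show "card (mbasis M) \<le> rank_at M g p"
    using card_image[OF F(1)] by simp
qed

end

section \<open>Related vector fields\<close>

context slices
begin
text \<open>The classical notion of \<open>\<pi>\<close>-related fields. Brackets of related fields
  are related, which gives brackets of lifts without coordinates.\<close>

definition rel :: "'a vfield \<Rightarrow> 'c vfield \<Rightarrow> bool" where
  "rel A X \<longleftrightarrow> A \<in> vfields M \<and> X \<in> vfields N \<and> (\<forall>x\<in>carrier_of M. differential N \<pi> (A x) = X (\<pi> x))"

lemma relD: "rel A X \<Longrightarrow> A \<in> vfields M" "rel A X \<Longrightarrow> X \<in> vfields N"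
  "rel A X \<Longrightarrow> x \<in> carrier_of M \<Longrightarrow> differential N \<pi> (A x) = X (\<pi> x)"
  by (simp_all add: rel_def)

lemma rel_lift: "X \<in> vfields N \<Longrightarrow> rel (lift X) X"
  by (simp add: rel_def lift_vfield push_lift)

lemma rel_app:
  assumes "rel A X" "f \<in> smooth_funs N" "x \<in> carrier_of M"
  shows "A x (f \<circ> \<pi>) = X (\<pi> x) f"
  using fun_cong[OF relD(3)[OF assms(1,3)], of f] assms(2) by (simp add: differential_def)

lemma rel_bracket:
  assumes A: "rel A X" "rel C Y" and x: "x \<in> carrier_of M"
  shows "differential N \<pi> (lie_bracket M A C x) = lie_bracket N X Y (\<pi> x)"
proof
  fix f
  show "differential N \<pi> (lie_bracket M A C x) f = lie_bracket N X Y (\<pi> x) f"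
  proof (cases "f \<in> smooth_funs N")
    case True
    have *: "A x (app_vf C (f \<circ> \<pi>)) = X (\<pi> x) (app_vf Y f)" if "rel A X" "rel C Y" for A X C Y
    proof -
      have "A x (app_vf C (f \<circ> \<pi>)) = A x (app_vf Y f \<circ> \<pi>)"
      proof (rule M.vf_app_cong[OF relD(1)[OF that(1)] x])
        show "app_vf C (f \<circ> \<pi>) y = (app_vf Y f \<circ> \<pi>) y" if "y \<in> carrier_of M" for y
          using rel_app[OF \<open>rel C Y\<close> True that] by (simp add: app_vf_def)
      qed
      also have "\<dots> = X (\<pi> x) (app_vf Y f)"
        by (rule rel_app[OF that(1) N.vf_smooth[OF relD(2)[OF that(2)] True] x])
      finally show ?thesis .
    qed
    have "differential N \<pi> (lie_bracket M A C x) f = lie_bracket M A C x (f \<circ> \<pi>)"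
      using True by (simp add: differential_def)
    also have "\<dots> = A x (app_vf C (f \<circ> \<pi>)) - C x (app_vf A (f \<circ> \<pi>))"
      using pull_smooth[OF True] by (simp add: lie_bracket_def app_vf_def[of _ "app_vf _ _"])
    also have "\<dots> = lie_bracket N X Y (\<pi> x) f"
      using True unfolding *[OF A] *[OF A(2,1)] by (simp add: lie_bracket_def app_vf_def[of _ "app_vf _ _"])
    finally show ?thesis .
  qed (simp add: differential_def lie_bracket_def)
qed

end

locale metric_slices = slices M N \<pi> \<iota> + nm: metric_manifold N g
  for M :: "('a, 'd::euclidean_space) mfd" and N :: "('c, 'e::euclidean_space) mfd" and \<pi> \<iota> g
begin
text \<open>The fields of \<open>M\<close> need not project to fields of \<open>N\<close>. Expanding
  the projected vectors in a frame of \<open>N\<close> gives the smooth coefficients A(x_a o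
  \<open>\<pi>\<close>).\<close>

lemma metric_pull_smooth:
  assumes A: "A \<in> vfields M" and C: "C \<in> vfields M"
  shows "(\<lambda>x. g (\<pi> x) (differential N \<pi> (A x)) (differential N \<pi> (C x))) \<in> smooth_funs M"
proof (rule M.smooth_funs_localI)
  fix x assume x: "x \<in> carrier_of M"
  obtain e xc N' where N: "openin (mtop N) N'" "\<pi> x \<in> N'" and e0: "\<forall>b\<in>mbasis N. e b \<in> vfields N"
    and xc0: "\<forall>b\<in>mbasis N. xc b \<in> smooth_funs N"
    and "\<forall>q\<in>N'. \<forall>b\<in>mbasis N. \<forall>d\<in>mbasis N. e b q (xc d) = (if b = d then 1 else 0)"
    and r0: "\<forall>q\<in>N'. \<forall>v\<in>tangent_space N q. \<forall>f. v f = (\<Sum>b\<in>mbasis N. v (xc b) * e b q f)"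
    using N.local_frame[OF pi_carrier[OF x]] by (elim exE conjE) (rule that)
  note e = e0[rule_format] and xc = xc0[rule_format] and r = r0[rule_format]
  obtain \<theta> W K where \<theta>: "\<theta> \<in> smooth_funs N" "openin (mtop N) W" "\<pi> x \<in> W" "W \<subseteq> N'"
    "\<And>y. y \<in> W \<Longrightarrow> \<theta> y = 1" "closedin (mtop N) K" "K \<subseteq> N'" "\<And>y. y \<notin> K \<Longrightarrow> \<theta> y = 0"
    by (rule N.bump[OF N]) (rule that)
  \<comment> \<open>An open set that \<open>\<pi>\<close> maps into \<open>N'\<close>; its openness
    comes from the smoothness of the pulled-back cutoff.\<close>
  define V where "V = {y \<in> carrier_of M. (\<theta> \<circ> \<pi>) y \<noteq> 0}"
  have V: "openin (mtop M) V" unfolding V_def by (rule M.smooth_nonzero_open[OF pull_smooth[OF \<theta>(1)]])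
  have xV: "x \<in> V" using x \<theta>(3,5) by (simp add: V_def)
  let ?h = "\<lambda>y. \<Sum>a\<in>mbasis N. app_vf A (xc a \<circ> \<pi>) y * (\<Sum>b\<in>mbasis N. app_vf C (xc b \<circ> \<pi>) y * (on_vf g (e a) (e b) \<circ> \<pi>) y)"
  have "?h \<in> smooth_funs M"
    by (intro M.smooth_sum M.smooth_mult M.vf_smooth A C pull_smooth xc nm.g_smooth e)
  moreover have "g (\<pi> y) (differential N \<pi> (A y)) (differential N \<pi> (C y)) = ?h y" if y: "y \<in> V" for y
  proof -
    have yc: "y \<in> carrier_of M" and "\<pi> y \<in> K" using y \<theta>(8)[of "\<pi> y"] by (auto simp: V_def)
    then have yN: "\<pi> y \<in> N'" using \<theta>(7) by blast
    note pc = pi_carrier[OF yc]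
    have DT: "differential N \<pi> (D y) \<in> tangent_space N (\<pi> y)" if "D \<in> vfields M" for D
      by (rule push_tangent[OF M.vf_tangent[OF that yc]])
    have D: "differential N \<pi> (D y) = (\<lambda>f. \<Sum>a\<in>mbasis N. app_vf D (xc a \<circ> \<pi>) y * e a (\<pi> y) f)" if "D \<in> vfields M" for D
    proof
      fix f
      have "differential N \<pi> (D y) f = (\<Sum>a\<in>mbasis N. differential N \<pi> (D y) (xc a) * e a (\<pi> y) f)"
        by (rule r[OF yN DT[OF that]])
      also have "\<dots> = (\<Sum>a\<in>mbasis N. app_vf D (xc a \<circ> \<pi>) y * e a (\<pi> y) f)"
        by (rule sum.cong[OF refl]) (simp add: differential_def xc app_vf_def)
      finally show "differential N \<pi> (D y) f = (\<Sum>a\<in>mbasis N. app_vf D (xc a \<circ> \<pi>) y * e a (\<pi> y) f)" .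
    qed
    have eT: "e a (\<pi> y) \<in> tangent_space N (\<pi> y)" if "a \<in> mbasis N" for a by (rule N.vf_tangent[OF e[OF that] pc])
    have gC: "g (\<pi> y) u (differential N \<pi> (C y)) = (\<Sum>b\<in>mbasis N. app_vf C (xc b \<circ> \<pi>) y * g (\<pi> y) u (e b (\<pi> y)))"
      if u: "u \<in> tangent_space N (\<pi> y)" for u
      unfolding D[OF C] by (rule nm.g_sum_right[OF pc u eT])
    have "g (\<pi> y) (differential N \<pi> (A y)) (differential N \<pi> (C y)) =
        g (\<pi> y) (differential N \<pi> (C y)) (differential N \<pi> (A y))" by (rule nm.g_sym[OF pc DT[OF A] DT[OF C]])
    also have "\<dots> = (\<Sum>a\<in>mbasis N. app_vf A (xc a \<circ> \<pi>) y * g (\<pi> y) (differential N \<pi> (C y)) (e a (\<pi> y)))"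
      unfolding D[OF A] by (rule nm.g_sum_right[OF pc DT[OF C] eT])
    also have "\<dots> = ?h y"
    proof (rule sum.cong[OF refl])
      fix a assume a: "a \<in> mbasis N"
      show "app_vf A (xc a \<circ> \<pi>) y * g (\<pi> y) (differential N \<pi> (C y)) (e a (\<pi> y)) =
        app_vf A (xc a \<circ> \<pi>) y * (\<Sum>b\<in>mbasis N. app_vf C (xc b \<circ> \<pi>) y * (on_vf g (e a) (e b) \<circ> \<pi>) y)"
        using nm.g_sym[OF pc DT[OF C] eT[OF a]] gC[OF eT[OF a]] by (simp add: on_vf_def)
    qed
    finally show ?thesis .
  qed
  ultimately show "\<exists>W h. openin (mtop M) W \<and> x \<in> W \<and> h \<in> smooth_funs M \<and>
      (\<forall>y\<in>W. g (\<pi> y) (differential N \<pi> (A y)) (differential N \<pi> (C y)) = h y)"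
    using V xV by (intro exI[of _ V] exI[of _ ?h]) simp
qed

end

section \<open>The warped metric\<close>

lemma semi_regular_metric_manifold: "semi_regular M g \<Longrightarrow> metric_manifold M g"
  unfolding semi_regular_def radical_stationary_def
  by (intro singular_semi_riemannian_metric_manifold) blast

lemma differential_add:
  "differential N \<pi> (\<lambda>f. v f + w f) = (\<lambda>h. differential N \<pi> v h + differential N \<pi> w h)"
  by (auto simp: differential_def)

lemma differential_scale: "differential N \<pi> (\<lambda>f. c * v f) = (\<lambda>h. c * differential N \<pi> v h)"
  by (auto simp: differential_def)

lemma differential_sum:
  "differential N \<pi> (\<lambda>f. \<Sum>i\<in>I. v i f) = (\<lambda>h. \<Sum>i\<in>I. differential N \<pi> (v i) h)"
  by (auto simp: differential_def)

locale warped_product = product_manifold B F for B :: "('b, 'd::euclidean_space) mfd"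
    and F :: "'m::finite \<Rightarrow> ('f, 'e::euclidean_space) mfd" +
  fixes gB :: "'b metric_form" and gF :: "'m \<Rightarrow> 'f metric_form" and b :: "'m \<Rightarrow> 'b \<Rightarrow> real"
  assumes gB: "nondegenerate_manifold B gB"
    and semi_regular: "semi_regular (F j) (gF j)"
    and b_smooth: "b j \<in> smooth_funs B"

sublocale warped_product \<subseteq> mB: nondegenerate_manifold B gB by (rule gB)

sublocale warped_product \<subseteq> mF: metric_manifold "F j" "gF j" for j
  by (rule semi_regular_metric_manifold[OF semi_regular])

sublocale warped_product \<subseteq> sB: metric_slices M B fst "\<lambda>x p. (p, snd x)" gB
  by unfold_locales

sublocale warped_product \<subseteq> sF: metric_slices M "F j" "\<lambda>x. snd x j" "\<lambda>x y. (fst x, (snd x)(j := y))" "gF j" for j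
  by unfold_locales

context warped_product
begin
abbreviation "gM \<equiv> warped_metric B gB F gF b"
abbreviation "dB \<equiv> differential B (fst :: 'b \<times> ('m \<Rightarrow> 'f) \<Rightarrow> 'b)"
abbreviation "dF j \<equiv> differential (F j) (\<lambda>x :: 'b \<times> ('m \<Rightarrow> 'f). snd x j)"
abbreviation "L \<equiv> bs.lift"

text \<open>A constant of its own, as the simplifier would rewrite the function update hidden in the lift.\<close>

definition E :: "'m \<Rightarrow> 'f vfield \<Rightarrow> ('b \<times> ('m \<Rightarrow> 'f)) vfield" where
  "E j V = fb.lift j V"

lemma gM_eq: "gM x v w = gB (fst x) (dB v) (dB w) + (\<Sum>j\<in>UNIV. (b j (fst x))\<^sup>2 * gF j (snd x j) (dF j v) (dF j w))"
  by (cases x) (simp add: warped_metric_def)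

lemma carrier_fst: "x \<in> carrier_of M \<Longrightarrow> fst x \<in> carrier_of B"
  and carrier_snd: "x \<in> carrier_of M \<Longrightarrow> snd x j \<in> carrier_of (F j)"
  using carrier_prod[of "fst x" "snd x"] by simp_all

lemma metric_manifold_warped: "metric_manifold M gM"
proof
  fix x u v assume x: "x \<in> carrier_of M" and u: "u \<in> tangent_space M x" and v: "v \<in> tangent_space M x"
  note p = carrier_fst[OF x] and q = carrier_snd[OF x]
  note uB = bs.push_tangent[OF u] and vB = bs.push_tangent[OF v]
  note uF = fb.push_tangent[OF u] and vF = fb.push_tangent[OF v]
  show "gM x u v = gM x v u"
    unfolding gM_eq mB.g_sym[OF p uB vB] by (simp only: mF.g_sym[OF q uF vF])
  show "gM x u (\<lambda>f. c * v f) = c * gM x u v" for c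
    unfolding gM_eq differential_scale mB.g_scale_right[OF p uB vB] mF.g_scale_right[OF q uF vF]
    by (simp add: algebra_simps sum_distrib_left)
  fix w assume w: "w \<in> tangent_space M x"
  note wB = bs.push_tangent[OF w] and wF = fb.push_tangent[OF w]
  show "gM x u (\<lambda>f. v f + w f) = gM x u v + gM x u w"
    unfolding gM_eq differential_add mB.g_add_right[OF p uB vB wB] mF.g_add_right[OF q uF vF wF]
    by (simp add: algebra_simps sum.distrib)
next
  fix A C assume A: "A \<in> vfields M" and C: "C \<in> vfields M"
  have "(\<lambda>x. gB (fst x) (dB (A x)) (dB (C x)) +
      (\<Sum>j\<in>UNIV. (b j \<circ> fst) x ^ 2 * gF j (snd x j) (dF j (A x)) (dF j (C x)))) \<in> smooth_funs M"
    by (intro tot.smooth_add tot.smooth_sum tot.smooth_mult tot.smooth_power bs.pull_smooth b_smooth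
        sB.metric_pull_smooth[OF A C] sF.metric_pull_smooth[OF A C])
  then show "on_vf gM A C \<in> smooth_funs M" by (simp add: on_vf_def[abs_def] gM_eq)
qed

end

sublocale warped_product \<subseteq> mt: metric_manifold M gM by (rule metric_manifold_warped)

context warped_product
begin

section \<open>Projections and brackets of lifts\<close>

lemma rel_LB: "X \<in> vfields B \<Longrightarrow> bs.rel (L X) X" by (rule bs.rel_lift)
lemma rel_EF: "V \<in> vfields (F j) \<Longrightarrow> fb.rel j (E j V) V" unfolding E_def by (rule fb.rel_lift)
lemma E_vf: "V \<in> vfields (F j) \<Longrightarrow> E j V \<in> vfields M" unfolding E_def by (rule fb.lift_vfield)

text \<open>A function pulled back from a fibre is constant along the base slices, so the lift of
  \<open>X\<close> annihilates it.\<close>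

lemma rel_LF: assumes "X \<in> vfields B" shows "fb.rel j (L X) (\<lambda>p f. 0)"
  unfolding fb.rel_def
proof (intro conjI ballI)
  fix x assume x: "x \<in> carrier_of M"
  show "dF j (L X x) = (\<lambda>f. 0)"
  proof
    fix h show "dF j (L X x) h = 0"
      using bs.lift_const[OF assms x fb.pull_smooth, of h j "h (snd x j)"] by (simp add: differential_def)
  qed
qed (auto intro: bs.lift_vfield assms fib.vf_zero)

lemma rel_EB: assumes "V \<in> vfields (F j)" shows "bs.rel (E j V) (\<lambda>p f. 0)"
  unfolding bs.rel_def
proof (intro conjI ballI)
  fix x assume x: "x \<in> carrier_of M"
  show "dB (E j V x) = (\<lambda>f. 0)"
  proof
    fix h show "dB (E j V x) h = 0"
      using fb.lift_const[OF assms x bs.pull_smooth, of h "h (fst x)", folded E_def] by (simp add: differential_def)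
  qed
qed (auto intro: E_vf assms base.vf_zero)

lemma rel_EF_other: assumes "V \<in> vfields (F j)" "l \<noteq> j" shows "fb.rel l (E j V) (\<lambda>p f. 0)"
  unfolding fb.rel_def
proof (intro conjI ballI)
  fix x assume x: "x \<in> carrier_of M"
  show "dF l (E j V x) = (\<lambda>f. 0)"
  proof
    fix h show "dF l (E j V x) h = 0"
      using fb.lift_const[OF assms(1) x fb.pull_smooth, of h l "h (snd x l)", folded E_def] assms(2) by (simp add: differential_def)
  qed
qed (auto intro: E_vf assms fib.vf_zero)

lemmas L_vf = bs.lift_vfield

lemma dB_L: "X \<in> vfields B \<Longrightarrow> x \<in> carrier_of M \<Longrightarrow> dB (L X x) = X (fst x)"
  by (rule bs.relD(3)[OF rel_LB])
lemma dF_L: "X \<in> vfields B \<Longrightarrow> x \<in> carrier_of M \<Longrightarrow> dF j (L X x) = (\<lambda>f. 0)"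
  by (rule fb.relD(3)[OF rel_LF])
lemma dB_E: "V \<in> vfields (F j) \<Longrightarrow> x \<in> carrier_of M \<Longrightarrow> dB (E j V x) = (\<lambda>f. 0)"
  by (rule bs.relD(3)[OF rel_EB])
lemma dF_E: "V \<in> vfields (F j) \<Longrightarrow> x \<in> carrier_of M \<Longrightarrow> dF l (E j V x) = (if l = j then V (snd x j) else (\<lambda>f. 0))"
  using fb.relD(3)[OF rel_EF] fb.relD(3)[OF rel_EF_other, of V j l x] by simp

lemma tangent_eqI:
  assumes v: "v \<in> tangent_space M x" and w: "w \<in> tangent_space M x" and x: "x \<in> carrier_of M"
    and "dB v = dB w" "\<And>j. dF j v = dF j w"
  shows "v = w"
proof
  fix f
  show "v f = w f"
  proof (cases "f \<in> smooth_funs M")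
    case True
    have sB: "f \<circ> (\<lambda>p. (p, snd x)) \<in> smooth_funs B" by (rule bs.slice_smooth[OF True x])
    have sF: "f \<circ> (\<lambda>y. (fst x, (snd x)(j := y))) \<in> smooth_funs (F j)" for j by (rule fb.slice_smooth[OF True x])
    have 1: "u (f \<circ> (\<lambda>p. (p, snd x)) \<circ> fst) = dB u (f \<circ> (\<lambda>p. (p, snd x)))" for u
      using sB by (simp add: differential_def)
    have 2: "u (f \<circ> (\<lambda>y. (fst x, (snd x)(j := y))) \<circ> (\<lambda>x. snd x j)) = dF j u (f \<circ> (\<lambda>y. (fst x, (snd x)(j := y))))" for u j
      using sF[of j] by (simp add: differential_def)
    show ?thesis
      unfolding tangent_split[OF v x True] tangent_split[OF w x True] 1 2 assms(4,5) ..
  next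
    case False
    then show ?thesis using tot.tangent_off[OF v] tot.tangent_off[OF w] by simp
  qed
qed

definition split_vf :: "'b vfield \<Rightarrow> ('m \<Rightarrow> 'f vfield) \<Rightarrow> ('b \<times> ('m \<Rightarrow> 'f)) vfield" where
  "split_vf Z U = (\<lambda>x f. L Z x f + (\<Sum>l\<in>UNIV. E l (U l) x f))"

lemma split_vf:
  assumes "Z \<in> vfields B" "\<And>l. U l \<in> vfields (F l)"
  shows "split_vf Z U \<in> vfields M"
  unfolding split_vf_def by (intro tot.vf_add tot.vf_sum L_vf E_vf assms)

lemma split_vf_parts:
  assumes Z: "Z \<in> vfields B" and U: "\<And>l. U l \<in> vfields (F l)" and x: "x \<in> carrier_of M"
  shows "dB (split_vf Z U x) = Z (fst x)" "dF j (split_vf Z U x) = U j (snd x j)"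
  unfolding split_vf_def differential_add differential_sum dB_L[OF Z x] dF_L[OF Z x] dB_E[OF U x] dF_E[OF U x]
  by (auto simp: if_distrib[of "\<lambda>k. k _"] cong: if_cong)

text \<open>Every tangent vector is the value of a sum of lifts, so a tensorial form on the product
  is determined by its values on lifts.\<close>

lemma split_vf_exists:
  assumes x: "x \<in> carrier_of M" and v: "v \<in> tangent_space M x"
  obtains Z U where "Z \<in> vfields B" "\<And>l. U l \<in> vfields (F l)" "v = split_vf Z U x"
    "Z (fst x) = dB v" "\<And>l. U l (snd x l) = dF l v"
proof -
  obtain Z where Z: "Z \<in> vfields B" "Z (fst x) = dB v"
    by (rule base.vf_extension[OF carrier_fst[OF x] bs.push_tangent[OF v]]) (rule that)
  have "\<exists>V. V \<in> vfields (F l) \<and> V (snd x l) = dF l v" for l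
  proof -
    obtain V where "V \<in> vfields (F l)" "V (snd x l) = dF l v"
      by (rule fib.vf_extension[OF carrier_snd[OF x] fb.push_tangent[OF v]]) (rule that)
    then show ?thesis by blast
  qed
  then have "\<forall>l. \<exists>V. V \<in> vfields (F l) \<and> V (snd x l) = dF l v" by blast
  from choice[OF this] obtain U where U: "\<forall>l. U l \<in> vfields (F l) \<and> U l (snd x l) = dF l v" by (elim exE) (rule that)
  have U1: "U l \<in> vfields (F l)" and U2: "U l (snd x l) = dF l v" for l using U by simp_all
  have "v = split_vf Z U x"
    by (rule tangent_eqI[OF v tot.vf_tangent[OF split_vf[OF Z(1) U1] x] x])
      (simp_all add: split_vf_parts[OF Z(1) U1 x] Z(2) U2)
  then show thesis by (rule that[OF Z(1) U1 _ Z(2) U2])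
qed

lemma bracket_zero: "lie_bracket N (\<lambda>p f. 0) (\<lambda>p f. 0) y = (\<lambda>f. 0)"
  by (auto simp: lie_bracket_def app_vf_def)

lemma bracket_zero_right:
  assumes "premanifold N" "X \<in> vfields N" "y \<in> carrier_of N"
  shows "lie_bracket N X (\<lambda>p f. 0) y = (\<lambda>f. 0)" "lie_bracket N (\<lambda>p f. 0) X y = (\<lambda>f. 0)"
proof -
  interpret premanifold N by (rule assms)
  show "lie_bracket N X (\<lambda>p f. 0) y = (\<lambda>f. 0)" "lie_bracket N (\<lambda>p f. 0) X y = (\<lambda>f. 0)"
    using tangent_const[OF vf_tangent[OF assms(2,3)], of 0] by (auto simp: lie_bracket_def app_vf_def)
qed

lemma bracket_LL:
  assumes X: "X \<in> vfields B" and Y: "Y \<in> vfields B" and x: "x \<in> carrier_of M"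
  shows "lie_bracket M (L X) (L Y) x = L (lie_bracket B X Y) x"
proof (rule tangent_eqI[OF tot.lie_bracket_tangent[OF L_vf[OF X] L_vf[OF Y] x]
      tot.vf_tangent[OF L_vf[OF base.vf_bracket[OF X Y]] x] x])
  show "dB (lie_bracket M (L X) (L Y) x) = dB (L (lie_bracket B X Y) x)"
    unfolding bs.rel_bracket[OF rel_LB[OF X] rel_LB[OF Y] x] dB_L[OF base.vf_bracket[OF X Y] x] ..
  show "dF j (lie_bracket M (L X) (L Y) x) = dF j (L (lie_bracket B X Y) x)" for j
    unfolding fb.rel_bracket[OF rel_LF[OF X] rel_LF[OF Y] x] dF_L[OF base.vf_bracket[OF X Y] x] bracket_zero ..
qed

text \<open>Every projection relates at least one of the two fields to the zero field, so the
  bracket has zero projection to each factor.\<close>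

lemma bracket_LE:
  assumes X: "X \<in> vfields B" and V: "V \<in> vfields (F j)" and x: "x \<in> carrier_of M"
  shows "lie_bracket M (L X) (E j V) x = (\<lambda>f. 0)"
proof (rule tangent_eqI[OF tot.lie_bracket_tangent[OF L_vf[OF X] E_vf[OF V] x] tot.tangent_zero x])
  note p = carrier_fst[OF x] and q = carrier_snd[OF x]
  show "dB (lie_bracket M (L X) (E j V) x) = dB (\<lambda>f. 0)"
    unfolding bs.rel_bracket[OF rel_LB[OF X] rel_EB[OF V] x] bracket_zero_right[OF base.premanifold_axioms X p]
    by (auto simp: differential_def)
  show "dF l (lie_bracket M (L X) (E j V) x) = dF l (\<lambda>f. 0)" for l
  proof (cases "l = j")
    case True
    show ?thesis
      unfolding True fb.rel_bracket[OF rel_LF[OF X] rel_EF[OF V] x] bracket_zero_right[OF fibres V q]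
      by (auto simp: differential_def)
  next
    case False
    show ?thesis
      unfolding fb.rel_bracket[OF rel_LF[OF X] rel_EF_other[OF V False] x] bracket_zero
      by (auto simp: differential_def)
  qed
qed

lemma bracket_EL:
  assumes "X \<in> vfields B" "V \<in> vfields (F j)" "x \<in> carrier_of M"
  shows "lie_bracket M (E j V) (L X) x = (\<lambda>f. 0)"
  using bracket_LE[OF assms] tot.lie_bracket_anti[of "E j V" "L X" x] by simp

lemma bracket_EE:
  assumes V: "V \<in> vfields (F j)" and W: "W \<in> vfields (F j)" and x: "x \<in> carrier_of M"
  shows "lie_bracket M (E j V) (E j W) x = E j (lie_bracket (F j) V W) x"
proof (rule tangent_eqI[OF tot.lie_bracket_tangent[OF E_vf[OF V] E_vf[OF W] x]
      tot.vf_tangent[OF E_vf[OF fib.vf_bracket[OF V W]] x] x])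
  note VW = fib.vf_bracket[OF V W]
  show "dB (lie_bracket M (E j V) (E j W) x) = dB (E j (lie_bracket (F j) V W) x)"
    unfolding bs.rel_bracket[OF rel_EB[OF V] rel_EB[OF W] x] dB_E[OF VW x] bracket_zero ..
  show "dF l (lie_bracket M (E j V) (E j W) x) = dF l (E j (lie_bracket (F j) V W) x)" for l
  proof (cases "l = j")
    case True
    show ?thesis
      unfolding True fb.rel_bracket[OF rel_EF[OF V] rel_EF[OF W] x] dF_E[OF VW x] by simp
  next
    case False
    show ?thesis
      unfolding fb.rel_bracket[OF rel_EF_other[OF V False] rel_EF_other[OF W False] x] dF_E[OF VW x] bracket_zero
      using False by simp
  qed
qed

lemma bracket_EE_other:
  assumes V: "V \<in> vfields (F i)" and W: "W \<in> vfields (F j)" and ij: "i \<noteq> j" and x: "x \<in> carrier_of M"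
  shows "lie_bracket M (E i V) (E j W) x = (\<lambda>f. 0)"
proof (rule tangent_eqI[OF tot.lie_bracket_tangent[OF E_vf[OF V] E_vf[OF W] x] tot.tangent_zero x])
  note q = carrier_snd[OF x]
  show "dB (lie_bracket M (E i V) (E j W) x) = dB (\<lambda>f. 0)"
    unfolding bs.rel_bracket[OF rel_EB[OF V] rel_EB[OF W] x] bracket_zero by (auto simp: differential_def)
  show "dF l (lie_bracket M (E i V) (E j W) x) = dF l (\<lambda>f. 0)" for l
  proof -
    consider "l = i" "l \<noteq> j" | "l \<noteq> i" "l = j" | "l \<noteq> i" "l \<noteq> j" using ij by blast
    then show ?thesis
    proof cases
      case 1
      show ?thesis unfolding \<open>l = i\<close>
          fb.rel_bracket[OF rel_EF[OF V] rel_EF_other[OF W ij] x] bracket_zero_right[OF fibres V q]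
        by (auto simp: differential_def)
    next
      case 2
      have "j \<noteq> i" using ij by simp
      show ?thesis unfolding \<open>l = j\<close>
          fb.rel_bracket[OF rel_EF_other[OF V \<open>j \<noteq> i\<close>] rel_EF[OF W] x] bracket_zero_right[OF fibres W q]
        by (auto simp: differential_def)
    next
      case 3
      show ?thesis unfolding fb.rel_bracket[OF rel_EF_other[OF V 3(1)] rel_EF_other[OF W 3(2)] x] bracket_zero
        by (auto simp: differential_def)
    qed
  qed
qed

end

section \<open>The rank of the warped metric\<close>

context warped_product
begin
definition active :: "'b \<Rightarrow> 'm set" where
  "active p = {j. b j p \<noteq> 0}"

lemma radical_annihilator_M_eq:
  assumes x: "x \<in> carrier_of M" and v: "v \<in> tangent_space M x"
  shows "flat M gM x v u = (if u \<in> tangent_space M x then flat B gB (fst x) (dB v) (dB u) +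
    (\<Sum>j\<in>active (fst x). (b j (fst x))\<^sup>2 * flat (F j) (gF j) (snd x j) (dF j v) (dF j u)) else 0)"
proof (cases "u \<in> tangent_space M x")
  case True
  have "(\<Sum>j\<in>UNIV. (b j (fst x))\<^sup>2 * gF j (snd x j) (dF j v) (dF j u)) =
      (\<Sum>j\<in>active (fst x). (b j (fst x))\<^sup>2 * gF j (snd x j) (dF j v) (dF j u))"
    by (rule sum.mono_neutral_right) (auto simp: active_def)
  then show ?thesis
    using True bs.push_tangent[OF True] fb.push_tangent[OF True] by (simp add: flat_def gM_eq)
qed (simp add: flat_def)

text \<open>Bases of the annihilators of the base and of the active fibres, pulled back, form a
  basis. Independence is tested on lifts, which see one factor at a time.\<close>

lemma rank_at_M:
  assumes x: "x \<in> carrier_of M"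
  shows "rank_at M gM x = card (mbasis B) + (\<Sum>j\<in>active (fst x). rank_at (F j) (gF j) (snd x j))"
proof -
  let ?p = "fst x" and ?q = "snd x"
  note p = carrier_fst[OF x] and q = carrier_snd[OF x]
  obtain B0 where B0: "B0 \<subseteq> radical_annihilator B gB ?p" "fs.independent B0"
    "radical_annihilator B gB ?p \<subseteq> fs.span B0" "finite B0" "card B0 = rank_at B gB ?p"
    by (rule mB.radical_annihilator_basis[OF p]) (rule that)
  have "\<forall>j. \<exists>C. C \<subseteq> radical_annihilator (F j) (gF j) (?q j) \<and> fs.independent C \<and>
    radical_annihilator (F j) (gF j) (?q j) \<subseteq> fs.span C \<and> finite C \<and> card C = rank_at (F j) (gF j) (?q j)"
  proof
    fix j
    obtain C where "C \<subseteq> radical_annihilator (F j) (gF j) (?q j)" "fs.independent C"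
      "radical_annihilator (F j) (gF j) (?q j) \<subseteq> fs.span C" "finite C" "card C = rank_at (F j) (gF j) (?q j)"
      by (rule mF.radical_annihilator_basis[OF q]) (rule that)
    then show "\<exists>C. C \<subseteq> radical_annihilator (F j) (gF j) (?q j) \<and> fs.independent C \<and>
      radical_annihilator (F j) (gF j) (?q j) \<subseteq> fs.span C \<and> finite C \<and> card C = rank_at (F j) (gF j) (?q j)" by blast
  qed
  from choice[OF this] obtain C where C: "\<forall>j. C j \<subseteq> radical_annihilator (F j) (gF j) (?q j) \<and> fs.independent (C j) \<and>
    radical_annihilator (F j) (gF j) (?q j) \<subseteq> fs.span (C j) \<and> finite (C j) \<and> card (C j) = rank_at (F j) (gF j) (?q j)"
    by (elim exE) (rule that)
  have C1: "C j \<subseteq> radical_annihilator (F j) (gF j) (?q j)" "fs.independent (C j)"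
    "radical_annihilator (F j) (gF j) (?q j) \<subseteq> fs.span (C j)" "finite (C j)"
    "card (C j) = rank_at (F j) (gF j) (?q j)" for j using C by simp_all
  \<comment> \<open>Indexed by a disjoint sum: covectors of different fibres have the same type and
    may coincide before they are pulled back.\<close>
  let ?I = "B0 <+> (SIGMA j:active ?p. C j)"
  have finI: "finite ?I" using B0(4) C1(4) by (intro finite_Plus finite_SigmaI) auto
  define \<Psi> where "\<Psi> = case_sum (\<lambda>\<beta> u. if u \<in> tangent_space M x then \<beta> (dB u) else (0::real))
      (\<lambda>(j, \<gamma>) u. if u \<in> tangent_space M x then \<gamma> (dF j u) else 0)"
  have \<Psi>: "\<Psi> (Inl \<beta>) u = (if u \<in> tangent_space M x then \<beta> (dB u) else 0)"
    "\<Psi> (Inr (j, \<gamma>)) u = (if u \<in> tangent_space M x then \<gamma> (dF j u) else 0)" for \<beta> \<gamma> j u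
    by (simp_all add: \<Psi>_def)
  have sumI: "(\<Sum>i\<in>?I. f i) = (\<Sum>\<beta>\<in>B0. f (Inl \<beta>)) + (\<Sum>j\<in>active ?p. \<Sum>\<gamma>\<in>C j. f (Inr (j, \<gamma>)))" for f :: "_ \<Rightarrow> real"
    using B0(4) C1(4) by (simp add: sum.Plus sum.Sigma)
  have B0_off: "\<beta> v = 0" if "\<beta> \<in> B0" "v \<notin> tangent_space B ?p" for \<beta> v
    using B0(1) that unfolding radical_annihilator_def by (auto simp: flat_def)
  have C_off: "\<gamma> v = 0" if "\<gamma> \<in> C j" "v \<notin> tangent_space (F j) (?q j)" for j \<gamma> v
    using C1(1)[of j] that unfolding radical_annihilator_def by (auto simp: flat_def)
  have B0_zero: "\<beta> (\<lambda>f. 0) = 0" if "\<beta> \<in> B0" for \<beta>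
    using B0(1) that mB.g_zero_right[OF p] base.tangent_zero unfolding radical_annihilator_def by (auto simp: flat_def)
  have C_zero: "\<gamma> (\<lambda>f. 0) = 0" if "\<gamma> \<in> C j" for j \<gamma>
    using C1(1)[of j] that mF.g_zero_right[OF q] fib.tangent_zero unfolding radical_annihilator_def by (auto simp: flat_def)
  have indI: "c i = 0" if c: "\<And>u. (\<Sum>i\<in>?I. c i * \<Psi> i u) = 0" and i: "i \<in> ?I" for c i
  proof -
    \<comment> \<open>Evaluated on lifts from the base, the fibre covectors drop out and a relation
      on \<open>B0\<close> remains.\<close>
    have "(\<Sum>\<beta>\<in>B0. (\<lambda>v. c (Inl \<beta>) * \<beta> v)) = 0"
    proof
      fix v
      show "(\<Sum>\<beta>\<in>B0. (\<lambda>v. c (Inl \<beta>) * \<beta> v)) v = 0 v"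
      proof (cases "v \<in> tangent_space B ?p")
        case True
        obtain Z where Z: "Z \<in> vfields B" "Z ?p = v" by (rule base.vf_extension[OF p True]) (rule that)
        note LT = tot.vf_tangent[OF L_vf[OF Z(1)] x]
        have "(\<Sum>j\<in>active ?p. \<Sum>\<gamma>\<in>C j. c (Inr (j, \<gamma>)) * \<Psi> (Inr (j, \<gamma>)) (L Z x)) = 0"
          by (intro sum.neutral ballI) (simp add: \<Psi> LT dF_L[OF Z(1) x] C_zero)
        then show ?thesis
          using c[of "L Z x"] unfolding sumI by (simp add: \<Psi> LT dB_L[OF Z(1) x] Z(2) fs_sum_apply)
      next
        case False
        have "(\<Sum>\<beta>\<in>B0. c (Inl \<beta>) * \<beta> v) = 0" by (intro sum.neutral ballI) (simp add: B0_off[OF _ False])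
        then show ?thesis by (simp add: fs_sum_apply)
      qed
    qed
    then have cB: "c (Inl \<beta>) = 0" if "\<beta> \<in> B0" for \<beta>
    proof (rule contrapos_pp)
      assume "c (Inl \<beta>) \<noteq> 0"
      then have "fs.dependent B0" if "(\<Sum>\<beta>\<in>B0. (\<lambda>v. c (Inl \<beta>) * \<beta> v)) = 0"
        unfolding fs.dependent_finite[OF B0(4)] using that \<open>\<beta> \<in> B0\<close>
        by (intro exI[of _ "\<lambda>\<beta>. c (Inl \<beta>)"] conjI) auto
      then show "(\<Sum>\<beta>\<in>B0. (\<lambda>v. c (Inl \<beta>) * \<beta> v)) \<noteq> 0" using B0(2) by blast
    qed
    have cC: "c (Inr (j, \<gamma>)) = 0" if j: "j \<in> active ?p" and \<gamma>: "\<gamma> \<in> C j" for j \<gamma>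
    proof -
      have z: "(\<Sum>\<gamma>\<in>C j. (\<lambda>v. c (Inr (j, \<gamma>)) * \<gamma> v)) = 0"
      proof
        fix v
        show "(\<Sum>\<gamma>\<in>C j. (\<lambda>v. c (Inr (j, \<gamma>)) * \<gamma> v)) v = 0 v"
        proof (cases "v \<in> tangent_space (F j) (?q j)")
          case True
          obtain V where V: "V \<in> vfields (F j)" "V (?q j) = v" by (rule fib.vf_extension[OF q True]) (rule that)
          note ET = tot.vf_tangent[OF E_vf[OF V(1)] x]
          have "(\<Sum>\<gamma>\<in>C l. c (Inr (l, \<gamma>)) * \<Psi> (Inr (l, \<gamma>)) (E j V x)) =
              (if l = j then (\<Sum>\<gamma>\<in>C j. c (Inr (j, \<gamma>)) * \<gamma> v) else 0)" for l
          proof (cases "l = j")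
            case True
            then show ?thesis by (simp add: \<Psi> ET dF_E[OF V(1) x] V(2))
          next
            case False
            have "(\<Sum>\<gamma>\<in>C l. c (Inr (l, \<gamma>)) * \<Psi> (Inr (l, \<gamma>)) (E j V x)) = 0"
              by (intro sum.neutral ballI) (simp add: \<Psi> ET dF_E[OF V(1) x] False C_zero)
            then show ?thesis using False by simp
          qed
          then have "(\<Sum>l\<in>active ?p. \<Sum>\<gamma>\<in>C l. c (Inr (l, \<gamma>)) * \<Psi> (Inr (l, \<gamma>)) (E j V x)) = (\<Sum>\<gamma>\<in>C j. c (Inr (j, \<gamma>)) * \<gamma> v)"
            using j by simp
          moreover have "(\<Sum>\<beta>\<in>B0. c (Inl \<beta>) * \<Psi> (Inl \<beta>) (E j V x)) = 0"
            by (intro sum.neutral ballI) (simp add: cB)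
          ultimately have "(\<Sum>\<gamma>\<in>C j. c (Inr (j, \<gamma>)) * \<gamma> v) = 0" using c[of "E j V x"] unfolding sumI by simp
          then show ?thesis by (simp add: fs_sum_apply)
        next
          case False
          have "(\<Sum>\<gamma>\<in>C j. c (Inr (j, \<gamma>)) * \<gamma> v) = 0" by (intro sum.neutral ballI) (simp add: C_off[OF _ False])
          then show ?thesis by (simp add: fs_sum_apply)
        qed
      qed
      show ?thesis
      proof (rule ccontr)
        assume "c (Inr (j, \<gamma>)) \<noteq> 0"
        then have "fs.dependent (C j)"
          unfolding fs.dependent_finite[OF C1(4)[of j]] using z \<gamma>
          by (intro exI[of _ "\<lambda>\<gamma>. c (Inr (j, \<gamma>))"] conjI) auto
        then show False using C1(2)[of j] by blast
      qed
    qed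
    show ?thesis using i cB cC by auto
  qed
  have inj: "inj_on \<Psi> ?I" and ind: "fs.independent (\<Psi> ` ?I)"
    by (rule fs_independent_family[OF finI], erule (1) indI)+
  have sub: "\<Psi> ` ?I \<subseteq> radical_annihilator M gM x"
  proof (rule image_subsetI)
    fix i assume "i \<in> ?I"
    then consider \<beta> where "i = Inl \<beta>" "\<beta> \<in> B0" | j \<gamma> where "i = Inr (j, \<gamma>)" "j \<in> active ?p" "\<gamma> \<in> C j" by auto
    then show "\<Psi> i \<in> radical_annihilator M gM x"
    proof cases
      case 1
      obtain v where v: "v \<in> tangent_space B ?p" "\<beta> = flat B gB ?p v" using 1 B0(1) unfolding radical_annihilator_def by blast
      obtain Z where Z: "Z \<in> vfields B" "Z ?p = v" by (rule base.vf_extension[OF p v(1)]) (rule that)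
      note LT = tot.vf_tangent[OF L_vf[OF Z(1)] x]
      have "\<Psi> i = flat M gM x (L Z x)"
      proof
        fix u
        show "\<Psi> i u = flat M gM x (L Z x) u"
          unfolding radical_annihilator_M_eq[OF x LT] dB_L[OF Z(1) x] dF_L[OF Z(1) x] 1(1) \<Psi> Z(2) v(2)
          using mF.g_zero_left[OF q] fb.push_tangent by (simp add: flat_def)
      qed
      then show ?thesis using LT unfolding radical_annihilator_def by blast
    next
      case 2
      obtain v where v: "v \<in> tangent_space (F j) (?q j)" "\<gamma> = flat (F j) (gF j) (?q j) v"
        using 2 C1(1)[of j] unfolding radical_annihilator_def by blast
      obtain V where V: "V \<in> vfields (F j)" "V (?q j) = v" by (rule fib.vf_extension[OF q v(1)]) (rule that)
      have bj: "b j ?p \<noteq> 0" using 2 by (simp add: active_def)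
      \<comment> \<open>The factor undoes the weight \<open>(b j ?p)\<^sup>2\<close> of the fibre in
        the warped metric; the index is active, so it exists.\<close>
      define w where "w = (\<lambda>f. inverse ((b j ?p)\<^sup>2) * E j V x f)"
      have w: "w \<in> tangent_space M x" unfolding w_def by (rule tot.tangent_space_scale[OF tot.vf_tangent[OF E_vf[OF V(1)] x]])
      have "\<Psi> i = flat M gM x w"
      proof
        fix u
        show "\<Psi> i u = flat M gM x w u"
        proof (cases "u \<in> tangent_space M x")
          case True
          note uF = fb.push_tangent[OF True] and uB = bs.push_tangent[OF True]
          have dBw: "dB w = (\<lambda>f. 0)" unfolding w_def differential_scale dB_E[OF V(1) x] by simp
          have dFw: "dF l w = (if l = j then (\<lambda>f. inverse ((b j ?p)\<^sup>2) * v f) else (\<lambda>f. 0))" for l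
            unfolding w_def differential_scale dF_E[OF V(1) x] V(2) by simp
          have g0: "gF l (?q l) (\<lambda>f. 0) (dF l u) = 0" for l by (rule mF.g_zero_left[OF q uF])
          have gj: "gF j (?q j) (\<lambda>f. inverse ((b j ?p)\<^sup>2) * v f) (dF j u) = inverse ((b j ?p)\<^sup>2) * gF j (?q j) v (dF j u)"
            by (rule mF.g_scale_left[OF q uF v(1)])
          have "gM x w u = (\<Sum>l\<in>UNIV. if l = j then gF j (?q j) v (dF j u) else 0)"
            unfolding gM_eq dBw dFw mB.g_zero_left[OF p uB] add_0 using bj g0 gj by (intro sum.cong) auto
          then show ?thesis using True uF by (simp add: 2(1) \<Psi> v(2) flat_def)
        qed (simp add: 2(1) \<Psi> flat_def)
      qed
      then show ?thesis using w unfolding radical_annihilator_def by blast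
    qed
  qed
  have "radical_annihilator M gM x \<subseteq> fs.span (\<Psi> ` ?I)"
  proof
    fix \<alpha> assume "\<alpha> \<in> radical_annihilator M gM x"
    then obtain v where v: "v \<in> tangent_space M x" "\<alpha> = flat M gM x v" unfolding radical_annihilator_def by blast
    have "flat B gB ?p (dB v) \<in> fs.span B0"
      using B0(3) bs.push_tangent[OF v(1)] unfolding radical_annihilator_def by blast
    then obtain r where r: "flat B gB ?p (dB v) = (\<Sum>\<beta>\<in>B0. (\<lambda>u. r \<beta> * \<beta> u))"
      unfolding fs.span_finite[OF B0(4)] by auto
    have "\<exists>s. flat (F j) (gF j) (?q j) (dF j v) = (\<Sum>\<gamma>\<in>C j. (\<lambda>u. s \<gamma> * \<gamma> u))" for j
    proof -
      have "flat (F j) (gF j) (?q j) (dF j v) \<in> fs.span (C j)"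
        using C1(3)[of j] fb.push_tangent[OF v(1), of j] unfolding radical_annihilator_def by blast
      then show ?thesis unfolding fs.span_finite[OF C1(4)[of j]] by auto
    qed
    then have "\<forall>j. \<exists>s. flat (F j) (gF j) (?q j) (dF j v) = (\<Sum>\<gamma>\<in>C j. (\<lambda>u. s \<gamma> * \<gamma> u))" by blast
    from choice[OF this] obtain s where s: "\<forall>j. flat (F j) (gF j) (?q j) (dF j v) = (\<Sum>\<gamma>\<in>C j. (\<lambda>u. s j \<gamma> * \<gamma> u))"
      by (elim exE) (rule that)
    define c where "c = case_sum r (\<lambda>(j, \<gamma>). (b j ?p)\<^sup>2 * s j \<gamma>)"
    have "\<alpha> = (\<Sum>i\<in>?I. (\<lambda>u. c i * \<Psi> i u))"
    proof
      fix u
      show "\<alpha> u = (\<Sum>i\<in>?I. (\<lambda>u. c i * \<Psi> i u)) u"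
        unfolding fs_sum_apply sumI v(2) radical_annihilator_M_eq[OF x v(1)] r s[rule_format]
        by (simp add: \<Psi> c_def sum_distrib_left mult_ac)
    qed
    also have "\<dots> \<in> fs.span (\<Psi> ` ?I)"
      by (intro fs.span_sum fs.span_scale fs.span_base) (rule imageI)
    finally show "\<alpha> \<in> fs.span (\<Psi> ` ?I)" .
  qed
  from fs.basis_card_eq_dim[OF sub this ind] have "rank_at M gM x = card (\<Psi> ` ?I)" by (simp add: rank_at_def)
  also have "\<dots> = card ?I" by (rule card_image[OF inj])
  also have "\<dots> = card B0 + (\<Sum>j\<in>active ?p. card (C j))"
    using B0(4) C1(4) by (subst card_Plus) (auto intro!: finite_SigmaI)
  finally show ?thesis using B0(5) C1(5) mB.rank_at_nondeg[OF p] by simp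
qed

text \<open>In a box the base point and the single fibre points can be moved independently.\<close>

lemma regular_box:
  assumes "x \<in> regular_set M gM"
  obtains U V where "openin (mtop B) U" "\<And>j. openin (mtop (F j)) (V j)" "fst x \<in> U" "\<And>j. snd x j \<in> V j"
    "\<forall>p\<in>U. \<forall>q. (\<forall>j. q j \<in> V j) \<longrightarrow> (p, q) \<in> carrier_of M \<and> rank_at M gM (p, q) = rank_at M gM x"
proof -
  obtain W where W: "openin (mtop M) W" "x \<in> W" "\<forall>y\<in>W. rank_at M gM y = rank_at M gM x"
    using assms unfolding regular_set_def by blast
  have "(fst x, snd x) \<in> W" using W(2) by simp
  then obtain U V where UV: "openin (mtop B) U" "\<And>j. openin (mtop (F j)) (V j)" "fst x \<in> U" "\<And>j. snd x j \<in> V j" "pdom U V \<subseteq> W"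
    by (rule openin_prodD[OF W(1)]) (rule that)
  have "(p, q) \<in> W" if "p \<in> U" "\<And>j. q j \<in> V j" for p q using UV(5) that by auto
  then show thesis using openin_subset[OF W(1)] W(3) by (intro that[OF UV(1-4)]) blast
qed

text \<open>Move only the fibre point \<open>j\<close>: all other summands of the rank stay fixed,
  so constancy of the total forces constancy of the rank of this fibre.\<close>

lemma regular_active:
  assumes x: "x \<in> regular_set M gM" and j: "b j (fst x) \<noteq> 0"
  shows "snd x j \<in> regular_set (F j) (gF j)"
proof -
  obtain U V where UV: "openin (mtop B) U" "\<And>j. openin (mtop (F j)) (V j)" "fst x \<in> U" "\<And>j. snd x j \<in> V j"
    and r0: "\<forall>p\<in>U. \<forall>q. (\<forall>j. q j \<in> V j) \<longrightarrow> (p, q) \<in> carrier_of M \<and> rank_at M gM (p, q) = rank_at M gM x"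
    by (rule regular_box[OF x]) (rule that)
  have r: "(p, q) \<in> carrier_of M \<and> rank_at M gM (p, q) = rank_at M gM x" if "p \<in> U" "\<And>j. q j \<in> V j" for p q
    using r0 that by simp
  note xc = mt.regular_set_carrier[OF x]
  have ja: "j \<in> active (fst x)" using j by (simp add: active_def)
  have split: "(\<Sum>l\<in>active (fst x). f l) = f j + (\<Sum>l\<in>active (fst x) - {j}. f l)" for f :: "'m \<Rightarrow> nat"
    by (rule sum.remove[OF _ ja]) simp
  have "rank_at (F j) (gF j) y = rank_at (F j) (gF j) (snd x j)" if y: "y \<in> V j" for y
  proof -
    let ?q = "(snd x)(j := y)"
    have qV: "?q l \<in> V l" for l using UV(4) y by simp
    have "(fst x, ?q) \<in> carrier_of M \<and> rank_at M gM (fst x, ?q) = rank_at M gM x" by (rule r[OF UV(3)]) (rule qV)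
    then have "(fst x, ?q) \<in> carrier_of M" "rank_at M gM (fst x, ?q) = rank_at M gM x" by blast+
    then have "rank_at (F j) (gF j) (?q j) + (\<Sum>l\<in>active (fst x) - {j}. rank_at (F l) (gF l) (?q l)) =
        rank_at (F j) (gF j) (snd x j) + (\<Sum>l\<in>active (fst x) - {j}. rank_at (F l) (gF l) (snd x l))"
      unfolding rank_at_M[OF xc] using rank_at_M[of "(fst x, ?q)"] by (simp add: split)
    moreover have "(\<Sum>l\<in>active (fst x) - {j}. rank_at (F l) (gF l) (?q l)) =
        (\<Sum>l\<in>active (fst x) - {j}. rank_at (F l) (gF l) (snd x l))" by (rule sum.cong) auto
    ultimately show ?thesis by simp
  qed
  then show ?thesis unfolding regular_set_def using UV(2,4) by blast
qed

text \<open>Move only the base point. A nearby point with \<open>b j\<close> nonzero would keep the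
  active indices and add \<open>j\<close>, raising the rank by that of the fibre metric at the
  unchanged fibre point; so this rank must be 0.\<close>

lemma regular_inactive:
  assumes x: "x \<in> regular_set M gM" and j: "b j (fst x) = 0"
  shows "(\<exists>U. openin (mtop B) U \<and> fst x \<in> U \<and> (\<forall>p\<in>U. b j p = 0)) \<or>
    (\<forall>v\<in>tangent_space (F j) (snd x j). \<forall>w\<in>tangent_space (F j) (snd x j). gF j (snd x j) v w = 0)"
proof (rule disjCI)
  assume nz: "\<not> (\<forall>v\<in>tangent_space (F j) (snd x j). \<forall>w\<in>tangent_space (F j) (snd x j). gF j (snd x j) v w = 0)"
  obtain U V where UV: "openin (mtop B) U" "\<And>j. openin (mtop (F j)) (V j)" "fst x \<in> U" "\<And>j. snd x j \<in> V j"
    and r0: "\<forall>p\<in>U. \<forall>q. (\<forall>j. q j \<in> V j) \<longrightarrow> (p, q) \<in> carrier_of M \<and> rank_at M gM (p, q) = rank_at M gM x"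
    by (rule regular_box[OF x]) (rule that)
  have r: "(p, q) \<in> carrier_of M \<and> rank_at M gM (p, q) = rank_at M gM x" if "p \<in> U" "\<And>j. q j \<in> V j" for p q
    using r0 that by simp
  note xc = mt.regular_set_carrier[OF x]
  note p = carrier_fst[OF xc] and q = carrier_snd[OF xc]
  obtain v w where vw: "v \<in> tangent_space (F j) (snd x j)" "w \<in> tangent_space (F j) (snd x j)" "gF j (snd x j) v w \<noteq> 0"
    using nz by blast
  have rank_pos: "rank_at (F j) (gF j) (snd x j) > 0"
  proof -
    let ?\<alpha> = "flat (F j) (gF j) (snd x j) v"
    have "?\<alpha> w \<noteq> 0" using vw by (simp add: flat_def)
    then have "fs.independent {?\<alpha>}" by (auto simp: fs.independent_insert fun_eq_iff)
    moreover have "{?\<alpha>} \<subseteq> radical_annihilator (F j) (gF j) (snd x j)" using vw(1) unfolding radical_annihilator_def by blast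
    ultimately have "card {?\<alpha>} \<le> rank_at (F j) (gF j) (snd x j)"
      using mF.radical_annihilator_independent(2)[OF q] by blast
    then show ?thesis by simp
  qed
  \<comment> \<open>Where the product is nonzero, all indices active at the given point remain
    active.\<close>
  define U' where "U' = U \<inter> {p' \<in> carrier_of B. (\<Prod>l\<in>active (fst x). b l p') \<noteq> 0}"
  have "(\<lambda>p'. \<Prod>l\<in>A. b l p') \<in> smooth_funs B" if "finite A" for A
    using that by (induction A rule: finite_induct) (auto intro: base.smooth_mult b_smooth)
  then have "openin (mtop B) U'" unfolding U'_def by (intro openin_Int UV(1) base.smooth_nonzero_open) simp
  moreover have "fst x \<in> U'" using UV(3) p by (simp add: U'_def active_def)
  moreover have "b j p' = 0" if p': "p' \<in> U'" for p'
  proof (rule ccontr)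
    assume bj: "b j p' \<noteq> 0"
    have p'U: "p' \<in> U" using p' by (simp add: U'_def)
    have sub: "insert j (active (fst x)) \<subseteq> active p'" using p' bj by (auto simp: U'_def active_def)
    have nj: "j \<notin> active (fst x)" using j by (simp add: active_def)
    let ?r = "\<lambda>l. rank_at (F l) (gF l) (snd x l)"
    have "(p', snd x) \<in> carrier_of M" "rank_at M gM (p', snd x) = rank_at M gM x" using r[OF p'U UV(4)] by simp_all
    then have "(\<Sum>l\<in>active p'. ?r l) = (\<Sum>l\<in>active (fst x). ?r l)"
      using rank_at_M[of "(p', snd x)"] rank_at_M[OF xc] by simp
    moreover have "(\<Sum>l\<in>insert j (active (fst x)). ?r l) \<le> (\<Sum>l\<in>active p'. ?r l)"
      by (rule sum_mono2[OF _ sub]) auto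
    moreover have "(\<Sum>l\<in>insert j (active (fst x)). ?r l) = ?r j + (\<Sum>l\<in>active (fst x). ?r l)"
      by (rule sum.insert) (use nj in auto)
    ultimately show False using rank_pos by simp
  qed
  ultimately show "\<exists>U. openin (mtop B) U \<and> fst x \<in> U \<and> (\<forall>p\<in>U. b j p = 0)" by blast
qed

section \<open>The Koszul form of the warped product on lifts\<close>

text \<open>In the names below \<open>L\<close> and \<open>E\<close> stand for a lift from the base and from a fibre, in argument order.\<close>

lemma g_LL: "X \<in> vfields B \<Longrightarrow> Y \<in> vfields B \<Longrightarrow> x \<in> carrier_of M \<Longrightarrow> on_vf gM (L X) (L Y) x = on_vf gB X Y (fst x)"
  unfolding on_vf_def gM_eq by (simp add: dB_L dF_L mF.g_zero_left[OF carrier_snd fib.tangent_zero])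

lemma g_LE:
  assumes X: "X \<in> vfields B" and V: "V \<in> vfields (F j)" and x: "x \<in> carrier_of M"
  shows "on_vf gM (L X) (E j V) x = 0"
  unfolding on_vf_def gM_eq dB_L[OF X x] dF_L[OF X x] dB_E[OF V x]
    mF.g_zero_left[OF carrier_snd[OF x] fb.push_tangent[OF tot.vf_tangent[OF E_vf[OF V] x]]]
    mB.g_zero_right[OF carrier_fst[OF x] base.vf_tangent[OF X carrier_fst[OF x]]] by simp

lemma g_EL: "X \<in> vfields B \<Longrightarrow> V \<in> vfields (F j) \<Longrightarrow> x \<in> carrier_of M \<Longrightarrow> on_vf gM (E j V) (L X) x = 0"
  using g_LE mt.on_vf_sym[OF E_vf L_vf] by simp

lemma g_EE:
  assumes V: "V \<in> vfields (F i)" and W: "W \<in> vfields (F j)" and x: "x \<in> carrier_of M"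
  shows "on_vf gM (E i V) (E j W) x = (if i = j then (b j (fst x))\<^sup>2 * on_vf (gF j) V W (snd x j) else 0)"
proof -
  note q = carrier_snd[OF x]
  have "(b l (fst x))\<^sup>2 * gF l (snd x l) (dF l (E i V x)) (dF l (E j W x)) =
    (if l = j then (if i = j then (b j (fst x))\<^sup>2 * gF j (snd x j) (V (snd x j)) (W (snd x j)) else 0) else 0)" for l
    unfolding dF_E[OF V x] dF_E[OF W x]
    using mF.g_zero_left[OF q fib.tangent_zero] mF.g_zero_left[OF q fib.vf_tangent[OF W q]]
      mF.g_zero_right[OF q fib.vf_tangent[OF V q]] by auto
  then show ?thesis
    unfolding on_vf_def gM_eq dB_E[OF V x] dB_E[OF W x] mB.g_zero_left[OF carrier_fst[OF x] base.tangent_zero] by simp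
qed

text \<open>Products of lifts under the warped metric have this form, a base function times a
  function of one fibre, so all derivatives in the Koszul form reduce to the factors.\<close>

lemma app_L_prod:
  assumes X: "X \<in> vfields B" and u: "u \<in> smooth_funs B" and h: "h \<in> smooth_funs (F j)" and x: "x \<in> carrier_of M"
    and eq: "\<And>y. y \<in> carrier_of M \<Longrightarrow> f y = u (fst y) * h (snd y j)"
  shows "app_vf (L X) f x = app_vf X u (fst x) * h (snd x j)"
proof -
  have "app_vf (L X) f x = app_vf (L X) (\<lambda>y. (u \<circ> fst) y * (h \<circ> (\<lambda>x. snd x j)) y) x"
    unfolding app_vf_def by (rule tot.vf_app_cong[OF L_vf[OF X] x]) (simp add: eq)
  also have "\<dots> = app_vf X u (fst x) * h (snd x j)"
    unfolding tot.app_vf_mult[OF L_vf[OF X] bs.pull_smooth[OF u] fb.pull_smooth[OF h] x]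
    unfolding app_vf_def bs.rel_app[OF rel_LB[OF X] u x] fb.rel_app[OF rel_LF[OF X] h x] by simp
  finally show ?thesis .
qed

lemma app_E_prod:
  assumes U: "U \<in> vfields (F k)" and u: "u \<in> smooth_funs B" and h: "h \<in> smooth_funs (F j)" and x: "x \<in> carrier_of M"
    and eq: "\<And>y. y \<in> carrier_of M \<Longrightarrow> f y = u (fst y) * h (snd y j)"
  shows "app_vf (E k U) f x = (if k = j then u (fst x) * app_vf U h (snd x j) else 0)"
proof -
  have "app_vf (E k U) f x = app_vf (E k U) (\<lambda>y. (u \<circ> fst) y * (h \<circ> (\<lambda>x. snd x j)) y) x"
    unfolding app_vf_def by (rule tot.vf_app_cong[OF E_vf[OF U] x]) (simp add: eq)
  also have "\<dots> = u (fst x) * E k U x (h \<circ> (\<lambda>x. snd x j))"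
    unfolding tot.app_vf_mult[OF E_vf[OF U] bs.pull_smooth[OF u] fb.pull_smooth[OF h] x]
    unfolding app_vf_def bs.rel_app[OF rel_EB[OF U] u x] by simp
  also have "E k U x (h \<circ> (\<lambda>x. snd x j)) = (if k = j then app_vf U h (snd x j) else 0)"
    using fb.rel_app[OF rel_EF[OF U] _ x] fb.rel_app[OF rel_EF_other[OF U, of j] h x] h
    by (cases "k = j") (auto simp: app_vf_def)
  finally show ?thesis by simp
qed

lemma app_L_base:
  assumes X: "X \<in> vfields B" and u: "u \<in> smooth_funs B" and x: "x \<in> carrier_of M"
    and eq: "\<And>y. y \<in> carrier_of M \<Longrightarrow> f y = u (fst y)"
  shows "app_vf (L X) f x = app_vf X u (fst x)"
  using app_L_prod[OF X u fib.smooth_const x, of f 1] eq by simp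

lemma app_E_base:
  assumes U: "U \<in> vfields (F k)" and u: "u \<in> smooth_funs B" and x: "x \<in> carrier_of M"
    and eq: "\<And>y. y \<in> carrier_of M \<Longrightarrow> f y = u (fst y)"
  shows "app_vf (E k U) f x = 0"
proof -
  have "app_vf (E k U) f x = (if k = k then u (fst x) * app_vf U (\<lambda>_. 1) (snd x k) else 0)"
    by (rule app_E_prod[OF U u fib.smooth_const x]) (simp add: eq)
  then show ?thesis using fib.tangent_const[OF fib.vf_tangent[OF U carrier_snd[OF x]], of 1] by (simp add: app_vf_def)
qed

lemma app_zero:
  assumes A: "A \<in> vfields M" and x: "x \<in> carrier_of M" and eq: "\<And>y. y \<in> carrier_of M \<Longrightarrow> f y = 0"
  shows "app_vf A f x = 0"
  unfolding app_vf_def using tot.vf_app_cong[OF A x, of f "\<lambda>_. 0"] eq tot.tangent_const[OF tot.vf_tangent[OF A x], of 0] by simp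

lemma app_b_square:
  assumes X: "X \<in> vfields B" and p: "p \<in> carrier_of B"
  shows "app_vf X (\<lambda>p. (b j p)\<^sup>2) p = 2 * b j p * app_vf X (b j) p"
  using base.app_vf_mult[OF X b_smooth b_smooth p, of j j] by (simp add: power2_eq_square)

lemma app_gLE: "A \<in> vfields M \<Longrightarrow> X \<in> vfields B \<Longrightarrow> V \<in> vfields (F j) \<Longrightarrow> x \<in> carrier_of M \<Longrightarrow> app_vf A (on_vf gM (L X) (E j V)) x = 0"
  by (rule app_zero) (simp_all add: g_LE)
lemma app_gEL: "A \<in> vfields M \<Longrightarrow> X \<in> vfields B \<Longrightarrow> V \<in> vfields (F j) \<Longrightarrow> x \<in> carrier_of M \<Longrightarrow> app_vf A (on_vf gM (E j V) (L X)) x = 0"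
  by (rule app_zero) (simp_all add: g_EL)
lemma app_L_gLL: "X \<in> vfields B \<Longrightarrow> Y \<in> vfields B \<Longrightarrow> Z \<in> vfields B \<Longrightarrow> x \<in> carrier_of M \<Longrightarrow>
    app_vf (L X) (on_vf gM (L Y) (L Z)) x = app_vf X (on_vf gB Y Z) (fst x)"
  by (rule app_L_base) (simp_all add: g_LL mB.g_smooth)
lemma app_E_gLL: "V \<in> vfields (F j) \<Longrightarrow> Y \<in> vfields B \<Longrightarrow> Z \<in> vfields B \<Longrightarrow> x \<in> carrier_of M \<Longrightarrow>
    app_vf (E j V) (on_vf gM (L Y) (L Z)) x = 0"
  by (rule app_E_base[of _ _ "on_vf gB Y Z"]) (simp_all add: g_LL mB.g_smooth)

lemma app_L_gEE:
  assumes X: "X \<in> vfields B" and V: "V \<in> vfields (F i)" and W: "W \<in> vfields (F j)" and x: "x \<in> carrier_of M"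
  shows "app_vf (L X) (on_vf gM (E i V) (E j W)) x =
    (if i = j then 2 * b j (fst x) * app_vf X (b j) (fst x) * on_vf (gF j) V W (snd x j) else 0)"
proof (cases "i = j")
  case True
  have V': "V \<in> vfields (F j)" using V True by simp
  have "app_vf (L X) (on_vf gM (E i V) (E j W)) x = app_vf X (\<lambda>p. (b j p)\<^sup>2) (fst x) * on_vf (gF j) V W (snd x j)"
    by (rule app_L_prod[OF X base.smooth_power[OF b_smooth] mF.g_smooth[OF V' W] x]) (simp add: g_EE[OF V' W] True)
  then show ?thesis using True by (simp add: app_b_square[OF X carrier_fst[OF x]])
next
  case False
  then show ?thesis using app_zero[OF L_vf[OF X] x, of "on_vf gM (E i V) (E j W)"] g_EE[OF V W] by simp
qed

lemma app_E_gEE: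
  assumes U: "U \<in> vfields (F k)" and V: "V \<in> vfields (F i)" and W: "W \<in> vfields (F j)" and x: "x \<in> carrier_of M"
  shows "app_vf (E k U) (on_vf gM (E i V) (E j W)) x =
    (if i = j \<and> k = j then (b j (fst x))\<^sup>2 * app_vf U (on_vf (gF j) V W) (snd x j) else 0)"
proof (cases "i = j")
  case True
  have V': "V \<in> vfields (F j)" using V True by simp
  have "app_vf (E k U) (on_vf gM (E i V) (E j W)) x = (if k = j then (b j (fst x))\<^sup>2 * app_vf U (on_vf (gF j) V W) (snd x j) else 0)"
    by (rule app_E_prod[OF U base.smooth_power[OF b_smooth] mF.g_smooth[OF V' W] x]) (simp add: g_EE[OF V' W] True)
  then show ?thesis using True by simp
next
  case False
  then show ?thesis using app_zero[OF E_vf[OF U] x, of "on_vf gM (E i V) (E j W)"] g_EE[OF V W] by simp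
qed

lemma g_bracket_zero:
  assumes "A \<in> vfields M" "x \<in> carrier_of M" "lie_bracket M C D x = (\<lambda>f. 0)"
  shows "on_vf gM A (lie_bracket M C D) x = 0"
  unfolding on_vf_def assms(3) by (rule mt.g_zero_right[OF assms(2) tot.vf_tangent[OF assms(1,2)]])

lemma g_brLE: "A \<in> vfields M \<Longrightarrow> X \<in> vfields B \<Longrightarrow> V \<in> vfields (F j) \<Longrightarrow> x \<in> carrier_of M \<Longrightarrow>
    on_vf gM A (lie_bracket M (L X) (E j V)) x = 0"
  by (rule g_bracket_zero) (simp_all add: bracket_LE)
lemma g_brEL: "A \<in> vfields M \<Longrightarrow> X \<in> vfields B \<Longrightarrow> V \<in> vfields (F j) \<Longrightarrow> x \<in> carrier_of M \<Longrightarrow>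
    on_vf gM A (lie_bracket M (E j V) (L X)) x = 0"
  by (rule g_bracket_zero) (simp_all add: bracket_EL)
lemma g_brLL: "X \<in> vfields B \<Longrightarrow> Y \<in> vfields B \<Longrightarrow> x \<in> carrier_of M \<Longrightarrow>
    on_vf gM A (lie_bracket M (L X) (L Y)) x = on_vf gM A (L (lie_bracket B X Y)) x"
  by (simp add: on_vf_def bracket_LL)
lemma g_E_brEE:
  assumes U: "U \<in> vfields (F k)" and V: "V \<in> vfields (F i)" and W: "W \<in> vfields (F j)" and x: "x \<in> carrier_of M"
  shows "on_vf gM (E k U) (lie_bracket M (E i V) (E j W)) x =
    (if i = j \<and> k = j then (b j (fst x))\<^sup>2 * on_vf (gF j) U (lie_bracket (F j) V W) (snd x j) else 0)"
proof (cases "i = j")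
  case True
  have V': "V \<in> vfields (F j)" using V True by simp
  have "on_vf gM (E k U) (lie_bracket M (E i V) (E j W)) x = on_vf gM (E k U) (E j (lie_bracket (F j) V W)) x"
    unfolding on_vf_def True bracket_EE[OF V' W x] ..
  then show ?thesis using True by (simp add: g_EE[OF U fib.vf_bracket[OF V' W] x])
next
  case False
  then show ?thesis using g_bracket_zero[OF E_vf[OF U] x bracket_EE_other[OF V W False x]] by simp
qed
lemma g_L_brEE:
  assumes U: "X \<in> vfields B" and V: "V \<in> vfields (F i)" and W: "W \<in> vfields (F j)" and x: "x \<in> carrier_of M"
  shows "on_vf gM (L X) (lie_bracket M (E i V) (E j W)) x = 0"
proof (cases "i = j")
  case True
  have V': "V \<in> vfields (F j)" using V True by simp
  have "on_vf gM (L X) (lie_bracket M (E i V) (E j W)) x = on_vf gM (L X) (E j (lie_bracket (F j) V W)) x"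
    unfolding on_vf_def True bracket_EE[OF V' W x] ..
  then show ?thesis by (simp add: g_LE[OF U fib.vf_bracket[OF V' W] x])
next
  case False
  then show ?thesis using g_bracket_zero[OF L_vf[OF U] x bracket_EE_other[OF V W False x]] by simp
qed

lemmas koszul_rules = g_LL g_LE g_EL g_EE app_gLE app_gEL app_L_gLL app_E_gLL app_L_gEE app_E_gEE
  g_brLE g_brEL g_brLL g_E_brEE g_L_brEE L_vf E_vf base.vf_bracket

context
  fixes x assumes x: "x \<in> carrier_of M"
begin
lemma K_LLL: "X \<in> vfields B \<Longrightarrow> Y \<in> vfields B \<Longrightarrow> Z \<in> vfields B \<Longrightarrow>
    koszul M gM (L X) (L Y) (L Z) x = koszul B gB X Y Z (fst x)"
  unfolding koszul_def by (simp add: koszul_rules x)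
lemma K_LLE: "X \<in> vfields B \<Longrightarrow> Y \<in> vfields B \<Longrightarrow> U \<in> vfields (F k) \<Longrightarrow> koszul M gM (L X) (L Y) (E k U) x = 0"
  unfolding koszul_def by (simp add: koszul_rules x)
lemma K_LEL: "X \<in> vfields B \<Longrightarrow> V \<in> vfields (F i) \<Longrightarrow> Z \<in> vfields B \<Longrightarrow> koszul M gM (L X) (E i V) (L Z) x = 0"
  unfolding koszul_def by (simp add: koszul_rules x)
lemma K_ELL: "X \<in> vfields B \<Longrightarrow> V \<in> vfields (F i) \<Longrightarrow> Z \<in> vfields B \<Longrightarrow> koszul M gM (E i V) (L X) (L Z) x = 0"
  unfolding koszul_def by (simp add: koszul_rules x)
text \<open>The factor 1/2 of the Koszul form absorbs the 2 of X(b_k^2) = 2 b_k X(b_k).\<close>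

lemma K_LEE: "X \<in> vfields B \<Longrightarrow> V \<in> vfields (F i) \<Longrightarrow> U \<in> vfields (F k) \<Longrightarrow> koszul M gM (L X) (E i V) (E k U) x =
    (if i = k then b k (fst x) * app_vf X (b k) (fst x) * on_vf (gF k) V U (snd x k) else 0)"
  unfolding koszul_def by (simp add: koszul_rules x)
lemma K_ELE: "X \<in> vfields B \<Longrightarrow> V \<in> vfields (F i) \<Longrightarrow> U \<in> vfields (F k) \<Longrightarrow> koszul M gM (E i V) (L X) (E k U) x =
    (if i = k then b k (fst x) * app_vf X (b k) (fst x) * on_vf (gF k) V U (snd x k) else 0)"
proof (cases "i = k")
  case True
  assume *: "X \<in> vfields B" "V \<in> vfields (F i)" "U \<in> vfields (F k)"
  then have V: "V \<in> vfields (F k)" using True by simp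
  show ?thesis unfolding koszul_def True using mF.on_vf_sym[OF V *(3) carrier_snd[OF x]] * V by (simp add: koszul_rules x)
next
  case False
  assume "X \<in> vfields B" "V \<in> vfields (F i)" "U \<in> vfields (F k)"
  then show ?thesis unfolding koszul_def using False by (simp add: koszul_rules x)
qed
lemma K_EEL: "X \<in> vfields B \<Longrightarrow> V \<in> vfields (F i) \<Longrightarrow> U \<in> vfields (F k) \<Longrightarrow> koszul M gM (E i V) (E k U) (L X) x =
    (if i = k then - (b k (fst x) * app_vf X (b k) (fst x) * on_vf (gF k) V U (snd x k)) else 0)"
  unfolding koszul_def by (simp add: koszul_rules x)
lemma K_EEE: "V \<in> vfields (F i) \<Longrightarrow> W \<in> vfields (F j) \<Longrightarrow> U \<in> vfields (F k) \<Longrightarrow> koszul M gM (E i V) (E j W) (E k U) x =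
    (if i = j \<and> j = k then (b k (fst x))\<^sup>2 * koszul (F k) (gF k) V W U (snd x k) else 0)"
  unfolding koszul_def by (simp add: koszul_rules x) (simp add: algebra_simps)

end

end

section \<open>Contractions on the warped product\<close>

context metric_manifold
begin
lemma contraction_sym: "contraction M g \<omega> \<tau> = contraction M g \<tau> \<omega>"
proof -
  have "is_contraction M g \<omega> \<tau> h \<longleftrightarrow> is_contraction M g \<tau> \<omega> h" for h
    using is_contraction_sym[of \<omega> \<tau> h] is_contraction_sym[of \<tau> \<omega> h] by blast
  then show ?thesis by (simp add: contraction_def)
qed

text \<open>The tensorial rules concern the third slot, whereas vanishing brackets of lifts enter
  the curvature in the first.\<close>

lemma koszul_zero_left:
  assumes Y: "Y \<in> vfields M" and Z: "Z \<in> vfields M" and p: "p \<in> carrier_of M"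
  shows "koszul M g (\<lambda>p f. 0) Y Z p = 0"
proof -
  have g0: "on_vf g A (\<lambda>p f. 0) x = 0" "on_vf g (\<lambda>p f. 0) A x = 0" if "A \<in> vfields M" "x \<in> carrier_of M" for A x
    using that g_zero_right g_zero_left vf_tangent by (simp_all add: on_vf_def)
  have app0: "app_vf A f p = 0" if "A \<in> vfields M" "\<And>x. x \<in> carrier_of M \<Longrightarrow> f x = 0" for A f
    using vf_app_cong[OF that(1) p, of f "\<lambda>_. 0"] that tangent_const[OF vf_tangent[OF that(1) p], of 0] by (simp add: app_vf_def)
  have b0: "lie_bracket M Y (\<lambda>p f. 0) p = (\<lambda>f. 0)" "lie_bracket M (\<lambda>p f. 0) Y p = (\<lambda>f. 0)" if "Y \<in> vfields M" for Y
    using tangent_const[OF vf_tangent[OF that p], of 0] by (auto simp: lie_bracket_def app_vf_def)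
  have br: "on_vf g A (lie_bracket M C (\<lambda>p f. 0)) p = 0" "on_vf g A (lie_bracket M (\<lambda>p f. 0) C) p = 0"
    if "A \<in> vfields M" "C \<in> vfields M" for A C
    unfolding on_vf_def b0[OF that(2)] using g_zero_right[OF p vf_tangent[OF that(1) p]] by auto
  have "app_vf Y (on_vf g Z (\<lambda>p f. 0)) p = 0" "app_vf Z (on_vf g (\<lambda>p f. 0) Y) p = 0"
    "app_vf (\<lambda>p f. 0) (on_vf g Y Z) p = 0"
    using app0[OF Y] app0[OF Z] g0 Y Z by (simp_all add: app_vf_def[of "\<lambda>p f. 0"])
  then show ?thesis
    unfolding koszul_def using br[OF Y Z] br[OF Z Y] g0(2)[OF vf_bracket[OF Y Z] p] by simp
qed

end

context warped_product
begin
lemma fibre_contraction: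
  assumes "X \<in> vfields (F j)" "Y \<in> vfields (F j)" "Z \<in> vfields (F j)" "T \<in> vfields (F j)"
  shows "is_contraction (F j) (gF j) (koszul (F j) (gF j) X Y) (koszul (F j) (gF j) Z T)
    (contraction (F j) (gF j) (koszul (F j) (gF j) X Y) (koszul (F j) (gF j) Z T))"
proof -
  let ?K = "koszul (F j) (gF j)"
  let ?C = "contraction (F j) (gF j) (?K X Y) (?K Z T)"
  have "\<forall>X\<in>vfields (F j). \<forall>Y\<in>vfields (F j). \<forall>Z\<in>vfields (F j). \<forall>T\<in>vfields (F j).
      \<exists>h. is_contraction (F j) (gF j) (?K X Y) (?K Z T) h"
    using semi_regular[of j] unfolding semi_regular_def by (rule conjunct2)
  from this[rule_format, OF assms] obtain h where h: "is_contraction (F j) (gF j) (?K X Y) (?K Z T) h"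
    by (elim exE) (rule that)
  have eq: "h y = ?C y" if "y \<in> carrier_of (F j)" for y by (rule mF.contraction_eqI[OF h that, symmetric])
  have hs: "h \<in> smooth_funs (F j)" and hr: "\<forall>y\<in>regular_set (F j) (gF j). h y = co_inner (F j) (gF j) y
      (covec_at (F j) (?K X Y) y) (covec_at (F j) (?K Z T) y)"
    using h unfolding is_contraction_def by simp_all
  have "?C \<in> smooth_funs (F j)" by (rule fib.smooth_funs_carrier_cong[THEN iffD1, OF _ hs]) (rule eq)
  moreover have "?C y = co_inner (F j) (gF j) y (covec_at (F j) (?K X Y) y) (covec_at (F j) (?K Z T) y)"
    if "y \<in> regular_set (F j) (gF j)" for y
    using hr that eq[OF mF.regular_set_carrier[OF that]] by simp
  ultimately show ?thesis by (simp add: is_contraction_def)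
qed

text \<open>The common shape of all \<open>Kh A C\<close> with lifts \<open>A\<close>,
  \<open>C\<close>: a base part \<open>s\<close> times the covector of \<open>A\<close>, and a part
  in one fibre with a factor b_j pulled out. The flag \<open>t\<close> is 0 or 1 in all uses and
  switches the fibre Koszul form on. The condition that \<open>a\<close> vanishes where b_j vanishes
  on a neighbourhood reflects a = X(b_j) and settles the regular points with b_j = 0.\<close>

definition nform :: "('b \<times> ('m \<Rightarrow> 'f)) form1 \<Rightarrow> ('b \<times> ('m \<Rightarrow> 'f) \<Rightarrow> real) \<Rightarrow> 'b vfield \<Rightarrow> 'm \<Rightarrow>
    ('b \<Rightarrow> real) \<Rightarrow> 'f vfield \<Rightarrow> real \<Rightarrow> 'f vfield \<Rightarrow> 'f vfield \<Rightarrow> bool" where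
  "nform \<omega> s A j a V t Y Y' \<longleftrightarrow> tensorial M \<omega> \<and> A \<in> vfields B \<and> V \<in> vfields (F j) \<and> Y \<in> vfields (F j) \<and> Y' \<in> vfields (F j) \<and>
     s \<in> smooth_funs M \<and> a \<in> smooth_funs B \<and>
     (\<forall>p W. openin (mtop B) W \<and> p \<in> W \<and> (\<forall>p'\<in>W. b j p' = 0) \<longrightarrow> a p = 0) \<and>
     (\<forall>x\<in>carrier_of M. \<forall>Z\<in>vfields B. \<omega> (L Z) x = s x * on_vf gB A Z (fst x)) \<and>
     (\<forall>x\<in>carrier_of M. \<forall>l. \<forall>U\<in>vfields (F l). \<omega> (E l U) x =
       (if l = j then b j (fst x) * (a (fst x) * on_vf (gF j) V U (snd x j) + b j (fst x) * t * koszul (F j) (gF j) Y Y' U (snd x j)) else 0))"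

lemma nformD:
  assumes "nform \<omega> s A j a V t Y Y'"
  shows "tensorial M \<omega>" "A \<in> vfields B" "V \<in> vfields (F j)" "Y \<in> vfields (F j)" "Y' \<in> vfields (F j)"
    "s \<in> smooth_funs M" "a \<in> smooth_funs B"
    "\<forall>p W. openin (mtop B) W \<and> p \<in> W \<and> (\<forall>p'\<in>W. b j p' = 0) \<longrightarrow> a p = 0"
    "\<forall>x\<in>carrier_of M. \<forall>Z\<in>vfields B. \<omega> (L Z) x = s x * on_vf gB A Z (fst x)"
    "\<forall>x\<in>carrier_of M. \<forall>l. \<forall>U\<in>vfields (F l). \<omega> (E l U) x =
       (if l = j then b j (fst x) * (a (fst x) * on_vf (gF j) V U (snd x j) + b j (fst x) * t * koszul (F j) (gF j) Y Y' U (snd x j)) else 0)"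
  by (insert assms[unfolded nform_def]) (elim conjE, assumption)+

text \<open>On the fibre \<open>j\<close> the warped metric carries b_j^2 and the form only b_j (a
  g(V, .) + b_j t K), hence the vector (a / b_j) V + t \<open>\<kappa>\<close>.\<close>

lemma nform_covec:
  assumes n: "nform \<omega> s A j a V t Y Y'" and x: "x \<in> carrier_of M"
    and \<kappa>: "\<kappa> \<in> tangent_space (F j) (snd x j)" "covec_at (F j) (koszul (F j) (gF j) Y Y') (snd x j) = flat (F j) (gF j) (snd x j) \<kappa>"
  shows "\<exists>v. v \<in> tangent_space M x \<and> covec_at M \<omega> x = flat M gM x v \<and> dB v = (\<lambda>f. s x * A (fst x) f) \<and>
    (\<forall>l. dF l v = (if l = j \<and> b j (fst x) \<noteq> 0 then (\<lambda>f. a (fst x) / b j (fst x) * V (snd x j) f + t * \<kappa> f) else (\<lambda>f. 0)))"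
proof -
  note p = carrier_fst[OF x] and q = carrier_snd[OF x]
  note \<omega> = nformD(1)[OF n] and A = nformD(2)[OF n] and V = nformD(3)[OF n] and Y = nformD(4,5)[OF n]
    and \<omega>L = nformD(9)[OF n, rule_format, OF x] and \<omega>E = nformD(10)[OF n, rule_format, OF x]
  \<comment> \<open>Where b_j = 0 the fibre part of \<open>\<omega>\<close> is 0 by its factor b_j,
    so the zero vector represents it and no division takes place.\<close>
  define k where "k = (if b j (fst x) \<noteq> 0 then (\<lambda>f. a (fst x) / b j (fst x) * V (snd x j) f + t * \<kappa> f) else (\<lambda>f. 0))"
  note VT = fib.vf_tangent[OF V q]
  have aV: "(\<lambda>f. a (fst x) / b j (fst x) * V (snd x j) f) \<in> tangent_space (F j) (snd x j)"
    by (rule fib.tangent_space_scale[OF VT])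
  have t\<kappa>: "(\<lambda>f. t * \<kappa> f) \<in> tangent_space (F j) (snd x j)" by (rule fib.tangent_space_scale[OF \<kappa>(1)])
  have kT: "k \<in> tangent_space (F j) (snd x j)"
    unfolding k_def using fib.tangent_space_add[OF aV t\<kappa>] fib.tangent_zero by simp
  obtain K where K: "K \<in> vfields (F j)" "K (snd x j) = k" by (rule fib.vf_extension[OF q kT]) (rule that)
  define v where "v = (\<lambda>f. s x * L A x f + E j K x f)"
  have vT: "v \<in> tangent_space M x"
    unfolding v_def by (intro tot.tangent_space_add tot.tangent_space_scale tot.vf_tangent L_vf E_vf A K x)
  have dBv: "dB v = (\<lambda>f. s x * A (fst x) f)"
    unfolding v_def differential_add differential_scale dB_L[OF A x] dB_E[OF K(1) x] by simp
  have dFv: "dF l v = (if l = j then k else (\<lambda>f. 0))" for l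
    unfolding v_def differential_add differential_scale dF_L[OF A x] dF_E[OF K(1) x] K(2) by simp
  have "covec_at M \<omega> x = flat M gM x v"
  proof
    fix u
    show "covec_at M \<omega> x u = flat M gM x v u"
    proof (cases "u \<in> tangent_space M x")
      case True
      obtain Z U where Z: "Z \<in> vfields B" and U: "\<And>l. U l \<in> vfields (F l)" and u: "u = split_vf Z U x"
        and Zu: "Z (fst x) = dB u" and Uu: "\<And>l. U l (snd x l) = dF l u"
        by (rule split_vf_exists[OF x True]) (rule that)
      have EU: "E l (U l) \<in> vfields M" for l by (rule E_vf[OF U])
      have sv: "(\<lambda>x f. \<Sum>l\<in>UNIV. E l (U l) x f) \<in> vfields M" by (rule tot.vf_sum[OF EU])
      have "covec_at M \<omega> x u = \<omega> (split_vf Z U) x"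
        unfolding u by (rule tot.covec_at_eq[OF \<omega> x split_vf[OF Z U]])
      also have "\<dots> = \<omega> (L Z) x + \<omega> (\<lambda>x f. \<Sum>l\<in>UNIV. E l (U l) x f) x"
        unfolding split_vf_def by (rule tot.tensorial_add[OF \<omega> x L_vf[OF Z] sv])
      also have "\<omega> (\<lambda>x f. \<Sum>l\<in>UNIV. E l (U l) x f) x = (\<Sum>l\<in>UNIV. \<omega> (E l (U l)) x)"
        by (rule tot.tensorial_sum[OF \<omega> x EU])
      also have "\<dots> = b j (fst x) * (a (fst x) * on_vf (gF j) V (U j) (snd x j) + b j (fst x) * t * koszul (F j) (gF j) Y Y' (U j) (snd x j))"
        by (simp add: \<omega>E[OF U])
      finally have 1: "covec_at M \<omega> x u = s x * gB (fst x) (A (fst x)) (dB u) +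
        b j (fst x) * (a (fst x) * gF j (snd x j) (V (snd x j)) (dF j u) + b j (fst x) * t * koszul (F j) (gF j) Y Y' (U j) (snd x j))"
        by (simp add: \<omega>L[OF Z] on_vf_def Zu Uu)
      note uB = bs.push_tangent[OF True] and uF = fb.push_tangent[OF True]
      have "koszul (F j) (gF j) Y Y' (U j) (snd x j) = covec_at (F j) (koszul (F j) (gF j) Y Y') (snd x j) (U j (snd x j))"
        by (rule fib.covec_at_eq[OF mF.tensorial_koszul[OF Y] q U, symmetric])
      then have K\<kappa>: "koszul (F j) (gF j) Y Y' (U j) (snd x j) = gF j (snd x j) \<kappa> (dF j u)"
        unfolding \<kappa>(2) Uu using uF by (simp add: flat_def)
      have gk: "(b j (fst x))\<^sup>2 * gF j (snd x j) k (dF j u) =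
        b j (fst x) * (a (fst x) * gF j (snd x j) (V (snd x j)) (dF j u) + b j (fst x) * t * gF j (snd x j) \<kappa> (dF j u))"
      proof (cases "b j (fst x) = 0")
        case False
        have kk: "k = (\<lambda>f. a (fst x) / b j (fst x) * V (snd x j) f + t * \<kappa> f)" unfolding k_def using False by simp
        have "gF j (snd x j) k (dF j u) = a (fst x) / b j (fst x) * gF j (snd x j) (V (snd x j)) (dF j u) + t * gF j (snd x j) \<kappa> (dF j u)"
          unfolding kk mF.g_add_left[OF q uF aV t\<kappa>] mF.g_scale_left[OF q uF VT] mF.g_scale_left[OF q uF \<kappa>(1)] ..
        then show ?thesis using False by (simp add: power2_eq_square field_simps)
      qed simp
      have "(\<Sum>l\<in>UNIV. (b l (fst x))\<^sup>2 * gF l (snd x l) (dF l v) (dF l u)) =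
          (\<Sum>l\<in>UNIV. if l = j then (b j (fst x))\<^sup>2 * gF j (snd x j) k (dF j u) else 0)"
        using mF.g_zero_left[OF q uF] by (intro sum.cong refl) (simp add: dFv)
      then have "gM x v u = s x * gB (fst x) (A (fst x)) (dB u) + (b j (fst x))\<^sup>2 * gF j (snd x j) k (dF j u)"
        unfolding gM_eq dBv mB.g_scale_left[OF p uB base.vf_tangent[OF A p]] by simp
      then show ?thesis using True unfolding 1 K\<kappa> gk by (simp add: flat_def)
    qed (simp add: covec_at_def flat_def)
  qed
  then show ?thesis
    using vT dBv dFv by (intro exI[of _ v]) (auto simp: k_def)
qed

lemma koszul_sharp_exists:
  assumes "Y \<in> vfields (F j)" "Y' \<in> vfields (F j)" "y \<in> carrier_of (F j)"
  shows "\<exists>\<kappa>. \<kappa> \<in> tangent_space (F j) y \<and> covec_at (F j) (koszul (F j) (gF j) Y Y') y = flat (F j) (gF j) y \<kappa>"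
proof -
  have "covec_at (F j) (koszul (F j) (gF j) Y Y') y \<in> radical_annihilator (F j) (gF j) y"
  proof -
    have "\<forall>X\<in>vfields (F j). \<forall>Y\<in>vfields (F j). \<forall>p\<in>carrier_of (F j).
        covec_at (F j) (koszul (F j) (gF j) X Y) p \<in> radical_annihilator (F j) (gF j) p"
      using semi_regular[of j] unfolding semi_regular_def radical_stationary_def by simp
    from this[rule_format, OF assms] show ?thesis .
  qed
  then show ?thesis unfolding radical_annihilator_def by blast
qed

text \<open>
  The term \<open>a * a' * g\<^sub>F(V, V')\<close> does not vanish where \<open>b\<close> does; on the regular set it does, since there
  \<open>b\<close> can only vanish together with its derivatives or with the metric of the fibre.
\<close>

lemma contraction_nform:
  assumes n: "nform \<omega> s A j a V t Y Z" and n': "nform \<omega>' s' A' j' a' V' t' Y' Z'" and x: "x \<in> carrier_of M"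
  shows "contraction M gM \<omega> \<omega>' x = s x * s' x * on_vf gB A A' (fst x) +
    (if j = j' then a (fst x) * a' (fst x) * on_vf (gF j) V V' (snd x j)
      + b j (fst x) * (a (fst x) * t' * koszul (F j) (gF j) Y' Z' V (snd x j) + a' (fst x) * t * koszul (F j) (gF j) Y Z V' (snd x j))
      + (b j (fst x))\<^sup>2 * (t * t') * contraction (F j) (gF j) (koszul (F j) (gF j) Y Z) (koszul (F j) (gF j) Y' Z') (snd x j) else 0)"
    (is "_ = ?h x")
proof (rule mt.contraction_eqI[OF _ x])
  note A = nformD(2)[OF n] and V = nformD(3)[OF n] and Y = nformD(4,5)[OF n] and s = nformD(6)[OF n]
    and a = nformD(7)[OF n] and a0 = nformD(8)[OF n]
  note A' = nformD(2)[OF n'] and V' = nformD(3)[OF n'] and Y' = nformD(4,5)[OF n'] and s' = nformD(6)[OF n']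
    and a' = nformD(7)[OF n']
  have sm: "?h \<in> smooth_funs M"
  proof (cases "j = j'")
    case True
    note W' = V'[folded True] Y'(1)[folded True] Y'(2)[folded True]
    let ?C = "contraction (F j) (gF j) (koszul (F j) (gF j) Y Z) (koszul (F j) (gF j) Y' Z')"
    have C: "?C \<in> smooth_funs (F j)" using fibre_contraction[OF Y W'(2,3)] unfolding is_contraction_def by blast
    have "(\<lambda>x. s x * s' x * (on_vf gB A A' \<circ> fst) x + ((a \<circ> fst) x * (a' \<circ> fst) x * (on_vf (gF j) V V' \<circ> (\<lambda>x. snd x j)) x
      + (b j \<circ> fst) x * ((a \<circ> fst) x * t' * (koszul (F j) (gF j) Y' Z' V \<circ> (\<lambda>x. snd x j)) x
        + (a' \<circ> fst) x * t * (koszul (F j) (gF j) Y Z V' \<circ> (\<lambda>x. snd x j)) x)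
      + ((b j \<circ> fst) x)\<^sup>2 * (t * t') * (?C \<circ> (\<lambda>x. snd x j)) x)) \<in> smooth_funs M"
      by (intro tot.smooth_add tot.smooth_mult tot.smooth_power tot.smooth_const s s' bs.pull_smooth fb.pull_smooth
          mB.g_smooth mF.g_smooth mF.koszul_smooth a a' b_smooth A A' V Y W' C)
    then show ?thesis using True by simp
  next
    case False
    have "(\<lambda>x. s x * s' x * (on_vf gB A A' \<circ> fst) x) \<in> smooth_funs M"
      by (intro tot.smooth_mult s s' bs.pull_smooth mB.g_smooth A A')
    then show ?thesis using False by simp
  qed
  have "?h y = co_inner M gM y (covec_at M \<omega> y) (covec_at M \<omega>' y)" if y: "y \<in> regular_set M gM" for y
  proof -
    note yc = mt.regular_set_carrier[OF y]
    note p = carrier_fst[OF yc] and q = carrier_snd[OF yc]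
    obtain \<kappa> where \<kappa>: "\<kappa> \<in> tangent_space (F j) (snd y j)"
      "covec_at (F j) (koszul (F j) (gF j) Y Z) (snd y j) = flat (F j) (gF j) (snd y j) \<kappa>"
      using koszul_sharp_exists[OF Y q] by blast
    obtain \<kappa>' where \<kappa>': "\<kappa>' \<in> tangent_space (F j') (snd y j')"
      "covec_at (F j') (koszul (F j') (gF j') Y' Z') (snd y j') = flat (F j') (gF j') (snd y j') \<kappa>'"
      using koszul_sharp_exists[OF Y' q] by blast
    obtain v where v: "v \<in> tangent_space M y" "covec_at M \<omega> y = flat M gM y v" "dB v = (\<lambda>f. s y * A (fst y) f)"
      "\<forall>l. dF l v = (if l = j \<and> b j (fst y) \<noteq> 0 then (\<lambda>f. a (fst y) / b j (fst y) * V (snd y j) f + t * \<kappa> f) else (\<lambda>f. 0))"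
      using nform_covec[OF n yc \<kappa>] by (elim exE conjE) (rule that)
    obtain w where w: "w \<in> tangent_space M y" "covec_at M \<omega>' y = flat M gM y w" "dB w = (\<lambda>f. s' y * A' (fst y) f)"
      "\<forall>l. dF l w = (if l = j' \<and> b j' (fst y) \<noteq> 0 then (\<lambda>f. a' (fst y) / b j' (fst y) * V' (snd y j') f + t' * \<kappa>' f) else (\<lambda>f. 0))"
      using nform_covec[OF n' yc \<kappa>'] by (elim exE conjE) (rule that)
    have co: "co_inner M gM y (covec_at M \<omega> y) (covec_at M \<omega>' y) = gM y v w"
      unfolding v(2) w(2) by (rule mt.co_inner_flat[OF yc v(1) w(1)])
    have AT: "A (fst y) \<in> tangent_space B (fst y)" "A' (fst y) \<in> tangent_space B (fst y)"
      by (rule base.vf_tangent[OF A p], rule base.vf_tangent[OF A' p])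
    have gBvw: "gB (fst y) (dB v) (dB w) = s y * s' y * on_vf gB A A' (fst y)"
      unfolding v(3) w(3) mB.g_scale_left[OF p base.tangent_space_scale[OF AT(2)] AT(1)] mB.g_scale_right[OF p AT]
      by (simp add: on_vf_def)
    note vF = fb.push_tangent[OF v(1)] and wF = fb.push_tangent[OF w(1)]
    \<comment> \<open>The vector \<open>v\<close> has no component in fibres other than
      \<open>j\<close>, so this is the only fibre term of the inner product.\<close>
    define c where "c = (b j (fst y))\<^sup>2 * gF j (snd y j) (dF j v) (dF j w)"
    have "(b l (fst y))\<^sup>2 * gF l (snd y l) (dF l v) (dF l w) = (if l = j then c else 0)" for l
      using mF.g_zero_left[OF q wF, of l] v(4) by (simp add: c_def)
    then have gMvw: "gM y v w = s y * s' y * on_vf gB A A' (fst y) + c" unfolding gM_eq gBvw by simp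
    show ?thesis
    proof (cases "j = j'")
      case False
      have "c = 0" using mF.g_zero_right[OF q vF, of j] w(4) False by (simp add: c_def)
      then show ?thesis using gMvw co False by simp
    next
      case True
      note W' = V'[folded True] Y'(1)[folded True] Y'(2)[folded True] and \<kappa>'' = \<kappa>'[folded True]
      have VT: "V (snd y j) \<in> tangent_space (F j) (snd y j)" and VT': "V' (snd y j) \<in> tangent_space (F j) (snd y j)"
        by (rule fib.vf_tangent[OF V q], rule fib.vf_tangent[OF W'(1) q])
      have K1: "koszul (F j) (gF j) Y Z V' (snd y j) = gF j (snd y j) \<kappa> (V' (snd y j))"
        using fib.covec_at_eq[OF mF.tensorial_koszul[OF Y] q W'(1)] VT' unfolding \<kappa>(2) by (simp add: flat_def)
      have K2: "koszul (F j) (gF j) Y' Z' V (snd y j) = gF j (snd y j) (V (snd y j)) \<kappa>'"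
        using fib.covec_at_eq[OF mF.tensorial_koszul[OF W'(2,3)] q V] VT mF.g_sym[OF q \<kappa>''(1) VT]
        unfolding \<kappa>''(2) by (simp add: flat_def)
      show ?thesis
      proof (cases "b j (fst y) = 0")
        case b0: True
        have "c = 0" by (simp add: c_def b0)
        \<comment> \<open>All other fibre terms of the formula carry a factor b_j; only this product
          can obstruct the equality.\<close>
        moreover have "a (fst y) = 0 \<or> on_vf (gF j) V V' (snd y j) = 0"
          using regular_inactive[OF y b0]
        proof
          assume "\<exists>U. openin (mtop B) U \<and> fst y \<in> U \<and> (\<forall>p\<in>U. b j p = 0)"
          then show ?thesis using a0 by blast
        next
          assume "\<forall>v\<in>tangent_space (F j) (snd y j). \<forall>w\<in>tangent_space (F j) (snd y j). gF j (snd y j) v w = 0"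
          then show ?thesis using VT VT' by (simp add: on_vf_def)
        qed
        ultimately show ?thesis using gMvw co b0 True by auto
      next
        case nb: False
        let ?\<beta> = "b j (fst y)"
        \<comment> \<open>Here the point of the fibre is regular for the fibre metric, so the fibre
          contraction is the plain inner product of the representing vectors.\<close>
        have C: "contraction (F j) (gF j) (koszul (F j) (gF j) Y Z) (koszul (F j) (gF j) Y' Z') (snd y j) = gF j (snd y j) \<kappa> \<kappa>'"
          using fibre_contraction[OF Y W'(2,3)] regular_active[OF y nb] mF.co_inner_flat[OF q \<kappa>(1) \<kappa>''(1)]
          unfolding is_contraction_def \<kappa>(2)[symmetric] \<kappa>''(2)[symmetric] by simp
        note sc = fib.tangent_space_scale
        let ?v1 = "\<lambda>f. a (fst y) / ?\<beta> * V (snd y j) f" and ?v2 = "\<lambda>f. t * \<kappa> f"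
        let ?w1 = "\<lambda>f. a' (fst y) / ?\<beta> * V' (snd y j) f" and ?w2 = "\<lambda>f. t' * \<kappa>' f"
        have wd: "dF j w = (\<lambda>f. ?w1 f + ?w2 f)" using w(4) nb True by simp
        have vd: "dF j v = (\<lambda>f. ?v1 f + ?v2 f)" using v(4) nb by simp
        have R: "gF j (snd y j) u (dF j w) = a' (fst y) / ?\<beta> * gF j (snd y j) u (V' (snd y j)) + t' * gF j (snd y j) u \<kappa>'"
          if u: "u \<in> tangent_space (F j) (snd y j)" for u
          unfolding wd mF.g_add_right[OF q u sc[OF VT'] sc[OF \<kappa>''(1)]] mF.g_scale_right[OF q u VT'] mF.g_scale_right[OF q u \<kappa>''(1)] ..
        have "gF j (snd y j) (dF j v) (dF j w) = a (fst y) / ?\<beta> * gF j (snd y j) (V (snd y j)) (dF j w) + t * gF j (snd y j) \<kappa> (dF j w)"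
          unfolding vd mF.g_add_left[OF q wF sc[OF VT] sc[OF \<kappa>(1)]] mF.g_scale_left[OF q wF VT] mF.g_scale_left[OF q wF \<kappa>(1)] ..
        then have "c = ?\<beta>\<^sup>2 * (a (fst y) / ?\<beta> * (a' (fst y) / ?\<beta> * gF j (snd y j) (V (snd y j)) (V' (snd y j)) + t' * gF j (snd y j) (V (snd y j)) \<kappa>')
            + t * (a' (fst y) / ?\<beta> * gF j (snd y j) \<kappa> (V' (snd y j)) + t' * gF j (snd y j) \<kappa> \<kappa>'))"
          unfolding c_def R[OF VT] R[OF \<kappa>(1)] by simp
        also have "\<dots> = a (fst y) * a' (fst y) * on_vf (gF j) V V' (snd y j)
            + ?\<beta> * (a (fst y) * t' * koszul (F j) (gF j) Y' Z' V (snd y j) + a' (fst y) * t * koszul (F j) (gF j) Y Z V' (snd y j))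
            + ?\<beta>\<^sup>2 * (t * t') * contraction (F j) (gF j) (koszul (F j) (gF j) Y Z) (koszul (F j) (gF j) Y' Z') (snd y j)"
          unfolding K1 K2 C using nb by (simp add: on_vf_def field_simps power2_eq_square)
        finally show ?thesis unfolding co gMvw using True by simp
      qed
    qed
  qed
  then show "is_contraction M gM \<omega> \<omega>' ?h" using sm by (simp add: is_contraction_def)
qed

end

section \<open>Curvature of the warped product\<close>

locale warped_ssnm = warped_product B F gB gF b
  for B :: "('b, 'd::euclidean_space) mfd" and F :: "'m::finite \<Rightarrow> ('f, 'e::euclidean_space) mfd" and gB gF b +
  fixes P :: "'b vfield"
  assumes P: "P \<in> vfields B"
begin
abbreviation "Kh \<equiv> ssnm_koszul M gM (L P)"
abbreviation "KB \<equiv> ssnm_koszul B gB P"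
abbreviation "Rm \<equiv> ssnm_riemann M gM (L P)"
abbreviation "zv \<equiv> (\<lambda>p f. 0) :: 'f vfield"
abbreviation "zB \<equiv> (\<lambda>p f. 0) :: 'b vfield"

lemma tensorial_d_fun: "tensorial B (d_fun (b j))"
  by (simp add: tensorial_def d_fun_def app_vf_def)

definition grad :: "'m \<Rightarrow> 'b vfield" where
  "grad j = (SOME A. A \<in> vfields B \<and> (\<forall>p\<in>carrier_of B. \<forall>Z\<in>vfields B. on_vf gB A Z p = d_fun (b j) Z p))"

lemma grad: "grad j \<in> vfields B" "p \<in> carrier_of B \<Longrightarrow> Z \<in> vfields B \<Longrightarrow> on_vf gB (grad j) Z p = d_fun (b j) Z p"
proof -
  have "\<exists>A. A \<in> vfields B \<and> (\<forall>p\<in>carrier_of B. \<forall>Z\<in>vfields B. on_vf gB A Z p = d_fun (b j) Z p)"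
    by (rule mB.sharp_vfield[OF tensorial_d_fun]) (simp add: d_fun_def base.vf_smooth b_smooth)
  from someI_ex[OF this] show "grad j \<in> vfields B" "p \<in> carrier_of B \<Longrightarrow> Z \<in> vfields B \<Longrightarrow> on_vf gB (grad j) Z p = d_fun (b j) Z p"
    unfolding grad_def by simp_all
qed

lemma inverse_metric_d_fun: "p \<in> carrier_of B \<Longrightarrow> inverse_metric B gB (d_fun (b i)) (d_fun (b j)) p = on_vf gB (grad i) (grad j) p"
  by (rule mB.inverse_metric_eq[OF tensorial_d_fun grad(1) _ tensorial_d_fun grad(1)]) (simp_all add: grad(2))

text \<open>Pairing a 1-form with db_j under the inverse metric is evaluation at the gradient of
  b_j.\<close>

lemma inverse_metric_koszul:
  assumes X: "X \<in> vfields B" and Y: "Y \<in> vfields B" and p: "p \<in> carrier_of B"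
  shows "inverse_metric B gB (koszul B gB X Y) (d_fun (b j)) p = koszul B gB X Y (grad j) p"
proof -
  have "\<exists>N. N \<in> vfields B \<and> (\<forall>p\<in>carrier_of B. \<forall>Z\<in>vfields B. on_vf gB N Z p = koszul B gB X Y Z p)"
    by (rule mB.sharp_vfield[OF mB.tensorial_koszul[OF X Y] mB.koszul_smooth[OF X Y]])
  then obtain N where N: "N \<in> vfields B" "\<forall>p\<in>carrier_of B. \<forall>Z\<in>vfields B. on_vf gB N Z p = koszul B gB X Y Z p"
    by (elim exE conjE) (rule that)
  have "inverse_metric B gB (koszul B gB X Y) (d_fun (b j)) p = on_vf gB N (grad j) p"
    by (rule mB.inverse_metric_eq[OF mB.tensorial_koszul[OF X Y] N(1) _ tensorial_d_fun grad(1) _ p]) (simp_all add: N(2) p grad(2))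
  then show ?thesis using N(2) p grad(1) by simp
qed

section \<open>The modified Koszul form on lifts\<close>

context
  fixes x assumes x: "x \<in> carrier_of M"
begin
text \<open>The added term g(Y,P) g(X,Z) involves a base field \<open>P\<close>, so it survives only
  if the middle argument is a base lift and the outer two come from the same factor: here and in
  \<open>Kh_ELE\<close>.\<close>

lemma Kh_LLL: "X \<in> vfields B \<Longrightarrow> Y \<in> vfields B \<Longrightarrow> Z \<in> vfields B \<Longrightarrow> Kh (L X) (L Y) (L Z) x = KB X Y Z (fst x)"
  by (simp add: ssnm_koszul_def K_LLL[OF x] g_LL x P)
lemma Kh_LLE: "X \<in> vfields B \<Longrightarrow> Y \<in> vfields B \<Longrightarrow> U \<in> vfields (F k) \<Longrightarrow> Kh (L X) (L Y) (E k U) x = 0"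
  by (simp add: ssnm_koszul_def K_LLE[OF x] g_LL g_LE x P)
lemma Kh_LEL: "X \<in> vfields B \<Longrightarrow> V \<in> vfields (F i) \<Longrightarrow> Z \<in> vfields B \<Longrightarrow> Kh (L X) (E i V) (L Z) x = 0"
  by (simp add: ssnm_koszul_def K_LEL[OF x] g_EL x P)
lemma Kh_ELL: "X \<in> vfields B \<Longrightarrow> V \<in> vfields (F i) \<Longrightarrow> Z \<in> vfields B \<Longrightarrow> Kh (E i V) (L X) (L Z) x = 0"
  by (simp add: ssnm_koszul_def K_ELL[OF x] g_EL x P)
lemma Kh_LEE: "X \<in> vfields B \<Longrightarrow> V \<in> vfields (F i) \<Longrightarrow> U \<in> vfields (F k) \<Longrightarrow> Kh (L X) (E i V) (E k U) x =
    (if i = k then (b k (fst x) * app_vf X (b k) (fst x)) * on_vf (gF k) V U (snd x k) else 0)"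
  by (simp add: ssnm_koszul_def K_LEE[OF x] g_EL x P)
lemma Kh_ELE: "X \<in> vfields B \<Longrightarrow> V \<in> vfields (F i) \<Longrightarrow> U \<in> vfields (F k) \<Longrightarrow> Kh (E i V) (L X) (E k U) x =
    (if i = k then (b k (fst x) * (app_vf X (b k) (fst x) + b k (fst x) * on_vf gB X P (fst x))) * on_vf (gF k) V U (snd x k) else 0)"
  by (simp add: ssnm_koszul_def K_ELE[OF x] g_LL g_EE x P algebra_simps power2_eq_square)
lemma Kh_EEL: "X \<in> vfields B \<Longrightarrow> V \<in> vfields (F i) \<Longrightarrow> U \<in> vfields (F k) \<Longrightarrow> Kh (E i V) (E k U) (L X) x =
    (if i = k then (- (b k (fst x) * app_vf X (b k) (fst x))) * on_vf (gF k) V U (snd x k) else 0)"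
  by (simp add: ssnm_koszul_def K_EEL[OF x] g_EL x P)
lemma Kh_EEE: "V \<in> vfields (F i) \<Longrightarrow> W \<in> vfields (F j) \<Longrightarrow> U \<in> vfields (F k) \<Longrightarrow> Kh (E i V) (E j W) (E k U) x =
    (if i = j \<and> j = k then (b k (fst x))\<^sup>2 * koszul (F k) (gF k) V W U (snd x k) else 0)"
  by (simp add: ssnm_koszul_def K_EEE[OF x] g_EL x P)

end

lemma Kh_zero:
  assumes A: "A \<in> vfields M" and A0: "\<And>y. y \<in> carrier_of M \<Longrightarrow> A y = (\<lambda>f. 0)"
    and C: "C \<in> vfields M" "D \<in> vfields M" and x: "x \<in> carrier_of M"
  shows "Kh A C D x = 0"
proof -
  have "Kh A C D x = Kh (\<lambda>p f. 0) C D x"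
    by (rule mt.ssnm_koszul_cong[OF A tot.vf_zero _ C x]) (simp add: A0)
  also have "\<dots> = 0"
    using mt.koszul_zero_left[OF C x] mt.g_zero_left[OF x tot.vf_tangent[OF C(2) x]] by (simp add: ssnm_koszul_def on_vf_def)
  finally show ?thesis .
qed

lemma Kh_brLE: "X \<in> vfields B \<Longrightarrow> V \<in> vfields (F j) \<Longrightarrow> C \<in> vfields M \<Longrightarrow> D \<in> vfields M \<Longrightarrow> x \<in> carrier_of M \<Longrightarrow>
    Kh (lie_bracket M (L X) (E j V)) C D x = 0"
  by (rule Kh_zero) (simp_all add: bracket_LE tot.vf_bracket L_vf E_vf)
lemma Kh_brEL: "X \<in> vfields B \<Longrightarrow> V \<in> vfields (F j) \<Longrightarrow> C \<in> vfields M \<Longrightarrow> D \<in> vfields M \<Longrightarrow> x \<in> carrier_of M \<Longrightarrow>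
    Kh (lie_bracket M (E j V) (L X)) C D x = 0"
  by (rule Kh_zero) (simp_all add: bracket_EL tot.vf_bracket L_vf E_vf)
lemma Kh_brLL: "X \<in> vfields B \<Longrightarrow> Y \<in> vfields B \<Longrightarrow> C \<in> vfields M \<Longrightarrow> D \<in> vfields M \<Longrightarrow> x \<in> carrier_of M \<Longrightarrow>
    Kh (lie_bracket M (L X) (L Y)) C D x = Kh (L (lie_bracket B X Y)) C D x"
  by (rule mt.ssnm_koszul_cong) (simp_all add: bracket_LL tot.vf_bracket base.vf_bracket L_vf)
lemma Kh_brEE:
  assumes V: "V \<in> vfields (F i)" and W: "W \<in> vfields (F j)" and C: "C \<in> vfields M" "D \<in> vfields M" and x: "x \<in> carrier_of M"
  shows "Kh (lie_bracket M (E i V) (E j W)) C D x = (if i = j then Kh (E j (lie_bracket (F j) V W)) C D x else 0)"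
proof (cases "i = j")
  case True
  have V': "V \<in> vfields (F j)" using V True by simp
  have "Kh (lie_bracket M (E j V) (E j W)) C D x = Kh (E j (lie_bracket (F j) V W)) C D x"
    by (rule mt.ssnm_koszul_cong[OF tot.vf_bracket[OF E_vf[OF V'] E_vf[OF W]] E_vf[OF fib.vf_bracket[OF V' W]] bracket_EE[OF V' W] C x])
  then show ?thesis using True by simp
next
  case False
  have "Kh (lie_bracket M (E i V) (E j W)) C D x = 0"
    by (rule Kh_zero[OF tot.vf_bracket[OF E_vf[OF V] E_vf[OF W]] bracket_EE_other[OF V W False] C x])
  then show ?thesis using False by simp
qed

lemma app_b_deriv:
  assumes X: "X \<in> vfields B" and Y: "Y \<in> vfields B" and p: "p \<in> carrier_of B"
  shows "app_vf Y (\<lambda>p. b j p * app_vf X (b j) p) p = app_vf Y (b j) p * app_vf X (b j) p + b j p * app_vf Y (app_vf X (b j)) p"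
  by (rule base.app_vf_mult[OF Y b_smooth base.vf_smooth[OF X b_smooth] p])

lemma app_neg:
  assumes Y: "Y \<in> vfields B" and u: "u \<in> smooth_funs B" and p: "p \<in> carrier_of B"
  shows "app_vf Y (\<lambda>p. - u p) p = - app_vf Y u p"
  unfolding app_vf_def by (rule base.tangent_minus[OF base.vf_tangent[OF Y p] u])

lemma app_b_deriv_P:
  assumes X: "X \<in> vfields B" and Y: "Y \<in> vfields B" and p: "p \<in> carrier_of B"
  shows "app_vf Y (\<lambda>p. b j p * (app_vf X (b j) p + b j p * on_vf gB X P p)) p =
    app_vf Y (b j) p * (app_vf X (b j) p + b j p * on_vf gB X P p) + b j p * (app_vf Y (app_vf X (b j)) p
      + (app_vf Y (b j) p * on_vf gB X P p + b j p * app_vf Y (on_vf gB X P) p))"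
proof -
  note Xb = base.vf_smooth[OF X b_smooth[of j]] and XP = mB.g_smooth[OF X P]
  note bXP = base.smooth_mult[OF b_smooth[of j] XP]
  show ?thesis
    unfolding base.app_vf_mult[OF Y b_smooth base.smooth_add[OF Xb bXP] p] base.app_vf_add[OF Y Xb bXP p]
      base.app_vf_mult[OF Y b_smooth XP p] ..
qed

lemma smooth_b_deriv: "X \<in> vfields B \<Longrightarrow> (\<lambda>p. b j p * app_vf X (b j) p) \<in> smooth_funs B"
  by (intro base.smooth_mult b_smooth base.vf_smooth)
lemma smooth_b_deriv_P: "X \<in> vfields B \<Longrightarrow> (\<lambda>p. b j p * (app_vf X (b j) p + b j p * on_vf gB X P p)) \<in> smooth_funs B"
  by (intro base.smooth_mult base.smooth_add b_smooth base.vf_smooth mB.g_smooth P)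

section \<open>Derivatives of the modified Koszul form along lifts\<close>

context
  fixes x assumes x: "x \<in> carrier_of M"
begin
lemma D_LLL: "Y \<in> vfields B \<Longrightarrow> X1 \<in> vfields B \<Longrightarrow> X2 \<in> vfields B \<Longrightarrow> X3 \<in> vfields B \<Longrightarrow>
    app_vf (L Y) (Kh (L X1) (L X2) (L X3)) x = app_vf Y (KB X1 X2 X3) (fst x)"
  by (rule app_L_base) (simp_all add: Kh_LLL x mB.ssnm_koszul_smooth P)
lemma DE_LLL: "W \<in> vfields (F l) \<Longrightarrow> X1 \<in> vfields B \<Longrightarrow> X2 \<in> vfields B \<Longrightarrow> X3 \<in> vfields B \<Longrightarrow>
    app_vf (E l W) (Kh (L X1) (L X2) (L X3)) x = 0"
  by (rule app_E_base[of _ _ "KB X1 X2 X3"]) (simp_all add: Kh_LLL x mB.ssnm_koszul_smooth P)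
lemma D_LLE: "A \<in> vfields M \<Longrightarrow> X \<in> vfields B \<Longrightarrow> Y \<in> vfields B \<Longrightarrow> U \<in> vfields (F k) \<Longrightarrow> app_vf A (Kh (L X) (L Y) (E k U)) x = 0"
  by (rule app_zero) (simp_all add: Kh_LLE x)
lemma D_LEL: "A \<in> vfields M \<Longrightarrow> X \<in> vfields B \<Longrightarrow> Y \<in> vfields B \<Longrightarrow> U \<in> vfields (F k) \<Longrightarrow> app_vf A (Kh (L X) (E k U) (L Y)) x = 0"
  by (rule app_zero) (simp_all add: Kh_LEL x)
lemma D_ELL: "A \<in> vfields M \<Longrightarrow> X \<in> vfields B \<Longrightarrow> Y \<in> vfields B \<Longrightarrow> U \<in> vfields (F k) \<Longrightarrow> app_vf A (Kh (E k U) (L X) (L Y)) x = 0"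
  by (rule app_zero) (simp_all add: Kh_ELL x)

lemma D_prod:
  assumes V: "V \<in> vfields (F i)" and U: "U \<in> vfields (F k)" and u: "u \<in> smooth_funs B"
    and eq: "\<And>y. y \<in> carrier_of M \<Longrightarrow> f y = (if i = k then u (fst y) * on_vf (gF k) V U (snd y k) else 0)"
  shows "Y \<in> vfields B \<Longrightarrow> app_vf (L Y) f x = (if i = k then app_vf Y u (fst x) * on_vf (gF k) V U (snd x k) else 0)"
    "W \<in> vfields (F l) \<Longrightarrow> app_vf (E l W) f x = (if i = k \<and> l = k then u (fst x) * app_vf W (on_vf (gF k) V U) (snd x k) else 0)"
proof -
  show "app_vf (L Y) f x = (if i = k then app_vf Y u (fst x) * on_vf (gF k) V U (snd x k) else 0)" if Y: "Y \<in> vfields B"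
  proof (cases "i = k")
    case True
    have V': "V \<in> vfields (F k)" using V True by simp
    show ?thesis using app_L_prod[OF Y u mF.g_smooth[OF V' U] x, of f] eq True by simp
  next
    case False
    then show ?thesis using app_zero[OF L_vf[OF Y] x, of f] eq by simp
  qed
  show "app_vf (E l W) f x = (if i = k \<and> l = k then u (fst x) * app_vf W (on_vf (gF k) V U) (snd x k) else 0)" if W: "W \<in> vfields (F l)"
  proof (cases "i = k")
    case True
    have V': "V \<in> vfields (F k)" using V True by simp
    show ?thesis using app_E_prod[OF W u mF.g_smooth[OF V' U] x, of f] eq True by simp
  next
    case False
    then show ?thesis using app_zero[OF E_vf[OF W] x, of f] eq by simp
  qed
qed

lemma D_LEE:
  assumes X: "X \<in> vfields B" and V: "V \<in> vfields (F i)" and U: "U \<in> vfields (F k)"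
  shows "Y \<in> vfields B \<Longrightarrow> app_vf (L Y) (Kh (L X) (E i V) (E k U)) x =
      (if i = k then (app_vf Y (b k) (fst x) * app_vf X (b k) (fst x) + b k (fst x) * app_vf Y (app_vf X (b k)) (fst x)) * on_vf (gF k) V U (snd x k) else 0)"
    "W \<in> vfields (F l) \<Longrightarrow> app_vf (E l W) (Kh (L X) (E i V) (E k U)) x =
      (if i = k \<and> l = k then (b k (fst x) * app_vf X (b k) (fst x)) * app_vf W (on_vf (gF k) V U) (snd x k) else 0)"
  using D_prod[OF V U smooth_b_deriv[OF X, of k] Kh_LEE[OF _ X V U]] app_b_deriv[OF X _ carrier_fst[OF x], of Y k] by simp_all

lemma D_ELE:
  assumes X: "X \<in> vfields B" and V: "V \<in> vfields (F i)" and U: "U \<in> vfields (F k)"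
  shows "Y \<in> vfields B \<Longrightarrow> app_vf (L Y) (Kh (E i V) (L X) (E k U)) x =
      (if i = k then (app_vf Y (b k) (fst x) * (app_vf X (b k) (fst x) + b k (fst x) * on_vf gB X P (fst x)) + b k (fst x) * (app_vf Y (app_vf X (b k)) (fst x)
      + (app_vf Y (b k) (fst x) * on_vf gB X P (fst x) + b k (fst x) * app_vf Y (on_vf gB X P) (fst x)))) * on_vf (gF k) V U (snd x k) else 0)"
    "W \<in> vfields (F l) \<Longrightarrow> app_vf (E l W) (Kh (E i V) (L X) (E k U)) x =
      (if i = k \<and> l = k then (b k (fst x) * (app_vf X (b k) (fst x) + b k (fst x) * on_vf gB X P (fst x))) * app_vf W (on_vf (gF k) V U) (snd x k) else 0)"
  using D_prod[OF V U smooth_b_deriv_P[OF X, of k] Kh_ELE[OF _ X V U]] app_b_deriv_P[OF X _ carrier_fst[OF x], of Y k] by simp_all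

lemma D_EEL:
  assumes X: "X \<in> vfields B" and V: "V \<in> vfields (F i)" and U: "U \<in> vfields (F k)"
  shows "Y \<in> vfields B \<Longrightarrow> app_vf (L Y) (Kh (E i V) (E k U) (L X)) x =
      (if i = k then (- (app_vf Y (b k) (fst x) * app_vf X (b k) (fst x) + b k (fst x) * app_vf Y (app_vf X (b k)) (fst x))) * on_vf (gF k) V U (snd x k) else 0)"
    "W \<in> vfields (F l) \<Longrightarrow> app_vf (E l W) (Kh (E i V) (E k U) (L X)) x =
      (if i = k \<and> l = k then (- (b k (fst x) * app_vf X (b k) (fst x))) * app_vf W (on_vf (gF k) V U) (snd x k) else 0)"
  using D_prod[OF V U base.smooth_minus[OF smooth_b_deriv[OF X, of k]] Kh_EEL[OF _ X V U]]
    app_neg[OF _ smooth_b_deriv[OF X, of k] carrier_fst[OF x], of Y] app_b_deriv[OF X _ carrier_fst[OF x], of Y k] by simp_all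

lemma D_EEE:
  assumes V: "V \<in> vfields (F i)" and W: "W \<in> vfields (F j)" and U: "U \<in> vfields (F k)"
  shows "Y \<in> vfields B \<Longrightarrow> app_vf (L Y) (Kh (E i V) (E j W) (E k U)) x =
      (if i = j \<and> j = k then 2 * b k (fst x) * app_vf Y (b k) (fst x) * koszul (F k) (gF k) V W U (snd x k) else 0)"
    "Q \<in> vfields (F l) \<Longrightarrow> app_vf (E l Q) (Kh (E i V) (E j W) (E k U)) x =
      (if i = j \<and> j = k \<and> l = k then (b k (fst x))\<^sup>2 * app_vf Q (koszul (F k) (gF k) V W U) (snd x k) else 0)"
proof -
  note K = Kh_EEE[OF _ V W U] and b2 = base.smooth_power[OF b_smooth[of k], of 2]
  show "app_vf (L Y) (Kh (E i V) (E j W) (E k U)) x =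
      (if i = j \<and> j = k then 2 * b k (fst x) * app_vf Y (b k) (fst x) * koszul (F k) (gF k) V W U (snd x k) else 0)" if Y: "Y \<in> vfields B"
  proof (cases "i = j \<and> j = k")
    case True
    have V': "V \<in> vfields (F k)" "W \<in> vfields (F k)" using V W True by simp_all
    show ?thesis
      using app_L_prod[OF Y b2 mF.koszul_smooth[OF V' U] x, of "Kh (E i V) (E j W) (E k U)"] K True app_b_square[OF Y carrier_fst[OF x]] by simp
  next
    case False
    have "app_vf (L Y) (Kh (E i V) (E j W) (E k U)) x = 0" by (rule app_zero[OF L_vf[OF Y] x]) (simp only: K False if_False)
    then show ?thesis by (simp only: False if_False)
  qed
  show "app_vf (E l Q) (Kh (E i V) (E j W) (E k U)) x =
      (if i = j \<and> j = k \<and> l = k then (b k (fst x))\<^sup>2 * app_vf Q (koszul (F k) (gF k) V W U) (snd x k) else 0)" if Q: "Q \<in> vfields (F l)"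
  proof (cases "i = j \<and> j = k")
    case True
    have V': "V \<in> vfields (F k)" "W \<in> vfields (F k)" using V W True by simp_all
    show ?thesis
      using app_E_prod[OF Q b2 mF.koszul_smooth[OF V' U] x, of "Kh (E i V) (E j W) (E k U)"] K True by simp
  next
    case False
    have "app_vf (E l Q) (Kh (E i V) (E j W) (E k U)) x = 0" by (rule app_zero[OF E_vf[OF Q] x]) (simp only: K False if_False)
    then show ?thesis using False by auto
  qed
qed

end

section \<open>Normal forms and contractions of the modified Koszul forms\<close>

lemma tensorial_Kh: "A \<in> vfields M \<Longrightarrow> C \<in> vfields M \<Longrightarrow> tensorial M (Kh A C)"
  by (rule mt.tensorial_ssnm_koszul)

text \<open>Locality of derivations; it establishes the vanishing clause of \<open>nform\<close> for
  the derivatives of b_j.\<close>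

lemma app_b_vanish:
  assumes "X \<in> vfields B" "openin (mtop B) W" "p \<in> W" "\<forall>p'\<in>W. b j p' = 0"
  shows "app_vf X (b j) p = 0"
proof -
  have p: "p \<in> carrier_of B" using assms(2,3) openin_subset by blast
  note T = base.vf_tangent[OF assms(1) p]
  have "X p (b j) = X p (\<lambda>_. 0)" by (rule base.tangent_local[OF T b_smooth base.smooth_const assms(2,3)]) (use assms(4) in simp)
  then show ?thesis using base.tangent_const[OF T] by (simp add: app_vf_def)
qed

text \<open>There is no fibre part, so the index \<open>j\<close> is arbitrary and can be matched to
  that of the other form.\<close>

lemma nform_LL:
  assumes X: "X \<in> vfields B" "Y \<in> vfields B" and S: "S \<in> vfields B"
    and eq: "\<forall>p\<in>carrier_of B. \<forall>Z\<in>vfields B. on_vf gB S Z p = KB X Y Z p"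
  shows "nform (Kh (L X) (L Y)) (\<lambda>_. 1) S j (\<lambda>_. 0) zv 0 zv zv"
  unfolding nform_def using X S eq
  by (simp add: tensorial_Kh L_vf fib.vf_zero tot.smooth_const base.smooth_const Kh_LLL Kh_LLE carrier_fst)

lemma nform_LE:
  assumes X: "X \<in> vfields B" and V: "V \<in> vfields (F i)"
  shows "nform (Kh (L X) (E i V)) (\<lambda>_. 0) zB i (app_vf X (b i)) V 0 zv zv"
  unfolding nform_def using X V app_b_vanish[OF X]
  by (auto simp: tensorial_Kh L_vf E_vf fib.vf_zero base.vf_zero tot.smooth_const base.vf_smooth b_smooth Kh_LEL Kh_LEE)

lemma nform_EL:
  assumes X: "X \<in> vfields B" and V: "V \<in> vfields (F i)"
  shows "nform (Kh (E i V) (L X)) (\<lambda>_. 0) zB i (\<lambda>p. app_vf X (b i) p + b i p * on_vf gB X P p) V 0 zv zv"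
  unfolding nform_def using X V app_b_vanish[OF X]
  by (auto simp: tensorial_Kh L_vf E_vf fib.vf_zero base.vf_zero tot.smooth_const base.vf_smooth b_smooth Kh_ELL Kh_ELE
      intro!: base.smooth_add base.smooth_mult mB.g_smooth P)

text \<open>The base part, the second fundamental form of the fibre, is a multiple of the gradient
  of b_j; the fibre part is b_j^2 K, that is, \<open>a\<close> = 0 and \<open>t\<close> = 1.\<close>

lemma nform_EE:
  assumes V: "V \<in> vfields (F j)" and W: "W \<in> vfields (F j)"
  shows "nform (Kh (E j V) (E j W)) (\<lambda>y. - (b j (fst y) * on_vf (gF j) V W (snd y j))) (grad j) j (\<lambda>_. 0) zv 1 V W"
proof -
  have "(\<lambda>y. - ((b j \<circ> fst) y * (on_vf (gF j) V W \<circ> (\<lambda>y. snd y j)) y)) \<in> smooth_funs M"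
    by (intro tot.smooth_minus tot.smooth_mult bs.pull_smooth fb.pull_smooth b_smooth mF.g_smooth V W)
  then show ?thesis
    unfolding nform_def using V W grad
    by (auto simp: tensorial_Kh E_vf fib.vf_zero base.smooth_const Kh_EEL Kh_EEE carrier_fst d_fun_def power2_eq_square)
qed

lemma nform_EE_other:
  assumes V: "V \<in> vfields (F i)" and W: "W \<in> vfields (F j)" and ij: "i \<noteq> j"
  shows "nform (Kh (E i V) (E j W)) (\<lambda>_. 0) zB i (\<lambda>_. 0) zv 0 zv zv"
  unfolding nform_def using V W ij
  by (auto simp: tensorial_Kh E_vf fib.vf_zero base.vf_zero tot.smooth_const base.smooth_const Kh_EEL Kh_EEE)

lemma KB_sharp:
  assumes X: "X \<in> vfields B" and Y: "Y \<in> vfields B"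
  shows "\<exists>S. S \<in> vfields B \<and> (\<forall>p\<in>carrier_of B. \<forall>Z\<in>vfields B. on_vf gB S Z p = KB X Y Z p)"
  by (rule mB.sharp_vfield[OF mB.tensorial_ssnm_koszul[OF X Y] mB.ssnm_koszul_smooth[OF X Y _ P]])

context
  fixes x assumes x: "x \<in> carrier_of M"
begin
abbreviation "Cx \<omega> \<tau> \<equiv> contraction M gM \<omega> \<tau> x"

lemma C_LL_LL:
  assumes X: "X \<in> vfields B" "Y \<in> vfields B" and Z: "Z \<in> vfields B" "T \<in> vfields B"
  shows "Cx (Kh (L X) (L Y)) (Kh (L Z) (L T)) = contraction B gB (KB X Y) (KB Z T) (fst x)"
proof -
  obtain S where S: "S \<in> vfields B" "\<forall>p\<in>carrier_of B. \<forall>Z\<in>vfields B. on_vf gB S Z p = KB X Y Z p" using KB_sharp[OF X] by (elim exE conjE) (rule that)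
  obtain S' where S': "S' \<in> vfields B" "\<forall>p\<in>carrier_of B. \<forall>A\<in>vfields B. on_vf gB S' A p = KB Z T A p" using KB_sharp[OF Z] by (elim exE conjE) (rule that)
  \<comment> \<open>Both fibre parts are 0, so any fibre index will do; \<open>undefined\<close>
    merely names one.\<close>
  have "Cx (Kh (L X) (L Y)) (Kh (L Z) (L T)) = on_vf gB S S' (fst x)"
    using contraction_nform[OF nform_LL[OF X S, of undefined] nform_LL[OF Z S', of undefined] x] by simp
  also have "\<dots> = contraction B gB (KB X Y) (KB Z T) (fst x)"
    by (rule mB.contraction_nondeg[OF mB.tensorial_ssnm_koszul[OF X] S(1) _ mB.tensorial_ssnm_koszul[OF Z] S'(1) _ carrier_fst[OF x], symmetric])
      (simp_all add: S(2) S'(2))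
  finally show ?thesis .
qed

lemma C_LL_LE:
  assumes X: "X \<in> vfields B" "Y \<in> vfields B" and Z: "Z \<in> vfields B" and V: "V \<in> vfields (F i)"
  shows "Cx (Kh (L X) (L Y)) (Kh (L Z) (E i V)) = 0" "Cx (Kh (L Z) (E i V)) (Kh (L X) (L Y)) = 0"
    "Cx (Kh (L X) (L Y)) (Kh (E i V) (L Z)) = 0" "Cx (Kh (E i V) (L Z)) (Kh (L X) (L Y)) = 0"
proof -
  obtain S where S: "S \<in> vfields B" "\<forall>p\<in>carrier_of B. \<forall>Z\<in>vfields B. on_vf gB S Z p = KB X Y Z p" using KB_sharp[OF X] by (elim exE conjE) (rule that)
  show *: "Cx (Kh (L X) (L Y)) (Kh (L Z) (E i V)) = 0"
    using contraction_nform[OF nform_LL[OF X S, of i] nform_LE[OF Z V] x] by simp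
  show **: "Cx (Kh (L X) (L Y)) (Kh (E i V) (L Z)) = 0"
    using contraction_nform[OF nform_LL[OF X S, of i] nform_EL[OF Z V] x] by simp
  show "Cx (Kh (L Z) (E i V)) (Kh (L X) (L Y)) = 0" "Cx (Kh (E i V) (L Z)) (Kh (L X) (L Y)) = 0"
    unfolding mt.contraction_sym[of _ "Kh (L X) (L Y)"] by (rule *, rule **)
qed

lemma C_LL_EE:
  assumes X: "X \<in> vfields B" "Y \<in> vfields B" and V: "V \<in> vfields (F i)" and W: "W \<in> vfields (F j)"
  shows "Cx (Kh (L X) (L Y)) (Kh (E i V) (E j W)) = (if i = j then - (b j (fst x) * on_vf (gF j) V W (snd x j)) *
      (koszul B gB X Y (grad j) (fst x) + on_vf gB Y P (fst x) * app_vf X (b j) (fst x)) else 0)" (is ?A)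
    and "Cx (Kh (E i V) (E j W)) (Kh (L X) (L Y)) = (if i = j then - (b j (fst x) * on_vf (gF j) V W (snd x j)) *
      (koszul B gB X Y (grad j) (fst x) + on_vf gB Y P (fst x) * app_vf X (b j) (fst x)) else 0)"
proof -
  obtain S where S: "S \<in> vfields B" "\<forall>p\<in>carrier_of B. \<forall>Z\<in>vfields B. on_vf gB S Z p = KB X Y Z p" using KB_sharp[OF X] by (elim exE conjE) (rule that)
  note p = carrier_fst[OF x]
  \<comment> \<open>Evaluation at the gradient; the second summand is the contribution of
    \<open>P\<close> to \<open>KB\<close>, as g(X, grad b_j) = X(b_j).\<close>
  have Sg: "on_vf gB S (grad j) (fst x) = koszul B gB X Y (grad j) (fst x) + on_vf gB Y P (fst x) * app_vf X (b j) (fst x)"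
    using S(2) p grad(1)[of j] grad(2)[of _ _ j] mB.on_vf_sym[OF X(1) grad(1) p, of j] X(1) by (simp add: ssnm_koszul_def d_fun_def)
  show ?A
  proof (cases "i = j")
    case True
    have V': "V \<in> vfields (F j)" using V True by simp
    show ?thesis using contraction_nform[OF nform_LL[OF X S, of j] nform_EE[OF V' W] x] Sg True by simp
  next
    case False
    show ?thesis using contraction_nform[OF nform_LL[OF X S, of j] nform_EE_other[OF V W False] x] False by simp
  qed
  then show "Cx (Kh (E i V) (E j W)) (Kh (L X) (L Y)) = (if i = j then - (b j (fst x) * on_vf (gF j) V W (snd x j)) *
      (koszul B gB X Y (grad j) (fst x) + on_vf gB Y P (fst x) * app_vf X (b j) (fst x)) else 0)"
    unfolding mt.contraction_sym[of _ "Kh (L X) (L Y)"] .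
qed

lemma C_mixed:
  assumes X: "X \<in> vfields B" "Y \<in> vfields B" and V: "V \<in> vfields (F i)" and U: "U \<in> vfields (F k)"
  shows "Cx (Kh (L X) (E i V)) (Kh (L Y) (E k U)) = (if i = k then app_vf X (b k) (fst x) * app_vf Y (b k) (fst x) * on_vf (gF k) V U (snd x k) else 0)"
    "Cx (Kh (L X) (E i V)) (Kh (E k U) (L Y)) = (if i = k then app_vf X (b k) (fst x) *
      (app_vf Y (b k) (fst x) + b k (fst x) * on_vf gB Y P (fst x)) * on_vf (gF k) V U (snd x k) else 0)"
    "Cx (Kh (E i V) (L X)) (Kh (L Y) (E k U)) = (if i = k then (app_vf X (b k) (fst x) + b k (fst x) * on_vf gB X P (fst x)) *
      app_vf Y (b k) (fst x) * on_vf (gF k) V U (snd x k) else 0)"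
    "Cx (Kh (E i V) (L X)) (Kh (E k U) (L Y)) = (if i = k then (app_vf X (b k) (fst x) + b k (fst x) * on_vf gB X P (fst x)) *
      (app_vf Y (b k) (fst x) + b k (fst x) * on_vf gB Y P (fst x)) * on_vf (gF k) V U (snd x k) else 0)"
  using contraction_nform[OF nform_LE[OF X(1) V] nform_LE[OF X(2) U] x] contraction_nform[OF nform_LE[OF X(1) V] nform_EL[OF X(2) U] x]
    contraction_nform[OF nform_EL[OF X(1) V] nform_LE[OF X(2) U] x] contraction_nform[OF nform_EL[OF X(1) V] nform_EL[OF X(2) U] x]
  by auto

lemma C_LE_EE:
  assumes X: "X \<in> vfields B" and U: "U \<in> vfields (F k)" and V: "V \<in> vfields (F i)" and W: "W \<in> vfields (F j)"
  shows "Cx (Kh (L X) (E k U)) (Kh (E i V) (E j W)) = (if i = j \<and> k = j then b j (fst x) * app_vf X (b j) (fst x) * koszul (F j) (gF j) V W U (snd x j) else 0)" (is ?A)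
    and "Cx (Kh (E k U) (L X)) (Kh (E i V) (E j W)) = (if i = j \<and> k = j then b j (fst x) *
      (app_vf X (b j) (fst x) + b j (fst x) * on_vf gB X P (fst x)) * koszul (F j) (gF j) V W U (snd x j) else 0)" (is ?B)
    and "Cx (Kh (E i V) (E j W)) (Kh (L X) (E k U)) = (if i = j \<and> k = j then b j (fst x) * app_vf X (b j) (fst x) * koszul (F j) (gF j) V W U (snd x j) else 0)"
    and "Cx (Kh (E i V) (E j W)) (Kh (E k U) (L X)) = (if i = j \<and> k = j then b j (fst x) *
      (app_vf X (b j) (fst x) + b j (fst x) * on_vf gB X P (fst x)) * koszul (F j) (gF j) V W U (snd x j) else 0)"
proof -
  show A: ?A and B: ?B
  proof -
    consider (eq) "i = j" | (ne) "i \<noteq> j" by blast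
    then have "?A \<and> ?B"
    proof cases
      case eq
      have V': "V \<in> vfields (F j)" using V eq by simp
      show ?thesis using contraction_nform[OF nform_LE[OF X U] nform_EE[OF V' W] x]
          contraction_nform[OF nform_EL[OF X U] nform_EE[OF V' W] x] eq by (auto simp: on_vf_def)
    next
      case ne
      show ?thesis using contraction_nform[OF nform_LE[OF X U] nform_EE_other[OF V W ne] x]
          contraction_nform[OF nform_EL[OF X U] nform_EE_other[OF V W ne] x] ne by auto
    qed
    then show ?A ?B by simp_all
  qed
  show "Cx (Kh (E i V) (E j W)) (Kh (L X) (E k U)) = (if i = j \<and> k = j then b j (fst x) * app_vf X (b j) (fst x) * koszul (F j) (gF j) V W U (snd x j) else 0)"
    "Cx (Kh (E i V) (E j W)) (Kh (E k U) (L X)) = (if i = j \<and> k = j then b j (fst x) *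
      (app_vf X (b j) (fst x) + b j (fst x) * on_vf gB X P (fst x)) * koszul (F j) (gF j) V W U (snd x j) else 0)"
    unfolding mt.contraction_sym[of "Kh (E i V) (E j W)"] by (rule A, rule B)
qed

lemma C_EE_EE:
  assumes V: "V \<in> vfields (F i)" and W: "W \<in> vfields (F j)" and U: "U \<in> vfields (F k)" and Q: "Q \<in> vfields (F s)"
  shows "Cx (Kh (E i V) (E j W)) (Kh (E k U) (E s Q)) = (if i = j \<and> k = s then
    b j (fst x) * b s (fst x) * on_vf gB (grad j) (grad s) (fst x) * on_vf (gF j) V W (snd x j) * on_vf (gF s) U Q (snd x s)
    + (if j = s then (b j (fst x))\<^sup>2 * contraction (F j) (gF j) (koszul (F j) (gF j) V W) (koszul (F j) (gF j) U Q) (snd x j) else 0) else 0)"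
proof (cases "i = j")
  case ij: True
  have V': "V \<in> vfields (F j)" using V ij by simp
  show ?thesis
  proof (cases "k = s")
    case True
    have U': "U \<in> vfields (F s)" using U True by simp
    show ?thesis using contraction_nform[OF nform_EE[OF V' W] nform_EE[OF U' Q] x] ij True by (simp add: mult_ac)
  next
    case False
    show ?thesis using contraction_nform[OF nform_EE[OF V' W] nform_EE_other[OF U Q False] x] ij False by simp
  qed
next
  case False
  show ?thesis
  proof (cases "k = s")
    case True
    have U': "U \<in> vfields (F s)" using U True by simp
    show ?thesis using contraction_nform[OF nform_EE_other[OF V W False] nform_EE[OF U' Q] x] False True by simp
  next
    case ks: False
    show ?thesis using contraction_nform[OF nform_EE_other[OF V W False] nform_EE_other[OF U Q ks] x] False by simp
  qed
qed

section \<open>Components of the curvature on lifts\<close>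

lemma Rm_eq: "Rm A1 A2 A3 A4 x = app_vf A1 (Kh A2 A3 A4) x - Cx (Kh A1 A4) (Kh A2 A3)
    - (app_vf A2 (Kh A1 A3 A4) x - Cx (Kh A2 A4) (Kh A1 A3)) - Kh (lie_bracket M A1 A2) A3 A4 x"
  by (simp add: ssnm_riemann_def ssnm_deriv_def)

lemmas tables = x L_vf E_vf base.vf_bracket fib.vf_bracket
  Kh_LLL Kh_LLE Kh_LEL Kh_ELL Kh_LEE Kh_ELE Kh_EEL Kh_EEE Kh_brLE Kh_brEL Kh_brLL Kh_brEE
  D_LLL DE_LLL D_LLE D_LEL D_ELL D_LEE D_ELE D_EEL D_EEE
  C_LL_LL C_LL_LE C_LL_EE C_mixed C_LE_EE C_EE_EE

lemma app_bracket_b: "app_vf (lie_bracket B X Y) (b j) p = app_vf X (app_vf Y (b j)) p - app_vf Y (app_vf X (b j)) p"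
proof -
  have "app_vf (lie_bracket B X Y) (b j) p = lie_bracket B X Y p (b j)" by (simp add: app_vf_def)
  also have "\<dots> = app_vf X (app_vf Y (b j)) p - app_vf Y (app_vf X (b j)) p"
    unfolding lie_bracket_def using b_smooth[of j] by simp
  finally show ?thesis .
qed

lemma fibre_metric: "X \<in> vfields (F j) \<Longrightarrow> Y \<in> vfields (F j) \<Longrightarrow> Z \<in> vfields (F j) \<Longrightarrow>
    app_vf X (on_vf (gF j) Y Z) (snd x j) = koszul (F j) (gF j) X Y Z (snd x j) + koszul (F j) (gF j) X Z Y (snd x j)"
  unfolding app_vf_def by (rule mF.koszul_metric[symmetric]) (simp_all add: carrier_snd x)

lemma fibre_torsion: "X \<in> vfields (F j) \<Longrightarrow> Y \<in> vfields (F j) \<Longrightarrow> Z \<in> vfields (F j) \<Longrightarrow>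
    on_vf (gF j) (lie_bracket (F j) X Y) Z (snd x j) = koszul (F j) (gF j) X Y Z (snd x j) - koszul (F j) (gF j) Y X Z (snd x j)"
  by (rule mF.koszul_torsion[symmetric]) (simp_all add: carrier_snd x)

lemma Rm_LLLL: "X \<in> vfields B \<Longrightarrow> Y \<in> vfields B \<Longrightarrow> Z \<in> vfields B \<Longrightarrow> T \<in> vfields B \<Longrightarrow>
    Rm (L X) (L Y) (L Z) (L T) x = ssnm_riemann B gB P X Y Z T (fst x)"
  unfolding Rm_eq by (simp add: tables) (simp add: ssnm_riemann_def ssnm_deriv_def)

lemma Rm_LLLE: "X \<in> vfields B \<Longrightarrow> Y \<in> vfields B \<Longrightarrow> Z \<in> vfields B \<Longrightarrow> W \<in> vfields (F j) \<Longrightarrow> Rm (L X) (L Y) (L Z) (E j W) x = 0"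
    "X \<in> vfields B \<Longrightarrow> Y \<in> vfields B \<Longrightarrow> Z \<in> vfields B \<Longrightarrow> W \<in> vfields (F j) \<Longrightarrow> Rm (L X) (L Y) (E j W) (L Z) x = 0"
    "X \<in> vfields B \<Longrightarrow> Y \<in> vfields B \<Longrightarrow> Z \<in> vfields B \<Longrightarrow> W \<in> vfields (F j) \<Longrightarrow> Rm (L Z) (E j W) (L X) (L Y) x = 0"
  unfolding Rm_eq by (simp_all add: tables)

text \<open>First-order products X(b_j) Y(b_j) cancel between derivative and contraction; the second
  derivatives of b_j cancel against the bracket of \<open>X\<close> and \<open>Y\<close>. In the
  second identity the symmetry of the fibre metric cancels the two halves.\<close>

lemma Rm_LLEE:
  assumes "X \<in> vfields B" "Y \<in> vfields B" "V \<in> vfields (F i)" "W \<in> vfields (F j)"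
  shows "Rm (L X) (L Y) (E i V) (E j W) x = 0" "Rm (E i V) (E j W) (L X) (L Y) x = 0"
proof -
  have s: "on_vf (gF j) V W (snd x j) = on_vf (gF j) W V (snd x j)" if "i = j"
    using mF.on_vf_sym[OF _ assms(4) carrier_snd[OF x]] assms(3) that by simp
  show "Rm (L X) (L Y) (E i V) (E j W) x = 0"
    unfolding Rm_eq using assms s by (simp add: tables app_bracket_b) (auto simp: algebra_simps)
  show "Rm (E i V) (E j W) (L X) (L Y) x = 0"
    unfolding Rm_eq using assms s by (simp add: tables) (auto simp: algebra_simps tables)
qed

text \<open>The term in \<open>P\<close> appears twice: once from \<open>Kh (E j V) (L Y)\<close>
  contracted with \<open>Kh (L X) (E j W)\<close>, once from \<open>Kh (L X) (L Y)\<close> paired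
  with the gradient in \<open>Kh (E j V) (E j W)\<close>.\<close>

lemma Rm_ELEL:
  assumes X: "X \<in> vfields B" "Y \<in> vfields B" and V: "V \<in> vfields (F j)" "W \<in> vfields (F j)"
  shows "Rm (E j V) (L X) (E j W) (L Y) x = - Rm (L X) (E j V) (E j W) (L Y) x"
    and "Rm (E j V) (L X) (E j W) (L Y) x = b j (fst x) * app_vf X (app_vf Y (b j)) (fst x) * on_vf (gF j) V W (snd x j)
         - b j (fst x) * koszul B gB X Y (grad j) (fst x) * on_vf (gF j) V W (snd x j)
         - 2 * b j (fst x) * app_vf X (b j) (fst x) * on_vf gB Y P (fst x) * on_vf (gF j) V W (snd x j)"
  unfolding Rm_eq using assms by (simp_all add: tables) (simp_all add: algebra_simps)

text \<open>The terms X(b_j) g(Y,P) cancel between derivative and contractions; what remains of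
  \<open>P\<close> is the derivative of g(Y,P), from the summand b_j^2 g(Y,P) in
  \<open>Kh_ELE\<close>.\<close>

lemma Rm_ELLE:
  assumes X: "X \<in> vfields B" "Y \<in> vfields B" and V: "V \<in> vfields (F j)" "W \<in> vfields (F j)"
  shows "Rm (E j V) (L X) (L Y) (E j W) x = - Rm (L X) (E j V) (L Y) (E j W) x"
    and "Rm (E j V) (L X) (L Y) (E j W) x = - b j (fst x) * app_vf X (app_vf Y (b j)) (fst x) * on_vf (gF j) V W (snd x j)
         + b j (fst x) * koszul B gB X Y (grad j) (fst x) * on_vf (gF j) V W (snd x j)
         - (b j (fst x))\<^sup>2 * app_vf X (on_vf gB Y P) (fst x) * on_vf (gF j) V W (snd x j)"
proof -
  have s: "on_vf (gF j) V W (snd x j) = on_vf (gF j) W V (snd x j)"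
    by (rule mF.on_vf_sym[OF V carrier_snd[OF x]])
  show "Rm (E j V) (L X) (L Y) (E j W) x = - Rm (L X) (E j V) (L Y) (E j W) x"
    unfolding Rm_eq using assms by (simp add: tables)
  show "Rm (E j V) (L X) (L Y) (E j W) x = - b j (fst x) * app_vf X (app_vf Y (b j)) (fst x) * on_vf (gF j) V W (snd x j)
         + b j (fst x) * koszul B gB X Y (grad j) (fst x) * on_vf (gF j) V W (snd x j)
         - (b j (fst x))\<^sup>2 * app_vf X (on_vf gB Y P) (fst x) * on_vf (gF j) V W (snd x j)"
    unfolding Rm_eq using assms s by (simp add: tables) (simp add: algebra_simps power2_eq_square)
qed

lemma Rm_LEEL_other:
  assumes "X \<in> vfields B" "Y \<in> vfields B" "V \<in> vfields (F i)" "W \<in> vfields (F j)" "i \<noteq> j"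
  shows "Rm (L X) (E i V) (E j W) (L Y) x = 0" "Rm (L X) (E i V) (L Y) (E j W) x = 0"
  unfolding Rm_eq using assms by (simp_all add: tables)

text \<open>Only the case of a single fibre has nonzero terms; they cancel by metric compatibility
  and vanishing torsion of the fibre Koszul form.\<close>

lemma Rm_LEEE:
  assumes "X \<in> vfields B" "V \<in> vfields (F i)" "W \<in> vfields (F j)" "U \<in> vfields (F k)"
  shows "Rm (L X) (E i V) (E j W) (E k U) x = 0" "Rm (E j W) (E k U) (L X) (E i V) x = 0"
proof -
  have "Rm (L X) (E i V) (E j W) (E k U) x = 0 \<and> Rm (E j W) (E k U) (L X) (E i V) x = 0"
  proof (cases "i = k \<and> j = k")
    case True
    then have V: "V \<in> vfields (F k)" "W \<in> vfields (F k)" using assms by simp_all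
    show ?thesis
      unfolding Rm_eq using assms(1,4) V True
      by (simp add: tables fibre_metric fibre_torsion) (simp add: algebra_simps)
  next
    case False
    then show ?thesis unfolding Rm_eq using assms by (auto simp: tables)
  qed
  then show "Rm (L X) (E i V) (E j W) (E k U) x = 0" "Rm (E j W) (E k U) (L X) (E i V) x = 0" by simp_all
qed

text \<open>The terms with X(b_j) cancel by metric compatibility and vanishing torsion in the fibre.
  Those with g(X,P) come from the two contractions only, so nothing cancels them.\<close>

lemma Rm_EEEL:
  assumes "X \<in> vfields B" "V \<in> vfields (F j)" "W \<in> vfields (F j)" "U \<in> vfields (F j)"
  shows "Rm (E j W) (E j U) (E j V) (L X) x = (b j (fst x))\<^sup>2 * on_vf gB X P (fst x) *
    (koszul (F j) (gF j) W V U (snd x j) - koszul (F j) (gF j) U V W (snd x j))"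
  unfolding Rm_eq using assms
  by (simp add: tables fibre_metric fibre_torsion) (simp add: algebra_simps power2_eq_square)

lemma Rm_EEEL_other:
  assumes "X \<in> vfields B" "V \<in> vfields (F i)" "W \<in> vfields (F j)" "U \<in> vfields (F k)" "\<not> (i = j \<and> j = k)"
  shows "Rm (E j W) (E k U) (E i V) (L X) x = 0"
  unfolding Rm_eq using assms by (auto simp: tables)

text \<open>The fibre parts of the normal forms reproduce the curvature of the fibre with weight
  b_j^2; the base parts contribute the products of gradients.\<close>

lemma Rm_EEEE:
  assumes "U \<in> vfields (F j)" "V \<in> vfields (F j)" "W \<in> vfields (F j)" "Q \<in> vfields (F j)"
  shows "Rm (E j U) (E j V) (E j W) (E j Q) x = (b j (fst x))\<^sup>2 * riemann (F j) (gF j) U V W Q (snd x j)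
    + (b j (fst x))\<^sup>2 * on_vf gB (grad j) (grad j) (fst x) *
      (on_vf (gF j) U W (snd x j) * on_vf (gF j) V Q (snd x j) - on_vf (gF j) V W (snd x j) * on_vf (gF j) U Q (snd x j))"
proof -
  \<comment> \<open>\<open>riemann\<close> contracts each pair of forms in the opposite
    order.\<close>
  note c = fun_cong[OF mF.contraction_sym]
  show ?thesis
    unfolding Rm_eq using assms
      c[of j "koszul (F j) (gF j) U W" "koszul (F j) (gF j) V Q" "snd x j"]
      c[of j "koszul (F j) (gF j) V W" "koszul (F j) (gF j) U Q" "snd x j"]
    by (simp add: tables riemann_def) (simp add: algebra_simps power2_eq_square)
qed

text \<open>A fibre Koszul form needs all its indices equal, so derivatives, brackets and fibre
  contractions drop out. Left are the contractions of the base parts, which are multiples of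
  gradients.\<close>

lemma Rm_EEEE_other:
  assumes "U \<in> vfields (F k)" "V \<in> vfields (F i)" "W \<in> vfields (F j)" "Q \<in> vfields (F s)" "\<not> (i = j \<and> j = k \<and> k = s)"
  shows "Rm (E k U) (E i V) (E j W) (E s Q) x =
    (if k = j \<and> i = s then b i (fst x) * b j (fst x) * on_vf gB (grad i) (grad j) (fst x) * on_vf (gF i) V Q (snd x i) * on_vf (gF j) U W (snd x j) else 0)
    - (if k = s \<and> j = i then b k (fst x) * b j (fst x) * on_vf gB (grad k) (grad j) (fst x) * on_vf (gF k) U Q (snd x k) * on_vf (gF j) V W (snd x j) else 0)"
proof -
  note V = assms(1-4) and ne = assms(5)
  have D1: "app_vf (E k U) (Kh (E i V) (E j W) (E s Q)) x = 0"
    using D_EEE(2)[OF x V(2,3,4,1)] ne by auto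
  have D2: "app_vf (E i V) (Kh (E k U) (E j W) (E s Q)) x = 0"
    using D_EEE(2)[OF x V(1,3,4,2)] ne by auto
  have br: "Kh (lie_bracket M (E k U) (E i V)) (E j W) (E s Q) x = 0"
  proof (cases "k = i")
    case True
    have U': "U \<in> vfields (F i)" using V(1) True by simp
    show ?thesis using Kh_brEE[OF V(1,2) E_vf[OF V(3)] E_vf[OF V(4)] x] Kh_EEE[OF x fib.vf_bracket[OF U' V(2)] V(3,4)] ne True by auto
  next
    case False
    then show ?thesis using Kh_brEE[OF V(1,2) E_vf[OF V(3)] E_vf[OF V(4)] x] by simp
  qed
  have C1: "Cx (Kh (E k U) (E s Q)) (Kh (E i V) (E j W)) = (if k = s \<and> j = i then
      b k (fst x) * b j (fst x) * on_vf gB (grad k) (grad j) (fst x) * on_vf (gF k) U Q (snd x k) * on_vf (gF j) V W (snd x j) else 0)"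
    unfolding C_EE_EE[OF V(1,4,2,3)] using ne by auto
  have C2: "Cx (Kh (E i V) (E s Q)) (Kh (E k U) (E j W)) = (if k = j \<and> i = s then
      b i (fst x) * b j (fst x) * on_vf gB (grad i) (grad j) (fst x) * on_vf (gF i) V Q (snd x i) * on_vf (gF j) U W (snd x j) else 0)"
    unfolding C_EE_EE[OF V(2,4,1,3)] using ne by auto
  show ?thesis unfolding Rm_eq D1 D2 br C1 C2 by simp
qed

end

end

theorem theorem3p7:
  fixes B :: "('b, 'd::euclidean_space) mfd" and gB :: "'b metric_form"
    and F :: "'m::finite \<Rightarrow> ('f, 'e::euclidean_space) mfd" and gF :: "'m \<Rightarrow> 'f metric_form"
    and b :: "'m \<Rightarrow> 'b \<Rightarrow> real" and P :: "'b vfield"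
    and X Y Z T :: "'b vfield" and i j k s :: 'm and U V W Q :: "'f vfield"
    and p :: 'b and q :: "'m \<Rightarrow> 'f"
    and L :: "'b vfield \<Rightarrow> ('b \<times> ('m \<Rightarrow> 'f)) vfield"
    and E :: "'m \<Rightarrow> 'f vfield \<Rightarrow> ('b \<times> ('m \<Rightarrow> 'f)) vfield"
    and Rh :: "('b \<times> ('m \<Rightarrow> 'f)) vfield \<Rightarrow> ('b \<times> ('m \<Rightarrow> 'f)) vfield \<Rightarrow>
      ('b \<times> ('m \<Rightarrow> 'f)) vfield \<Rightarrow> ('b \<times> ('m \<Rightarrow> 'f)) vfield \<Rightarrow> real"
    and G :: "'m \<Rightarrow> 'f vfield \<Rightarrow> 'f vfield \<Rightarrow> real"
    and gBi :: "'b form1 \<Rightarrow> 'b form1 \<Rightarrow> real"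
  assumes "singular_semi_riemannian B gB" and "nondegenerate B gB"
    and "\<And>l. semi_regular (F l) (gF l)"
    and "\<And>l. b l \<in> smooth_funs B"
    and "P \<in> vfields B"
    and "X \<in> vfields B" and "Y \<in> vfields B" and "Z \<in> vfields B" and "T \<in> vfields B"
    and "U \<in> vfields (F k)" and "V \<in> vfields (F i)" and "W \<in> vfields (F j)" and "Q \<in> vfields (F s)"
    and "p \<in> carrier_of B" and "\<And>l. q l \<in> carrier_of (F l)"
  defines "L \<equiv> lift_base B F" and "E \<equiv> lift_fibre B F"
    and "Rh \<equiv> \<lambda>A1 A2 A3 A4. ssnm_riemann (prod_mfd B F) (warped_metric B gB F gF b)
      (lift_base B F P) A1 A2 A3 A4 (p, q)"
    and "G \<equiv> \<lambda>l A1 A2. on_vf (gF l) A1 A2 (q l)"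
    and "gBi \<equiv> \<lambda>\<omega> \<tau>. inverse_metric B gB \<omega> \<tau> p"
  shows
    "\<comment> \<open>(1)\<close>
     Rh (L X) (L Y) (L Z) (L T) = ssnm_riemann B gB P X Y Z T p
   \<and> \<comment> \<open>(2)\<close>
     Rh (L X) (L Y) (L Z) (E j W) = 0 \<and> Rh (L X) (L Y) (E j W) (L Z) = 0 \<and>
     Rh (L Z) (E j W) (L X) (L Y) = 0
   \<and> \<comment> \<open>(3)\<close>
     (i = j \<longrightarrow>
       Rh (L X) (L Y) (E i V) (E j W) = 0 \<and> Rh (E i V) (E j W) (L X) (L Y) = 0)
   \<and> \<comment> \<open>(4)\<close>
     (i = j \<longrightarrow>
       Rh (E i V) (L X) (E j W) (L Y) = - Rh (L X) (E i V) (E j W) (L Y) \<and>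
       Rh (E i V) (L X) (E j W) (L Y) =
         b j p * app_vf X (app_vf Y (b j)) p * G j V W
         - b j p * gBi (koszul B gB X Y) (d_fun (b j)) * G j V W
         - 2 * b j p * app_vf X (b j) p * on_vf gB Y P p * G j V W)
   \<and> \<comment> \<open>(5)\<close>
     (i = j \<longrightarrow>
       Rh (E i V) (L X) (L Y) (E j W) = - Rh (L X) (E i V) (L Y) (E j W) \<and>
       Rh (E i V) (L X) (L Y) (E j W) =
         - b j p * app_vf X (app_vf Y (b j)) p * G j V W
         + b j p * gBi (koszul B gB X Y) (d_fun (b j)) * G j V W
         - (b j p)\<^sup>2 * app_vf X (on_vf gB Y P) p * G j V W)
   \<and> \<comment> \<open>(6)\<close>
     (i \<noteq> j \<longrightarrow>
       Rh (L X) (L Y) (E i V) (E j W) = 0 \<and> Rh (E i V) (E j W) (L X) (L Y) = 0 \<and>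
       Rh (L X) (E i V) (E j W) (L Y) = 0 \<and> Rh (L X) (E i V) (L Y) (E j W) = 0)
   \<and> \<comment> \<open>(7)\<close>
     (i = j \<and> j = k \<longrightarrow>
       Rh (L X) (E i V) (E j W) (E k U) = 0 \<and> Rh (E j W) (E k U) (L X) (E i V) = 0)
   \<and> \<comment> \<open>(8)\<close>
     (i = j \<and> j = k \<longrightarrow>
       Rh (E j W) (E k U) (E i V) (L X) =
         (b j p)\<^sup>2 * on_vf gB X P p *
           (koszul (F j) (gF j) W V U (q j) - koszul (F j) (gF j) U V W (q j)))
   \<and> \<comment> \<open>(9)\<close>
     (\<not> (i = j \<and> j = k) \<longrightarrow>
       Rh (L X) (E i V) (E j W) (E k U) = 0 \<and> Rh (E j W) (E k U) (L X) (E i V) = 0 \<and>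
       Rh (E j W) (E k U) (E i V) (L X) = 0)
   \<and> \<comment> \<open>(10)\<close>
     (i = j \<and> j = k \<and> k = s \<longrightarrow>
       Rh (E k U) (E i V) (E j W) (E s Q) =
         (b j p)\<^sup>2 * riemann (F j) (gF j) U V W Q (q j)
         + (b j p)\<^sup>2 * gBi (d_fun (b j)) (d_fun (b j)) *
             (G j U W * G j V Q - G j V W * G j U Q))
   \<and> \<comment> \<open>(11)\<close>
     (k = j \<and> j \<noteq> i \<and> i = s \<longrightarrow>
       Rh (E k U) (E i V) (E j W) (E s Q) =
         b i p * b j p * gBi (d_fun (b i)) (d_fun (b j)) * G i V Q * G j U W)
   \<and> \<comment> \<open>(12)\<close>
     (k = s \<and> s \<noteq> j \<and> j = i \<longrightarrow>
       Rh (E k U) (E i V) (E j W) (E s Q) =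
         - (b j p * b k p * gBi (d_fun (b j)) (d_fun (b k)) * G j V W * G k U Q))
   \<and> \<comment> \<open>(13)\<close>
     (\<not> (i = j \<and> j = k \<and> k = s) \<and> \<not> (k = j \<and> j \<noteq> i \<and> i = s) \<and>
      \<not> (k = s \<and> s \<noteq> j \<and> j = i) \<longrightarrow>
       Rh (E k U) (E i V) (E j W) (E s Q) = 0)"
proof -
  interpret mB: metric_manifold B gB by (rule singular_semi_riemannian_metric_manifold[OF assms(1)])
  interpret mf: metric_manifold "F l" "gF l" for l by (rule semi_regular_metric_manifold[OF assms(3)])
  interpret W: warped_ssnm B F gB gF b P
    by unfold_locales (use assms(2-5) in auto)
  let ?x = "(p, q)"
  have x: "?x \<in> carrier_of (prod_mfd B F)" using assms(14,15) by (simp add: W.carrier_prod)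
  have L: "L X = W.L X" for X unfolding L_def by (rule W.lift_base_eq)
  have E: "E j V = W.E j V" for j V unfolding E_def W.E_def by (rule W.lift_fibre_eq)
  have R: "Rh A1 A2 A3 A4 = W.Rm A1 A2 A3 A4 ?x" for A1 A2 A3 A4
    unfolding Rh_def by (simp only: W.lift_base_eq)
  note vB = assms(6-9) and U = assms(10) and V = assms(11) and W = assms(12) and Q = assms(13)
  have gk: "gBi (koszul B gB X Y) (d_fun (b j)) = koszul B gB X Y (W.grad j) p"
    unfolding gBi_def by (rule W.inverse_metric_koszul[OF vB(1,2) assms(14)])
  have gd: "gBi (d_fun (b i)) (d_fun (b j)) = on_vf gB (W.grad i) (W.grad j) p" for i j
    unfolding gBi_def by (rule W.inverse_metric_d_fun[OF assms(14)])
  have gs: "on_vf gB (W.grad i) (W.grad j) p = on_vf gB (W.grad j) (W.grad i) p" for i j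
    by (rule mB.on_vf_sym[OF W.grad(1) W.grad(1) assms(14)])
  \<comment> \<open>One formula for all four-fibre components with indices not all equal; the
    hypotheses of each remaining case decide its two conditions.\<close>
  note R13 = W.Rm_EEEE_other[OF x U V W Q]
  show ?thesis
    unfolding L E R gk gd G_def
  proof (intro conjI impI)
    show "W.Rm (W.L X) (W.L Y) (W.L Z) (W.L T) ?x = ssnm_riemann B gB P X Y Z T p"
      using W.Rm_LLLL[OF x vB] by simp
  next
    show "W.Rm (W.L X) (W.L Y) (W.L Z) (W.E j W) ?x = 0" by (rule W.Rm_LLLE(1)[OF x vB(1-3) W])
  next
    show "W.Rm (W.L X) (W.L Y) (W.E j W) (W.L Z) ?x = 0" by (rule W.Rm_LLLE(2)[OF x vB(1-3) W])
  next
    show "W.Rm (W.L Z) (W.E j W) (W.L X) (W.L Y) ?x = 0" by (rule W.Rm_LLLE(3)[OF x vB(1-3) W])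
  next
    assume ij: "i = j"
    note V' = V[unfolded ij]
    show "W.Rm (W.E i V) (W.L X) (W.E j W) (W.L Y) ?x = - W.Rm (W.L X) (W.E i V) (W.E j W) (W.L Y) ?x"
      unfolding ij by (rule W.Rm_ELEL(1)[OF x vB(1,2) V' W])
    show "W.Rm (W.E i V) (W.L X) (W.E j W) (W.L Y) ?x = b j p * app_vf X (app_vf Y (b j)) p * on_vf (gF j) V W (q j)
         - b j p * koszul B gB X Y (W.grad j) p * on_vf (gF j) V W (q j)
         - 2 * b j p * app_vf X (b j) p * on_vf gB Y P p * on_vf (gF j) V W (q j)"
      unfolding ij using W.Rm_ELEL(2)[OF x vB(1,2) V' W] by simp
    show "W.Rm (W.E i V) (W.L X) (W.L Y) (W.E j W) ?x = - W.Rm (W.L X) (W.E i V) (W.L Y) (W.E j W) ?x"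
      unfolding ij by (rule W.Rm_ELLE(1)[OF x vB(1,2) V' W])
    show "W.Rm (W.E i V) (W.L X) (W.L Y) (W.E j W) ?x = - b j p * app_vf X (app_vf Y (b j)) p * on_vf (gF j) V W (q j)
         + b j p * koszul B gB X Y (W.grad j) p * on_vf (gF j) V W (q j)
         - (b j p)\<^sup>2 * app_vf X (on_vf gB Y P) p * on_vf (gF j) V W (q j)"
      unfolding ij using W.Rm_ELLE(2)[OF x vB(1,2) V' W] by simp
  next
    assume ij: "i \<noteq> j"
    show "W.Rm (W.L X) (W.E i V) (W.E j W) (W.L Y) ?x = 0" by (rule W.Rm_LEEL_other(1)[OF x vB(1,2) V W ij])
    show "W.Rm (W.L X) (W.E i V) (W.L Y) (W.E j W) ?x = 0" by (rule W.Rm_LEEL_other(2)[OF x vB(1,2) V W ij])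
  next
    assume e: "i = j \<and> j = k"
    then have V': "V \<in> vfields (F j)" and U': "U \<in> vfields (F j)" using V U by simp_all
    have k: "k = j" "i = j" using e by simp_all
    show "W.Rm (W.E j W) (W.E k U) (W.E i V) (W.L X) ?x = (b j p)\<^sup>2 * on_vf gB X P p *
        (koszul (F j) (gF j) W V U (q j) - koszul (F j) (gF j) U V W (q j))"
      unfolding k using W.Rm_EEEL[OF x vB(1) V' W U'] by simp
  next
    assume e: "\<not> (i = j \<and> j = k)"
    show "W.Rm (W.E j W) (W.E k U) (W.E i V) (W.L X) ?x = 0" by (rule W.Rm_EEEL_other[OF x vB(1) V W U e])
  next
    assume e: "i = j \<and> j = k \<and> k = s"
    then have V': "V \<in> vfields (F j)" and U': "U \<in> vfields (F j)" and Q': "Q \<in> vfields (F j)" using V U Q by simp_all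
    have k: "k = j" "i = j" "s = j" using e by simp_all
    show "W.Rm (W.E k U) (W.E i V) (W.E j W) (W.E s Q) ?x = (b j p)\<^sup>2 * riemann (F j) (gF j) U V W Q (q j)
         + (b j p)\<^sup>2 * on_vf gB (W.grad j) (W.grad j) p *
             (on_vf (gF j) U W (q j) * on_vf (gF j) V Q (q j) - on_vf (gF j) V W (q j) * on_vf (gF j) U Q (q j))"
      unfolding k using W.Rm_EEEE[OF x U' V' W Q'] by simp
  next
    assume e: "k = j \<and> j \<noteq> i \<and> i = s"
    have n: "\<not> (k = s \<and> j = i)" and c: "k = j \<and> i = s" and "\<not> (i = j \<and> j = k \<and> k = s)" using e by auto
    note r = R13[OF this(3)]
    show "W.Rm (W.E k U) (W.E i V) (W.E j W) (W.E s Q) ?x =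
        b i p * b j p * on_vf gB (W.grad i) (W.grad j) p * on_vf (gF i) V Q (q i) * on_vf (gF j) U W (q j)"
      unfolding r if_not_P[OF n] if_P[OF c] by simp
  next
    assume e: "k = s \<and> s \<noteq> j \<and> j = i"
    have n: "\<not> (k = j \<and> i = s)" and c: "k = s \<and> j = i" and "\<not> (i = j \<and> j = k \<and> k = s)" using e by auto
    note r = R13[OF this(3)]
    show "W.Rm (W.E k U) (W.E i V) (W.E j W) (W.E s Q) ?x =
        - (b j p * b k p * on_vf gB (W.grad j) (W.grad k) p * on_vf (gF j) V W (q j) * on_vf (gF k) U Q (q k))"
      unfolding r if_not_P[OF n] if_P[OF c] gs[of j k] by simp
  next
    assume e: "\<not> (i = j \<and> j = k \<and> k = s) \<and> \<not> (k = j \<and> j \<noteq> i \<and> i = s) \<and> \<not> (k = s \<and> s \<noteq> j \<and> j = i)"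
    have n: "\<not> (k = j \<and> i = s)" and n': "\<not> (k = s \<and> j = i)" and "\<not> (i = j \<and> j = k \<and> k = s)" using e by auto
    note r = R13[OF this(3)]
    show "W.Rm (W.E k U) (W.E i V) (W.E j W) (W.E s Q) ?x = 0" unfolding r if_not_P[OF n] if_not_P[OF n'] by simp
  \<comment> \<open>The remaining goals have two or three fibre arguments and occur both for equal
    and for unequal indices; these lemmas hold for all indices.\<close>
  qed (rule W.Rm_LLEE[OF x vB(1,2) V W] W.Rm_LEEE[OF x vB(1) V W U])+
qed

end
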